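(* Let $0\le\beta\le\alpha<1$, and let $(\chi,(\psi_i)_{i\in I_\ast})$ be a wave-packet scattering bank subordinate to the covering $\mathcal Q^{(\alpha,\beta)}$ which satisfies the multiplier regularity conditions (C1) and (C2). For every $\kappa\in(0,1)$ there exists $C>0$ such that, whenever $\tau\in W^{1,\infty}(\mathbb R^2;\mathbb R^2)$ satisfies $\|D\tau\|_{L^\infty}\le\kappa$, for every $f\in H^{1-\beta}(\mathbb R^2)$ one has $$\|\mathsf S_\chi(L_\tau f)-\mathsf S_\chi f\|_{\ell^2(L^2)}\le C\bigl(\|\tau\|_{L^\infty}+\|D\tau\|_{L^\infty}\bigr)\,\|f\|_{H^{1-\beta}}.$$
   Context: Notation: $\mathbb N=\{1,2,\dots\}$, $\mathbb N_0=\{0,1,2,\dots\}$; $\widehat f(\xi)=\int_{\mathbb R^2}e^{-2\pi \mathrm i x\cdot\xi}f(x)\,dx$; $\|f\|_{H^s}=\|(1+|\xi|^2)^{s/2}\widehat f\|_{L^2}$; $B_r(x_0)$ is the open ball. $L_\tau f(x)=f(x-\tau(x))$, and $\|D\tau\|_{L^\infty}$ is the essential supremum of the operator norm of $D\tau(x)$. For a countable family $q=(q_p)_p$, $\|q\|_{\ell^2(L^2)}=(\sum_p\|q_p\|_{L^2}^2)^{1/2}$. Covering. Fix $0\le\beta\le\alpha\le1$ and $\varepsilon_0\in(0,1/32)$. Let $Q=(-\varepsilon_0,1+\varepsilon_0)\times(-1-\varepsilon_0,1+\varepsilon_0)$. For $j\in\mathbb N$ let $m_j^{\max}=\lceil 2^{(1-\alpha)j-1}\rceil$,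 $\ell_j^{\max}=\lceil 10\cdot2^{(1-\beta)j}\rceil$, $A_j=\mathrm{diag}(2^{\alpha j},2^{\beta j})$, $c_{j,m}=(2^{j-1}+m2^{\alpha j},0)^\top$, and let $R_{j,\ell}$ be the rotation matrix by the angle $\theta_{j,\ell}=2\ell\cdot\frac{\pi}{10}2^{(\beta-1)j}$. Put $I_\ast=\{(j,m,\ell)\in\mathbb N\times\mathbb N_0\times\mathbb N_0: m\le m_j^{\max},\ \ell\le\ell_j^{\max}\}$, $I_{\ast,j}$ = the set of elements of $I_\ast$ with first entry $j$, $I=\{0\}\cup I_\ast$, $Q_i=R_{j,\ell}(A_jQ+c_{j,m})$ for $i=(j,m,\ell)\in I_\ast$, and $Q_0=B_4(0)$. The covering is $\mathcal Q^{(\alpha,\beta)}=(Q_i)_{i\in I}$. Filter bank. A wave-packet scattering bank subordinate to $\mathcal Q^{(\alpha,\beta)}$ consists of $\chi\in L^1\cap L^2(\mathbb R^2)$ and $\psi_i\in L^1\cap L^2(\mathbb R^2)$, $i\in I_\ast$, with $m_i:=\widehat\psi_i$, such that $|\widehat\chi(\xi)|^2+\sum_{i\in I_\ast}|m_i(\xi)|^2=1$ for a.e. $\xi$, $\operatorname{supp}\widehat\chi\subset Q_0$ and $\operatorname{supp}m_i\subset Q_i$ for all $i\in I_\ast$. Scattering. $U[e]f=f$ for the empty path $e$, and for $p=(i_1,\dots,i_n)\in I_\ast^n$, $U[p]f=U[i_n]\cdots U[i_1]f$ with $U[i]g=|g*\psi_i|$. With $I_\ast^0=\{e\}$, $\mathsf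 S_\chi f=(U[p]f*\chi)_{p\in\bigcup_{n\ge0}I_\ast^n}$. Multiplier regularity (the $m_i$ being understood to have derivatives up to order $4$): there is $j_{\rm reg}\in\mathbb N$ such that (C1) all $m_i$ with $i\in\bigcup_{1\le j<j_{\rm reg}}I_{\ast,j}$ have compact support and bounded derivatives up to order $4$; (C2) for every multi-index $\nu$ with $1\le|\nu|\le4$, $\sup_{j\ge j_{\rm reg}}\sup_{\xi\in\mathbb R^2}2^{\beta j|\nu|}\bigl(\sum_{i\in I_{\ast,j}}|\partial^\nu m_i(\xi)|^2\bigr)^{1/2}<\infty$. *)

theory Defs
  imports "HOL-Analysis.Analysis" "HOL-Probability.Essential_Supremum"
begin

type_synonym plane = "real^2"

section \<open>Lebesgue spaces\<close>

text \<open>All spaces are taken with respect to the complete Lebesgue measure, and their elements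
  are represented by functions rather than by classes modulo null sets.\<close>

definition L1 :: "(plane \<Rightarrow> complex) set" where
  "L1 = {f. integrable lebesgue f}"

definition L2 :: "(plane \<Rightarrow> complex) set" where
  "L2 = {f. f \<in> borel_measurable lebesgue \<and> integrable lebesgue (\<lambda>x. (cmod (f x))\<^sup>2)}"

definition L2_norm :: "(plane \<Rightarrow> complex) \<Rightarrow> real" where
  "L2_norm f = sqrt (LINT x|lebesgue. (cmod (f x))\<^sup>2)"

text \<open>The constant \<open>esssup\<close> is infinite on non-measurable functions. The measurability in
  \<open>Linf\<close> is that of \<open>f\<close> itself, which that of the norm of \<open>f\<close> does not imply.\<close>

definition Linf :: "(plane \<Rightarrow> 'a::real_normed_vector) set" where
  "Linf = {f. f \<in> borel_measurable lebesgue \<and> esssup lebesgue (\<lambda>x. ereal (norm (f x))) < \<infinity>}"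

definition Linf_norm :: "(plane \<Rightarrow> 'a::real_normed_vector) \<Rightarrow> real" where
  "Linf_norm f = real_of_ereal (esssup lebesgue (\<lambda>x. ereal (norm (f x))))"

definition ell2_L2 :: "'p set \<Rightarrow> ('p \<Rightarrow> plane \<Rightarrow> complex) set" where
  "ell2_L2 P = {q. (\<forall>p\<in>P. q p \<in> L2) \<and> (\<lambda>p. (L2_norm (q p))\<^sup>2) summable_on P}"

definition ell2_L2_norm :: "'p set \<Rightarrow> ('p \<Rightarrow> plane \<Rightarrow> complex) \<Rightarrow> real" where
  "ell2_L2_norm P q = sqrt (\<Sum>\<^sub>\<infinity>p\<in>P. (L2_norm (q p))\<^sup>2)"

section \<open>Fourier transform, convolution and Sobolev spaces of order s\<close>

definition fourier :: "(plane \<Rightarrow> complex) \<Rightarrow> plane \<Rightarrow> complex" where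
  "fourier f \<xi> = (LINT x|lebesgue. exp (- 2 * of_real pi * \<i> * of_real (x \<bullet> \<xi>)) * f x)"

text \<open>The Plancherel extension of the Fourier transform to square integrable functions, as the
  limit in L2 of the transforms of the truncations of \<open>f\<close> to balls. It is determined up to
  null sets only, so that \<open>SOME\<close> selects a representative.\<close>

definition is_fourier_L2 :: "(plane \<Rightarrow> complex) \<Rightarrow> (plane \<Rightarrow> complex) \<Rightarrow> bool" where
  "is_fourier_L2 f g \<longleftrightarrow> g \<in> L2 \<and>
     (\<lambda>n. L2_norm (\<lambda>\<xi>. fourier (\<lambda>x. indicator (ball 0 (real n)) x * f x) \<xi> - g \<xi>))
       \<longlonglongrightarrow> 0"

definition fourier_L2 :: "(plane \<Rightarrow> complex) \<Rightarrow> plane \<Rightarrow> complex" where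
  "fourier_L2 f = (SOME g. is_fourier_L2 f g)"

definition bessel_weight :: "real \<Rightarrow> (plane \<Rightarrow> complex) \<Rightarrow> plane \<Rightarrow> complex" where
  "bessel_weight s g \<xi> = of_real ((1 + (norm \<xi>)\<^sup>2) powr (s / 2)) * g \<xi>"

text \<open>For \<open>s \<ge> 0\<close>, the only case used, these spaces consist of square integrable functions.\<close>

definition Hs :: "real \<Rightarrow> (plane \<Rightarrow> complex) set" where
  "Hs s = {f \<in> L2. bessel_weight s (fourier_L2 f) \<in> L2}"

definition Hs_norm :: "real \<Rightarrow> (plane \<Rightarrow> complex) \<Rightarrow> real" where
  "Hs_norm s f = L2_norm (bessel_weight s (fourier_L2 f))"

definition conv :: "(plane \<Rightarrow> complex) \<Rightarrow> (plane \<Rightarrow> complex) \<Rightarrow> plane \<Rightarrow> complex"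
  where "conv f g x = (LINT y|lebesgue. f (x - y) * g y)"

section \<open>Derivatives\<close>

definition partial :: "2 \<Rightarrow> (plane \<Rightarrow> 'a::real_normed_vector) \<Rightarrow> plane \<Rightarrow> 'a" where
  "partial k f x = vector_derivative (\<lambda>t. f (x + t *\<^sub>R axis k 1)) (at 0)"

text \<open>Total differentiability of all derivatives of order less than \<open>n\<close>; this makes the
  partial derivatives of order up to \<open>n\<close> independent of the order of differentiation.\<close>

primrec times_differentiable :: "nat \<Rightarrow> (plane \<Rightarrow> 'a::real_normed_vector) \<Rightarrow> bool" where
  "times_differentiable 0 f \<longleftrightarrow> True"
| "times_differentiable (Suc n) f \<longleftrightarrow>
     (\<forall>x. f differentiable (at x)) \<and> (\<forall>k. times_differentiable n (partial k f))"

definition mderiv :: "nat \<times> nat \<Rightarrow> (plane \<Rightarrow> 'a::real_normed_vector) \<Rightarrow> plane \<Rightarrow> 'a" where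
  "mderiv \<nu> f = (partial 1 ^^ fst \<nu>) ((partial 2 ^^ snd \<nu>) f)"

definition mdeg :: "nat \<times> nat \<Rightarrow> nat" where
  "mdeg \<nu> = fst \<nu> + snd \<nu>"

definition supp :: "(plane \<Rightarrow> 'a::zero) \<Rightarrow> plane set" where
  "supp f = closure {x. f x \<noteq> 0}"

definition test_functions :: "(plane \<Rightarrow> real) set" where
  "test_functions = {\<phi>. (\<forall>n. times_differentiable n \<phi>) \<and> compact (supp \<phi>)}"

definition has_weak_jacobian :: "(plane \<Rightarrow> plane) \<Rightarrow> (plane \<Rightarrow> real^2^2) \<Rightarrow> bool" where
  "has_weak_jacobian \<tau> D \<longleftrightarrow> (\<forall>\<phi>\<in>test_functions. \<forall>i k.
     (LINT x|lebesgue. \<tau> x $ i * partial k \<phi> x) = - (LINT x|lebesgue. D x $ i $ k * \<phi> x))"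

definition W1inf :: "(plane \<Rightarrow> plane) set" where
  "W1inf = {\<tau> \<in> Linf. \<exists>D\<in>Linf. has_weak_jacobian \<tau> D}"

text \<open>Again a representative of a class modulo null sets.\<close>

definition weak_jacobian :: "(plane \<Rightarrow> plane) \<Rightarrow> plane \<Rightarrow> real^2^2" where
  "weak_jacobian \<tau> = (SOME D. D \<in> Linf \<and> has_weak_jacobian \<tau> D)"

text \<open>The norm of the type of matrices is the Frobenius norm, hence the explicit \<open>onorm\<close>.\<close>

definition jacobian_norm :: "(plane \<Rightarrow> plane) \<Rightarrow> real" where
  "jacobian_norm \<tau> = Linf_norm (\<lambda>x. onorm (\<lambda>v. weak_jacobian \<tau> x *v v))"

definition deform :: "(plane \<Rightarrow> plane) \<Rightarrow> (plane \<Rightarrow> complex) \<Rightarrow> plane \<Rightarrow> complex" where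
  "deform \<tau> f x = f (x - \<tau> x)"

section \<open>The wave packet covering\<close>

type_synonym index = "nat \<times> nat \<times> nat"

definition m_max :: "real \<Rightarrow> nat \<Rightarrow> nat" where
  "m_max \<alpha> j = nat \<lceil>2 powr ((1 - \<alpha>) * real j - 1)\<rceil>"

definition l_max :: "real \<Rightarrow> nat \<Rightarrow> nat" where
  "l_max \<beta> j = nat \<lceil>10 * 2 powr ((1 - \<beta>) * real j)\<rceil>"

definition Istar :: "real \<Rightarrow> real \<Rightarrow> index set" where
  "Istar \<alpha> \<beta> = {(j, m, l). 1 \<le> j \<and> m \<le> m_max \<alpha> j \<and> l \<le> l_max \<beta> j}"

definition Istar_level :: "real \<Rightarrow> real \<Rightarrow> nat \<Rightarrow> index set" where
  "Istar_level \<alpha> \<beta> j = {i \<in> Istar \<alpha> \<beta>. fst i = j}"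

lemma finite_Istar_level: "finite (Istar_level \<alpha> \<beta> j)"
  by (rule finite_subset[of _ "{j} \<times> {..m_max \<alpha> j} \<times> {..l_max \<beta> j}"])
     (auto simp: Istar_level_def Istar_def)

definition base_box :: "real \<Rightarrow> plane set" where
  "base_box \<epsilon> = {x. - \<epsilon> < x $ 1 \<and> x $ 1 < 1 + \<epsilon> \<and> - 1 - \<epsilon> < x $ 2 \<and> x $ 2 < 1 + \<epsilon>}"

definition dilation :: "real \<Rightarrow> real \<Rightarrow> nat \<Rightarrow> real^2^2" where
  "dilation \<alpha> \<beta> j = vector [vector [2 powr (\<alpha> * real j), 0], vector [0, 2 powr (\<beta> * real j)]]"

definition shift :: "real \<Rightarrow> nat \<Rightarrow> nat \<Rightarrow> plane" where
  "shift \<alpha> j m = vector [2 powr (real j - 1) + real m * 2 powr (\<alpha> * real j), 0]"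

definition angle :: "real \<Rightarrow> nat \<Rightarrow> nat \<Rightarrow> real" where
  "angle \<beta> j l = 2 * real l * (pi / 10 * 2 powr ((\<beta> - 1) * real j))"

definition rotation :: "real \<Rightarrow> real^2^2" where
  "rotation \<theta> = vector [vector [cos \<theta>, - sin \<theta>], vector [sin \<theta>, cos \<theta>]]"

fun cover_set :: "real \<Rightarrow> real \<Rightarrow> real \<Rightarrow> index \<Rightarrow> plane set" where
  "cover_set \<alpha> \<beta> \<epsilon> (j, m, l) =
     (\<lambda>x. rotation (angle \<beta> j l) *v (dilation \<alpha> \<beta> j *v x + shift \<alpha> j m)) ` base_box \<epsilon>"

section \<open>Scattering banks\<close>

text \<open>The Fourier transforms of the filters are continuous, so that their topological support
  is also their essential support. Only the values of \<open>\<psi>\<close> on \<open>Istar \<alpha> \<beta>\<close> matter.\<close>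

definition wave_packet_bank ::
  "real \<Rightarrow> real \<Rightarrow> real \<Rightarrow> (plane \<Rightarrow> complex) \<Rightarrow> (index \<Rightarrow> plane \<Rightarrow> complex) \<Rightarrow> bool" where
  "wave_packet_bank \<alpha> \<beta> \<epsilon> chi \<psi> \<longleftrightarrow>
     chi \<in> L1 \<inter> L2 \<and> (\<forall>i\<in>Istar \<alpha> \<beta>. \<psi> i \<in> L1 \<inter> L2) \<and>
     (AE \<xi> in lebesgue.
        (\<lambda>i. (cmod (fourier (\<psi> i) \<xi>))\<^sup>2) summable_on Istar \<alpha> \<beta> \<and>
        (cmod (fourier chi \<xi>))\<^sup>2 + (\<Sum>\<^sub>\<infinity>i\<in>Istar \<alpha> \<beta>. (cmod (fourier (\<psi> i) \<xi>))\<^sup>2) = 1) \<and>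
     supp (fourier chi) \<subseteq> ball 0 4 \<and>
     (\<forall>i\<in>Istar \<alpha> \<beta>. supp (fourier (\<psi> i)) \<subseteq> cover_set \<alpha> \<beta> \<epsilon> i)"

definition multiplier_C1 ::
  "real \<Rightarrow> real \<Rightarrow> (index \<Rightarrow> plane \<Rightarrow> complex) \<Rightarrow> nat \<Rightarrow> bool" where
  "multiplier_C1 \<alpha> \<beta> mu jreg \<longleftrightarrow>
     (\<forall>j. 1 \<le> j \<and> j < jreg \<longrightarrow> (\<forall>i\<in>Istar_level \<alpha> \<beta> j.
        compact (supp (mu i)) \<and> (\<forall>\<nu>. mdeg \<nu> \<le> 4 \<longrightarrow> bounded (range (mderiv \<nu> (mu i))))))"

definition multiplier_C2 ::
  "real \<Rightarrow> real \<Rightarrow> (index \<Rightarrow> plane \<Rightarrow> complex) \<Rightarrow> nat \<Rightarrow> bool" where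
  "multiplier_C2 \<alpha> \<beta> mu jreg \<longleftrightarrow>
     (\<forall>\<nu>. 1 \<le> mdeg \<nu> \<and> mdeg \<nu> \<le> 4 \<longrightarrow>
        (\<exists>K. \<forall>j\<ge>jreg. \<forall>\<xi>. 2 powr (\<beta> * real j * real (mdeg \<nu>)) *
           sqrt (\<Sum>i\<in>Istar_level \<alpha> \<beta> j. (cmod (mderiv \<nu> (mu i) \<xi>))\<^sup>2) \<le> K))"

definition multiplier_regular ::
  "real \<Rightarrow> real \<Rightarrow> (index \<Rightarrow> plane \<Rightarrow> complex) \<Rightarrow> bool" where
  "multiplier_regular \<alpha> \<beta> mu \<longleftrightarrow>
     (\<forall>i\<in>Istar \<alpha> \<beta>. times_differentiable 4 (mu i)) \<and>
     (\<exists>jreg\<ge>1. multiplier_C1 \<alpha> \<beta> mu jreg \<and> multiplier_C2 \<alpha> \<beta> mu jreg)"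

text \<open>The head of a path is the filter applied first.\<close>

primrec propagate ::
  "(index \<Rightarrow> plane \<Rightarrow> complex) \<Rightarrow> index list \<Rightarrow> (plane \<Rightarrow> complex) \<Rightarrow> plane \<Rightarrow> complex" where
  "propagate \<psi> [] f = f"
| "propagate \<psi> (i # p) f = propagate \<psi> p (\<lambda>x. of_real (cmod (conv f (\<psi> i) x)))"

definition scattering ::
  "(plane \<Rightarrow> complex) \<Rightarrow> (index \<Rightarrow> plane \<Rightarrow> complex) \<Rightarrow> (plane \<Rightarrow> complex)
     \<Rightarrow> index list \<Rightarrow> plane \<Rightarrow> complex" where
  "scattering chi \<psi> f p = conv (propagate \<psi> p f) chi"

end

theory Submission
  imports Defs "HOL-Probability.Characteristic_Functions" "HOL-Probability.Sinc_Integral"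
    "HOL-Computational_Algebra.Polynomial"
begin
text \<open>
Write \<open>L f = f \<circ> (id - \<tau>)\<close>, with displacement bounded by \<open>T\<close> and derivative by \<open>D\<close>. Filtering and the
modulus are contractions, so the scattering distance of \<open>L f\<close> and \<open>f\<close> is at most the norm of
\<open>L f - f\<close>. That costs a full derivative of \<open>f\<close>. The theorem saves \<open>\<beta>\<close> of it by two mechanisms.

First, a filter of level \<open>j\<close> nearly commutes with \<open>L\<close>, since its kernel has spatial extent
\<open>2^(-\<beta> j)\<close>, and a deformation frozen at a point is a translation. On frequencies up to \<open>2^j\<close> the
commutator is of size \<open>D 2^(-\<beta> j)\<close> times a gradient (\<open>commutator_low\<close>). Much higher frequencies of
\<open>f\<close> reach the filter only by leaking through the deformation, which is of size \<open>D\<close> without any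
gradient (\<open>high_bound_exists\<close>). The sum over the levels is bounded by \<open>D\<close> times the norm of \<open>f\<close> of
order \<open>1 - \<beta>\<close> (\<open>commutator_estimate\<close>). The output \<open>chi\<close> is treated alike (\<open>chi_estimate\<close>).

Second, the commutator leaves the tree over \<open>|\<psi>\<^sub>i * f|\<close> and its deformation, to which an estimate
of some order \<open>t\<close> may be applied. The modulus demodulates a packet of radius \<open>2^(\<alpha> j)\<close>, so that its
norm of order \<open>t\<close> is bounded by the packet of \<open>f\<close> in order \<open>\<alpha> t\<close> (\<open>modulus_estimate\<close>). An estimate
of order \<open>t\<close> thus implies one of order \<open>max (1 - \<beta>) (\<alpha> t)\<close> (\<open>stable_step\<close>), and since \<open>\<alpha> < 1\<close>,
finitely many steps lead from order one to \<open>1 - \<beta>\<close> (\<open>stable_critical\<close>). All constants are uniform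
in the depth and in the finite set of filters, so the bound passes to the infinite tree.

The estimates are first proved for differentiable deformations. A field in the Sobolev space has
mollifications with the same bounds that converge uniformly to a Lipschitz representative
(\<open>mollification\<close>), and contractivity of the tree allows the limit (\<open>tree_dist_limit\<close>).
Square integrable functions are handled through the relation \<open>FT f g\<close>, that \<open>g\<close> is the transform of
\<open>f\<close>, defined by the multiplication formula and built on Plancherel's identity.
\<close>

abbreviation Bor :: "('a::topological_space => 'b::topological_space) set" where
 "Bor == borel_measurable borel"

abbreviation nn_lborel :: "('a::euclidean_space => ennreal) => ennreal" (binder "NN " 10) where
 "nn_lborel f == nn_integral lborel f"

abbreviation scale_left :: "real => 'a::real_vector => 'a" (infixr "*R" 75) where
 "c *R v == c *\<^sub>R v"

abbreviation tends_to :: "(nat => 'a::topological_space) => 'a => bool" (infixr "---->" 60) where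
 "X ----> L == X \<longlonglongrightarrow> L"


section \<open>Square integrable Borel functions\<close>

text \<open>The squared norm takes values in the extended half line, so that it can be estimated before
  it is known to be finite.\<close>
definition E2 :: "(plane => complex) => ennreal" where
 "E2 f = (NN x. ennreal ((cmod (f x))^2))"

definition BL2 :: "(plane => complex) set" where
 "BL2 = {f \<in> Bor. E2 f < \<infinity>}"

definition BL12 :: "(plane => complex) set" where
 "BL12 = {f \<in> BL2. integrable lborel f}"

lemma BL2D [measurable_dest]: "f \<in> BL2 ==> f \<in> Bor"
 by (simp add: BL2_def)

lemma BL2_fin: "f \<in> BL2 ==> E2 f < \<infinity>"
 by (simp add: BL2_def)

lemma BL12D: "f \<in> BL12 ==> f \<in> BL2" "f \<in> BL12 ==> integrable lborel f"
 by (auto simp: BL12_def)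

lemma borel_measurable_cnj [measurable (raw)]:
 "f \<in> borel_measurable M ==> (%x. cnj (f x)) \<in> borel_measurable M"
 by (rule measurable_compose[OF _ borel_measurable_continuous_onI]) (auto intro!: continuous_intros)

lemma E2_zero [simp]: "E2 (%x. 0) = 0"
 by (simp add: E2_def)

lemma cmod_add_sq: "(cmod (a + b))^2 <= 2 * (cmod a)^2 + 2 * (cmod b)^2"
proof -
 have "(cmod (a + b))^2 <= (cmod a + cmod b)^2"
  by (intro power_mono norm_triangle_ineq) auto
 also have "... <= 2 * (cmod a)^2 + 2 * (cmod b)^2"
  using sum_squares_bound[of "cmod a" "cmod b"] by (simp add: power2_sum)
 finally show ?thesis .
qed

lemma ennreal_cmod_add_sq:
 "ennreal ((cmod (a + b))^2) <= 2 * ennreal ((cmod a)^2) + 2 * ennreal ((cmod b)^2)"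
proof -
 have "ennreal ((cmod (a + b))^2) <= ennreal (2 * (cmod a)^2 + 2 * (cmod b)^2)"
  by (rule ennreal_leI[OF cmod_add_sq])
 also have "... = 2 * ennreal ((cmod a)^2) + 2 * ennreal ((cmod b)^2)"
  by (simp add: ennreal_mult)
 finally show ?thesis .
qed

lemma E2_cong_AE: "AE x in lborel. f x = g x ==> E2 f = E2 g"
 unfolding E2_def by (rule nn_integral_cong_AE) auto

lemma E2_mono:
 "AE x in lborel. cmod (f x) <= cmod (g x) ==> E2 f <= E2 g"
 unfolding E2_def by (rule nn_integral_mono_AE) (auto intro!: ennreal_leI power_mono)

lemma E2_add:
 assumes [measurable]: "f \<in> Bor" "g \<in> Bor"
 shows "E2 (%x. f x + g x) <= 2 * E2 f + 2 * E2 g"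
proof -
 have "E2 (%x. f x + g x)
   <= (NN x. 2 * ennreal ((cmod (f x))^2) + 2 * ennreal ((cmod (g x))^2))"
  unfolding E2_def by (intro nn_integral_mono ennreal_cmod_add_sq)
 also have "... = 2 * E2 f + 2 * E2 g"
  by (simp add: E2_def nn_integral_add nn_integral_cmult)
 finally show ?thesis .
qed

lemma E2_minus: "E2 (%x. - f x) = E2 f"
 by (simp add: E2_def)

lemma E2_minus_commute: "E2 (%x. f x - g x) = E2 (%x. g x - f x)"
 by (simp add: E2_def norm_minus_commute)

lemma E2_diff:
 assumes [measurable]: "f \<in> Bor" "g \<in> Bor"
 shows "E2 (%x. f x - g x) <= 2 * E2 f + 2 * E2 g"
 using E2_add[of f "%x. - g x"] by (simp add: E2_minus)

lemma E2_triangle: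
 assumes [measurable]: "f \<in> Bor" "g \<in> Bor"
  "h \<in> Bor"
 shows "E2 (%x. f x - h x) <= 2 * E2 (%x. f x - g x) + 2 * E2 (%x. g x - h x)"
 using E2_add[of "%x. f x - g x" "%x. g x - h x"] by simp

lemma E2_cmult: "f \<in> Bor ==> E2 (%x. c * f x) = ennreal ((cmod c)^2) * E2 f"
 unfolding E2_def
 by (subst nn_integral_cmult[symmetric]) (auto simp: norm_mult power_mult_distrib ennreal_mult)

lemma BL2_add: "f \<in> BL2 ==> g \<in> BL2 ==> (%x. f x + g x) \<in> BL2"
 using E2_add[of f g]
 by (auto simp: BL2_def ennreal_add_less_top ennreal_mult_less_top
   intro!: order.strict_trans1[of "E2 (%x. f x + g x)" "2 * E2 f + 2 * E2 g"])

lemma BL2_cmult: "f \<in> BL2 ==> (%x. c * f x) \<in> BL2"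
 by (auto simp: BL2_def E2_cmult ennreal_mult_less_top)

lemma BL2_diff: "f \<in> BL2 ==> g \<in> BL2 ==> (%x. f x - g x) \<in> BL2"
 using BL2_add[of f "%x. (-1) * g x"] BL2_cmult[of g "-1"] by simp

lemma BL2_bound:
 assumes "f \<in> BL2" "g \<in> Bor"
  "AE x in lborel. cmod (g x) <= K * cmod (f x)"
 shows "g \<in> BL2"
proof -
 have "E2 g <= E2 (%x. of_real K * f x)"
 proof (rule E2_mono, use assms(3) in eventually_elim)
  case (elim x)
  also have "K * cmod (f x) <= \<bar>K\<bar> * cmod (f x)" by (intro mult_right_mono) auto
  finally show ?case by (simp add: norm_mult)
 qed
 also have "... < \<infinity>" using BL2_cmult[OF assms(1)] by (rule BL2_fin)
 finally show ?thesis using assms by (simp add: BL2_def)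
qed

lemma BL2_iff_integrable:
 "f \<in> Bor ==> f \<in> BL2 \<longleftrightarrow> integrable lborel (%x. (cmod (f x))\<^sup>2)"
 by (simp add: BL2_def E2_def integrable_iff_bounded)

lemma E2_eq_integral:
 "f \<in> BL2 ==> E2 f = ennreal (LINT x|lborel. (cmod (f x))\<^sup>2)"
 unfolding E2_def by (rule nn_integral_eq_integral) (auto simp flip: BL2_iff_integrable)

lemma E2_Cauchy_Schwarz:
 assumes [measurable]: "f \<in> Bor" "g \<in> Bor"
 shows "(NN x. ennreal (cmod (f x * g x)))^2 <= E2 f * E2 g"
 using Cauchy_Schwarz_nn_integral[of "%x. cmod (f x)" lborel "%x. cmod (g x)"]
 by (simp add: E2_def norm_mult ennreal_mult ennreal_power)

lemma BL2_mult_integrable: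
 assumes "f \<in> BL2" "g \<in> BL2"
 shows "integrable lborel (%x. f x * g x)"
proof -
 note [measurable] = assms[THEN BL2D]
 have "(NN x. ennreal (cmod (f x * g x)))^2 < \<infinity>"
  using E2_Cauchy_Schwarz[of f g] assms[THEN BL2_fin]
  by (auto intro: order.strict_trans1 simp: ennreal_mult_less_top less_top)
 then show ?thesis
  by (auto simp: integrable_iff_bounded power_less_top_ennreal)
qed

lemma norm_integral_mult_le:
 assumes "f \<in> BL2" "g \<in> BL2"
 shows "ennreal ((cmod (LINT x|lborel. f x * g x))^2) <= E2 f * E2 g"
proof -
 note [measurable] = assms[THEN BL2D]
 have "ennreal (cmod (LINT x|lborel. f x * g x)) <= (NN x. ennreal (cmod (f x * g x)))"
  by (intro integral_norm_bound_ennreal BL2_mult_integrable assms)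
 then have "ennreal (cmod (LINT x|lborel. f x * g x))^2 <= (NN x. ennreal (cmod (f x * g x)))^2"
  by (rule power_mono) simp
 with E2_Cauchy_Schwarz[of f g] show ?thesis
  by (auto simp: ennreal_power intro: order_trans)
qed

lemma E2_eq_0: "f \<in> Bor ==> E2 f = 0 ==> AE x in lborel. f x = 0"
 unfolding E2_def by (subst (asm) nn_integral_0_iff_AE) auto


lemma BL2_indicator: "bounded S ==> S \<in> sets borel ==> (%x. indicator S x :: complex) \<in> BL2"
proof -
 assume S: "bounded S" "S \<in> sets borel"
 have "E2 (%x. indicator S x) = (NN x. indicator S x)"
  unfolding E2_def by (intro nn_integral_cong) (simp split: split_indicator)
 also have "... = emeasure lborel S" using S by simp
 finally have "E2 (%x. indicator S x) = emeasure lborel S" .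
 then show ?thesis using S emeasure_bounded_finite[OF S(1)] by (auto simp: BL2_def)
qed

lemma BL12_bounded_support:
 assumes f: "f \<in> BL2" and S: "bounded S" "S \<in> sets borel" "!!x. x \<notin> S ==> f x = 0"
 shows "f \<in> BL12"
proof -
 have "integrable lborel (%x. indicator S x * f x)"
  by (rule BL2_mult_integrable[OF BL2_indicator f]) (use S in auto)
 also have "(%x. indicator S x * f x) = f" using S(3) by (auto split: split_indicator)
 finally show ?thesis using f by (simp add: BL12_def)
qed

text \<open>Duality: a square integrable function that annihilates bounded functions of compact
  support vanishes.\<close>
lemma BL2_annihilator:
 assumes f: "f \<in> BL2" and 0: "!!h. h \<in> BL12 ==> (LINT x|lborel. f x * h x) = 0"
 shows "AE x in lborel. f x = 0"
proof -
 note [measurable] = f[THEN BL2D]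
 have "AE x in lborel. x \<in> ball 0 (real n) --> f x = 0" for n :: nat
 proof -
  define h where "h = (%x. indicator (ball 0 (real n)) x * cnj (f x))"
  have [measurable]: "h \<in> Bor"
   unfolding h_def using f[THEN BL2D]
   by (intro borel_measurable_times borel_measurable_cnj borel_measurable_indicator) auto
  have h2: "h \<in> BL2"
   by (rule BL2_bound[OF f, of _ 1]) (auto simp: h_def norm_mult indicator_def)
  have "h \<in> BL12"
   by (rule BL12_bounded_support[OF h2, of "ball 0 (real n)"]) (auto simp: h_def)
  from 0[OF this] have "(LINT x|lborel. f x * h x) = 0" .
  also have "(%x. f x * h x) = (%x. of_real (indicator (ball 0 (real n)) x * (cmod (f x))^2))"
   by (auto simp: h_def fun_eq_iff complex_norm_square[unfolded of_real_power] split: split_indicator)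
  finally have "(LINT x|lborel. indicator (ball 0 (real n)) x * (cmod (f x))^2) = 0"
   by (simp only: integral_complex_of_real of_real_eq_0_iff)
  moreover have "integrable lborel (%x. indicator (ball 0 (real n)) x * (cmod (f x))^2)"
   by (rule Bochner_Integration.integrable_bound[of _ "%x. (cmod (f x))\<^sup>2"])
    (use f in \<open>auto simp: BL2_iff_integrable indicator_def\<close>)
  ultimately have "AE x in lborel. indicator (ball 0 (real n)) x * (cmod (f x))^2 = 0"
   by (subst (asm) integral_nonneg_eq_0_iff_AE) auto
  then show ?thesis by eventually_elim (auto simp: indicator_def split: if_splits)
 qed
 then have "AE x in lborel. \<forall>n::nat. x \<in> ball 0 (real n) --> f x = 0"
  unfolding AE_all_countable by blast
 then show ?thesis
 proof eventually_elim
  case (elim x)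
  obtain n :: nat where "norm x < real n" using reals_Archimedean2 by blast
  with elim show ?case by auto
 qed
qed

lemma E2_fatou:
 assumes [measurable]: "!!n. u n \<in> Bor" "v \<in> Bor"
  and "AE x in lborel. (%n. u n x) ----> v x"
 shows "E2 v <= liminf (%n. E2 (u n))"
proof -
 have "E2 v = (NN x. liminf (%n. ennreal ((cmod (u n x))^2)))"
  unfolding E2_def
 proof (rule nn_integral_cong_AE, use assms(3) in eventually_elim)
  case (elim x)
  have "(%n. ennreal ((cmod (u n x))^2)) ----> ennreal ((cmod (v x))^2)"
   by (intro tendsto_ennrealI tendsto_intros elim)
  then show ?case by (rule lim_imp_Liminf[symmetric, rotated]) simp
 qed
 also have "... <= liminf (%n. E2 (u n))"
  unfolding E2_def by (rule nn_integral_liminf) measurable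
 finally show ?thesis .
qed

lemma integrable_scaleR_iff:
 fixes g :: "plane => 'b::{banach, second_countable_topology}"
 assumes "c ~= (0::real)"
 shows "integrable lborel (%x. c *R g x) \<longleftrightarrow> integrable lborel g"
 using integrable_scaleR_right[of "inverse c" lborel "%x. c *R g x"]
  integrable_scaleR_right[of c lborel g] assms by auto

lemma lborel_subst:
 fixes t :: plane assumes "c ~= 0"
 shows "f \<in> Bor ==>
  (NN x. f x) = ennreal (c\<^sup>2) * (NN x. f (t + c *R x))"
 "g \<in> Bor ==>
  (LINT x|lborel. g x) = c\<^sup>2 *R (LINT x|lborel. (g (t + c *R x) :: 'b::{banach, second_countable_topology}))"
 "g \<in> Bor ==>
  integrable lborel g \<longleftrightarrow> integrable lborel (%x. g (t + c *R x))"
proof -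
 have c: "ennreal \<bar>c\<bar> ^ DIM(plane) = ennreal (c\<^sup>2)"
  by (simp add: ennreal_power)
 show "f \<in> Bor ==>
  (NN x. f x) = ennreal (c\<^sup>2) * (NN x. f (t + c *R x))"
  by (subst lborel_affine[OF assms, of t])
    (simp add: nn_integral_density nn_integral_distr nn_integral_cmult c)
 show "g \<in> Bor ==>
  (LINT x|lborel. g x) = c\<^sup>2 *R (LINT x|lborel. g (t + c *R x))"
  by (subst lborel_affine[OF assms, of t])
    (simp add: integral_density integral_distr)
 show "g \<in> Bor ==>
  integrable lborel g \<longleftrightarrow> integrable lborel (%x. g (t + c *R x))"
  by (subst lborel_affine[OF assms, of t])
    (use assms in \<open>simp add: integrable_density integrable_distr_eq integrable_scaleR_iff\<close>)
qed

lemmas lborel_shift = lborel_subst[of 1, simplified]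
lemmas lborel_reflect = lborel_subst[of "-1", simplified]

lemma AE_lborel_subst:
 fixes t :: plane assumes c: "c ~= 0" and "AE x in lborel. P x"
 shows "AE x in lborel. P (t + c *R x)"
proof -
 obtain N where N: "{x. \<not> P x} \<subseteq> N" "N \<in> sets borel" "emeasure lborel N = 0"
  using AE_E[OF assms(2)] by auto
 have "(NN x. indicator N x) = 0" using N by simp
 then have "(NN x. indicator N (t + c *R x)) = 0"
  using N(2) c by (subst (asm) lborel_subst(1)[OF c, of _ t]) auto
 then have "AE x in lborel. indicator N (t + c *R x) = (0::ennreal)"
  using N(2) by (subst (asm) nn_integral_0_iff_AE) auto
 then show ?thesis by eventually_elim (use N in \<open>auto simp: indicator_def split: if_splits\<close>)
qed


section \<open>The Fourier transform on integrable functions\<close>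

definition ft :: "(plane => complex) => plane => complex" where
 "ft f xi = (LINT x|lborel. cis (- 2 * pi * (x \<bullet> xi)) * f x)"

definition ift :: "(plane => complex) => plane => complex" where
 "ift g x = (LINT xi|lborel. cis (2 * pi * (x \<bullet> xi)) * g xi)"

lemma borel_measurable_cis [measurable (raw)]:
 "f \<in> borel_measurable M ==> (%x. cis (f x)) \<in> borel_measurable M"
 by (rule measurable_compose[OF _ borel_measurable_continuous_onI]) (auto intro!: continuous_intros)

lemma integrable_cis_mult:
 assumes "integrable M f" "a \<in> borel_measurable M"
 shows "integrable M (%x. cis (a x) * f x)"
 by (rule Bochner_Integration.integrable_bound[OF assms(1)])
   (use assms in \<open>auto simp: norm_mult\<close>)

lemma ift_eq_ft: "ift f x = ft f (- x)"
 by (simp add: ift_def ft_def inner_commute)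

lemma ft_borel [measurable (raw)]:
 assumes [measurable]: "f \<in> Bor"
 shows "ft f \<in> Bor"
proof -
 have "(%(xi, x). cis (- 2 * pi * (x \<bullet> xi)) * f x) \<in> borel_measurable (borel \<Otimes>\<^sub>M lborel)"
  by measurable
 then show ?thesis
  unfolding ft_def by (intro lborel.borel_measurable_lebesgue_integral)
qed

lemma ift_borel [measurable (raw)]:
 assumes [measurable]: "f \<in> Bor"
 shows "ift f \<in> Bor"
proof -
 have "(%x. ft f (- x)) \<in> Bor"
  by (rule measurable_compose[OF _ ft_borel]) auto
 then show ?thesis by (simp add: ift_eq_ft[abs_def])
qed

lemma ft_bound: "cmod (ft f xi) <= (LINT x|lborel. cmod (f x))"
 unfolding ft_def by (rule order_trans[OF integral_norm_bound]) (simp add: norm_mult)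

lemma ft_add:
 "integrable lborel f ==> integrable lborel g ==> ft (%x. f x + g x) xi = ft f xi + ft g xi"
 unfolding ft_def by (simp add: distrib_left integrable_cis_mult)

lemma ft_diff:
 "integrable lborel f ==> integrable lborel g ==> ft (%x. f x - g x) xi = ft f xi - ft g xi"
 unfolding ft_def by (simp add: right_diff_distrib integrable_cis_mult)

lemma ft_cmult: "ft (%x. c * f x) xi = c * ft f xi"
proof -
 have "ft (%x. c * f x) xi = (LINT x|lborel. c * (cis (- 2 * pi * (x \<bullet> xi)) * f x))"
  unfolding ft_def by (simp add: mult_ac)
 then show ?thesis by (simp add: ft_def)
qed

lemma ft_cnj: "ft (%x. cnj (f x)) xi = cnj (ft f (- xi))"
proof -
 have "cnj (ft f (- xi)) = (LINT x|lborel. cnj (cis (- 2 * pi * (x \<bullet> - xi)) * f x))"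
  unfolding ft_def by (rule Bochner_Integration.integral_cnj[symmetric])
 then show ?thesis by (simp add: ft_def cis_cnj)
qed

lemma integrable_pair_mult:
 fixes f g :: "plane => complex"
 assumes f: "integrable lborel f" and g: "integrable lborel g"
  and [measurable]: "k \<in> borel_measurable (borel \<Otimes>\<^sub>M borel)"
  and k: "!!x y. cmod (k (x, y)) <= 1"
 shows "integrable (lborel \<Otimes>\<^sub>M lborel) (%(x, y). k (x, y) * (f x * g y))"
proof -
 have [measurable]: "f \<in> Bor" "g \<in> Bor"
  using f g by auto
 have "integrable (lborel \<Otimes>\<^sub>M lborel) (%(x, y). f x * g y)"
 proof (rule lborel_pair.Fubini_integrable)
  show "integrable lborel (%x. LINT y|lborel. norm (case (x, y) of (x, y) => f x * g y))"
   using f by (simp add: norm_mult)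
  show "AE x in lborel. integrable lborel (%y. case (x, y) of (x, y) => f x * g y)"
   using g by simp
 qed simp
 then show ?thesis
  by (rule Bochner_Integration.integrable_bound)
    (auto simp: norm_mult intro!: AE_I2 mult_left_le_one_le k)
qed

text \<open>The multiplication formula, by Fubini.\<close>
lemma ft_mult:
 assumes f: "integrable lborel f" and g: "integrable lborel g"
 shows "(LINT xi|lborel. ft f xi * g xi) = (LINT x|lborel. f x * ft g x)"
proof -
 have *: "integrable (lborel \<Otimes>\<^sub>M lborel)
   (%(x, xi). cis (- 2 * pi * (fst (x, xi) \<bullet> snd (x, xi))) * (f x * g xi))"
  by (rule integrable_pair_mult[OF f g, of "%z. cis (- 2 * pi * (fst z \<bullet> snd z))"]) auto
 have "(LINT xi|lborel. ft f xi * g xi)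
   = (LINT xi|lborel. LINT x|lborel. cis (- 2 * pi * (x \<bullet> xi)) * (f x * g xi))"
 proof (rule Bochner_Integration.integral_cong[OF refl])
  fix xi :: plane
  have "ft f xi * g xi = (LINT x|lborel. (cis (- 2 * pi * (x \<bullet> xi)) * f x) * g xi)"
   by (simp add: ft_def)
  then show "ft f xi * g xi = (LINT x|lborel. cis (- 2 * pi * (x \<bullet> xi)) * (f x * g xi))"
   by (simp add: mult_ac)
 qed
 also have "... = (LINT x|lborel. LINT xi|lborel. cis (- 2 * pi * (x \<bullet> xi)) * (f x * g xi))"
  using lborel_pair.Fubini_integral[OF *] by simp
 also have "... = (LINT x|lborel. f x * ft g x)"
 proof (rule Bochner_Integration.integral_cong[OF refl])
  fix x :: plane
  have "f x * ft g x = (LINT xi|lborel. f x * (cis (- 2 * pi * (xi \<bullet> x)) * g xi))"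
   by (simp add: ft_def)
  moreover have "cis (- 2 * pi * (x \<bullet> xi)) * (f x * g xi) = f x * (cis (- 2 * pi * (xi \<bullet> x)) * g xi)" for xi
   by (simp only: inner_commute[of x xi]) (simp add: mult_ac)
  ultimately show "(LINT xi|lborel. cis (- 2 * pi * (x \<bullet> xi)) * (f x * g xi)) = f x * ft g x"
   by (simp only:)
 qed
 finally show ?thesis .
qed

text \<open>The transform of an autocorrelation is the power spectrum.\<close>
lemma ft_autocorrelation:
 assumes f: "integrable lborel f"
 defines "A \<equiv> (%z. LINT y|lborel. f (y + z) * cnj (f y))"
 shows "integrable lborel A" "ft A xi = ft f xi * cnj (ft f xi)"
proof -
 have [measurable]: "f \<in> Bor" using f by auto
 have shift: "integrable lborel (%z. f (y + z))" for y
  using lborel_shift(3)[of f y] f by simp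
 have int: "integrable (lborel \<Otimes>\<^sub>M lborel) (%(y, z). cis (- 2 * pi * (z \<bullet> xi)) * (f (y + z) * cnj (f y)))" for xi
 proof (rule lborel_pair.Fubini_integrable)
  have "(LINT z|lborel. cmod (f (y + z)) * cmod (f y)) = cmod (f y) * (LINT z|lborel. cmod (f z))" for y
   using lborel_shift(2)[of "%z. cmod (f z)" y] by simp
  then show "integrable lborel (%y. LINT z|lborel. norm (case (y, z) of (y, z) =>
    cis (- 2 * pi * (z \<bullet> xi)) * (f (y + z) * cnj (f y))))"
   using f by (simp add: norm_mult del: integral_mult_left_zero)
  show "AE y in lborel. integrable lborel (%z. case (y, z) of (y, z) =>
    cis (- 2 * pi * (z \<bullet> xi)) * (f (y + z) * cnj (f y)))"
   using shift by (auto intro!: AE_I2 integrable_cis_mult)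
 qed measurable
 from lborel_pair.integrable_snd[OF int[of 0]] show "integrable lborel A"
  by (simp add: A_def)
 have "ft A xi = (LINT z|lborel. LINT y|lborel. cis (- 2 * pi * (z \<bullet> xi)) * (f (y + z) * cnj (f y)))"
  by (simp add: ft_def A_def)
 also have "... = (LINT y|lborel. LINT z|lborel. cis (- 2 * pi * (z \<bullet> xi)) * (f (y + z) * cnj (f y)))"
  using lborel_pair.Fubini_integral[OF int[of xi]] by simp
 also have "... = (LINT y|lborel. ft f xi * (cis (2 * pi * (y \<bullet> xi)) * cnj (f y)))"
 proof (rule Bochner_Integration.integral_cong[OF refl])
  fix y :: plane
  have "ft f xi = (LINT z|lborel. cis (- 2 * pi * ((y + z) \<bullet> xi)) * f (y + z))"
   unfolding ft_def by (subst lborel_shift(2)[of _ y]) auto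
  also have "... = (LINT z|lborel. cis (- 2 * pi * (y \<bullet> xi)) * (cis (- 2 * pi * (z \<bullet> xi)) * f (y + z)))"
  proof (intro Bochner_Integration.integral_cong refl)
   fix z :: plane
   have "cis (- 2 * pi * ((y + z) \<bullet> xi)) = cis (- 2 * pi * (y \<bullet> xi)) * cis (- 2 * pi * (z \<bullet> xi))"
    by (simp add: cis_mult inner_add_left algebra_simps)
   then show "cis (- 2 * pi * ((y + z) \<bullet> xi)) * f (y + z)
    = cis (- 2 * pi * (y \<bullet> xi)) * (cis (- 2 * pi * (z \<bullet> xi)) * f (y + z))" by simp
  qed
  also have "... = cis (- 2 * pi * (y \<bullet> xi)) * (LINT z|lborel. cis (- 2 * pi * (z \<bullet> xi)) * f (y + z))"
   by simp
  finally have "ft f xi * cis (2 * pi * (y \<bullet> xi))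
    = (cis (2 * pi * (y \<bullet> xi)) * cis (- 2 * pi * (y \<bullet> xi))) * (LINT z|lborel. cis (- 2 * pi * (z \<bullet> xi)) * f (y + z))"
   by (simp add: mult_ac)
  then have "ft f xi * cis (2 * pi * (y \<bullet> xi)) = (LINT z|lborel. cis (- 2 * pi * (z \<bullet> xi)) * f (y + z))"
   by (simp add: cis_mult)
  then have "ft f xi * cis (2 * pi * (y \<bullet> xi)) * cnj (f y)
    = (LINT z|lborel. (cis (- 2 * pi * (z \<bullet> xi)) * f (y + z)) * cnj (f y))"
   by simp
  then show "(LINT z|lborel. cis (- 2 * pi * (z \<bullet> xi)) * (f (y + z) * cnj (f y)))
    = ft f xi * (cis (2 * pi * (y \<bullet> xi)) * cnj (f y))"
   by (simp only: mult.assoc)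
 qed
 also have "... = ft f xi * cnj (ft f xi)"
  unfolding ft_def by (simp add: Bochner_Integration.integral_cnj[symmetric] cis_cnj
    del: Bochner_Integration.integral_cnj)
 finally show "ft A xi = ft f xi * cnj (ft f xi)" .
qed

subsection \<open>Gaussians\<close>

lemma std_normal_integral:
 "integrable lborel (%x. cis (t * x) * complex_of_real (exp (- x\<^sup>2 / 2)))"
 "(LINT x|lborel. cis (t * x) * complex_of_real (exp (- x\<^sup>2 / 2))) =
   of_real (sqrt (2 * pi) * exp (- t\<^sup>2 / 2))"
proof -
 have d: "std_normal_density x = exp (- x\<^sup>2 / 2) / sqrt (2 * pi)" for x
  by (simp add: std_normal_density_def)
 have "integrable lborel (%x. sqrt (2 * pi) * std_normal_density x)"
  by simp
 then have i: "integrable lborel (%x. exp (- x\<^sup>2 / 2) :: real)"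
  by (simp add: d)
 then show "integrable lborel (%x. cis (t * x) * complex_of_real (exp (- x\<^sup>2 / 2)))"
  by (intro integrable_cis_mult) auto
 have "complex_of_real (exp (- t\<^sup>2 / 2)) = char std_normal_distribution t"
  by (simp add: char_std_normal_distribution)
 also have "... = (LINT x|lborel. std_normal_density x *R cis (t * x))"
  unfolding char_def cis_conv_exp by (subst integral_density) (auto simp: mult_ac)
 also have "... = (LINT x|lborel. of_real (1 / sqrt (2 * pi)) * (cis (t * x) * of_real (exp (- x\<^sup>2 / 2))))"
  by (intro Bochner_Integration.integral_cong refl) (simp add: d scaleR_conv_of_real)
 also have "... = of_real (1 / sqrt (2 * pi)) * (LINT x|lborel. cis (t * x) * of_real (exp (- x\<^sup>2 / 2)))"
  by (rule integral_mult_right_zero)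
 finally show "(LINT x|lborel. cis (t * x) * complex_of_real (exp (- x\<^sup>2 / 2))) =
   of_real (sqrt (2 * pi) * exp (- t\<^sup>2 / 2))"
  by (simp add: field_simps)
qed

lemma norm_sq_Basis: "(norm u)^2 = (\<Sum>b\<in>Basis. (u \<bullet> b)\<^sup>2)" for u :: "'a::euclidean_space"
 unfolding power2_norm_eq_inner by (subst euclidean_inner) (simp add: power2_eq_square)

lemma cis_sum: "finite I ==> cis (\<Sum>i\<in>I. a i) = (\<Prod>i\<in>I. cis (a i))"
 by (induction I rule: finite_induct) (auto simp: cis_mult[symmetric])

lemma gaussian_integral:
 fixes s :: plane
 shows "integrable lborel (%u. cis (s \<bullet> u) * complex_of_real (exp (- (norm u)\<^sup>2 / 2)))" (is ?I)
  and "(LINT u|lborel. cis (s \<bullet> u) * complex_of_real (exp (- (norm u)\<^sup>2 / 2)))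
   = of_real (2 * pi * exp (- (norm s)\<^sup>2 / 2))" (is ?E)
proof -
 interpret product_sigma_finite "%_::plane. lborel :: real measure" ..
 let ?g = "%(b::plane) (x::real). cis ((s \<bullet> b) * x) * complex_of_real (exp (- x\<^sup>2 / 2))"
 have eq: "cis (s \<bullet> (\<Sum>b\<in>Basis. f b *R b)) * complex_of_real (exp (- (norm (\<Sum>b\<in>Basis. f b *R b :: plane))\<^sup>2 / 2))
   = (\<Prod>b\<in>Basis. ?g b (f b))" for f
 proof -
  have "s \<bullet> (\<Sum>b\<in>Basis. f b *R b) = (\<Sum>b\<in>Basis. (s \<bullet> b) * f b)"
   by (simp add: inner_sum_right mult.commute)
  moreover have "- (norm (\<Sum>b\<in>Basis. f b *R b :: plane))\<^sup>2 / 2 = (\<Sum>b\<in>Basis. - (f b)\<^sup>2 / 2)"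
   by (simp add: norm_sq_Basis sum_divide_distrib sum_negf)
  ultimately show ?thesis
   by (simp only: cis_sum[OF finite_Basis] exp_sum[OF finite_Basis] of_real_prod prod.distrib)
 qed
 have m: "(%u::plane. cis (s \<bullet> u) * complex_of_real (exp (- (norm u)\<^sup>2 / 2))) \<in> Bor"
  by measurable
 have m2: "(%f. \<Sum>b\<in>Basis. f b *R b :: plane) \<in> measurable (\<Pi>\<^sub>M b\<in>Basis. lborel) borel"
  by measurable
 show ?I
  by (subst lborel_eq, subst integrable_distr_eq[OF m2 m])
    (unfold eq, rule product_integrable_prod[OF finite_Basis std_normal_integral(1)])
 have "(LINT u|lborel. cis (s \<bullet> u) * complex_of_real (exp (- (norm u)\<^sup>2 / 2)))
   = (LINT f|(\<Pi>\<^sub>M b\<in>Basis. lborel). (\<Prod>b\<in>Basis. ?g b (f b)))"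
  by (subst lborel_eq, subst integral_distr[OF m2 m]) (simp only: eq)
 also have "... = (\<Prod>b\<in>Basis. LINT x|lborel. ?g b x)"
  by (rule product_integral_prod[OF finite_Basis std_normal_integral(1)])
 also have "... = (\<Prod>b\<in>(Basis::plane set). complex_of_real (sqrt (2 * pi)) * of_real (exp (- (s \<bullet> b)\<^sup>2 / 2)))"
  by (simp only: std_normal_integral of_real_mult)
 also have "... = of_real (sqrt (2 * pi)) ^ 2 * of_real (\<Prod>b\<in>Basis. exp (- (s \<bullet> b)\<^sup>2 / 2))"
  by (simp add: prod.distrib)
 also have "(\<Prod>b\<in>Basis. exp (- (s \<bullet> b)\<^sup>2 / 2)) = exp (- (norm s)\<^sup>2 / 2)"
  by (simp add: norm_sq_Basis exp_sum[symmetric] sum_divide_distrib sum_negf)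
 also have "complex_of_real (sqrt (2 * pi)) ^ 2 = of_real (2 * pi)"
  by (simp only: of_real_power[symmetric]) simp
 finally show ?E by simp
qed

definition gauss :: "plane => complex" where
 "gauss u = of_real (exp (- (norm u)\<^sup>2 / 2))"

lemma gauss_borel [measurable]: "gauss \<in> Bor"
 unfolding gauss_def by measurable

lemma gauss_integrable: "integrable lborel gauss"
 using gaussian_integral(1)[of 0] by (simp add: gauss_def[abs_def])

lemma ft_gauss: "ft gauss z = of_real (2 * pi * exp (- 2 * pi\<^sup>2 * (norm z)^2))"
 using gaussian_integral(2)[of "(- 2 * pi) *R z"]
 by (simp add: ft_def gauss_def inner_commute power_mult_distrib field_simps)

lemma ft_gauss_integral:
 "integrable lborel (ft gauss)" "(LINT z|lborel. ft gauss z) = 1"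
proof -
 have *: "ft gauss z = of_real (2 * pi) * gauss ((2 * pi) *R z)" for z
  by (simp add: ft_gauss gauss_def power_mult_distrib field_simps)
 have i: "integrable lborel (%z. gauss ((2 * pi) *R z))"
  using lborel_subst(3)[of "2 * pi" gauss 0] gauss_integrable by simp
 then show "integrable lborel (ft gauss)"
  unfolding *[abs_def] by (rule integrable_mult_right)
 have "complex_of_real (2 * pi) = (LINT x|lborel. gauss x)"
  using gaussian_integral(2)[of 0] by (simp add: gauss_def[abs_def])
 also have "... = (2 * pi)^2 *R (LINT z|lborel. gauss ((2 * pi) *R z))"
  using lborel_subst(2)[of "2 * pi" gauss 0] by simp
 finally show "(LINT z|lborel. ft gauss z) = 1"
  unfolding * by (simp add: scaleR_conv_of_real power2_eq_square field_simps)
qed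

lemma ft_gauss_scaled:
 assumes "a > 0"
 shows "ft (%xi. gauss (a *R xi)) z = of_real (1 / a\<^sup>2) * ft gauss (z /\<^sub>R a)"
proof -
 have "ft gauss (z /\<^sub>R a) = a\<^sup>2 *R (LINT x|lborel. cis (- 2 * pi * ((a *R x) \<bullet> (z /\<^sub>R a))) * gauss (a *R x))"
  unfolding ft_def using assms
  by (subst lborel_subst(2)[of a _ 0]) auto
 also have "... = a\<^sup>2 *R ft (%xi. gauss (a *R xi)) z"
 proof -
  have "(a *R x) \<bullet> (z /\<^sub>R a) = x \<bullet> z" for x using assms by simp
  then show ?thesis by (simp only: ft_def)
 qed
 finally show ?thesis using assms by (simp add: scaleR_conv_of_real)
qed


subsection \<open>Translations are continuous in the mean\<close>

lemma tendsto_ennreal_0I: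
 fixes f :: "nat => ennreal"
 assumes "!!e::real. e > 0 ==> \<forall>\<^sub>F n in sequentially. f n <= ennreal e"
 shows "f ----> 0"
proof (rule tendsto_zero_ennreal)
 fix r :: real assume "0 < r"
 then have "ennreal (r / 2) < ennreal r" by (simp add: ennreal_lessI)
 moreover have "\<forall>\<^sub>F n in sequentially. f n <= ennreal (r / 2)" using assms \<open>0 < r\<close> by simp
 ultimately show "\<forall>\<^sub>F n in sequentially. f n < ennreal r"
  by (auto elim!: eventually_mono)
qed

lemma tendsto_ennreal_0D:
 fixes f :: "nat => ennreal"
 assumes "f ----> 0" "e > (0::real)"
 shows "\<forall>\<^sub>F n in sequentially. f n <= ennreal e"
 using order_tendstoD(2)[OF assms(1), of "ennreal e"] assms(2)
 by (auto elim!: eventually_mono)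

lemma translation_open:
 fixes U :: "plane set"
 assumes U: "open U" "emeasure lborel U < \<infinity>" and X: "X ----> 0"
 shows "(%n. \<integral>\<^sup>+x. indicator U x * indicator (- U) (x + X n) \<partial>lborel) ----> (0::ennreal)"
proof -
 have [measurable]: "U \<in> sets borel" using U by simp
 have "(%n. \<integral>\<^sup>+x. indicator U x * indicator (- U) (x + X n) \<partial>lborel) ----> (\<integral>\<^sup>+(x::plane). 0 \<partial>lborel)"
 proof (rule nn_integral_dominated_convergence[where w = "indicator U"])
  show "AE x in lborel. (%n. indicator U x * indicator (- U) (x + X n)) ----> (0::ennreal)"
  proof (rule AE_I2)
   fix x
   show "(%n. indicator U x * indicator (- U) (x + X n)) ----> (0::ennreal)"
   proof (cases "x \<in> U")
    case True
    have "(%n. x + X n) ----> x + 0" by (intro tendsto_intros X)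
    then have "\<forall>\<^sub>F n in sequentially. x + X n \<in> U"
    using True U(1) by (auto dest: topological_tendstoD)
    then have "\<forall>\<^sub>F n in sequentially. indicator U x * indicator (- U) (x + X n) = (0::ennreal)"
    by eventually_elim simp
    then show ?thesis by (rule tendsto_eventually)
   qed simp
  qed
  show "!!j. AE x in lborel. indicator U x * indicator (- U) (x + X j) <= (indicator U x :: ennreal)"
   by (intro AE_I2) (auto split: split_indicator)
 qed (use U in \<open>auto\<close>)
 then show ?thesis by simp
qed

lemma translation_continuous_L1:
 fixes f :: "plane => complex"
 assumes "integrable lborel f" and X: "X ----> 0"
 shows "(%n. \<integral>\<^sup>+x. ennreal (cmod (f (x + X n) - f x)) \<partial>lborel) ----> 0"
proof -
 define T where "T = (%(f::plane => complex) n. \<integral>\<^sup>+x. ennreal (cmod (f (x + X n) - f x)) \<partial>lborel)"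
 have Tadd: "T (%x. f x + g x) n <= T f n + T g n"
  if [measurable]: "f \<in> Bor" "g \<in> Bor" for f g n
 proof -
  have "T (%x. f x + g x) n
    <= (NN x. ennreal (cmod (f (x + X n) - f x)) + ennreal (cmod (g (x + X n) - g x)))"
   unfolding T_def
   by (intro nn_integral_mono)
    (auto simp: ennreal_plus[symmetric] add_diff_add norm_triangle_ineq simp del: ennreal_plus intro!: ennreal_leI)
  also have "... = T f n + T g n" unfolding T_def by (rule nn_integral_add) auto
  finally show ?thesis .
 qed
 have bound: "T f n <= 2 * (NN x. ennreal (cmod (f x)))"
  if [measurable]: "f \<in> Bor" for f n
 proof -
  have "T f n <= (NN x. ennreal (cmod (f (x + X n))) + ennreal (cmod (f x)))"
   unfolding T_def
   by (intro nn_integral_mono)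
    (auto simp: ennreal_plus[symmetric] norm_triangle_ineq4 simp del: ennreal_plus intro!: ennreal_leI)
  also have "... = (NN x. ennreal (cmod (f (x + X n)))) + (NN x. ennreal (cmod (f x)))"
   by (rule nn_integral_add) auto
  also have "(NN x. ennreal (cmod (f (x + X n)))) = (NN x. ennreal (cmod (f x)))"
   using lborel_shift(1)[of "%x. ennreal (cmod (f x))" "X n"] by (simp add: add.commute)
  finally show ?thesis by (simp add: mult_2)
 qed
 have approx: "T f ----> 0"
  if [measurable]: "f \<in> Bor"
   and ex: "!!e. e > 0 ==> \<exists>g\<in>Bor.
    (NN x. ennreal (cmod (f x - g x))) <= ennreal e \<and> T g ----> 0" for f
 proof (rule tendsto_ennreal_0I)
  fix e :: real assume "e > 0"
  then obtain g where [measurable]: "g \<in> Bor"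
   and g: "(NN x. ennreal (cmod (f x - g x))) <= ennreal (e / 3)" "T g ----> 0"
   using ex[of "e / 3"] by auto
  have "\<forall>\<^sub>F n in sequentially. T g n <= ennreal (e / 3)"
   using tendsto_ennreal_0D[OF g(2), of "e / 3"] \<open>e > 0\<close> by simp
  then show "\<forall>\<^sub>F n in sequentially. T f n <= ennreal e"
  proof eventually_elim
   case (elim n)
   have "T f n <= T (%x. f x - g x) n + T g n"
    using Tadd[of "%x. f x - g x" g n] by simp
   also have "... <= 2 * ennreal (e / 3) + ennreal (e / 3)"
    using bound[of "%x. f x - g x" n] elim
    by (intro add_mono order_trans[OF bound mult_left_mono[OF g(1)]]) auto
   also have "... = ennreal e"
   proof -
    have "2 * ennreal (e / 3) + ennreal (e / 3) = ennreal (2 * (e / 3)) + ennreal (e / 3)"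
    using \<open>e > 0\<close> by (subst ennreal_mult) auto
    also have "... = ennreal e"
    using \<open>e > 0\<close> by (subst ennreal_plus[symmetric]) auto
    finally show ?thesis .
   qed
   finally show ?case .
  qed
 qed
 have open_case: "T (%x. indicator U x *R c) ----> 0"
  if U: "open U" "emeasure lborel U < \<infinity>" for U c
 proof -
  have [measurable]: "U \<in> sets borel" using U by simp
  have "T (%x. indicator U x *R c) n <= ennreal (cmod c) *
    ((NN x. indicator U x * indicator (- U) (x + X n)) +
    (NN x. indicator U x * indicator (- U) (x + (- X n))))" for n
  proof -
   have "T (%x. indicator U x *R c) n <= (NN x. ennreal (cmod c) *
    (indicator U x * indicator (- U) (x + X n) + indicator U (x + X n) * indicator (- U) x))"
    unfolding T_def by (intro nn_integral_mono) (auto split: split_indicator)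
   also have "... = ennreal (cmod c) * ((NN x. indicator U x * indicator (- U) (x + X n)) +
    (NN x. indicator U (x + X n) * indicator (- U) x))"
    by (subst nn_integral_cmult, measurable) (subst nn_integral_add, auto)
   also have "(NN x. indicator U (x + X n) * indicator (- U) x)
    = (NN x. indicator U x * indicator (- U) (x + (- X n)))"
    by (subst lborel_shift(1)[of _ "- X n"]) (auto simp: algebra_simps)
   finally show ?thesis .
  qed
  moreover have "(%n. ennreal (cmod c) *
    ((NN x. indicator U x * indicator (- U) (x + X n)) +
    (NN x. indicator U x * indicator (- U) (x + (- X n))))) ----> ennreal (cmod c) * (0 + 0)"
   using tendsto_minus[OF X]
   by (intro ennreal_tendsto_cmult tendsto_add translation_open U X) auto
  ultimately show ?thesis
   by (intro tendsto_sandwich[OF _ _ tendsto_const, of 0 "T (%x. indicator U x *R c)"]) auto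
 qed
 have "T f ----> 0"
  using assms(1)
 proof (induction rule: integrable_induct)
  case (base A c)
  then have [measurable]: "A \<in> sets borel" by simp
  show ?case
  proof (rule approx)
   fix e :: real assume "e > 0"
   then have "e / (cmod c + 1) > 0" by (simp add: add_nonneg_pos)
   then obtain U where U: "open U" "A \<subseteq> U" "emeasure lborel (U - A) < ennreal (e / (cmod c + 1))"
    using outer_regular_lborel[of A "e / (cmod c + 1)"] by auto
   have [measurable]: "U \<in> sets borel" using U by simp
   have "emeasure lborel U = emeasure lborel A + emeasure lborel (U - A)"
    using U(2) by (subst plus_emeasure) (auto simp: Un_absorb1)
   also have "... < \<infinity>"
    using base(2) order.strict_trans[OF U(3) ennreal_less_top] by simp
   finally have fin: "emeasure lborel U < \<infinity>" .
   have "(NN x. ennreal (cmod (indicator A x *R c - indicator U x *R c)))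
    = (NN x. ennreal (cmod c) * indicator (U - A) x)"
    using U(2) by (intro nn_integral_cong) (auto split: split_indicator)
   also have "... = ennreal (cmod c) * emeasure lborel (U - A)"
    by (rule nn_integral_cmult_indicator) auto
   also have "... <= ennreal (cmod c + 1) * ennreal (e / (cmod c + 1))"
    using U(3) by (intro mult_mono) (auto intro!: ennreal_leI simp del: ennreal_plus)
   also have "... = ennreal e"
    using \<open>e > 0\<close> by (subst ennreal_mult[symmetric]) (auto simp: add_nonneg_eq_0_iff)
   finally show "\<exists>g\<in>Bor.
    (NN x. ennreal (cmod (indicator A x *R c - g x))) <= ennreal e \<and> T g ----> 0"
    by (intro bexI[of _ "%x. indicator U x *R c"] conjI open_case U fin) auto
  qed simp
 next
  case (add f g)
  have "(%n. T f n + T g n) ----> 0 + 0" by (intro tendsto_add add)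
  moreover have "T (%x. f x + g x) n <= T f n + T g n" for n
   using add.hyps by (intro Tadd) auto
  ultimately show ?case
   by (intro tendsto_sandwich[OF _ _ tendsto_const, of 0 "T (%x. f x + g x)"]) auto
 next
  case (lim f s)
  have [measurable]: "f \<in> Bor" "!!i. s i \<in> Bor"
   using lim by auto
  show ?case
  proof (rule approx)
   fix e :: real assume "e > 0"
   have "(%i. \<integral>\<^sup>+x. ennreal (cmod (f x - s i x)) \<partial>lborel) ----> (\<integral>\<^sup>+(x::plane). 0 \<partial>lborel)"
   proof (rule nn_integral_dominated_convergence[where w = "%x. ennreal (3 * cmod (f x))"])
    show "(NN x. ennreal (3 * cmod (f x))) < \<infinity>"
    proof -
    have "(NN x. ennreal (cmod (f x))) < \<infinity>"
    using lim.hyps unfolding integrable_iff_bounded by blast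
    then show ?thesis by (simp add: ennreal_mult nn_integral_cmult ennreal_mult_less_top)
    qed
    show "!!j. AE x in lborel. ennreal (cmod (f x - s j x)) <= ennreal (3 * cmod (f x))"
    proof (intro AE_I2 ennreal_leI)
    fix j x
    show "cmod (f x - s j x) <= 3 * cmod (f x)"
    using lim.hyps(3)[of x j] norm_triangle_ineq4[of "f x" "s j x"] by simp
    qed
    show "AE x in lborel. (%i. ennreal (cmod (f x - s i x))) ----> 0"
    proof (rule AE_I2)
    fix x :: plane
    have "(%i. cmod (f x - s i x)) ----> cmod (f x - f x)"
    using lim.hyps(2)[of x] by (intro tendsto_intros) auto
    then show "(%i. ennreal (cmod (f x - s i x))) ----> 0"
    by (simp add: ennreal_tendsto_0_iff)
    qed
   qed auto
   then have "(%i. \<integral>\<^sup>+x. ennreal (cmod (f x - s i x)) \<partial>lborel) ----> 0" by simp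
   from tendsto_ennreal_0D[OF this \<open>e > 0\<close>] obtain i where
    "(NN x. ennreal (cmod (f x - s i x))) <= ennreal e"
    by (auto simp: eventually_sequentially)
   then show "\<exists>g\<in>Bor.
    (NN x. ennreal (cmod (f x - g x))) <= ennreal e \<and> T g ----> 0"
    using lim.IH by (intro bexI[of _ "s i"]) auto
  qed simp
 qed
 then show ?thesis by (simp add: T_def)
qed

subsection \<open>Plancherel's identity\<close>

definition L2n :: "(plane => complex) => real" where
 "L2n f = sqrt (enn2real (E2 f))"

lemma L2n_nonneg [simp]: "0 <= L2n f" by (simp add: L2n_def)

lemma E2_L2n: "f \<in> BL2 ==> E2 f = ennreal ((L2n f)^2)"
 using BL2_fin[of f] by (simp add: L2n_def)

lemma L2n_minus_commute: "L2n (%x. f x - g x) = L2n (%x. g x - f x)"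
 unfolding L2n_def by (subst E2_minus_commute) (rule refl)

lemma L2n_sq: "f \<in> BL2 ==> (L2n f)\<^sup>2 = (LINT x|lborel. (cmod (f x))\<^sup>2)"
 by (simp add: L2n_def E2_eq_integral)

lemma L2n_Minkowski:
 assumes f: "f \<in> BL2" and g: "g \<in> BL2"
 shows "L2n (%x. f x + g x) <= L2n f + L2n g"
proof -
 note [measurable] = f[THEN BL2D] g[THEN BL2D]
 note fg = BL2_add[OF f g]
 have i: "integrable lborel (%x. cmod (f x) * cmod (g x))"
  using integrable_norm[OF BL2_mult_integrable[OF f g]] by (simp add: norm_mult)
 have CS: "(LINT x|lborel. cmod (f x) * cmod (g x)) <= L2n f * L2n g"
 proof -
  have "(NN x. ennreal (cmod (f x * g x)))^2 <= ennreal ((L2n f)^2) * ennreal ((L2n g)^2)"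
   using E2_Cauchy_Schwarz[of f g] E2_L2n f g by simp
  also have "(NN x. ennreal (cmod (f x * g x))) = ennreal (LINT x|lborel. cmod (f x) * cmod (g x))"
   using i by (simp add: norm_mult nn_integral_eq_integral)
  finally have "(LINT x|lborel. cmod (f x) * cmod (g x))^2 <= (L2n f * L2n g)^2"
   by (simp add: ennreal_power ennreal_mult[symmetric] power_mult_distrib)
  then show ?thesis by (rule power2_le_imp_le) simp
 qed
 have "(L2n (%x. f x + g x))^2 = (LINT x|lborel. (cmod (f x + g x))\<^sup>2)"
  by (rule L2n_sq[OF fg])
 also have "... <= (LINT x|lborel. (cmod (f x))\<^sup>2 + 2 * (cmod (f x) * cmod (g x)) + (cmod (g x))^2)"
 proof (rule integral_mono)
  show "integrable lborel (%x. (cmod (f x + g x))\<^sup>2)"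
   using fg by (subst BL2_iff_integrable[symmetric]) auto
  show "integrable lborel (%x. (cmod (f x))\<^sup>2 + 2 * (cmod (f x) * cmod (g x)) + (cmod (g x))^2)"
   using f g i by (auto simp: BL2_iff_integrable)
  fix x
  have "(cmod (f x + g x))^2 <= (cmod (f x) + cmod (g x))^2"
   by (intro power_mono norm_triangle_ineq) auto
  then show "(cmod (f x + g x))^2 <= (cmod (f x))^2 + 2 * (cmod (f x) * cmod (g x)) + (cmod (g x))^2"
   by (simp add: power2_sum mult_ac)
 qed
 also have "... = (L2n f)^2 + 2 * (LINT x|lborel. cmod (f x) * cmod (g x)) + (L2n g)^2"
  using f g i by (simp add: L2n_sq BL2_iff_integrable)
 also have "... <= (L2n f + L2n g)^2"
  using CS by (simp add: power2_sum mult_ac)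
 finally show ?thesis by (rule power2_le_imp_le) simp
qed

lemma L2n_triangle_diff:
 assumes f: "f \<in> BL2" and g: "g \<in> BL2"
 shows "\<bar>L2n f - L2n g\<bar> <= L2n (%x. f x - g x)"
 using L2n_Minkowski[OF BL2_diff[OF f g] g] L2n_Minkowski[OF BL2_diff[OF g f] f]
  L2n_minus_commute[of f g] by simp

lemma L2n_tendsto_0_iff:
 assumes "!!n. u n \<in> BL2"
 shows "(%n. L2n (u n)) ----> 0 \<longleftrightarrow> (%n. E2 (u n)) ----> 0"
proof -
 have "(%n. E2 (u n)) ----> 0 \<longleftrightarrow> (%n. (L2n (u n))\<^sup>2) ----> 0"
  using assms by (simp add: E2_L2n ennreal_tendsto_0_iff)
 also have "... \<longleftrightarrow> (%n. L2n (u n)) ----> 0"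
  by (simp add: power_tendsto_0_iff)
 finally show ?thesis by simp
qed

lemma E2_tendsto:
 assumes u: "!!n. u n \<in> BL2" and v: "v \<in> BL2" and "(%n. E2 (%x. u n x - v x)) ----> 0"
 shows "(%n. E2 (u n)) ----> E2 v"
proof -
 have "(%n. L2n (%x. u n x - v x)) ----> 0"
  using assms(3) L2n_tendsto_0_iff[of "%n x. u n x - v x"] BL2_diff[OF u v] by simp
 then have "(%n. L2n (u n) - L2n v) ----> 0"
  by (rule Lim_null_comparison[rotated]) (use L2n_triangle_diff[OF u v] in auto)
 then have "(%n. L2n (u n)) ----> L2n v" by (simp add: LIM_zero_iff)
 then have "(%n. ennreal ((L2n (u n))^2)) ----> ennreal ((L2n v)^2)"
  by (intro tendsto_ennrealI tendsto_power)
 then show ?thesis using u v by (simp add: E2_L2n)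
qed


lemma liminf_le_const:
 fixes X :: "nat => ennreal"
 assumes "\<forall>\<^sub>F n in sequentially. X n <= C"
 shows "liminf X <= C"
proof -
 have "liminf X <= liminf (%n. C)" using assms by (rule Liminf_mono)
 then show ?thesis by (simp add: Liminf_const)
qed

lemma tendsto_ennreal_0_le:
 fixes f g :: "nat => ennreal"
 assumes "g ----> 0" "!!n. f n <= g n"
 shows "f ----> 0"
 by (rule tendsto_sandwich[OF _ _ tendsto_const assms(1)]) (use assms(2) in auto)

lemma ft_BL12_integrable: "f \<in> BL12 ==> integrable lborel f" "f \<in> BL12 ==> f \<in> Bor"
 by (auto simp: BL12_def BL2_def)

lemma BL12_add: "f \<in> BL12 ==> g \<in> BL12 ==> (%x. f x + g x) \<in> BL12"
 by (auto simp: BL12_def BL2_add)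

lemma BL12_diff: "f \<in> BL12 ==> g \<in> BL12 ==> (%x. f x - g x) \<in> BL12"
 by (auto simp: BL12_def BL2_diff)

lemma BL12_cmult: "f \<in> BL12 ==> (%x. c * f x) \<in> BL12"
 by (auto simp: BL12_def BL2_cmult)

lemma BL2_cnj: "f \<in> BL2 ==> (%x. cnj (f x)) \<in> BL2"
 by (rule BL2_bound[of f _ 1]) auto

lemma BL12_cnj: "f \<in> BL12 ==> (%x. cnj (f x)) \<in> BL12"
 using BL2_cnj[of f] by (auto simp: BL12_def)

lemma BL12_bounded_mult:
 assumes f: "f \<in> BL12" and [measurable]: "g \<in> Bor" and g: "!!x. cmod (g x) <= K"
 shows "(%x. g x * f x) \<in> BL12"
proof -
 have [measurable]: "f \<in> Bor" using f by (rule ft_BL12_integrable)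
 have "(%x. g x * f x) \<in> BL2"
  by (rule BL2_bound[OF BL12D(1)[OF f], of _ K]) (auto simp: norm_mult intro!: AE_I2 mult_right_mono g)
 moreover have "integrable lborel (%x. of_real K * f x)"
  using f by (simp add: BL12D)
 then have "integrable lborel (%x. g x * f x)"
 proof (rule Bochner_Integration.integrable_bound)
  show "AE x in lborel. cmod (g x * f x) <= cmod (of_real K * f x)"
   by (intro AE_I2) (auto simp: norm_mult intro!: mult_right_mono order_trans[OF g abs_ge_self])
 qed simp
 ultimately show ?thesis by (simp add: BL12_def)
qed

text \<open>The power spectrum is the transform of the autocorrelation. Integrating it against a
  shrinking Gaussian evaluates the autocorrelation near \<open>0\<close>, where it is continuous with value the
  squared norm.\<close>
lemma plancherel_bounded:
 assumes f: "f \<in> BL12" and K: "!!x. cmod (f x) <= K"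
 shows "E2 (ft f) = E2 f"
proof -
 note fi = BL12D(2)[OF f]
 have [measurable]: "f \<in> Bor" using fi by auto
 define A where "A = (%z. LINT y|lborel. f (y + z) * cnj (f y))"
 have Ai: "integrable lborel A" and fA: "!!xi. ft A xi = ft f xi * cnj (ft f xi)"
  unfolding A_def by (rule ft_autocorrelation[OF fi])+
 have [measurable]: "A \<in> Bor" using Ai by auto
 define a where "a = (%n. 1 / real (Suc n))"
 have a: "a n > 0" for n by (simp add: a_def)
 have a0: "a ----> 0" unfolding a_def by (rule LIMSEQ_Suc, rule lim_1_over_n)
 define w where "w = (%n xi. gauss (a n *R xi))"
 have wi: "integrable lborel (w n)" for n
  using lborel_subst(3)[of "a n" gauss 0] a[of n] gauss_integrable by (simp add: w_def)
 have fint: "integrable lborel (%y. f (y + z) * cnj (f y))" for z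
 proof (rule Bochner_Integration.integrable_bound[of _ "%y. of_real K * f y"])
  show "AE x in lborel. norm (f (x + z) * cnj (f x)) <= norm (of_real K * f x)"
   by (intro AE_I2) (auto simp: norm_mult intro!: mult_right_mono order_trans[OF K abs_ge_self])
 qed (use fi in auto)
 have Abd: "cmod (A z) <= K * (LINT y|lborel. cmod (f y))" for z
 proof -
  have "cmod (A z) <= (LINT y|lborel. cmod (f (y + z) * cnj (f y)))"
   unfolding A_def by (rule integral_norm_bound)
  also have "... <= (LINT y|lborel. K * cmod (f y))"
   using fint[of z, THEN integrable_norm] fi
   by (intro integral_mono) (auto simp: norm_mult intro!: mult_right_mono K)
  finally show ?thesis by simp
 qed
 have A0: "A 0 = of_real (LINT y|lborel. (cmod (f y))\<^sup>2)"
  unfolding A_def by (subst integral_complex_of_real[symmetric]) (simp add: complex_norm_square[unfolded of_real_power])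
 have Acont: "(%n. A (a n *R v)) ----> A 0" for v
 proof -
  have "(%n. a n *R v) ----> 0 *R v" by (intro tendsto_intros a0)
  then have T: "(%n. \<integral>\<^sup>+x. ennreal (cmod (f (x + a n *R v) - f x)) \<partial>lborel) ----> 0"
   by (intro translation_continuous_L1 fi) simp
  have le: "ennreal (cmod (A (a n *R v) - A 0))
    <= ennreal K * (NN x. ennreal (cmod (f (x + a n *R v) - f x)))" for n
  proof -
   have "A (a n *R v) - A 0 = (LINT y|lborel. f (y + a n *R v) * cnj (f y) - f (y + 0) * cnj (f y))"
    unfolding A_def using fint[of 0] fint[of "a n *R v"] by simp
   also have "ennreal (cmod ...) <= (NN y. ennreal (cmod (f (y + a n *R v) * cnj (f y) - f (y + 0) * cnj (f y))))"
    using fint[of 0] fint[of "a n *R v"] by (intro integral_norm_bound_ennreal Bochner_Integration.integrable_diff)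
   also have "... <= (NN y. ennreal K * ennreal (cmod (f (y + a n *R v) - f y)))"
   proof (rule nn_integral_mono)
    fix y
    have "cmod (f (y + a n *R v) * cnj (f y) - f (y + 0) * cnj (f y)) = cmod (f y) * cmod (f (y + a n *R v) - f y)"
    by (simp add: left_diff_distrib[symmetric] norm_mult)
    also have "... <= K * cmod (f (y + a n *R v) - f y)" by (intro mult_right_mono K) simp
    finally show "ennreal (cmod (f (y + a n *R v) * cnj (f y) - f (y + 0) * cnj (f y)))
    <= ennreal K * ennreal (cmod (f (y + a n *R v) - f y))"
    using order_trans[OF norm_ge_zero K] by (subst ennreal_mult[symmetric]) (auto intro: ennreal_leI)
   qed
   also have "... = ennreal K * (NN x. ennreal (cmod (f (x + a n *R v) - f x)))"
    by (rule nn_integral_cmult) measurable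
   finally show ?thesis .
  qed
  have "(%n. ennreal K * (NN x. ennreal (cmod (f (x + a n *R v) - f x)))) ----> ennreal K * 0"
   by (intro ennreal_tendsto_cmult T) simp
  then have "(%n. ennreal K * (NN x. ennreal (cmod (f (x + a n *R v) - f x)))) ----> 0"
   by simp
  then have "(%n. ennreal (cmod (A (a n *R v) - A 0))) ----> 0"
   by (rule tendsto_ennreal_0_le[OF _ le])
  then have "(%n. cmod (A (a n *R v) - A 0)) ----> 0" by (simp add: ennreal_tendsto_0_iff)
  then show ?thesis by (simp add: tendsto_norm_zero_iff LIM_zero_iff)
 qed
 have [measurable]: "ft gauss \<in> Bor" by (rule ft_borel[OF gauss_borel])
 have R: "(LINT xi|lborel. ft A xi * w n xi) = (LINT v|lborel. A (a n *R v) * ft gauss v)" for n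
 proof -
  have "(LINT xi|lborel. ft A xi * w n xi) = (LINT z|lborel. A z * ft (w n) z)"
   by (rule ft_mult[OF Ai wi])
  also have "... = (LINT z|lborel. A z * (of_real (1 / (a n)^2) * ft gauss (z /\<^sub>R a n)))"
   unfolding w_def using ft_gauss_scaled[OF a] by simp
  also have "... = (a n)^2 *R (LINT v|lborel. A (a n *R v) * (of_real (1 / (a n)^2) * ft gauss ((a n *R v) /\<^sub>R a n)))"
   using a[of n] by (subst lborel_subst(2)[of "a n" _ 0]) auto
  also have "... = (a n)^2 *R (LINT v|lborel. of_real (1 / (a n)^2) * (A (a n *R v) * ft gauss v))"
   using a[of n] by (simp add: mult_ac)
  also have "... = (LINT v|lborel. A (a n *R v) * ft gauss v)"
   using a[of n] by (subst integral_mult_right_zero) (simp add: scaleR_conv_of_real)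
  finally show ?thesis .
 qed
 have "(%n. LINT v|lborel. A (a n *R v) * ft gauss v) ----> (LINT v|lborel. A 0 * ft gauss v)"
 proof (rule integral_dominated_convergence[where w = "%v. K * (LINT y|lborel. cmod (f y)) * cmod (ft gauss v)"])
  show "integrable lborel (%v. K * (LINT y|lborel. cmod (f y)) * cmod (ft gauss v))"
   using ft_gauss_integral(1) by (intro integrable_mult_right integrable_norm)
  show "AE v in lborel. (%n. A (a n *R v) * ft gauss v) ----> A 0 * ft gauss v"
   by (intro AE_I2 tendsto_intros Acont)
  show "AE v in lborel. norm (A (a n *R v) * ft gauss v) <= K * (LINT y|lborel. cmod (f y)) * cmod (ft gauss v)" for n
   by (intro AE_I2) (auto simp: norm_mult intro!: mult_right_mono Abd)
 qed measurable
 then have L: "(%n. LINT xi|lborel. ft A xi * w n xi) ----> of_real (LINT y|lborel. (cmod (f y))\<^sup>2)"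
  unfolding R by (simp add: ft_gauss_integral A0)
 define g where "g = (%n xi. (cmod (ft f xi))\<^sup>2 * exp (- (a n * norm xi)\<^sup>2 / 2))"
 have g: "ft A xi * w n xi = of_real (g n xi)" for n xi
  using a[of n] unfolding g_def w_def gauss_def fA
  by (simp add: complex_norm_square[unfolded of_real_power])
 have [measurable]: "g n \<in> Bor" for n unfolding g_def by measurable
 have gi: "integrable lborel (g n)" for n
 proof -
  have "integrable lborel (%xi. ft A xi * w n xi)"
  proof (rule Bochner_Integration.integrable_bound[of _ "%xi. of_real (LINT x|lborel. cmod (A x)) * w n xi"])
   show "AE xi in lborel. norm (ft A xi * w n xi) <= norm (of_real (LINT x|lborel. cmod (A x)) * w n xi)"
    by (intro AE_I2) (auto simp: norm_mult intro!: mult_right_mono ft_bound)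
  qed (use wi[of n] in auto)
  then show ?thesis unfolding g by (simp add: complex_of_real_integrable_eq)
 qed
 have "(%n. LINT xi|lborel. g n xi) ----> (LINT y|lborel. (cmod (f y))\<^sup>2)"
  using L unfolding g integral_complex_of_real tendsto_of_real_iff .
 then have "(%n. ennreal (LINT xi|lborel. g n xi)) ----> ennreal (LINT y|lborel. (cmod (f y))\<^sup>2)"
  by (rule tendsto_ennrealI)
 also have "(%n. ennreal (LINT xi|lborel. g n xi)) = (%n. \<integral>\<^sup>+xi. ennreal (g n xi) \<partial>lborel)"
  using gi by (subst nn_integral_eq_integral) (auto simp: g_def)
 finally have 1: "(%n. \<integral>\<^sup>+xi. ennreal (g n xi) \<partial>lborel) ----> E2 f"
  using E2_eq_integral[OF BL12D(1)[OF f]] by simp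
 have 2: "(%n. \<integral>\<^sup>+xi. ennreal (g n xi) \<partial>lborel) ----> E2 (ft f)"
  unfolding E2_def
 proof (rule nn_integral_LIMSEQ)
  show "incseq (%n xi. ennreal (g n xi))"
  proof (intro incseq_SucI le_funI ennreal_leI)
   fix n and xi :: plane
   have "a (Suc n) <= a n" by (simp add: a_def field_simps)
   then have "(a (Suc n) * norm xi)^2 <= (a n * norm xi)^2"
    using a[of "Suc n"] by (intro power_mono mult_right_mono) auto
   then show "g n xi <= g (Suc n) xi" unfolding g_def by (intro mult_left_mono) auto
  qed
  fix xi
  have "(%n. g n xi) ----> (cmod (ft f xi))\<^sup>2 * exp (- (0 * norm xi)\<^sup>2 / 2)"
   unfolding g_def by (intro tendsto_intros a0) auto
  then show "(%n. ennreal (g n xi)) ----> ennreal ((cmod (ft f xi))^2)"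
   by (intro tendsto_ennrealI) simp
 qed measurable
 from LIMSEQ_unique[OF 2 1] show ?thesis .
qed

text \<open>Truncation reduces this to bounded functions; Fatou on both sides controls the limit.\<close>
theorem plancherel:
 assumes f: "f \<in> BL12"
 shows "E2 (ft f) = E2 f"
proof -
 note fi = BL12D(2)[OF f]
 have [measurable]: "f \<in> Bor" using fi by auto
 define h where "h = (%n x. if cmod (f x) <= real n then f x else 0)"
 have [measurable]: "h n \<in> Bor" for n unfolding h_def by measurable
 have hf: "cmod (h n x) <= cmod (f x)" "cmod (f x - h n x) <= cmod (f x)" for n x
  by (auto simp: h_def)
 have h12: "h n \<in> BL12" for n
 proof -
  have "h n = (%x. (if cmod (f x) <= real n then 1 else 0) * f x)" by (auto simp: h_def)
  also have "... \<in> BL12" by (rule BL12_bounded_mult[OF f, of _ 1]) auto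
  finally show ?thesis .
 qed
 have hlim: "(%n. h n x) ----> f x" for x
 proof (rule tendsto_eventually)
  obtain N :: nat where "cmod (f x) <= real N" using real_arch_simple by blast
  then show "\<forall>\<^sub>F n in sequentially. h n x = f x"
   by (intro eventually_sequentiallyI[of N]) (auto simp: h_def)
 qed
 have E0: "(%n. E2 (%x. f x - h n x)) ----> 0"
 proof -
  have "(%n. E2 (%x. f x - h n x)) ----> (\<integral>\<^sup>+(x::plane). 0 \<partial>lborel)"
   unfolding E2_def
  proof (rule nn_integral_dominated_convergence[where w = "%x. ennreal ((cmod (f x))^2)"])
   show "(NN x. ennreal ((cmod (f x))^2)) < \<infinity>"
    using f by (auto simp: E2_def[symmetric] BL12_def BL2_def)
   show "AE x in lborel. ennreal ((cmod (f x - h n x))^2) <= ennreal ((cmod (f x))^2)" for n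
    by (intro AE_I2 ennreal_leI power_mono hf) auto
   show "AE x in lborel. (%n. ennreal ((cmod (f x - h n x))^2)) ----> 0"
   proof (rule AE_I2)
    fix x
    have "(%n. (cmod (f x - h n x))\<^sup>2) ----> (cmod (f x - f x))\<^sup>2"
    by (intro tendsto_intros hlim)
    then show "(%n. ennreal ((cmod (f x - h n x))^2)) ----> 0"
    by (subst ennreal_tendsto_0_iff) auto
   qed
  qed measurable
  then show ?thesis by simp
 qed
 have ftlim: "(%n. ft (h n) xi) ----> ft f xi" for xi
  unfolding ft_def
 proof (rule integral_dominated_convergence[where w = "%x. cmod (f x)"])
  show "AE x in lborel. (%n. cis (- 2 * pi * (x \<bullet> xi)) * h n x) ----> cis (- 2 * pi * (x \<bullet> xi)) * f x"
   by (intro AE_I2 tendsto_intros hlim)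
  show "AE x in lborel. norm (cis (- 2 * pi * (x \<bullet> xi)) * h n x) <= cmod (f x)" for n
   by (intro AE_I2) (auto simp: norm_mult hf)
 qed (use fi in auto)
 have hb: "E2 (ft (h n)) = E2 (h n)" for n
  by (rule plancherel_bounded[OF h12, of _ "real n"]) (auto simp: h_def)
 have hdiff: "E2 (%xi. ft (h m) xi - ft (h n) xi) <= E2 (%x. f x - h n x)" if "n <= m" for m n
 proof -
  have "E2 (%xi. ft (h m) xi - ft (h n) xi) = E2 (ft (%x. h m x - h n x))"
   using h12 by (intro arg_cong[where f=E2] ext) (simp add: ft_diff BL12D)
  also have "... = E2 (%x. h m x - h n x)"
  proof (rule plancherel_bounded[of _ "real m + real n"])
   show "(%x. h m x - h n x) \<in> BL12" by (intro BL12_diff h12)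
   show "cmod (h m x - h n x) <= real m + real n" for x by (auto simp: h_def)
  qed
  also have "... <= E2 (%x. f x - h n x)"
   using that by (intro E2_mono AE_I2) (auto simp: h_def)
  finally show ?thesis .
 qed
 have fd: "E2 (%xi. ft f xi - ft (h n) xi) <= E2 (%x. f x - h n x)" for n
 proof -
  have "E2 (%xi. ft f xi - ft (h n) xi) <= liminf (%m. E2 (%xi. ft (h m) xi - ft (h n) xi))"
   by (rule E2_fatou) (auto intro!: AE_I2 tendsto_intros ftlim)
  also have "... <= E2 (%x. f x - h n x)"
   by (rule liminf_le_const, rule eventually_sequentiallyI[of n], rule hdiff)
  finally show ?thesis .
 qed
 have fb: "ft f \<in> BL2"
 proof -
  have "E2 (ft f) <= liminf (%m. E2 (ft (h m)))"
   by (rule E2_fatou) (auto intro!: AE_I2 ftlim)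
  also have "... <= E2 f"
   unfolding hb by (rule liminf_le_const) (auto intro!: always_eventually E2_mono AE_I2 hf)
  also have "... < \<infinity>" using f by (auto simp: BL12_def BL2_def)
  finally show ?thesis by (simp add: BL2_def)
 qed
 have hb2: "ft (h n) \<in> BL2" for n
  using h12[of n] by (simp add: BL2_def hb BL12_def)
 have "(%n. E2 (%xi. ft (h n) xi - ft f xi)) ----> 0"
  by (rule tendsto_ennreal_0_le[OF E0]) (subst E2_minus_commute, rule fd)
 from E2_tendsto[OF hb2 fb this] have "(%n. E2 (h n)) ----> E2 (ft f)" by (simp add: hb)
 moreover have "(%n. E2 (h n)) ----> E2 f"
  by (rule E2_tendsto) (use h12 f E0 in \<open>auto simp: BL12_def E2_minus_commute[of f]\<close>)
 ultimately show ?thesis by (rule LIMSEQ_unique)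
qed

lemma ft_BL2: "f \<in> BL12 ==> ft f \<in> BL2"
 using plancherel[of f] by (auto simp: BL2_def BL12_def)

lemma E2_reflect: "f \<in> Bor ==> E2 (%x. f (- x)) = E2 f"
 unfolding E2_def using lborel_reflect(1)[of "%x. ennreal ((cmod (f x))^2)" 0] by simp

lemma plancherel_ift: "f \<in> BL12 ==> E2 (ift f) = E2 f"
 using E2_reflect[of "ft f"] plancherel[of f] ft_BL12_integrable(2)[of f]
 by (simp add: ift_eq_ft[abs_def])

lemma ift_BL2: "f \<in> BL12 ==> ift f \<in> BL2"
 using plancherel_ift[of f] by (auto simp: BL2_def BL12_def)

lemma L2n_add_sq:
 assumes u: "u \<in> BL2" and v: "v \<in> BL2"
 shows "(L2n (%x. u x + v x))^2 = (L2n u)^2 + (L2n v)^2 + 2 * Re (LINT x|lborel. u x * cnj (v x))"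
proof -
 note i = BL2_mult_integrable[OF u BL2_cnj[OF v]]
 have "(L2n (%x. u x + v x))^2 = (LINT x|lborel. (cmod (u x))\<^sup>2 + (cmod (v x))^2 + 2 * Re (u x * cnj (v x)))"
  unfolding L2n_sq[OF BL2_add[OF u v]]
 proof (intro Bochner_Integration.integral_cong refl)
  fix x
  show "(cmod (u x + v x))^2 = (cmod (u x))^2 + (cmod (v x))^2 + 2 * Re (u x * cnj (v x))"
   by (simp add: cmod_power2) (simp add: power2_eq_square algebra_simps)
 qed
 also have "... = (L2n u)^2 + (L2n v)^2 + 2 * Re (LINT x|lborel. u x * cnj (v x))"
  using u v i by (simp add: L2n_sq BL2_iff_integrable[symmetric] BL2D del: times_complex.simps complex_cnj)
 finally show ?thesis .
qed

lemma plancherel_inner: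
 assumes f: "f \<in> BL12" and g: "g \<in> BL12"
 shows "(LINT xi|lborel. ft f xi * cnj (ft g xi)) = (LINT x|lborel. f x * cnj (g x))"
proof -
 have Re: "Re (LINT xi|lborel. ft f xi * cnj (ft g xi)) = Re (LINT x|lborel. f x * cnj (g x))"
  if f: "f \<in> BL12" and g: "g \<in> BL12" for f g
 proof -
  have "(%xi. ft f xi + ft g xi) = ft (%x. f x + g x)" using f g by (auto simp: ft_add BL12D)
  then have "L2n (%xi. ft f xi + ft g xi) = L2n (%x. f x + g x)"
   using plancherel[OF BL12_add[OF f g]] by (simp add: L2n_def)
  moreover have "L2n (ft f) = L2n f" "L2n (ft g) = L2n g"
   using plancherel f g by (auto simp: L2n_def)
  ultimately show ?thesis
   using L2n_add_sq[OF ft_BL2[OF f] ft_BL2[OF g]] L2n_add_sq[OF BL12D(1)[OF f] BL12D(1)[OF g]] by simp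
 qed
 have Im: "Im (LINT xi|lborel. ft f xi * cnj (ft g xi)) = Im (LINT x|lborel. f x * cnj (g x))"
 proof -
  have "Re (LINT xi|lborel. ft (%x. (- \<i>) * f x) xi * cnj (ft g xi)) = Re (LINT x|lborel. ((- \<i>) * f x) * cnj (g x))"
   by (intro Re BL12_cmult f g)
  also have "(LINT xi|lborel. ft (%x. (- \<i>) * f x) xi * cnj (ft g xi)) = (- \<i>) * (LINT xi|lborel. ft f xi * cnj (ft g xi))"
   unfolding ft_cmult mult.assoc by (rule integral_mult_right_zero)
  also have "(LINT x|lborel. ((- \<i>) * f x) * cnj (g x)) = (- \<i>) * (LINT x|lborel. f x * cnj (g x))"
   unfolding mult.assoc by (rule integral_mult_right_zero)
  finally show ?thesis by simp
 qed
 show ?thesis using Re[OF f g] Im by (rule complex_eqI)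
qed


subsection \<open>Completeness\<close>

lemma BL2_complete:
 assumes u: "!!n. u n \<in> BL2"
  and C: "!!e::real. e > 0 ==> \<exists>N. \<forall>m\<ge>N. \<forall>n\<ge>N. E2 (%x. u m x - u n x) <= ennreal e"
 shows "\<exists>v\<in>BL2. (%n. E2 (%x. u n x - v x)) ----> 0"
proof -
 have um [measurable]: "u n \<in> Bor" for n using u by auto
 obtain N where N: "!!k m n. m >= N k ==> n >= N k ==> E2 (%x. u m x - u n x) <= ennreal ((1/4)^k)"
 proof -
  have "\<forall>k. \<exists>N. \<forall>m\<ge>N. \<forall>n\<ge>N. E2 (%x. u m x - u n x) <= ennreal ((1/4)^k)"
   using C[of "(1/4)^_"] by simp
  then show ?thesis using that by metis
 qed
 define r where "r = (%k. \<Sum>j\<le>k. N j)"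
 have rN: "r k >= N k" for k by (simp add: r_def member_le_sum)
 have rmono: "r k <= r (Suc k)" for k by (simp add: r_def)
 define d where "d = (%k x. u (r (Suc k)) x - u (r k) x)"
 have [measurable]: "d k \<in> Bor" for k unfolding d_def by measurable
 have "(NN x. (\<Sum>k. ennreal (2^k) * ennreal ((cmod (d k x))^2)))
   = (\<Sum>k. ennreal (2^k) * E2 (d k))"
  unfolding E2_def by (subst nn_integral_suminf) (auto simp: nn_integral_cmult)
 also have "... <= (\<Sum>k. ennreal (2^k) * ennreal ((1/4)^k))"
 proof (intro suminf_le mult_left_mono)
  fix k show "E2 (d k) <= ennreal ((1/4)^k)"
   unfolding d_def using N[of k "r (Suc k)" "r k"] rN[of k] rmono[of k] by simp
 qed auto
 also have "... = (\<Sum>k. ennreal ((1/2)^k))"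
  by (subst ennreal_mult[symmetric]) (auto simp: power_mult_distrib[symmetric])
 also have "... = ennreal (\<Sum>k. (1/2)^k)"
  by (rule suminf_ennreal2) (auto intro: summable_geometric)
 also have "... < \<infinity>" by simp
 finally have "AE x in lborel. (\<Sum>k. ennreal (2^k) * ennreal ((cmod (d k x))^2)) ~= \<infinity>"
  by (intro nn_integral_noteq_infinite) auto
 then have conv: "AE x in lborel. convergent (%k. u (r k) x)"
 proof eventually_elim
  case (elim x)
  then obtain M where M: "(\<Sum>k. ennreal (2^k) * ennreal ((cmod (d k x))^2)) = ennreal M" "M >= 0"
   by (cases "(\<Sum>k. ennreal (2^k) * ennreal ((cmod (d k x))^2))") auto
  have le: "cmod (d k x) <= sqrt M * (sqrt (1/2)) ^ k" for k
  proof -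
   have "ennreal (2^k) * ennreal ((cmod (d k x))^2) <= ennreal M"
    unfolding M(1)[symmetric] using sum_le_suminf[of "%k. ennreal (2^k) * ennreal ((cmod (d k x))^2)" "{k}"] by simp
   then have "2^k * (cmod (d k x))^2 <= M"
    using M(2) by (simp add: ennreal_mult[symmetric])
   then have "(cmod (d k x))^2 <= M * (1/2)^k"
    by (simp add: field_simps power_one_over)
   then have "cmod (d k x) <= sqrt (M * (1/2)^k)" by (rule real_le_rsqrt)
   then show ?thesis by (simp only: real_sqrt_mult real_sqrt_power)
  qed
  have "summable (%k. d k x)"
  proof (rule summable_comparison_test'[where N = 0])
   have "sqrt (1/2) < sqrt 1" by (rule real_sqrt_less_mono) simp
   then show "summable (%k. sqrt M * (sqrt (1/2)) ^ k)"
    by (intro summable_mult summable_geometric) auto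
  qed (use le in auto)
  then have "convergent (%n. \<Sum>k<n. d k x)" by (simp add: summable_iff_convergent)
  moreover have "(\<Sum>k<n. d k x) = u (r n) x - u (r 0) x" for n
   unfolding d_def by (rule sum_lessThan_telescope)
  ultimately have "convergent (%n. u (r n) x - u (r 0) x)" by simp
  from convergent_add[OF this convergent_const[of "u (r 0) x"]] show ?case by simp
 qed
 define v where "v = (%x. lim (%k. u (r k) x))"
 have vm [measurable]: "v \<in> Bor" unfolding v_def by measurable
 have lim: "AE x in lborel. (%k. u (r k) x) ----> v x"
  using conv by eventually_elim (simp add: v_def convergent_LIMSEQ_iff)
 have close: "E2 (%x. u n x - v x) <= ennreal ((1/4)^k)" if "n >= N k" for n k
 proof -
  have "E2 (%x. u n x - v x) <= liminf (%j. E2 (%x. u n x - u (r j) x))"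
  proof (rule E2_fatou)
   show "AE x in lborel. (%j. u n x - u (r j) x) ----> u n x - v x"
    using lim by eventually_elim (rule tendsto_diff[OF tendsto_const])
  qed (intro borel_measurable_diff um vm)+
  also have "... <= ennreal ((1/4)^k)"
  proof (rule liminf_le_const, rule eventually_sequentiallyI[of k])
   fix j assume "j >= k"
   then have "r k <= r j" by (rule lift_Suc_mono_le[of r, OF rmono])
   then show "E2 (%x. u n x - u (r j) x) <= ennreal ((1/4)^k)"
    using N[OF that, of "r j"] rN[of k] by simp
  qed
  finally show ?thesis .
 qed
 have "(%x. u (N 0) x - (u (N 0) x - v x)) \<in> BL2"
 proof (rule BL2_diff[OF u])
  have "E2 (%x. u (N 0) x - v x) < \<infinity>"
   using close[of 0 "N 0"] by (auto intro: order.strict_trans1)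
  then show "(%x. u (N 0) x - v x) \<in> BL2" by (simp add: BL2_def)
 qed
 then have "v \<in> BL2" by simp
 moreover have "(%n. E2 (%x. u n x - v x)) ----> 0"
 proof (rule tendsto_ennreal_0I)
  fix e :: real assume "e > 0"
  then obtain k where "(1/4 :: real)^k < e" using real_arch_pow_inv[of e "1/4"] by auto
  then have "E2 (%x. u n x - v x) <= ennreal e" if "n >= N k" for n
   using order_trans[OF close[OF that] ennreal_leI[of "(1/4)^k" e]] by simp
  then show "\<forall>\<^sub>F n in sequentially. E2 (%x. u n x - v x) <= ennreal e"
   by (rule eventually_sequentiallyI)
 qed
 ultimately show ?thesis by blast
qed

section \<open>The Fourier transform on square integrable functions\<close>

text \<open>The transform is characterised by the multiplication formula. Since that formula involves
  only pairings, linearity, translation and above all the convolution theorem become immediate;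
  norms and existence come from Plancherel's identity.\<close>

definition FT :: "(plane => complex) => (plane => complex) => bool" where
 "FT f g \<longleftrightarrow> f \<in> BL2 \<and> g \<in> BL2 \<and>
   (\<forall>h\<in>BL12. (LINT xi|lborel. g xi * h xi) = (LINT x|lborel. f x * ft h x))"

lemma FT_BL2: "FT f g ==> f \<in> BL2" "FT f g ==> g \<in> BL2"
 by (auto simp: FT_def)

lemma FT_mult: "FT f g ==> h \<in> BL12 ==> (LINT xi|lborel. g xi * h xi) = (LINT x|lborel. f x * ft h x)"
 by (auto simp: FT_def)


lemma FT_add:
 assumes "FT f g" "FT f' g'"
 shows "FT (%x. f x + f' x) (%x. g x + g' x)"
 unfolding FT_def
proof (intro conjI ballI BL2_add)
 fix h assume h: "h \<in> BL12"
 note i = BL2_mult_integrable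
 have "(LINT xi|lborel. (g xi + g' xi) * h xi) = (LINT xi|lborel. g xi * h xi) + (LINT xi|lborel. g' xi * h xi)"
  unfolding distrib_right
  by (intro Bochner_Integration.integral_add i FT_BL2(2)[OF assms(1)] FT_BL2(2)[OF assms(2)] BL12D h)
 also have "... = (LINT x|lborel. f x * ft h x) + (LINT x|lborel. f' x * ft h x)"
  using assms h by (simp add: FT_mult)
 also have "... = (LINT x|lborel. (f x + f' x) * ft h x)"
  unfolding distrib_right
  by (intro Bochner_Integration.integral_add[symmetric] i FT_BL2(1)[OF assms(1)] FT_BL2(1)[OF assms(2)] ft_BL2 h)
 finally show "(LINT xi|lborel. (g xi + g' xi) * h xi) = (LINT x|lborel. (f x + f' x) * ft h x)" .
qed (use assms in \<open>auto simp: FT_def\<close>)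

lemma FT_cmult:
 assumes "FT f g"
 shows "FT (%x. c * f x) (%x. c * g x)"
 using assms unfolding FT_def mult.assoc by (auto intro: BL2_cmult)

lemma FT_diff:
 assumes "FT f g" "FT f' g'"
 shows "FT (%x. f x - f' x) (%x. g x - g' x)"
 using FT_add[OF assms(1) FT_cmult[OF assms(2), of "-1"]] by simp

lemma FT_unique:
 assumes "FT f g" "FT f g'"
 shows "AE x in lborel. g x = g' x"
proof -
 have "AE x in lborel. g x - g' x = 0"
 proof (rule BL2_annihilator)
  show "(%x. g x - g' x) \<in> BL2" using assms by (intro BL2_diff) (auto simp: FT_def)
  fix h assume h: "h \<in> BL12"
  then show "(LINT x|lborel. (g x - g' x) * h x) = 0"
   using FT_mult[OF FT_diff[OF assms] h] by simp
 qed
 then show ?thesis by simp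
qed

lemma FT_ft: "f \<in> BL12 ==> FT f (ft f)"
 unfolding FT_def using ft_mult ft_BL2 BL12D by blast

text \<open>Inversion follows from the polarised Plancherel identity.\<close>
lemma FT_ift:
 assumes g: "g \<in> BL12"
 shows "FT (ift g) g"
 unfolding FT_def
proof (intro conjI ballI)
 fix h assume h: "h \<in> BL12"
 have "(LINT x|lborel. ift g x * ft h x) = (LINT x|lborel. ft g (- x) * ft h x)"
  by (simp add: ift_eq_ft)
 also have "... = (LINT x|lborel. ft g x * ft h (- x))"
 proof -
  have [measurable]: "ft g \<in> Bor" "ft h \<in> Bor"
   by (intro ft_borel ft_BL12_integrable g h)+
  show ?thesis by (subst lborel_reflect(2)[of _ 0]) auto
 qed
 also have "... = (LINT x|lborel. ft g x * cnj (ft (%x. cnj (h x)) x))"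
  by (simp add: ft_cnj)
 also have "... = (LINT x|lborel. g x * cnj (cnj (h x)))"
  by (rule plancherel_inner[OF g BL12_cnj[OF h]])
 finally show "(LINT xi|lborel. g xi * h xi) = (LINT x|lborel. ift g x * ft h x)" by simp
qed (use g in \<open>auto simp: ift_BL2 BL12D\<close>)

lemma FT_limit:
 assumes f: "f \<in> BL2" and g: "g \<in> BL2" and uv: "!!n. FT (u n) (v n)"
  and u: "(%n. E2 (%x. u n x - f x)) ----> 0" and v: "(%n. E2 (%x. v n x - g x)) ----> 0"
 shows "FT f g"
 unfolding FT_def
proof (intro conjI ballI f g)
 have pair: "(%n. LINT x|lborel. w n x * k x) ----> (LINT x|lborel. w' x * k x)"
  if w: "!!n. w n \<in> BL2" "w' \<in> BL2" "k \<in> BL2" "(%n. E2 (%x. w n x - w' x)) ----> 0" for w w' k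
 proof -
  have "(%n. E2 k * E2 (%x. w n x - w' x)) ----> E2 k * 0"
   using BL2_fin[OF w(3)] by (intro ennreal_tendsto_cmult w) auto
  then have *: "(%n. E2 k * E2 (%x. w n x - w' x)) ----> 0" by simp
  have "(%n. ennreal ((cmod (LINT x|lborel. (w n x - w' x) * k x))^2)) ----> 0"
   using norm_integral_mult_le[OF BL2_diff[OF w(1,2)] w(3)]
   by (intro tendsto_ennreal_0_le[OF *]) (simp add: mult.commute)
  then have "(%n. (cmod (LINT x|lborel. (w n x - w' x) * k x))\<^sup>2) ----> 0"
   by (simp add: ennreal_tendsto_0_iff)
  then have "(%n. LINT x|lborel. (w n x - w' x) * k x) ----> 0"
   by (simp add: power_tendsto_0_iff tendsto_norm_zero_iff)
  moreover have "(LINT x|lborel. (w n x - w' x) * k x) = (LINT x|lborel. w n x * k x) - (LINT x|lborel. w' x * k x)" for n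
   unfolding left_diff_distrib
   by (intro Bochner_Integration.integral_diff BL2_mult_integrable w)
  ultimately show ?thesis by (simp add: LIM_zero_iff)
 qed
 fix h assume h: "h \<in> BL12"
 have "(%n. LINT xi|lborel. v n xi * h xi) ----> (LINT xi|lborel. g xi * h xi)"
  by (rule pair[OF FT_BL2(2)[OF uv] g BL12D(1)[OF h] v])
 moreover have "(%n. LINT x|lborel. u n x * ft h x) ----> (LINT x|lborel. f x * ft h x)"
  by (rule pair[OF FT_BL2(1)[OF uv] f ft_BL2[OF h] u])
 moreover have "(LINT xi|lborel. v n xi * h xi) = (LINT x|lborel. u n x * ft h x)" for n
  by (rule FT_mult[OF uv h])
 ultimately show "(LINT xi|lborel. g xi * h xi) = (LINT x|lborel. f x * ft h x)"
  using LIMSEQ_unique by simp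
qed

definition trunc :: "nat => (plane => complex) => plane => complex" where
 "trunc n f x = indicator (ball 0 (real n)) x * f x"

lemma trunc_BL12: assumes "f \<in> BL2" shows "trunc n f \<in> BL12"
proof (rule BL12_bounded_support[of _ "ball 0 (real n)"])
 have [measurable]: "f \<in> Bor" using assms by auto
 have "trunc n f \<in> Bor"
  unfolding trunc_def by (intro borel_measurable_times borel_measurable_indicator) auto
 then show "trunc n f \<in> BL2"
  by (rule BL2_bound[OF assms, of _ 1]) (auto simp: trunc_def norm_mult split: split_indicator)
qed (auto simp: trunc_def)

lemma trunc_limit: assumes f: "f \<in> BL2" shows "(%n. E2 (%x. trunc n f x - f x)) ----> 0"
proof -
 have [measurable]: "f \<in> Bor" "trunc n f \<in> Bor" for n
  using f trunc_BL12[OF f, THEN BL12D(1)] by auto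
 have "(%n. E2 (%x. trunc n f x - f x)) ----> (\<integral>\<^sup>+(x::plane). 0 \<partial>lborel)"
  unfolding E2_def
 proof (rule nn_integral_dominated_convergence[where w = "%x. ennreal ((cmod (f x))^2)"])
  show "(NN x. ennreal ((cmod (f x))^2)) < \<infinity>"
   using f by (auto simp: E2_def[symmetric] BL2_def)
  show "AE x in lborel. ennreal ((cmod (trunc n f x - f x))^2) <= ennreal ((cmod (f x))^2)" for n
   by (intro AE_I2 ennreal_leI power_mono) (auto simp: trunc_def split: split_indicator)
  show "AE x in lborel. (%n. ennreal ((cmod (trunc n f x - f x))^2)) ----> 0"
  proof (intro AE_I2 tendsto_eventually)
   fix x :: plane
   obtain N :: nat where "norm x < real N" using reals_Archimedean2 by blast
   then show "\<forall>\<^sub>F n in sequentially. ennreal ((cmod (trunc n f x - f x))^2) = 0"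
    by (intro eventually_sequentiallyI[of N]) (auto simp: trunc_def)
  qed
 qed measurable
 then show ?thesis by simp
qed

text \<open>The transforms of the truncations form a Cauchy sequence by Plancherel.\<close>
lemma FT_exists:
 assumes f: "f \<in> BL2"
 shows "\<exists>g. FT f g \<and> E2 g = E2 f \<and> (%n. E2 (%xi. ft (trunc n f) xi - g xi)) ----> 0"
proof -
 have [measurable]: "f \<in> Bor" "trunc n f \<in> Bor" for n
  using f trunc_BL12[OF f, THEN BL12D(1)] by auto
 have tf: "trunc n f \<in> BL2" for n using trunc_BL12[OF f] by (rule BL12D)
 have ftf: "ft (trunc n f) \<in> BL2" for n by (intro ft_BL2 trunc_BL12 f)
 have "\<exists>g\<in>BL2. (%n. E2 (%xi. ft (trunc n f) xi - g xi)) ----> 0"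
 proof (rule BL2_complete[OF ftf])
  fix e :: real assume "e > 0"
  then have "\<forall>\<^sub>F n in sequentially. E2 (%x. trunc n f x - f x) <= ennreal (e / 4)"
   by (intro tendsto_ennreal_0D[OF trunc_limit[OF f]]) simp
  then obtain N where N: "!!n. n >= N ==> E2 (%x. trunc n f x - f x) <= ennreal (e / 4)"
   by (auto simp: eventually_sequentially)
  show "\<exists>N. \<forall>m\<ge>N. \<forall>n\<ge>N. E2 (%xi. ft (trunc m f) xi - ft (trunc n f) xi) <= ennreal e"
  proof (intro exI[of _ N] allI impI)
   fix m n assume mn: "m >= N" "n >= N"
   have "E2 (%xi. ft (trunc m f) xi - ft (trunc n f) xi) = E2 (ft (%x. trunc m f x - trunc n f x))"
    using trunc_BL12[OF f, THEN BL12D(2)] by (intro arg_cong[where f=E2] ext) (simp add: ft_diff)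
   also have "... = E2 (%x. trunc m f x - trunc n f x)"
    by (intro plancherel BL12_diff trunc_BL12 f)
   also have "... <= 2 * E2 (%x. trunc m f x - f x) + 2 * E2 (%x. f x - trunc n f x)"
    by (rule E2_triangle) auto
   also have "... <= 2 * ennreal (e / 4) + 2 * ennreal (e / 4)"
    using N[OF mn(1)] N[OF mn(2)] by (intro add_mono mult_left_mono) (auto simp: E2_minus_commute[of f])
   also have "... = ennreal (2 * (e / 4) + 2 * (e / 4))"
    using \<open>e > 0\<close> by (simp only: ennreal_mult ennreal_plus) simp
   finally show "E2 (%xi. ft (trunc m f) xi - ft (trunc n f) xi) <= ennreal e" by simp
  qed
 qed
 then obtain g where g: "g \<in> BL2" "(%n. E2 (%xi. ft (trunc n f) xi - g xi)) ----> 0" by blast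
 have "FT f g"
  by (rule FT_limit[OF f g(1) FT_ft trunc_limit g(2)]) (intro trunc_BL12 f, rule f)
 moreover have "E2 g = E2 f"
 proof (rule LIMSEQ_unique)
  show "(%n. E2 (ft (trunc n f))) ----> E2 g" by (rule E2_tendsto[OF ftf g])
  show "(%n. E2 (ft (trunc n f))) ----> E2 f"
   using E2_tendsto[OF tf f trunc_limit[OF f]] plancherel[OF trunc_BL12[OF f]] by simp
 qed
 ultimately show ?thesis using g(2) by blast
qed

lemma FT_E2: assumes "FT f g" shows "E2 g = E2 f"
proof -
 obtain g' where g': "FT f g'" "E2 g' = E2 f" using FT_exists[OF FT_BL2(1)[OF assms]] by blast
 from E2_cong_AE[OF FT_unique[OF assms g'(1)]] g'(2) show ?thesis by simp
qed

lemma FT_inj: assumes "FT f g" "FT f' g" shows "AE x in lborel. f x = f' x"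
proof -
 have "E2 (%x. f x - f' x) = 0" using FT_E2[OF FT_diff[OF assms]] by simp
 then have "AE x in lborel. f x - f' x = 0"
  using assms[THEN FT_BL2(1)] by (intro E2_eq_0) auto
 then show ?thesis by simp
qed

lemma ft_mod: "ft (%x. cis (2 * pi * (x \<bullet> a)) * f x) xi = ft f (xi - a)"
 unfolding ft_def
proof (intro Bochner_Integration.integral_cong refl)
 fix x
 have "cis (- 2 * pi * (x \<bullet> xi)) * cis (2 * pi * (x \<bullet> a)) = cis (- 2 * pi * (x \<bullet> (xi - a)))"
  by (simp add: cis_mult inner_diff_right algebra_simps)
 then show "cis (- 2 * pi * (x \<bullet> xi)) * (cis (2 * pi * (x \<bullet> a)) * f x) = cis (- 2 * pi * (x \<bullet> (xi - a))) * f x"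
  by (simp only: mult.assoc[symmetric])
qed

lemma FT_shift:
 assumes "FT f g"
 shows "FT (%x. f (x + a)) (%xi. cis (2 * pi * (xi \<bullet> a)) * g xi)"
 unfolding FT_def
proof (intro conjI ballI)
 have [measurable]: "f \<in> Bor" "g \<in> Bor"
  using assms by (auto simp: FT_def)
 have "E2 (%x. f (x + a)) = E2 f"
  unfolding E2_def using lborel_shift(1)[of "%x. ennreal ((cmod (f x))^2)" a] by (simp add: add.commute)
 then show "(%x. f (x + a)) \<in> BL2" using assms by (auto simp: FT_def BL2_def)
 show "(%xi. cis (2 * pi * (xi \<bullet> a)) * g xi) \<in> BL2"
  by (rule BL2_bound[OF FT_BL2(2)[OF assms], of _ 1]) (auto simp: norm_mult)
 fix h assume h: "h \<in> BL12"
 have [measurable]: "h \<in> Bor" using h by (rule ft_BL12_integrable)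
 have "(LINT xi|lborel. cis (2 * pi * (xi \<bullet> a)) * g xi * h xi) = (LINT xi|lborel. g xi * (cis (2 * pi * (xi \<bullet> a)) * h xi))"
  by (simp add: mult_ac)
 also have "... = (LINT x|lborel. f x * ft (%xi. cis (2 * pi * (xi \<bullet> a)) * h xi) x)"
  by (rule FT_mult[OF assms BL12_bounded_mult[OF h, of _ 1]]) auto
 also have "... = (LINT x|lborel. f x * ft h (x - a))" unfolding ft_mod ..
 also have "... = (LINT x|lborel. f (x + a) * ft h x)"
  by (subst lborel_shift(2)[of _ a]) (auto simp: add.commute intro!: borel_measurable_times measurable_compose[OF _ ft_borel])
 finally show "(LINT xi|lborel. cis (2 * pi * (xi \<bullet> a)) * g xi * h xi) = (LINT x|lborel. f (x + a) * ft h x)" .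
qed

text \<open>The convolution theorem holds at every point: the kernel \<open>y \<mapsto> ift m (x - y)\<close> is itself the
  transform of \<open>m\<close> modulated by \<open>x\<close>, so that the multiplication formula applies to it.\<close>
lemma conv_ift:
 assumes fg: "FT f g" and m: "m \<in> BL12"
 shows "(LINT y|lborel. f (x - y) * ift m y) = ift (%xi. m xi * g xi) x"
proof -
 have [measurable]: "f \<in> Bor" "m \<in> Bor"
  using fg m ft_BL12_integrable(2) by (auto simp: FT_def)
 have "(LINT y|lborel. f (x - y) * ift m y) = (LINT y|lborel. f y * ift m (x - y))"
  by (subst lborel_reflect(2)[of _ x]) (auto intro!: borel_measurable_times measurable_compose[OF _ ift_borel])
 also have "... = (LINT y|lborel. f y * ft (%xi. cis (2 * pi * (xi \<bullet> x)) * m xi) y)"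
  unfolding ft_mod ift_eq_ft by simp
 also have "... = (LINT xi|lborel. g xi * (cis (2 * pi * (xi \<bullet> x)) * m xi))"
  by (rule FT_mult[OF fg BL12_bounded_mult[OF m, of _ 1], symmetric]) auto
 also have "... = ift (%xi. m xi * g xi) x"
  by (simp add: ift_def inner_commute mult_ac)
 finally show ?thesis .
qed


section \<open>Composition with perturbations of the identity\<close>

lemma emeasure_ball_plane: "r >= 0 ==> emeasure lborel (ball (w :: plane) r) = ennreal (pi * r\<^sup>2)"
 by (simp add: emeasure_ball unit_ball_vol_2)

text \<open>A map that contracts distances at most by the factor \<open>c\<close> pulls measures back with a bounded
  factor. Averaging the indicator of an open set over small discs turns this into the trivial
  estimate for preimages of discs.\<close>
lemma emeasure_preimage_open_le:
 fixes g :: "plane => plane"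
 assumes [measurable]: "g \<in> Bor" and c: "c > 0"
  and g: "!!x y. c * norm (x - y) <= norm (g x - g y)" and U: "open U"
 shows "(NN x. indicator U (g x)) <= ennreal (4 / c\<^sup>2) * emeasure lborel U"
proof -
 have [measurable]: "U \<in> sets borel" using U by simp
 define e where "e = (%n. 1 / real (Suc n))"
 have e: "e n > 0" for n by (simp add: e_def)
 have e0: "e ----> 0" unfolding e_def by (rule LIMSEQ_Suc, rule lim_1_over_n)
 define F where "F = (%n z. ennreal (1 / (pi * (e n)^2)) * (NN w. indicator U w * indicator {..< e n} (norm (z - w))))"
 have [measurable]: "F n \<in> Bor" for n unfolding F_def by measurable
 have low: "indicator U z <= liminf (%n. F n z)" for z
 proof (cases "z \<in> U")
  case True
  then obtain r where r: "r > 0" "ball z r \<subseteq> U" using U openE by blast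
  have "\<forall>\<^sub>F n in sequentially. e n < r" using e0 r(1) by (rule order_tendstoD)
  then have "\<forall>\<^sub>F n in sequentially. 1 <= F n z"
  proof eventually_elim
   case (elim n)
   have "(NN w. indicator U w * indicator {..< e n} (norm (z - w))) = (NN w. indicator (ball z (e n)) w)"
    using r elim by (intro nn_integral_cong) (auto simp: indicator_def dist_norm)
   also have "... = ennreal (pi * (e n)^2)" using e[of n] by (simp add: emeasure_ball_plane)
   finally show ?case using e[of n] unfolding F_def
    by (simp only:, subst ennreal_mult[symmetric]) auto
  qed
  then have "liminf (%n. 1) <= liminf (%n. F n z)" by (rule Liminf_mono)
  then show ?thesis using True by (simp add: Liminf_const)
 qed simp
 have up: "(NN x. F n (g x)) <= ennreal (4 / c\<^sup>2) * emeasure lborel U" for n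
 proof -
  have pre: "(NN x. indicator {..< e n} (norm (g x - w))) <= ennreal (pi * (2 * e n / c)^2)" for w
  proof (cases "\<exists>x0. norm (g x0 - w) < e n")
   case True
   then obtain x0 where x0: "norm (g x0 - w) < e n" by blast
   have "indicator {..< e n} (norm (g x - w)) <= (indicator (ball x0 (2 * e n / c)) x :: ennreal)" for x
   proof (cases "norm (g x - w) < e n")
    case True
    have "c * norm (x0 - x) <= norm (g x0 - g x)" by (rule g)
    also have "... = norm ((g x0 - w) - (g x - w))" by simp
    also have "... <= norm (g x0 - w) + norm (g x - w)" by (rule norm_triangle_ineq4)
    also have "... < 2 * e n" using x0 True by simp
    finally show ?thesis using c by (simp add: dist_norm field_simps indicator_def)
   qed simp
   then have "(NN x. indicator {..< e n} (norm (g x - w))) <= (NN x. indicator (ball x0 (2 * e n / c)) x)"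
    by (rule nn_integral_mono)
   also have "... = ennreal (pi * (2 * e n / c)^2)" using e[of n] c by (simp add: emeasure_ball_plane)
   finally show ?thesis .
  next
   case False
   then have "!!x. indicator {..< e n} (norm (g x - w)) = (0::ennreal)" by (simp add: indicator_def)
   then show ?thesis by simp
  qed
  have "(NN x. F n (g x))
    = ennreal (1 / (pi * (e n)^2)) * (NN x. (NN w. indicator U w * indicator {..< e n} (norm (g x - w))))"
   unfolding F_def by (rule nn_integral_cmult) measurable
  also have "(NN x. (NN w. indicator U w * indicator {..< e n} (norm (g x - w))))
    = (NN w. (NN x. indicator U w * indicator {..< e n} (norm (g x - w))))"
   by (rule lborel_pair.Fubini') measurable
  also have "... = (NN w. indicator U w * (NN x. indicator {..< e n} (norm (g x - w))))"
   by (intro nn_integral_cong nn_integral_cmult) measurable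
  also have "... <= (NN w. indicator U w * ennreal (pi * (2 * e n / c)^2))"
   by (intro nn_integral_mono mult_left_mono pre) auto
  also have "... = emeasure lborel U * ennreal (pi * (2 * e n / c)^2)"
   by (subst nn_integral_multc) auto
  also have "ennreal (1 / (pi * (e n)^2)) * (emeasure lborel U * ennreal (pi * (2 * e n / c)^2))
    = ennreal ((1 / (pi * (e n)^2)) * (pi * (2 * e n / c)^2)) * emeasure lborel U"
   by (subst ennreal_mult) (auto simp: mult_ac)
  also have "(1 / (pi * (e n)^2)) * (pi * (2 * e n / c)^2) = 4 / c\<^sup>2"
   using e[of n] c by (simp add: field_simps power2_eq_square)
  finally show ?thesis by (simp add: mult_left_mono)
 qed
 have "(NN x. indicator U (g x)) <= (NN x. liminf (%n. F n (g x)))"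
  by (intro nn_integral_mono low)
 also have "... <= liminf (%n. \<integral>\<^sup>+x. F n (g x) \<partial>lborel)"
  by (rule nn_integral_liminf) measurable
 also have "... <= ennreal (4 / c\<^sup>2) * emeasure lborel U"
  by (rule liminf_le_const) (auto intro: always_eventually up)
 finally show ?thesis .
qed

text \<open>Outer regularity passes from open sets to Borel sets, and simple functions to all others.\<close>
lemma nn_integral_comp_expanding_le:
 fixes g :: "plane => plane"
 assumes g [measurable]: "g \<in> Bor" and c: "c > 0"
  and exp: "!!x y. c * norm (x - y) <= norm (g x - g y)"
  and [measurable]: "F \<in> Bor"
 shows "(NN x. F (g x)) <= ennreal (4 / c\<^sup>2) * (NN x. F x)"
proof -
 define C where "C = 4 / c\<^sup>2"
 have C: "C > 0" using c by (simp add: C_def)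
 have le: "emeasure (distr lborel borel g) A <= ennreal C * emeasure lborel A"
  if [measurable]: "A \<in> sets borel" for A
 proof (rule ennreal_le_epsilon)
  fix e :: real assume e: "e > 0"
  obtain U where U: "open U" "A \<subseteq> U" "emeasure lborel (U - A) < ennreal (e / C)"
   using outer_regular_lborel[of A "e / C"] e C by auto
  have [measurable]: "U \<in> sets borel" using U by simp
  have "emeasure (distr lborel borel g) A = (\<integral>\<^sup>+x. indicator A x \<partial>distr lborel borel g)" by simp
  also have "... = (NN x. indicator A (g x))"
   by (rule nn_integral_distr) auto
  also have "... <= (NN x. indicator U (g x))"
   using U(2) by (intro nn_integral_mono) (auto simp: indicator_def)
  also have "... <= ennreal C * emeasure lborel U"
   unfolding C_def by (rule emeasure_preimage_open_le[OF g c exp U(1)])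
  also have "emeasure lborel U = emeasure lborel A + emeasure lborel (U - A)"
   using U(2) by (subst plus_emeasure) (auto simp: Un_absorb1)
  also have "ennreal C * ... <= ennreal C * (emeasure lborel A + ennreal (e / C))"
   using U(3) by (intro mult_left_mono add_left_mono) auto
  also have "... = ennreal C * emeasure lborel A + ennreal e"
   using C e by (simp add: distrib_left ennreal_mult[symmetric])
  finally show "emeasure (distr lborel borel g) A <= ennreal C * emeasure lborel A + ennreal e" .
 qed
 have "(NN x. F (g x)) = (\<integral>\<^sup>+x. F x \<partial>distr lborel borel g)"
  by (simp add: nn_integral_distr)
 also have "... <= (\<integral>\<^sup>+x. F x \<partial>scale_measure (ennreal C) lborel)"
  by (rule nn_integral_mono_measure) (use le in \<open>auto simp: le_measure\<close>)
 also have "... = ennreal C * (NN x. F x)"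
  by (rule nn_integral_scale_measure) simp
 finally show ?thesis by (simp add: C_def)
qed

context
 fixes \<kappa> :: real and \<sigma> :: "plane => plane"
 assumes \<sigma>: "\<kappa>-lipschitz_on UNIV \<sigma>" and \<kappa>: "\<kappa> < 1"
begin

lemma lipschitz_borel: "\<sigma> \<in> Bor"
 by (intro borel_measurable_continuous_onI lipschitz_on_continuous_on[OF \<sigma>])

lemma id_minus_expanding: "(1 - \<kappa>) * norm (x - y) <= norm ((x - \<sigma> x) - (y - \<sigma> y))"
proof -
 have "norm (\<sigma> x - \<sigma> y) <= \<kappa> * norm (x - y)"
  using lipschitz_onD[OF \<sigma>, of x y] by (simp add: dist_norm)
 moreover have "norm (x - y) <= norm ((x - \<sigma> x) - (y - \<sigma> y)) + norm (\<sigma> x - \<sigma> y)"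
  using norm_triangle_ineq[of "(x - \<sigma> x) - (y - \<sigma> y)" "\<sigma> x - \<sigma> y"] by (simp add: algebra_simps)
 ultimately show ?thesis by (simp add: algebra_simps)
qed

lemma nn_integral_deform_le:
 assumes [measurable]: "F \<in> Bor"
 shows "(NN x. F (x - \<sigma> x)) <= ennreal (4 / (1 - \<kappa>)^2) * (NN x. F x)"
 using lipschitz_borel \<kappa> id_minus_expanding
 by (intro nn_integral_comp_expanding_le) auto

lemma E2_deform_le:
 assumes [measurable]: "f \<in> Bor"
 shows "E2 (%x. f (x - \<sigma> x)) <= ennreal (4 / (1 - \<kappa>)^2) * E2 f"
 unfolding E2_def by (rule nn_integral_deform_le) measurable

lemma deform_BL2: "f \<in> BL2 ==> (%x. f (x - \<sigma> x)) \<in> BL2"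
proof -
 assume f: "f \<in> BL2"
 have [measurable]: "f \<in> Bor" "\<sigma> \<in> Bor"
  using f lipschitz_borel by auto
 have "E2 (%x. f (x - \<sigma> x)) <= ennreal (4 / (1 - \<kappa>)^2) * E2 f"
  by (rule E2_deform_le) measurable
 also have "... < \<infinity>" using BL2_fin[OF f] by (simp add: ennreal_mult_less_top)
 finally show ?thesis by (simp add: BL2_def)
qed

lemma AE_deform:
 assumes "AE x in lborel. P x"
 shows "AE x in lborel. P (x - \<sigma> x)"
proof -
 obtain N where N: "{x. \<not> P x} \<subseteq> N" "N \<in> sets borel" "emeasure lborel N = 0"
  using AE_E[OF assms] by auto
 have [measurable]: "N \<in> sets borel" "\<sigma> \<in> Bor" using N lipschitz_borel by auto
 have "(NN x. indicator N (x - \<sigma> x)) <= ennreal (4 / (1 - \<kappa>)^2) * (NN x. indicator N x)"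
  by (rule nn_integral_deform_le) measurable
 then have "(NN x. indicator N (x - \<sigma> x)) = 0" using N by simp
 then have "AE x in lborel. indicator N (x - \<sigma> x) = (0::ennreal)"
  by (subst (asm) nn_integral_0_iff_AE) auto
 then show ?thesis by eventually_elim (use N in \<open>auto simp: indicator_def split: if_splits\<close>)
qed

end

section \<open>Band limited functions\<close>

definition BLc :: "(plane => complex) set" where
 "BLc = {G \<in> BL2. \<exists>R. \<forall>xi. R < norm xi --> G xi = 0}"

lemma BLc_BL12: "G \<in> BLc ==> G \<in> BL12"
proof -
 assume "G \<in> BLc"
 then obtain R where R: "G \<in> BL2" "!!xi. R < norm xi ==> G xi = 0" by (auto simp: BLc_def)
 show ?thesis by (rule BL12_bounded_support[OF R(1), of "cball 0 R"]) (use R(2) in auto)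
qed

lemma BLc_borel: "G \<in> BLc ==> G \<in> Bor"
 by (auto simp: BLc_def)

lemma BLc_mult:
 assumes G: "G \<in> BLc" and m: "m \<in> Bor" "!!xi. cmod (m xi) <= K * norm xi + L" and "0 <= K"
 shows "(%xi. m xi * G xi) \<in> BLc"
proof -
 obtain R where R: "G \<in> BL2" "!!xi. R < norm xi ==> G xi = 0" using G by (auto simp: BLc_def)
 have "(%xi. m xi * G xi) \<in> BL2"
 proof (rule BL2_bound[OF R(1), of _ "K * R + L"])
  show "AE xi in lborel. cmod (m xi * G xi) <= (K * R + L) * cmod (G xi)"
  proof (rule AE_I2)
   fix xi
   show "cmod (m xi * G xi) <= (K * R + L) * cmod (G xi)"
   proof (cases "R < norm xi")
    case False
    then have "cmod (m xi) <= K * R + L"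
    using m(2)[of xi] mult_left_mono[of "norm xi" R K] \<open>0 <= K\<close> by simp
    then show ?thesis by (simp add: norm_mult mult_right_mono)
   qed (simp add: R(2))
  qed
 qed (use R(1) m(1) in auto)
 then show ?thesis using R(2) by (auto simp: BLc_def)
qed

definition grad :: "2 => (plane => complex) => plane => complex" where
 "grad k G xi = 2 * pi * \<i> * of_real (xi $ k) * G xi"

lemma grad_BLc: assumes "G \<in> BLc" shows "grad k G \<in> BLc"
proof -
 have "(%xi. (2 * pi * \<i> * of_real (xi $ k)) * G xi) \<in> BLc"
 proof (rule BLc_mult[OF assms, of _ "2 * pi" 0])
  show "cmod (2 * pi * \<i> * complex_of_real (xi $ k)) <= 2 * pi * norm xi + 0" for xi :: plane
   using component_le_norm_cart[of xi k] by (simp add: norm_mult)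
 qed auto
 then show ?thesis by (simp add: grad_def[abs_def])
qed

text \<open>The squared length of the gradient of \<open>ift G\<close>, and the Dirichlet integral of \<open>ift G\<close>
 computed on the transform side.\<close>
definition gsq :: "(plane => complex) => plane => real" where
 "gsq G x = (cmod (ift (grad 1 G) x))^2 + (cmod (ift (grad 2 G) x))^2"

definition D2 :: "(plane => complex) => ennreal" where
 "D2 G = (NN xi. ennreal ((norm xi)^2 * (cmod (G xi))^2))"

lemma norm_sq_plane: "(norm x)^2 = (x $ 1)^2 + (x $ 2)^2" for x :: plane
 by (simp add: norm_vec_def L2_set_def sum_2)

lemma inner_plane: "x \<bullet> y = x $ 1 * y $ 1 + x $ 2 * y $ 2" for x y :: plane
 by (simp add: inner_vec_def sum_2)

lemma gsq_borel: "G \<in> BLc ==> gsq G \<in> Bor"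
proof -
 assume G: "G \<in> BLc"
 have [measurable]: "ift (grad k G) \<in> Bor" for k
  by (intro ift_borel BLc_borel grad_BLc G)
 show ?thesis unfolding gsq_def by measurable
qed

lemma nn_integral_gsq:
 assumes G: "G \<in> BLc"
 shows "(NN x. ennreal (gsq G x)) = ennreal ((2 * pi)^2) * D2 G"
proof -
 have m: "ift (grad k G) \<in> Bor" for k
  by (intro ift_borel BLc_borel grad_BLc G)
 have [measurable]: "G \<in> Bor" "grad k G \<in> Bor" for k
  by (intro BLc_borel grad_BLc G)+
 have "(NN x. ennreal (gsq G x)) = E2 (ift (grad 1 G)) + E2 (ift (grad 2 G))"
  unfolding E2_def gsq_def using m by (subst nn_integral_add[symmetric]) (auto simp: ennreal_plus)
 also have "... = E2 (grad 1 G) + E2 (grad 2 G)"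
  using G by (simp add: plancherel_ift BLc_BL12 grad_BLc)
 also have "... = (NN xi. ennreal ((cmod (grad 1 G xi))^2) + ennreal ((cmod (grad 2 G xi))^2))"
  unfolding E2_def by (rule nn_integral_add[symmetric]) auto
 also have "... = (NN xi. ennreal ((2 * pi)^2) * ennreal ((norm xi)^2 * (cmod (G xi))^2))"
 proof (intro nn_integral_cong)
  fix xi :: plane
  have "(cmod (grad 1 G xi))^2 + (cmod (grad 2 G xi))^2 = (2 * pi)^2 * ((norm xi)^2 * (cmod (G xi))^2)"
   by (simp add: grad_def norm_mult power_mult_distrib norm_sq_plane) (simp add: algebra_simps)
  then show "ennreal ((cmod (grad 1 G xi))^2) + ennreal ((cmod (grad 2 G xi))^2)
    = ennreal ((2 * pi)^2) * ennreal ((norm xi)^2 * (cmod (G xi))^2)"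
   by (simp add: ennreal_plus[symmetric] ennreal_mult[symmetric] del: ennreal_plus)
 qed
 also have "... = ennreal ((2 * pi)^2) * D2 G"
  unfolding D2_def by (rule nn_integral_cmult) measurable
 finally show ?thesis .
qed

text \<open>The fundamental theorem of calculus along a segment, obtained by integrating the
  exponentials under the integral sign.\<close>
lemma ift_segment:
 assumes G: "G \<in> BLc"
 shows "ift G (a + v) - ift G a
  = (LINT t|lborel. indicator {0..1} t *R (of_real (v $ 1) * ift (grad 1 G) (a + t *R v) + of_real (v $ 2) * ift (grad 2 G) (a + t *R v)))"
proof -
 have [measurable]: "G \<in> Bor" by (rule BLc_borel[OF G])
 have Gi: "integrable lborel G" and gi: "integrable lborel (grad k G)" for k
  using BLc_BL12[OF G] BLc_BL12[OF grad_BLc[OF G]] by (auto simp: BL12_def)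
 define H where "H = (%xi. of_real (v $ 1) * grad 1 G xi + of_real (v $ 2) * grad 2 G xi)"
 have H: "H xi = 2 * pi * \<i> * of_real (v \<bullet> xi) * G xi" for xi
  by (simp add: H_def grad_def inner_plane algebra_simps)
 have Hi: "integrable lborel H" unfolding H_def by (intro Bochner_Integration.integrable_add integrable_mult_right gi)
 have [measurable]: "H \<in> Bor" using Hi by auto
 have iH: "of_real (v $ 1) * ift (grad 1 G) x + of_real (v $ 2) * ift (grad 2 G) x = ift H x" for x
 proof -
  have "ift H x = (LINT xi|lborel. of_real (v $ 1) * (cis (2 * pi * (x \<bullet> xi)) * grad 1 G xi) + of_real (v $ 2) * (cis (2 * pi * (x \<bullet> xi)) * grad 2 G xi))"
   by (simp add: ift_def H_def algebra_simps)
  also have "... = of_real (v $ 1) * ift (grad 1 G) x + of_real (v $ 2) * ift (grad 2 G) x"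
   unfolding ift_def by (subst Bochner_Integration.integral_add) (auto intro!: integrable_cis_mult gi)
  finally show ?thesis by simp
 qed
 have int: "integrable (lborel \<Otimes>\<^sub>M lborel) (%(t, xi). indicator {0..1::real} t *R (cis (2 * pi * ((a + t *R v) \<bullet> xi)) * H xi))"
 proof (rule lborel_pair.Fubini_integrable)
  have "(%t. LINT xi|lborel. norm (case (t, xi) of (t, xi) => indicator {0..1::real} t *R (cis (2 * pi * ((a + t *R v) \<bullet> xi)) * H xi)))
    = (%t. indicator {0..1} t *R (LINT xi|lborel. cmod (H xi)))"
   by (auto simp: norm_mult)
  then show "integrable lborel (%t. LINT xi|lborel. norm (case (t, xi) of (t, xi) => indicator {0..1::real} t *R (cis (2 * pi * ((a + t *R v) \<bullet> xi)) * H xi)))"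
   by simp
  show "AE t in lborel. integrable lborel (%xi. case (t, xi) of (t, xi) => indicator {0..1::real} t *R (cis (2 * pi * ((a + t *R v) \<bullet> xi)) * H xi))"
   by (intro AE_I2) (auto intro!: integrable_cis_mult Hi)
 qed measurable
 have inner: "(LINT t|lborel. indicator {0..1} t *R (cis (2 * pi * ((a + t *R v) \<bullet> xi)) * H xi))
   = cis (2 * pi * ((a + v) \<bullet> xi)) * G xi - cis (2 * pi * (a \<bullet> xi)) * G xi" for xi
 proof -
  have "(LINT t|lborel. indicator {0..1} t *R (cis (2 * pi * ((a + t *R v) \<bullet> xi)) * H xi))
   = cis (2 * pi * ((a + 1 *R v) \<bullet> xi)) * G xi - cis (2 * pi * ((a + 0 *R v) \<bullet> xi)) * G xi"
  proof (rule integral_FTC_atLeastAtMost)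
   fix t :: real
   show "((%t. cis (2 * pi * ((a + t *R v) \<bullet> xi)) * G xi) has_vector_derivative cis (2 * pi * ((a + t *R v) \<bullet> xi)) * H xi) (at t within {0..1})"
   proof -
    have c: "cis (2 * pi * ((a + t *R v) \<bullet> xi)) = exp (\<i> * (of_real (2 * pi * (a \<bullet> xi)) + of_real t * of_real (2 * pi * (v \<bullet> xi))))" for t
    by (simp add: cis_conv_exp inner_add_left algebra_simps)
    have "((%z. exp (\<i> * (of_real (2 * pi * (a \<bullet> xi)) + z * of_real (2 * pi * (v \<bullet> xi)))) * G xi) has_field_derivative
    exp (\<i> * (of_real (2 * pi * (a \<bullet> xi)) + of_real t * of_real (2 * pi * (v \<bullet> xi)))) * H xi) (at (of_real t))"
    by (rule derivative_eq_intros refl)+ (simp add: H mult_ac)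
    from has_vector_derivative_real_field[OF this] show ?thesis unfolding c .
   qed
   show "continuous_on {0..1} (%t. cis (2 * pi * ((a + t *R v) \<bullet> xi)) * H xi)"
    by (intro continuous_intros)
  qed simp
  then show ?thesis by simp
 qed
 have "(LINT t|lborel. indicator {0..1} t *R (of_real (v $ 1) * ift (grad 1 G) (a + t *R v) + of_real (v $ 2) * ift (grad 2 G) (a + t *R v)))
   = (LINT t|lborel. LINT xi|lborel. indicator {0..1} t *R (cis (2 * pi * ((a + t *R v) \<bullet> xi)) * H xi))"
  unfolding iH by (simp add: ift_def)
 also have "... = (LINT xi|lborel. LINT t|lborel. indicator {0..1} t *R (cis (2 * pi * ((a + t *R v) \<bullet> xi)) * H xi))"
  using lborel_pair.Fubini_integral[OF int] by simp
 also have "... = (LINT xi|lborel. cis (2 * pi * ((a + v) \<bullet> xi)) * G xi - cis (2 * pi * (a \<bullet> xi)) * G xi)"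
  unfolding inner ..
 also have "... = ift G (a + v) - ift G a"
  unfolding ift_def by (intro Bochner_Integration.integral_diff integrable_cis_mult Gi) auto
 finally show ?thesis by simp
qed

lemma ift_segment_bound:
 assumes G: "G \<in> BLc"
 shows "ennreal ((cmod (ift G (a + v) - ift G a))^2)
  <= ennreal ((norm v)^2) * (NN t. indicator {0..1} t * ennreal (gsq G (a + t *R v)))"
proof -
 have [measurable]: "ift (grad k G) \<in> Bor" for k
  by (intro ift_borel BLc_borel grad_BLc G)
 define \<phi> where "\<phi> = (%t. of_real (v $ 1) * ift (grad 1 G) (a + t *R v) + of_real (v $ 2) * ift (grad 2 G) (a + t *R v))"
 have seg: "ift G (a + v) - ift G a = (LINT t|lborel. indicator {0..1} t *R \<phi> t)"
  unfolding \<phi>_def by (rule ift_segment[OF G])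
 have [measurable]: "\<phi> \<in> Bor" unfolding \<phi>_def by measurable
 have [measurable]: "gsq G \<in> Bor" by (rule gsq_borel[OF G])
 have p: "(cmod (\<phi> t))^2 <= (norm v)^2 * gsq G (a + t *R v)" for t
 proof -
  let ?A = "cmod (ift (grad 1 G) (a + t *R v))" and ?B = "cmod (ift (grad 2 G) (a + t *R v))"
  have "cmod (\<phi> t) <= \<bar>v $ 1\<bar> * ?A + \<bar>v $ 2\<bar> * ?B"
   unfolding \<phi>_def by (rule order_trans[OF norm_triangle_ineq]) (simp add: norm_mult)
  then have "(cmod (\<phi> t))^2 <= (\<bar>v $ 1\<bar> * ?A + \<bar>v $ 2\<bar> * ?B)^2" by (intro power_mono) auto
  also have "... <= (norm v)^2 * gsq G (a + t *R v)"
  proof -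
   have "0 <= (\<bar>v $ 1\<bar> * ?B - \<bar>v $ 2\<bar> * ?A)^2" by simp
   moreover have "(norm v)^2 = \<bar>v $ 1\<bar>\<^sup>2 + \<bar>v $ 2\<bar>\<^sup>2" by (simp add: norm_sq_plane)
   ultimately show ?thesis
    unfolding gsq_def by (simp only: power2_eq_square algebra_simps)
  qed
  finally show ?thesis .
 qed
 have "ennreal (cmod (ift G (a + v) - ift G a)) <= (NN t. indicator {0..1} t * ennreal (cmod (\<phi> t)))"
 proof (cases "integrable lborel (%t. indicator {0..1} t *R \<phi> t)")
  case True
  have "ennreal (cmod (ift G (a + v) - ift G a)) <= (NN t. ennreal (cmod (indicator {0..1} t *R \<phi> t)))"
   unfolding seg by (rule integral_norm_bound_ennreal[OF True])
  also have "... = (NN t. indicator {0..1} t * ennreal (cmod (\<phi> t)))"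
   by (intro nn_integral_cong) (auto simp: indicator_def)
  finally show ?thesis .
 next
  case False
  then show ?thesis
   unfolding seg by (simp add: not_integrable_integral_eq)
 qed
 also have "(NN t. indicator {0..1} t * ennreal (cmod (\<phi> t)))
   = (NN t. indicator {0..1} t * (indicator {0..1} t * ennreal (cmod (\<phi> t))))"
  by (intro nn_integral_cong) (auto split: split_indicator)
 finally have "(ennreal (cmod (ift G (a + v) - ift G a)))^2
   <= (NN t. indicator {0..1} t * (indicator {0..1} t * ennreal (cmod (\<phi> t))))^2"
  by (intro power_mono) simp_all
 also have "... <= (NN t. (indicator {0..1::real} t)\<^sup>2) * (NN t. (indicator {0..1} t * ennreal (cmod (\<phi> t)))\<^sup>2)"
  by (rule Cauchy_Schwarz_nn_integral) measurable
 also have "(NN t. (indicator {0..1::real} t :: ennreal)\<^sup>2) = (NN t. indicator {0..1::real} t)"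
  by (intro nn_integral_cong) (auto simp: indicator_def)
 also have "... = 1" by simp
 also have "(NN t. (indicator {0..1} t * ennreal (cmod (\<phi> t)))\<^sup>2)
   <= (NN t. ennreal ((norm v)^2) * (indicator {0..1} t * ennreal (gsq G (a + t *R v))))"
 proof (rule nn_integral_mono)
  fix t :: real
  have "ennreal ((cmod (\<phi> t))^2) <= ennreal ((norm v)^2 * gsq G (a + t *R v))"
   by (rule ennreal_leI[OF p])
  also have "... = ennreal ((norm v)^2) * ennreal (gsq G (a + t *R v))"
   by (rule ennreal_mult) (auto simp: gsq_def)
  finally show "(indicator {0..1} t * ennreal (cmod (\<phi> t)))^2
    <= ennreal ((norm v)^2) * (indicator {0..1} t * ennreal (gsq G (a + t *R v)))"
   by (cases "t \<in> {0..1}") (simp_all add: ennreal_power)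
 qed
 also have "... = ennreal ((norm v)^2) * (NN t. indicator {0..1} t * ennreal (gsq G (a + t *R v)))"
  by (rule nn_integral_cmult) measurable
 finally have "(ennreal (cmod (ift G (a + v) - ift G a)))^2
   <= 1 * (ennreal ((norm v)^2) * (NN t. indicator {0..1} t * ennreal (gsq G (a + t *R v))))"
  by (simp only: mult_1_left)
 then show ?thesis by (simp only: mult_1_left ennreal_power[OF norm_ge_zero])
qed

text \<open>Two deformations at uniform distance \<open>\<delta>\<close>: on the segment between them every intermediate
  deformation is again an expanding map, so the gradient may be integrated along the way.\<close>
lemma E2_deform_diff:
 assumes G: "G \<in> BLc" and \<kappa>: "\<kappa> < 1"
  and s0: "\<kappa>-lipschitz_on UNIV \<sigma>0" and s1: "\<kappa>-lipschitz_on UNIV \<sigma>1"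
  and \<delta>: "!!y. norm (\<sigma>0 y - \<sigma>1 y) <= \<delta>"
 shows "E2 (%y. ift G (y - \<sigma>0 y) - ift G (y - \<sigma>1 y))
  <= ennreal (\<delta>\<^sup>2 * (4 / (1 - \<kappa>)^2 * (2 * pi)^2)) * D2 G"
proof -
 have [measurable]: "\<sigma>0 \<in> Bor" "\<sigma>1 \<in> Bor"
  using s0 s1 \<kappa> by (auto intro: lipschitz_borel)
 have [measurable]: "gsq G \<in> Bor" by (rule gsq_borel[OF G])
 define s where "s = (%t y. (1 - t) *R \<sigma>1 y + t *R \<sigma>0 y)"
 have "\<delta> >= 0" using order_trans[OF norm_ge_zero \<delta>] .
 have lip: "\<kappa>-lipschitz_on UNIV (s t)" if "t \<in> {0..1}" for t
 proof (rule lipschitz_onI)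
  show "0 <= \<kappa>" using s0 by (rule lipschitz_on_nonneg)
  fix x y
  have "norm (s t x - s t y) = norm ((1 - t) *R (\<sigma>1 x - \<sigma>1 y) + t *R (\<sigma>0 x - \<sigma>0 y))"
   by (simp add: s_def algebra_simps)
  also have "... <= (1 - t) * norm (\<sigma>1 x - \<sigma>1 y) + t * norm (\<sigma>0 x - \<sigma>0 y)"
   using that by (intro order_trans[OF norm_triangle_ineq]) auto
  also have "... <= (1 - t) * (\<kappa> * norm (x - y)) + t * (\<kappa> * norm (x - y))"
   using that lipschitz_onD[OF s0, of x y] lipschitz_onD[OF s1, of x y]
   by (intro add_mono mult_left_mono) (auto simp: dist_norm)
  finally show "dist (s t x) (s t y) <= \<kappa> * dist x y" by (simp add: dist_norm algebra_simps)
 qed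
 have "E2 (%y. ift G (y - \<sigma>0 y) - ift G (y - \<sigma>1 y))
   <= (NN y. ennreal (\<delta>\<^sup>2) * (NN t. indicator {0..1} t * ennreal (gsq G (y - s t y))))"
  unfolding E2_def
 proof (rule nn_integral_mono)
  fix y
  have "ennreal ((cmod (ift G (y - \<sigma>0 y) - ift G (y - \<sigma>1 y)))^2)
    <= ennreal ((norm (\<sigma>1 y - \<sigma>0 y))^2) * (NN t. indicator {0..1} t * ennreal (gsq G ((y - \<sigma>1 y) + t *R (\<sigma>1 y - \<sigma>0 y))))"
   using ift_segment_bound[OF G, of "y - \<sigma>1 y" "\<sigma>1 y - \<sigma>0 y"] by simp
  also have "... = ennreal ((norm (\<sigma>1 y - \<sigma>0 y))^2) * (NN t. indicator {0..1} t * ennreal (gsq G (y - s t y)))"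
   by (simp add: s_def algebra_simps)
  also have "... <= ennreal (\<delta>\<^sup>2) * (NN t. indicator {0..1} t * ennreal (gsq G (y - s t y)))"
   using \<delta>[of y] by (intro mult_right_mono ennreal_leI power_mono) (auto simp: norm_minus_commute)
  finally show "ennreal ((cmod (ift G (y - \<sigma>0 y) - ift G (y - \<sigma>1 y)))^2)
   <= ennreal (\<delta>\<^sup>2) * (NN t. indicator {0..1} t * ennreal (gsq G (y - s t y)))" .
 qed
 also have "... = ennreal (\<delta>\<^sup>2) * (NN y. (NN t. indicator {0..1} t * ennreal (gsq G (y - s t y))))"
  unfolding s_def by (rule nn_integral_cmult) measurable
 also have "... <= ennreal (\<delta>\<^sup>2) * (ennreal (4 / (1 - \<kappa>)^2) * (ennreal ((2 * pi)^2) * D2 G))"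
 proof (rule mult_left_mono)
 have "(NN y. (NN t. indicator {0..1} t * ennreal (gsq G (y - s t y))))
   = (NN t. (NN y. indicator {0..1} t * ennreal (gsq G (y - s t y))))"
  unfolding s_def by (rule lborel_pair.Fubini') measurable
 also have "... <= (NN t. indicator {0..1::real} t * (ennreal (4 / (1 - \<kappa>)^2) * (ennreal ((2 * pi)^2) * D2 G)))"
 proof (rule nn_integral_mono)
  fix t :: real
  show "(NN y. indicator {0..1} t * ennreal (gsq G (y - s t y)))
    <= indicator {0..1::real} t * (ennreal (4 / (1 - \<kappa>)^2) * (ennreal ((2 * pi)^2) * D2 G))"
  proof (cases "t \<in> {0..1}")
   case True
   have "(NN y. ennreal (gsq G (y - s t y))) <= ennreal (4 / (1 - \<kappa>)^2) * (NN y. ennreal (gsq G y))"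
    by (rule nn_integral_deform_le[OF lip[OF True] \<kappa>]) measurable
   then show ?thesis using True by (simp add: nn_integral_gsq[OF G])
  qed simp
 qed
 also have "... = ennreal (4 / (1 - \<kappa>)^2) * (ennreal ((2 * pi)^2) * D2 G)"
  by (subst nn_integral_multc) auto
 finally show "(NN y. (NN t. indicator {0..1} t * ennreal (gsq G (y - s t y))))
   <= ennreal (4 / (1 - \<kappa>)^2) * (ennreal ((2 * pi)^2) * D2 G)" .
 qed simp
 also have "... = ennreal (\<delta>\<^sup>2 * (4 / (1 - \<kappa>)^2 * (2 * pi)^2)) * D2 G"
  by (subst ennreal_mult, simp, simp, subst ennreal_mult, simp, simp) (simp only: mult.assoc)
 finally show ?thesis .
qed


section \<open>Derivatives of multipliers and moments of kernels\<close>

lemma partial_has_vector_derivative: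
 fixes F :: "plane => 'a::real_normed_vector"
 assumes "!!x. F differentiable (at x)"
 shows "((%t. F (xi + t *R axis k 1)) has_vector_derivative partial k F (xi + t *R axis k 1)) (at t)"
proof -
 obtain D where D: "(F has_derivative D) (at (xi + t *R axis k 1))"
  using assms unfolding differentiable_def by blast
 have "((%s. F (xi + t *R axis k 1 + s *R axis k 1)) has_derivative (%s. D (s *R axis k 1))) (at 0)"
  by (rule has_derivative_compose[of "%s. xi + t *R axis k 1 + s *R axis k 1" "%s. s *R axis k 1" 0 UNIV F D])
    (auto intro!: derivative_eq_intros D)
 moreover have "D (s *R axis k 1) = s *R D (axis k 1)" for s
  by (rule linear_scale[OF has_derivative_linear[OF D]])
 ultimately have "((%s. F (xi + t *R axis k 1 + s *R axis k 1)) has_vector_derivative D (axis k 1)) (at 0)"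
  by (simp add: has_vector_derivative_def)
 then have p: "partial k F (xi + t *R axis k 1) = D (axis k 1)"
  unfolding partial_def by (rule vector_derivative_at)
 have "((%s. F (xi + s *R axis k 1)) has_derivative (%s. D (s *R axis k 1))) (at t)"
  by (rule has_derivative_compose[of "%s. xi + s *R axis k 1" "%s. s *R axis k 1" t UNIV F D])
    (auto intro!: derivative_eq_intros D)
 then show ?thesis
  unfolding p has_vector_derivative_def by (simp add: \<open>!!s. D (s *R axis k 1) = s *R D (axis k 1)\<close>)
qed

lemma differentiable_borel:
 fixes F :: "plane => 'a::{real_normed_vector}"
 assumes "!!x. F differentiable (at x)"
 shows "F \<in> Bor"
 using assms by (intro borel_measurable_continuous_onI continuous_at_imp_continuous_on)
  (auto intro: differentiable_imp_continuous_within)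

lemma ift_shift: "ift (%xi. F (xi + a)) x = cis (- 2 * pi * (x \<bullet> a)) * ift F x"
 if [measurable]: "F \<in> Bor"
proof -
 have "ift F x = (LINT xi|lborel. cis (2 * pi * (x \<bullet> (a + xi))) * F (a + xi))"
  unfolding ift_def by (subst lborel_shift(2)[of _ a]) auto
 also have "... = (LINT xi|lborel. cis (2 * pi * (x \<bullet> a)) * (cis (2 * pi * (x \<bullet> xi)) * F (xi + a)))"
 proof (intro Bochner_Integration.integral_cong refl)
  fix xi
  have "cis (2 * pi * (x \<bullet> (a + xi))) = cis (2 * pi * (x \<bullet> a)) * cis (2 * pi * (x \<bullet> xi))"
   by (simp add: cis_mult inner_add_right algebra_simps)
  then show "cis (2 * pi * (x \<bullet> (a + xi))) * F (a + xi) = cis (2 * pi * (x \<bullet> a)) * (cis (2 * pi * (x \<bullet> xi)) * F (xi + a))"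
   by (simp add: add.commute)
 qed
 also have "... = cis (2 * pi * (x \<bullet> a)) * ift (%xi. F (xi + a)) x"
  unfolding ift_def by (rule integral_mult_right_zero)
 finally have "cis (- 2 * pi * (x \<bullet> a)) * ift F x = (cis (- 2 * pi * (x \<bullet> a)) * cis (2 * pi * (x \<bullet> a))) * ift (%xi. F (xi + a)) x"
  by simp
 then show ?thesis by (simp add: cis_mult)
qed

lemma partial_limit:
 fixes F :: "plane => 'a::real_normed_vector"
 assumes d: "!!x. F differentiable (at x)"
 shows "(%n. (F (xi + (1 / real (Suc n)) *R axis k 1) - F xi) /\<^sub>R (1 / real (Suc n))) ----> partial k F xi"
proof -
 have "((%t. F (xi + t *R axis k 1)) has_vector_derivative partial k F xi) (at 0)"
  using partial_has_vector_derivative[OF d, of xi k 0] by simp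
 then have lim: "((%h. norm (F (xi + h *R axis k 1) - F xi - h *R partial k F xi) / norm h) \<longlongrightarrow> 0) (at 0)"
  unfolding has_vector_derivative_def has_derivative_iff_norm by simp
 have "((%h. norm ((F (xi + h *R axis k 1) - F xi) /\<^sub>R h - partial k F xi)) \<longlongrightarrow> 0) (at 0)"
 proof (rule Lim_transform_eventually[OF lim])
  show "\<forall>\<^sub>F h in at 0. norm (F (xi + h *R axis k 1) - F xi - h *R partial k F xi) / norm h
    = norm ((F (xi + h *R axis k 1) - F xi) /\<^sub>R h - partial k F xi)"
   unfolding eventually_at_filter
  proof (intro always_eventually allI impI)
   fix h :: real assume "h ~= 0"
   then have "(F (xi + h *R axis k 1) - F xi) /\<^sub>R h - partial k F xi
    = (F (xi + h *R axis k 1) - F xi - h *R partial k F xi) /\<^sub>R h"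
    by (simp add: scaleR_diff_right)
   then show "norm (F (xi + h *R axis k 1) - F xi - h *R partial k F xi) / norm h
    = norm ((F (xi + h *R axis k 1) - F xi) /\<^sub>R h - partial k F xi)"
    by (simp only: norm_scaleR) (simp add: divide_inverse mult.commute)
  qed
 qed
 then have "((%h. (F (xi + h *R axis k 1) - F xi) /\<^sub>R h) \<longlongrightarrow> partial k F xi) (at 0)"
  by (simp only: tendsto_norm_zero_iff LIM_zero_iff)
 moreover have "filterlim (%n. 1 / real (Suc n)) (at 0) sequentially"
 proof -
  have "(%n. 1 / real (Suc n)) ----> 0" by (rule LIMSEQ_Suc, rule lim_1_over_n)
  then show ?thesis by (simp add: filterlim_at del: of_nat_Suc)
 qed
 ultimately show ?thesis by (rule filterlim_compose)
qed

lemma partial_borel: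
 fixes F :: "plane => complex"
 assumes d: "!!x. F differentiable (at x)"
 shows "partial k F \<in> Bor"
proof (rule borel_measurable_LIMSEQ_metric)
 show "(%n. (F (xi + (1 / real (Suc n)) *R axis k 1) - F xi) /\<^sub>R (1 / real (Suc n))) ----> partial k F xi" for xi
  by (rule partial_limit[OF d])
 have [measurable]: "F \<in> Bor" by (rule differentiable_borel[OF d])
 show "(%xi. (F (xi + (1 / real (Suc n)) *R axis k 1) - F xi) /\<^sub>R (1 / real (Suc n))) \<in> Bor" for n
  by measurable
qed

lemma partial_mean_value:
 fixes F :: "plane => 'a::real_normed_vector"
 assumes d: "!!x. F differentiable (at x)" and B: "!!x. norm (partial k F x) <= B"
 shows "norm (F (xi + h *R axis k 1) - F xi) <= B * \<bar>h\<bar>"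
proof -
 have "norm (F (xi + h *R axis k 1) - F (xi + 0 *R axis k 1)) <= B * norm (h - 0)"
 proof (rule differentiable_bound[where S = UNIV and f' = "%t s. s *R partial k F (xi + t *R axis k 1)"])
  show "((%t. F (xi + t *R axis k 1)) has_derivative (%s. s *R partial k F (xi + t *R axis k 1))) (at t within UNIV)" for t
   using partial_has_vector_derivative[OF d, of xi k t] by (simp add: has_vector_derivative_def)
  show "onorm (%s. s *R partial k F (xi + t *R axis k 1)) <= B" for t
   by (rule onorm_le) (use B in \<open>auto simp: mult.commute[of B] intro!: mult_left_mono\<close>)
 qed auto
 then show ?thesis by simp
qed

text \<open>Differentiating a multiplier multiplies its kernel by a coordinate. No integration by parts
  is needed: difference quotients converge boundedly and transform into exact factors.\<close>
lemma ift_partial: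
 assumes d: "!!x. F differentiable (at x)" and S: "!!xi. R < norm xi ==> F xi = 0"
  and B: "!!x. cmod (partial k F x) <= B"
 shows "ift (partial k F) x = - 2 * pi * \<i> * of_real (x $ k) * ift F x"
proof -
 have [measurable]: "F \<in> Bor" by (rule differentiable_borel[OF d])
 define h where "h = (%n. 1 / real (Suc n))"
 have h: "h n > 0" "h n <= 1" for n by (auto simp: h_def)
 define Q where "Q = (%n xi. (F (xi + h n *R axis k 1) - F xi) /\<^sub>R h n)"
 have [measurable]: "Q n \<in> Bor" for n unfolding Q_def by measurable
 have Qlim: "(%n. Q n xi) ----> partial k F xi" for xi
  unfolding Q_def h_def by (rule partial_limit[OF d])
 have Q: "cmod (Q n xi) <= B * indicator (cball 0 (R + 1)) xi" for n xi
 proof (cases "norm xi <= R + 1")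
  case True
  have "cmod (Q n xi) = cmod (F (xi + h n *R axis k 1) - F xi) / h n"
   using h[of n] by (simp add: Q_def divide_inverse mult.commute)
  also have "... <= B" using partial_mean_value[OF d B, of xi "h n"] h[of n] by (simp add: field_simps)
  finally show ?thesis using True by simp
 next
  case False
  have "norm xi <= norm (xi + h n *R axis k 1) + norm (h n *R axis k 1 :: plane)"
   using norm_triangle_ineq4[of "xi + h n *R axis k 1" "h n *R axis k 1"] by simp
  also have "norm (h n *R axis k 1 :: plane) <= 1" using h[of n] by simp
  finally have "R < norm (xi + h n *R axis k 1)" "R < norm xi" using False by auto
  then show ?thesis using False by (simp add: Q_def S)
 qed
 have "(%n. ift (Q n) x) ----> ift (partial k F) x"
  unfolding ift_def
 proof (rule integral_dominated_convergence[where w = "%xi. B * indicator (cball 0 (R + 1)) xi"])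
  show "integrable lborel (%xi::plane. B * indicator (cball 0 (R + 1)) xi :: real)"
   by (intro integrable_mult_right integrable_real_indicator emeasure_bounded_finite) auto
  show "AE xi in lborel. (%n. cis (2 * pi * (x \<bullet> xi)) * Q n xi) ----> cis (2 * pi * (x \<bullet> xi)) * partial k F xi"
   by (intro AE_I2 tendsto_mult tendsto_const Qlim)
  show "AE xi in lborel. norm (cis (2 * pi * (x \<bullet> xi)) * Q n xi) <= B * indicator (cball 0 (R + 1)) xi" for n
   using Q by (intro AE_I2) (simp add: norm_mult)
  show "(%xi. cis (2 * pi * (x \<bullet> xi)) * partial k F xi) \<in> borel_measurable lborel"
   using partial_borel[OF d, of k] by simp
 qed measurable
 moreover have "(%n. ift (Q n) x) ----> - 2 * pi * \<i> * of_real (x $ k) * ift F x"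
 proof -
  have Fi: "integrable lborel F"
  proof -
   have "continuous_on UNIV F"
    using d by (intro continuous_at_imp_continuous_on) (auto intro: differentiable_imp_continuous_within)
   then have "integrable lborel (%xi. indicator (cball 0 R) xi *R F xi)"
    using borel_integrable_compact[of "cball 0 R" F] continuous_on_subset[of UNIV F]
    by (simp add: set_integrable_def)
   also have "(%xi. indicator (cball 0 R) xi *R F xi) = F"
    using S by (auto simp: indicator_def not_le)
   finally show ?thesis .
  qed
  have Fi2: "integrable lborel (%xi. F (xi + a))" for a
   using lborel_shift(3)[of F a] Fi by (simp add: add.commute)
  have q: "ift (Q n) x = ((cis (- 2 * pi * (h n * x $ k)) - 1) /\<^sub>R h n) * ift F x" for n
  proof -
   have "ift (Q n) x = (LINT xi|lborel. inverse (h n) *R (cis (2 * pi * (x \<bullet> xi)) * F (xi + h n *R axis k 1) - cis (2 * pi * (x \<bullet> xi)) * F xi))"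
    unfolding ift_def Q_def by (simp add: right_diff_distrib scaleR_conv_of_real mult_ac)
   also have "... = inverse (h n) *R (ift (%xi. F (xi + h n *R axis k 1)) x - ift F x)"
    unfolding ift_def integral_scaleR_right
    by (subst Bochner_Integration.integral_diff) (auto intro!: integrable_cis_mult Fi Fi2)
   also have "ift (%xi. F (xi + h n *R axis k 1)) x = cis (- 2 * pi * (h n * x $ k)) * ift F x"
    by (subst ift_shift) (auto simp: inner_axis)
   finally show ?thesis by (simp add: scaleR_conv_of_real algebra_simps)
  qed
  have "(%n. (cis (- 2 * pi * (h n * x $ k)) - 1) /\<^sub>R h n) ----> - 2 * pi * \<i> * of_real (x $ k)"
  proof -
   have "((%z::complex. exp (\<i> * (- 2 * pi * (z * x $ k)))) has_field_derivative - 2 * pi * \<i> * of_real (x $ k)) (at 0)"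
    by (auto intro!: derivative_eq_intros)
   then have "((%z::complex. (exp (\<i> * (- 2 * pi * (z * x $ k))) - 1) / z) \<longlongrightarrow> - 2 * pi * \<i> * of_real (x $ k)) (at 0)"
    by (simp add: has_field_derivative_iff)
   moreover have "filterlim (%n. complex_of_real (h n)) (at 0) sequentially"
   proof -
    have "(%n. complex_of_real (h n)) ----> of_real 0"
    unfolding h_def by (intro tendsto_of_real LIMSEQ_Suc lim_1_over_n)
    moreover have "h n ~= 0" for n using h(1)[of n] by simp
    ultimately show ?thesis by (simp add: filterlim_at)
   qed
   ultimately have "(%n. (exp (\<i> * (- 2 * pi * (complex_of_real (h n) * x $ k))) - 1) / complex_of_real (h n)) ----> - 2 * pi * \<i> * of_real (x $ k)"
    by (rule filterlim_compose)
   moreover have "(exp (\<i> * (- 2 * pi * (complex_of_real (h n) * x $ k))) - 1) / complex_of_real (h n)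
    = (cis (- 2 * pi * (h n * x $ k)) - 1) /\<^sub>R h n" for n
   proof -
    have "exp (\<i> * (- 2 * pi * (complex_of_real (h n) * x $ k))) = cis (- 2 * pi * (h n * x $ k))"
    unfolding cis_conv_exp by simp
    then show ?thesis
    by (simp only: scaleR_conv_of_real divide_inverse of_real_inverse) (rule mult.commute)
   qed
   ultimately show ?thesis by (simp only:)
  qed
  then show ?thesis unfolding q by (intro tendsto_mult[OF _ tendsto_const])
 qed
 ultimately show ?thesis by (rule LIMSEQ_unique)
qed

lemma partial_support:
 fixes F :: "plane => 'a::real_normed_vector"
 assumes S: "!!xi. R < norm xi ==> F xi = 0" and xi: "R < norm xi"
 shows "partial k F xi = 0"
proof -
 have "((%t. F (xi + t *R axis k 1)) has_vector_derivative 0) (at 0)"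
 proof (rule has_vector_derivative_transform_within_open[of "%t. 0" 0 0 "{t. R < norm (xi + t *R axis k 1)}"])
  show "open {t. R < norm (xi + t *R axis k 1)}"
   by (intro open_Collect_less continuous_intros)
 qed (use S xi in auto)
 then show ?thesis unfolding partial_def by (rule vector_derivative_at)
qed

text \<open>A multiplier of bounded support with bounded derivatives up to order \<open>n\<close>.\<close>
definition regular :: "nat => (plane => complex) => bool" where
 "regular n F \<longleftrightarrow> times_differentiable n F \<and> (\<exists>R. \<forall>xi. R < norm xi --> F xi = 0) \<and>
   (\<forall>\<nu>. mdeg \<nu> <= n --> bounded (range (mderiv \<nu> F)))"

lemma mderiv_Suc: "mderiv (Suc a, b) F = partial 1 (mderiv (a, b) F)"
 "mderiv (0, Suc b) F = partial 2 (mderiv (0, b) F)" "mderiv (0, 0) F = F"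
 by (auto simp: mderiv_def)

lemma times_differentiable_mderiv:
 "times_differentiable (a + b + n) F ==> times_differentiable n (mderiv (a, b) F)"
proof (induction a arbitrary: n)
 case 0
 have "times_differentiable (b + n) F ==> times_differentiable n (mderiv (0, b) F)" for n
 proof (induction b arbitrary: n)
  case (Suc b)
  have "times_differentiable (Suc n) (mderiv (0, b) F)"
   by (rule Suc.IH) (use Suc.prems in simp)
  then show ?case by (simp add: mderiv_Suc)
 qed (simp add: mderiv_Suc)
 with 0 show ?case by simp
next
 case (Suc a)
 have "times_differentiable (Suc n) (mderiv (a, b) F)"
  by (rule Suc.IH) (use Suc.prems in simp)
 then show ?case by (simp add: mderiv_Suc)
qed

lemma mderiv_support:
 assumes "!!xi. R < norm xi ==> F xi = 0"
 shows "R < norm xi ==> mderiv (a, b) F xi = 0"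
proof (induction a arbitrary: xi)
 case 0
 then show ?case
 proof (induction b arbitrary: xi)
  case (Suc b)
  show ?case unfolding mderiv_Suc by (rule partial_support[OF Suc.IH Suc.prems])
 qed (simp add: mderiv_Suc assms)
next
 case (Suc a)
 show ?case unfolding mderiv_Suc by (rule partial_support[OF Suc.IH Suc.prems])
qed

lemma mderiv_borel:
 fixes F :: "plane => complex"
 assumes F: "times_differentiable n F" "F \<in> Bor" "a + b <= n"
 shows "mderiv (a, b) F \<in> Bor"
proof (cases "a + b = 0")
 case False
 then obtain k a' b' where e: "mderiv (a, b) F = partial k (mderiv (a', b') F)" "Suc (a' + b') = a + b"
  by (cases a; cases b) (auto simp: mderiv_Suc)
 have "times_differentiable (Suc (n - (a + b))) (mderiv (a', b') F)"
 proof (rule times_differentiable_mderiv)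
  have "a' + b' + Suc (n - (a + b)) = n" using e(2) F(3) by simp
  then show "times_differentiable (a' + b' + Suc (n - (a + b))) F" using F(1) by (simp only:)
 qed
 then have d: "!!x. mderiv (a', b') F differentiable (at x)" by simp
 show ?thesis unfolding e(1) by (rule partial_borel[OF d])
qed (use F in \<open>simp add: mderiv_Suc\<close>)

lemma regular_mderiv_BLc:
 assumes F: "regular n F" "F \<in> Bor" and ab: "a + b <= n"
 shows "mderiv (a, b) F \<in> BLc" "\<exists>B. \<forall>xi. cmod (mderiv (a, b) F xi) <= B"
proof -
 obtain R where R: "!!xi. R < norm xi ==> F xi = 0" and td: "times_differentiable n F"
  using F(1) by (auto simp: regular_def)
 have b: "bounded (range (mderiv (a, b) F))"
  using F(1) ab by (auto simp: regular_def mdeg_def)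
 then show ex: "\<exists>B. \<forall>xi. cmod (mderiv (a, b) F xi) <= B"
  by (auto simp: bounded_iff)
 then obtain B where B: "!!xi. cmod (mderiv (a, b) F xi) <= B" by blast
 have "mderiv (a, b) F \<in> BL2"
 proof (rule BL2_bound[OF BL2_indicator[of "cball 0 R"], of _ B])
  show "mderiv (a, b) F \<in> Bor" by (rule mderiv_borel[OF td F(2) ab])
  show "AE x in lborel. cmod (mderiv (a, b) F x) <= B * cmod (indicator (cball 0 R) x)"
   using B mderiv_support[of R F, OF R] by (intro AE_I2) (auto simp: indicator_def not_le)
 qed auto
 then show "mderiv (a, b) F \<in> BLc"
  unfolding BLc_def using mderiv_support[of R F _ a b, OF R] by auto
qed

lemma ift_mderiv:
 assumes F: "regular n F" "F \<in> Bor" and ab: "a + b <= n"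
 shows "ift (mderiv (a, b) F) x
  = (- 2 * pi * \<i>) ^ (a + b) * of_real (x $ 1) ^ a * of_real (x $ 2) ^ b * ift F x"
proof -
 obtain R where R: "!!xi. R < norm xi ==> F xi = 0" and td: "times_differentiable n F"
  using F(1) by (auto simp: regular_def)
 have step: "ift (partial k (mderiv (a, b) F)) x = - 2 * pi * \<i> * of_real (x $ k) * ift (mderiv (a, b) F) x"
  if lt: "a + b < n" and ex: "\<exists>a' b'. partial k (mderiv (a, b) F) = mderiv (a', b') F \<and> a' + b' <= n" for a b k
 proof -
  obtain a' b' where e: "partial k (mderiv (a, b) F) = mderiv (a', b') F" "a' + b' <= n"
   using ex by blast
  then obtain B where B: "!!xi. cmod (partial k (mderiv (a, b) F) xi) <= B"
   using regular_mderiv_BLc(2)[OF F e(2)] by auto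
  have "times_differentiable (Suc (n - a - b - 1)) (mderiv (a, b) F)"
  proof (rule times_differentiable_mderiv)
   have "a + b + Suc (n - a - b - 1) = n" using lt by simp
   then show "times_differentiable (a + b + Suc (n - a - b - 1)) F" using td by (simp only:)
  qed
  then show ?thesis
   by (intro ift_partial[where R = R and B = B] mderiv_support[of R F] R B) auto
 qed
 from ab show ?thesis
 proof (induction a)
  case 0
  then show ?case
  proof (induction b)
   case (Suc b)
   have "ift (mderiv (0, Suc b) F) x = - 2 * pi * \<i> * of_real (x $ 2) * ift (mderiv (0, b) F) x"
    unfolding mderiv_Suc
    by (rule step, use Suc.prems in simp, rule exI[of _ 0], rule exI[of _ "Suc b"])
    (use Suc.prems in \<open>simp add: mderiv_Suc\<close>)
   then show ?case using Suc by (simp add: mult_ac)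
  qed (simp add: mderiv_Suc)
 next
  case (Suc a)
  have "ift (mderiv (Suc a, b) F) x = - 2 * pi * \<i> * of_real (x $ 1) * ift (mderiv (a, b) F) x"
   unfolding mderiv_Suc
   by (rule step, use Suc.prems in simp, rule exI[of _ "Suc a"], rule exI[of _ b])
    (use Suc.prems in \<open>simp add: mderiv_Suc\<close>)
  then show ?case using Suc by (simp add: mult_ac)
 qed
qed


section \<open>Localisation of frequency multipliers\<close>

text \<open>Convolution with the kernel of the multiplier \<open>m\<close>.\<close>
definition cv :: "(plane => complex) => (plane => complex) => plane => complex" where
 "cv f m x = (LINT y|lborel. f (x - y) * ift m y)"

lemma cv_eq: "FT f g ==> m \<in> BL12 ==> cv f m x = ift (%xi. m xi * g xi) x"
 unfolding cv_def by (rule conv_ift)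

lemma reflect_BL2: assumes f: "f \<in> BL2" shows "(%y. f (x - y)) \<in> BL2"
proof -
 have [measurable]: "f \<in> Bor" using f by auto
 have "E2 (%y. f (x - y)) = E2 f"
  unfolding E2_def using lborel_reflect(1)[of "%y. ennreal ((cmod (f y))^2)" x] by simp
 then show ?thesis using BL2_fin[OF f] by (simp add: BL2_def)
qed

lemma shift_BL2: assumes f: "f \<in> BL2" shows "(%y. f (y - a)) \<in> BL2"
proof -
 have [measurable]: "f \<in> Bor" using f by auto
 have "E2 (%y. f (y - a)) = E2 f"
  unfolding E2_def using lborel_shift(1)[of "%y. ennreal ((cmod (f y))^2)" "- a"] by simp
 then show ?thesis using BL2_fin[OF f] by (simp add: BL2_def)
qed

lemma cv_integrable: "f \<in> BL2 ==> m \<in> BL12 ==> integrable lborel (%y. f (x - y) * ift m y)"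
 by (intro BL2_mult_integrable reflect_BL2 ift_BL2)

lemma cv_diff: "f \<in> BL2 ==> g \<in> BL2 ==> m \<in> BL12 ==> cv (%x. f x - g x) m x = cv f m x - cv g m x"
 unfolding cv_def left_diff_distrib by (intro Bochner_Integration.integral_diff cv_integrable)

lemma cv_shift: "cv (%y. f (y - a)) m x = cv f m (x - a)"
 unfolding cv_def by (simp add: algebra_simps)

lemma cv_borel: assumes f: "f \<in> BL2" and m: "m \<in> BL12" shows "cv f m \<in> Bor"
proof -
 obtain g where g: "FT f g" using FT_exists[OF f] by blast
 have [measurable]: "m \<in> Bor" "g \<in> Bor"
  using m g ft_BL12_integrable(2) by (auto simp: FT_def)
 have "ift (%xi. m xi * g xi) \<in> Bor" by measurable
 then show ?thesis using cv_eq[OF g m] by (simp add: cv_eq[OF g m, abs_def])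
qed


text \<open>A bounded multiplier of bounded support times a square integrable function.\<close>
lemma BLc_times_BL2:
 assumes m: "m \<in> BLc" "!!xi. cmod (m xi) <= K" and g: "g \<in> BL2"
 shows "(%xi. m xi * g xi) \<in> BLc"
proof -
 obtain R where R: "!!xi. R < norm xi ==> m xi = 0" using m by (auto simp: BLc_def)
 have "m \<in> Bor" "g \<in> Bor" using m(1) g BLc_borel by auto
 then have "(%xi. m xi * g xi) \<in> Bor" by measurable
 moreover have "AE xi in lborel. cmod (m xi * g xi) <= K * cmod (g xi)"
  using m(2) by (intro AE_I2) (simp add: norm_mult mult_right_mono)
 ultimately have "(%xi. m xi * g xi) \<in> BL2" by (rule BL2_bound[OF g])
 then show ?thesis using R by (auto simp: BLc_def)
qed

text \<open>The weight of the localisation estimates, and the polynomial that inverts it.\<close>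
definition wt :: "plane => real" where
 "wt z = 1 / ((1 + (z $ 1)^2)^2 * (1 + (z $ 2)^2)^2)"

lemma wt_borel [measurable]: "wt \<in> Bor"
 unfolding wt_def by measurable

lemma wt_pos: "0 < wt z"
 unfolding wt_def by (intro divide_pos_pos mult_pos_pos zero_less_power add_pos_nonneg) auto

lemma nn_integral_cauchy: "(\<integral>\<^sup>+x. ennreal (1 / (1 + x\<^sup>2)) \<partial>(lborel :: real measure)) < \<infinity>"
proof -
 have "integrable lborel (%x::real. inverse (1 + x\<^sup>2))"
  using Sinc_Integral.integrable_inverse_1_plus_square by (simp add: set_integrable_def einterval_def)
 then show ?thesis by (simp add: integrable_iff_bounded divide_inverse)
qed

lemma prod_Basis_plane: "(\<Prod>b\<in>(Basis::plane set). f (x \<bullet> b)) = f (x $ 1) * f (x $ 2)"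
proof -
 have B: "(Basis::plane set) = {axis 1 1, axis 2 1}" by (auto simp: Basis_vec_def UNIV_2)
 have "axis 1 1 ~= (axis 2 1 :: plane)" by (simp add: axis_eq_axis)
 then show ?thesis unfolding B by (simp add: inner_axis)
qed

lemma nn_integral_cauchy_plane:
 "(\<integral>\<^sup>+(z::plane). ennreal (1 / ((1 + (z $ 1)^2) * (1 + (z $ 2)^2))) \<partial>lborel) < \<infinity>"
proof -
 have "(\<integral>\<^sup>+(z::plane). ennreal (1 / ((1 + (z $ 1)^2) * (1 + (z $ 2)^2))) \<partial>lborel)
   = (\<integral>\<^sup>+(z::plane). (\<Prod>b\<in>Basis. ennreal (1 / (1 + (z \<bullet> b)^2))) \<partial>lborel)"
  by (intro nn_integral_cong) (simp add: prod_Basis_plane[of "%t. ennreal (1 / (1 + t\<^sup>2))"] ennreal_mult[symmetric])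
 also have "... = (\<Prod>b\<in>(Basis::plane set). \<integral>\<^sup>+x. ennreal (1 / (1 + x\<^sup>2)) \<partial>lborel)"
  by (rule nn_integral_lborel_prod) auto
 also have "... < \<infinity>" using nn_integral_cauchy by (simp add: power_less_top_ennreal)
 finally show ?thesis .
qed

definition wt_moment :: ennreal where
 "wt_moment = (NN z. ennreal (wt z * (norm z)^2))"

lemma wt_moment_fin: "wt_moment < \<infinity>"
proof -
 have "wt z * (norm z)^2 <= 2 * (1 / ((1 + (z $ 1)^2) * (1 + (z $ 2)^2)))" for z
 proof -
  define a where "a = 1 + (z $ 1)^2" define b where "b = 1 + (z $ 2)^2"
  have ab: "a >= 1" "b >= 1" by (auto simp: a_def b_def)
  have "(norm z)^2 <= a + b" by (simp add: norm_sq_plane a_def b_def)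
  also have "... <= 2 * (a * b)"
  proof -
   have "a * 1 <= a * b" "1 * b <= a * b" using ab by (auto intro!: mult_mono)
   then show ?thesis by simp
  qed
  finally have "1 / (a\<^sup>2 * b\<^sup>2) * (norm z)^2 <= 1 / (a\<^sup>2 * b\<^sup>2) * (2 * (a * b))"
   by (intro mult_left_mono) auto
  also have "... = 2 * (1 / (a * b))" using ab by (simp add: power2_eq_square)
  finally show ?thesis by (simp add: wt_def a_def b_def)
 qed
 then have "wt_moment <= (\<integral>\<^sup>+(z::plane). 2 * ennreal (1 / ((1 + (z $ 1)^2) * (1 + (z $ 2)^2))) \<partial>lborel)"
  unfolding wt_moment_def
  by (intro nn_integral_mono) (metis ennreal_leI ennreal_mult' ennreal_numeral zero_le_numeral)
 also have "... = 2 * (\<integral>\<^sup>+(z::plane). ennreal (1 / ((1 + (z $ 1)^2) * (1 + (z $ 2)^2))) \<partial>lborel)"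
  by (rule nn_integral_cmult) measurable
 also have "... < \<infinity>" using nn_integral_cauchy_plane by (simp add: ennreal_mult_less_top)
 finally show ?thesis .
qed

definition qc :: "nat => real => real" where
 "qc a s = (if a = 0 then 1 + s\<^sup>2 else if a = 1 then - 2 * s else 1)"

lemma qc_expand: "1 + (s - t)^2 = (\<Sum>a\<le>2. qc a s * t ^ a)"
 by (simp add: numeral_2_eq_2 qc_def power2_eq_square algebra_simps)

lemma qc_bound: "\<bar>s\<bar> <= 1 ==> a <= 2 ==> \<bar>qc a s\<bar> <= 2"
proof -
 assume s: "\<bar>s\<bar> <= 1"
 then have "s\<^sup>2 <= 1" "0 <= s\<^sup>2" by (simp_all add: abs_square_le_1)
 with s show ?thesis by (auto simp: qc_def)
qed

definition cell :: "real => plane => plane => real" where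
 "cell r c x = indicator {x. \<bar>x $ 1 - c $ 1\<bar> <= r \<and> \<bar>x $ 2 - c $ 2\<bar> <= r} x"

text \<open>The multipliers of one level, whose kernels live at the spatial scale \<open>r\<close>: each derivative
  costs a factor \<open>r\<close>. Order zero is only known almost everywhere.\<close>
definition bank_bound :: "nat => 'i set => ('i => plane => complex) => real => real => bool" where
 "bank_bound n J m r B \<longleftrightarrow> finite J \<and> (\<forall>i\<in>J. regular n (m i) \<and> m i \<in> Bor) \<and>
   (\<forall>a b. a + b <= n --> (AE xi in lborel. (\<Sum>i\<in>J. (cmod (mderiv (a, b) (m i) xi))\<^sup>2) <= B * (r ^ (a + b))^2))"

lemma sum_E2_ift_le:
 assumes J: "finite J" and M: "!!i. i \<in> J ==> M i \<in> BLc" "!!i. i \<in> J ==> \<exists>K. \<forall>xi. cmod (M i xi) <= K"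
  and B: "AE xi in lborel. (\<Sum>i\<in>J. (cmod (M i xi))\<^sup>2) <= B" and g: "g \<in> BL2" and "0 <= B"
 shows "(\<Sum>i\<in>J. E2 (ift (%xi. M i xi * g xi))) <= ennreal B * E2 g"
proof -
 have [measurable]: "g \<in> Bor" using g by auto
 have Mm: "i \<in> J ==> M i \<in> Bor" for i using M(1) by (rule BLc_borel)
 have "E2 (ift (%xi. M i xi * g xi)) = E2 (%xi. M i xi * g xi)" if i: "i \<in> J" for i
 proof -
  obtain K where "!!xi. cmod (M i xi) <= K" using M(2)[OF i] by blast
  then show ?thesis by (intro plancherel_ift BLc_BL12 BLc_times_BL2[of "M i" K] M(1) i g)
 qed
 then have "(\<Sum>i\<in>J. E2 (ift (%xi. M i xi * g xi))) = (\<Sum>i\<in>J. E2 (%xi. M i xi * g xi))" by simp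
 also have "... = (NN xi. (\<Sum>i\<in>J. ennreal ((cmod (M i xi * g xi))^2)))"
  unfolding E2_def using Mm by (intro nn_integral_sum[symmetric]) auto
 also have "... <= (NN xi. ennreal B * ennreal ((cmod (g xi))^2))"
 proof (rule nn_integral_mono_AE, use B in eventually_elim)
  case (elim xi)
  have "(\<Sum>i\<in>J. ennreal ((cmod (M i xi * g xi))^2)) = ennreal ((\<Sum>i\<in>J. (cmod (M i xi))\<^sup>2) * (cmod (g xi))^2)"
   by (simp add: norm_mult power_mult_distrib sum_distrib_right)
  also have "... <= ennreal (B * (cmod (g xi))^2)"
   by (intro ennreal_leI mult_right_mono elim) simp
  finally show ?case using \<open>0 <= B\<close> by (simp add: ennreal_mult)
 qed
 also have "... = ennreal B * E2 g" unfolding E2_def by (rule nn_integral_cmult) measurable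
 finally show ?thesis .
qed

lemma sum9_square:
 fixes X :: "nat => nat => complex"
 shows "(cmod (\<Sum>a\<le>2. \<Sum>b\<le>(2::nat). X a b))^2 <= 9 * (\<Sum>a\<le>(2::nat). \<Sum>b\<le>2. (cmod (X a b))\<^sup>2)"
proof -
 have "cmod (\<Sum>a\<le>2. \<Sum>b\<le>(2::nat). X a b) <= (\<Sum>p\<in>{..2::nat}\<times>{..2::nat}. cmod (X (fst p) (snd p)))"
  unfolding sum.cartesian_product case_prod_beta by (rule norm_sum)
 then have "(cmod (\<Sum>a\<le>2. \<Sum>b\<le>(2::nat). X a b))^2 <= (\<Sum>p\<in>{..2::nat}\<times>{..2::nat}. cmod (X (fst p) (snd p)))^2"
  by (intro power_mono) auto
 also have "... <= real (card ({..2::nat}\<times>{..2::nat})) * (\<Sum>p\<in>{..2::nat}\<times>{..2::nat}. (cmod (X (fst p) (snd p)))\<^sup>2)"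
  using sum_squared_le_sum_of_squares[of "%p. cmod (X (fst p) (snd p))" "{..2::nat}\<times>{..2::nat}"] by (simp add: mult.commute)
 also have "... = 9 * (\<Sum>a\<le>(2::nat). \<Sum>b\<le>2. (cmod (X a b))\<^sup>2)"
  by (simp add: card_cartesian_product sum.cartesian_product case_prod_beta)
 finally show ?thesis .
qed

text \<open>Near \<open>c\<close>, at the scale \<open>r\<close> of the kernels, a bank sees a function only through the weight
  \<open>wt\<close>: write \<open>h = p * u\<close> with the polynomial \<open>p = 1 / sqrt wt\<close> and expand \<open>p (x - z)\<close> in powers
  of \<open>z\<close>. The powers turn the multipliers into their derivatives, of order at most four.\<close>
lemma local_bound:
 assumes r: "r > 0" and bb: "bank_bound 4 J m r B" and "0 <= B" and h: "h \<in> BL2"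
 shows "(\<Sum>i\<in>J. \<integral>\<^sup>+x. ennreal (cell r c x * (cmod (cv h (m i) x))^2) \<partial>lborel)
  <= ennreal (1296 * B) * (NN y. ennreal (wt ((y - c) /\<^sub>R r) * (cmod (h y))^2))"
proof -
 have J: "finite J" and reg: "!!i. i \<in> J ==> regular 4 (m i)" and mb: "!!i. i \<in> J ==> m i \<in> Bor"
  using bb by (auto simp: bank_bound_def)
 have [measurable]: "h \<in> Bor" using h by auto
 define p where "p = (%y::plane. (1 + ((y $ 1 - c $ 1) / r)^2) * (1 + ((y $ 2 - c $ 2) / r)^2))"
 have p1: "p y >= 1" for y
  unfolding p_def using mult_mono[of 1 "1 + ((y $ 1 - c $ 1) / r)^2" 1 "1 + ((y $ 2 - c $ 2) / r)^2"] by simp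
 have [measurable]: "p \<in> Bor" unfolding p_def by measurable
 have wtp: "wt ((y - c) /\<^sub>R r) = 1 / (p y)^2" for y
  by (simp add: wt_def p_def power_mult_distrib divide_inverse mult.commute)
 define u where "u = (%y. h y / of_real (p y))"
 have hu: "h y = of_real (p y) * u y" for y
  using p1[of y] by (simp add: u_def)
 have [measurable]: "u \<in> Bor" unfolding u_def by measurable
 have u2: "u \<in> BL2"
 proof (rule BL2_bound[OF h, of _ 1])
  show "AE x in lborel. cmod (u x) <= 1 * cmod (h x)"
  proof (rule AE_I2)
   fix x
   have "cmod (u x) * 1 <= cmod (u x) * p x" by (intro mult_left_mono p1) simp
   then show "cmod (u x) <= 1 * cmod (h x)" using p1[of x] unfolding hu[of x] by (simp add: norm_mult mult.commute)
  qed
 qed measurable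
 obtain g where g: "FT u g" using FT_exists[OF u2] by blast
 note g2 = FT_BL2(2)[OF g]
 have E2u: "E2 u = (NN y. ennreal (wt ((y - c) /\<^sub>R r) * (cmod (h y))^2))"
  unfolding E2_def using p1
  by (intro nn_integral_cong) (auto simp: u_def wtp norm_divide power_divide abs_of_nonneg order_trans[OF zero_le_one])
 let ?d = "%a b i. mderiv (a, b) (m i)"
 have pt: "cell r c x * (cmod (cv h (m i) x))^2
   <= 144 * (\<Sum>a\<le>2. \<Sum>b\<le>2. (1 / (r ^ (a + b))^2) * (cmod (ift (%xi. ?d a b i xi * g xi) x))^2)"
  if i: "i \<in> J" for x i
 proof (cases "\<bar>x $ 1 - c $ 1\<bar> <= r \<and> \<bar>x $ 2 - c $ 2\<bar> <= r")
  case True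
  define s1 s2 where "s1 = (x $ 1 - c $ 1) / r" and "s2 = (x $ 2 - c $ 2) / r"
  have s: "\<bar>s1\<bar> <= 1" "\<bar>s2\<bar> <= 1" using True r by (auto simp: s1_def s2_def)
  define cc where "cc = (%a b. qc a s1 * qc b s2 / r ^ (a + b))"
  let ?K = "ift (m i)"
  have dint: "integrable lborel (%z. u (x - z) * (of_real (z $ 1) ^ a * of_real (z $ 2) ^ b * ?K z))"
   and dval: "(LINT z|lborel. u (x - z) * (of_real (z $ 1) ^ a * of_real (z $ 2) ^ b * ?K z))
    = (1 / (- 2 * pi * \<i>) ^ (a + b)) * ift (%xi. ?d a b i xi * g xi) x" if "a <= 2" "b <= 2" for a b
  proof -
   have ab: "a + b <= 4" using that by simp
   have e: "of_real (z $ 1) ^ a * of_real (z $ 2) ^ b * ?K z = (1 / (- 2 * pi * \<i>) ^ (a + b)) * ift (?d a b i) z" for z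
    unfolding ift_mderiv[OF reg[OF i] mb[OF i] ab] by simp
   have d12: "?d a b i \<in> BL12" by (intro BLc_BL12 regular_mderiv_BLc(1)[OF reg[OF i] mb[OF i] ab])
   have "integrable lborel (%z. (1 / (- 2 * pi * \<i>) ^ (a + b)) * (u (x - z) * ift (?d a b i) z))"
    by (intro integrable_mult_right cv_integrable u2 d12)
   then show "integrable lborel (%z. u (x - z) * (of_real (z $ 1) ^ a * of_real (z $ 2) ^ b * ?K z))"
    unfolding e by (simp only: mult.left_commute)
   have "(LINT z|lborel. u (x - z) * (of_real (z $ 1) ^ a * of_real (z $ 2) ^ b * ?K z))
    = (LINT z|lborel. (1 / (- 2 * pi * \<i>) ^ (a + b)) * (u (x - z) * ift (?d a b i) z))"
    unfolding e by (simp only: mult.left_commute)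
   also have "... = (1 / (- 2 * pi * \<i>) ^ (a + b)) * cv u (?d a b i) x"
    unfolding cv_def by (rule integral_mult_right_zero)
   also have "cv u (?d a b i) x = ift (%xi. ?d a b i xi * g xi) x" by (rule cv_eq[OF g d12])
   finally show "(LINT z|lborel. u (x - z) * (of_real (z $ 1) ^ a * of_real (z $ 2) ^ b * ?K z))
    = (1 / (- 2 * pi * \<i>) ^ (a + b)) * ift (%xi. ?d a b i xi * g xi) x" .
  qed
  have pexp: "p (x - z) = (\<Sum>a\<le>2. \<Sum>b\<le>2. cc a b * (z $ 1 ^ a * z $ 2 ^ b))" for z
  proof -
   have "p (x - z) = (1 + (s1 - z $ 1 / r)^2) * (1 + (s2 - z $ 2 / r)^2)"
   proof -
    have "((x - z) $ 1 - c $ 1) / r = s1 - z $ 1 / r" "((x - z) $ 2 - c $ 2) / r = s2 - z $ 2 / r"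
    by (simp_all add: s1_def s2_def diff_divide_distrib)
    then show ?thesis by (simp only: p_def)
   qed
   also have "... = (\<Sum>a\<le>2. qc a s1 * (z $ 1 / r) ^ a) * (\<Sum>b\<le>2. qc b s2 * (z $ 2 / r) ^ b)"
    by (simp only: qc_expand)
   also have "... = (\<Sum>a\<le>2. \<Sum>b\<le>2. cc a b * (z $ 1 ^ a * z $ 2 ^ b))"
    unfolding sum_product cc_def by (intro sum.cong refl) (simp add: power_divide power_add)
   finally show ?thesis .
  qed
  have "cv h (m i) x = (LINT z|lborel. (\<Sum>a\<le>2. \<Sum>b\<le>2. of_real (cc a b) * (u (x - z) * (of_real (z $ 1) ^ a * of_real (z $ 2) ^ b * ?K z))))"
   unfolding cv_def hu pexp by (simp add: sum_distrib_left sum_distrib_right mult_ac)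
  also have "... = (\<Sum>a\<le>2. \<Sum>b\<le>2. of_real (cc a b) * (LINT z|lborel. u (x - z) * (of_real (z $ 1) ^ a * of_real (z $ 2) ^ b * ?K z)))"
  proof -
   let ?F = "%a b z. of_real (cc a b) * (u (x - z) * (of_real (z $ 1) ^ a * of_real (z $ 2) ^ b * ?K z))"
   have i: "a \<in> {..2} ==> b \<in> {..2} ==> integrable lborel (?F a b)" for a b
    by (intro integrable_mult_right dint) auto
   have "(LINT z|lborel. (\<Sum>a\<le>2. \<Sum>b\<le>2. ?F a b z)) = (\<Sum>a\<le>2. LINT z|lborel. (\<Sum>b\<le>2. ?F a b z))"
    by (intro Bochner_Integration.integral_sum Bochner_Integration.integrable_sum i)
   also have "... = (\<Sum>a\<le>2. \<Sum>b\<le>2. LINT z|lborel. ?F a b z)"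
    by (intro sum.cong refl Bochner_Integration.integral_sum i)
   also have "... = (\<Sum>a\<le>2. \<Sum>b\<le>2. of_real (cc a b) * (LINT z|lborel. u (x - z) * (of_real (z $ 1) ^ a * of_real (z $ 2) ^ b * ?K z)))"
    by (intro sum.cong refl integral_mult_right_zero)
   finally show ?thesis .
  qed
  also have "... = (\<Sum>a\<le>2. \<Sum>b\<le>2. of_real (cc a b) * ((1 / (- 2 * pi * \<i>) ^ (a + b)) * ift (%xi. ?d a b i xi * g xi) x))"
   using dval by (intro sum.cong refl) simp
  finally have "(cmod (cv h (m i) x))^2 <= 9 * (\<Sum>a\<le>(2::nat). \<Sum>b\<le>2. (cmod (of_real (cc a b) * ((1 / (- 2 * pi * \<i>) ^ (a + b)) * ift (%xi. ?d a b i xi * g xi) x)))\<^sup>2)"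
   by (simp only: sum9_square)
  also have "... <= 9 * (\<Sum>a\<le>(2::nat). \<Sum>b\<le>2. 16 * ((1 / (r ^ (a + b))^2) * (cmod (ift (%xi. ?d a b i xi * g xi) x))^2))"
  proof (intro mult_left_mono sum_mono)
   fix a b assume "a \<in> {..2::nat}" "b \<in> {..2::nat}"
   define I where "I = cmod (ift (%xi. ?d a b i xi * g xi) x)"
   show "(cmod (of_real (cc a b) * ((1 / (- 2 * pi * \<i>) ^ (a + b)) * ift (%xi. ?d a b i xi * g xi) x)))^2
    <= 16 * ((1 / (r ^ (a + b))^2) * (cmod (ift (%xi. ?d a b i xi * g xi) x))^2)"
   proof -
    have c1: "\<bar>cc a b\<bar> <= 4 / r ^ (a + b)"
    proof -
    have "\<bar>qc a s1\<bar> * \<bar>qc b s2\<bar> <= 2 * 2"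
    using \<open>a \<in> {..2}\<close> \<open>b \<in> {..2}\<close> s by (intro mult_mono qc_bound) auto
    then show ?thesis using r by (simp add: cc_def abs_mult divide_right_mono)
    qed
    have "1 <= (2 * pi) ^ (a + b)" using pi_gt3 by (intro one_le_power) simp
    then have c2: "cmod (1 / (- 2 * pi * \<i>) ^ (a + b)) <= 1"
    by (simp add: norm_divide norm_power norm_mult)
    have "cmod (of_real (cc a b) * ((1 / (- 2 * pi * \<i>) ^ (a + b)) * ift (%xi. ?d a b i xi * g xi) x))
    = \<bar>cc a b\<bar> * (cmod (1 / (- 2 * pi * \<i>) ^ (a + b)) * I)"
    by (simp only: norm_mult norm_of_real I_def)
    also have "... <= (4 / r ^ (a + b)) * (1 * I)"
    using c1 c2 r by (intro mult_mono) (auto simp: I_def)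
    finally have "(cmod (of_real (cc a b) * ((1 / (- 2 * pi * \<i>) ^ (a + b)) * ift (%xi. ?d a b i xi * g xi) x)))^2
    <= (4 / r ^ (a + b) * (1 * I))^2"
    by (intro power_mono) auto
    also have "... = 16 * ((1 / (r ^ (a + b))^2) * I\<^sup>2)"
    by (simp add: power_mult_distrib power_divide)
    finally show ?thesis by (simp only: I_def)
   qed
  qed simp
  finally show ?thesis using True by (simp add: cell_def sum_distrib_left)
 next
  case False
  then show ?thesis by (auto simp: cell_def intro!: sum_nonneg)
 qed
 have bx [measurable]: "cell r c \<in> Bor" unfolding cell_def by measurable
 have im: "ift (%xi. ?d a b i xi * g xi) \<in> Bor" if "i \<in> J" "a <= 2" "b <= 2" for i a b
 proof -
  have "?d a b i \<in> Bor"
   by (intro BLc_borel regular_mderiv_BLc(1)[OF reg[OF that(1)] mb[OF that(1)]]) (use that in simp)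
  then show ?thesis using g2 by (intro ift_borel borel_measurable_times) auto
 qed
 have "(\<Sum>i\<in>J. \<integral>\<^sup>+x. ennreal (cell r c x * (cmod (cv h (m i) x))^2) \<partial>lborel)
   <= (\<Sum>i\<in>J. 144 * (\<Sum>a\<le>2. \<Sum>b\<le>2. ennreal (1 / (r ^ (a + b))^2) * E2 (ift (%xi. ?d a b i xi * g xi))))"
 proof (rule sum_mono)
  fix i assume i: "i \<in> J"
  have "(NN x. ennreal (cell r c x * (cmod (cv h (m i) x))^2))
    <= (NN x. 144 * (\<Sum>a\<le>2. \<Sum>b\<le>2. ennreal (1 / (r ^ (a + b))^2) * ennreal ((cmod (ift (%xi. ?d a b i xi * g xi) x))^2)))"
  proof (rule nn_integral_mono)
   fix x
   have "ennreal (cell r c x * (cmod (cv h (m i) x))^2)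
    <= ennreal (144 * (\<Sum>a\<le>2. \<Sum>b\<le>2. (1 / (r ^ (a + b))^2) * (cmod (ift (%xi. ?d a b i xi * g xi) x))^2))"
    by (rule ennreal_leI[OF pt[OF i]])
   also have "... = 144 * (\<Sum>a\<le>2. \<Sum>b\<le>2. ennreal (1 / (r ^ (a + b))^2) * ennreal ((cmod (ift (%xi. ?d a b i xi * g xi) x))^2))"
   proof -
    have "ennreal (144 * (\<Sum>a\<le>2. \<Sum>b\<le>2. (1 / (r ^ (a + b))^2) * (cmod (ift (%xi. ?d a b i xi * g xi) x))^2))
    = ennreal 144 * ennreal (\<Sum>a\<le>2. \<Sum>b\<le>2. (1 / (r ^ (a + b))^2) * (cmod (ift (%xi. ?d a b i xi * g xi) x))^2)"
    by (rule ennreal_mult) (auto intro!: sum_nonneg)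
    also have "ennreal (\<Sum>a\<le>2. \<Sum>b\<le>2. (1 / (r ^ (a + b))^2) * (cmod (ift (%xi. ?d a b i xi * g xi) x))^2)
    = (\<Sum>a\<le>2. \<Sum>b\<le>2. ennreal ((1 / (r ^ (a + b))^2) * (cmod (ift (%xi. ?d a b i xi * g xi) x))^2))"
    by (subst sum_ennreal[symmetric], intro sum_nonneg, simp, intro sum.cong refl, subst sum_ennreal[symmetric], simp, rule refl)
    also have "... = (\<Sum>a\<le>2. \<Sum>b\<le>2. ennreal (1 / (r ^ (a + b))^2) * ennreal ((cmod (ift (%xi. ?d a b i xi * g xi) x))^2))"
    by (intro sum.cong refl ennreal_mult) auto
    finally show ?thesis by (simp only: ennreal_numeral)
   qed
   finally show "ennreal (cell r c x * (cmod (cv h (m i) x))^2)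
    <= 144 * (\<Sum>a\<le>2. \<Sum>b\<le>2. ennreal (1 / (r ^ (a + b))^2) * ennreal ((cmod (ift (%xi. ?d a b i xi * g xi) x))^2))" .
  qed
  also have "... = 144 * (\<Sum>a\<le>2. \<Sum>b\<le>2. ennreal (1 / (r ^ (a + b))^2) * E2 (ift (%xi. ?d a b i xi * g xi)))"
  proof -
   let ?f = "%a b x. ennreal ((cmod (ift (%xi. ?d a b i xi * g xi) x))^2)"
   have fm: "a \<in> {..2} ==> b \<in> {..2} ==> ?f a b \<in> borel_measurable lborel" for a b
    using im[OF i, of a b] by simp
   have fm2: "a \<in> {..2} ==> b \<in> {..2} ==> (%x. ennreal (1 / (r ^ (a + b))^2) * ?f a b x) \<in> borel_measurable lborel" for a b
    using fm[of a b] by measurable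
   have "(NN x. 144 * (\<Sum>a\<le>2. \<Sum>b\<le>2. ennreal (1 / (r ^ (a + b))^2) * ?f a b x))
    = 144 * (NN x. (\<Sum>a\<le>2. \<Sum>b\<le>2. ennreal (1 / (r ^ (a + b))^2) * ?f a b x))"
    by (intro nn_integral_cmult borel_measurable_sum fm2)
   also have "(NN x. (\<Sum>a\<le>2. \<Sum>b\<le>2. ennreal (1 / (r ^ (a + b))^2) * ?f a b x))
    = (\<Sum>a\<le>2. \<integral>\<^sup>+x. (\<Sum>b\<le>2. ennreal (1 / (r ^ (a + b))^2) * ?f a b x) \<partial>lborel)"
    by (intro nn_integral_sum borel_measurable_sum fm2)
   also have "... = (\<Sum>a\<le>2. \<Sum>b\<le>2. \<integral>\<^sup>+x. ennreal (1 / (r ^ (a + b))^2) * ?f a b x \<partial>lborel)"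
    by (intro sum.cong refl nn_integral_sum fm2)
   also have "... = (\<Sum>a\<le>2. \<Sum>b\<le>2. ennreal (1 / (r ^ (a + b))^2) * E2 (ift (%xi. ?d a b i xi * g xi)))"
    unfolding E2_def by (intro sum.cong refl nn_integral_cmult fm)
   finally show ?thesis .
  qed
  finally show "(NN x. ennreal (cell r c x * (cmod (cv h (m i) x))^2))
   <= 144 * (\<Sum>a\<le>2. \<Sum>b\<le>2. ennreal (1 / (r ^ (a + b))^2) * E2 (ift (%xi. ?d a b i xi * g xi)))" .
 qed
 also have "... = 144 * (\<Sum>a\<le>2. \<Sum>b\<le>2. ennreal (1 / (r ^ (a + b))^2) * (\<Sum>i\<in>J. E2 (ift (%xi. ?d a b i xi * g xi))))"
  unfolding sum_distrib_left[symmetric]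
  by (subst sum.swap, intro arg_cong2[where f="(*)"] refl sum.cong, subst sum.swap) (simp only: sum_distrib_left)
 also have "... <= 144 * (\<Sum>a\<le>(2::nat). \<Sum>b\<le>(2::nat). ennreal B * E2 u)"
 proof (intro mult_left_mono sum_mono)
  fix a b :: nat assume "a \<in> {..2}" "b \<in> {..2}"
  then have ab: "a + b <= 4" by simp
  have "(\<Sum>i\<in>J. E2 (ift (%xi. ?d a b i xi * g xi))) <= ennreal (B * (r ^ (a + b))^2) * E2 g"
   using regular_mderiv_BLc[OF reg mb ab] bb ab \<open>0 <= B\<close> g2 J
   by (intro sum_E2_ift_le) (auto simp: bank_bound_def)
  then have "ennreal (1 / (r ^ (a + b))^2) * (\<Sum>i\<in>J. E2 (ift (%xi. ?d a b i xi * g xi)))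
    <= ennreal (1 / (r ^ (a + b))^2) * (ennreal (B * (r ^ (a + b))^2) * E2 g)"
   by (rule mult_left_mono) simp
  also have "... = ennreal (1 / (r ^ (a + b))^2 * (B * (r ^ (a + b))^2)) * E2 g"
   using \<open>0 <= B\<close> by (subst ennreal_mult) (auto simp: mult.assoc)
  also have "1 / (r ^ (a + b))^2 * (B * (r ^ (a + b))^2) = B" using r by simp
  finally show "ennreal (1 / (r ^ (a + b))^2) * (\<Sum>i\<in>J. E2 (ift (%xi. ?d a b i xi * g xi))) <= ennreal B * E2 u"
   by (simp only: FT_E2[OF g])
 qed simp
 also have "... = ennreal (1296 * B) * E2 u"
  using \<open>0 <= B\<close> by (simp add: ennreal_mult mult_ac)
 finally show ?thesis by (simp only: E2u)
qed


section \<open>The commutator on low frequencies\<close>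

lemma borel_measurable_vec_nth [measurable (raw)]:
 fixes f :: "'a => plane"
 shows "f \<in> borel_measurable M ==> (%x. f x $ i) \<in> borel_measurable M"
 by (rule measurable_compose[OF _ borel_measurable_continuous_onI]) (auto intro!: continuous_intros)

lemma wt_minus: "wt (- z) = wt z" by (simp add: wt_def)

lemma cell_le_wt: assumes r: "r > 0" shows "cell r c x <= 16 * wt ((x - c) /\<^sub>R r)"
proof (cases "\<bar>x $ 1 - c $ 1\<bar> <= r \<and> \<bar>x $ 2 - c $ 2\<bar> <= r")
 case True
 have q: "1 + (((x - c) /\<^sub>R r) $ k)^2 <= 2" if "\<bar>x $ k - c $ k\<bar> <= r" for k
 proof -
  have "\<bar>((x - c) /\<^sub>R r) $ k\<bar> <= 1" using that r by (simp add: abs_mult field_simps)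
  then show ?thesis by (simp add: abs_square_le_1)
 qed
 have "(1 + (((x - c) /\<^sub>R r) $ 1)^2)^2 * (1 + (((x - c) /\<^sub>R r) $ 2)^2)^2 <= 2\<^sup>2 * 2\<^sup>2"
  using True by (intro mult_mono power_mono q) auto
 moreover have "0 < (1 + (((x - c) /\<^sub>R r) $ 1)^2)\<^sup>2 * (1 + (((x - c) /\<^sub>R r) $ 2)^2)^2"
  by (intro mult_pos_pos zero_less_power add_pos_nonneg) auto
 ultimately have "1 <= 16 * wt ((x - c) /\<^sub>R r)"
  unfolding wt_def by (simp only: times_divide_eq_right mult_1_right le_divide_eq_1_pos) simp
 then show ?thesis using True by (simp add: cell_def)
next
 case False
 then show ?thesis using wt_pos[of "(x - c) /\<^sub>R r"] by (simp add: cell_def)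
qed

lemma nn_integral_cell: assumes "r > 0" shows "(NN c. ennreal (cell r c x)) = ennreal (4 * r\<^sup>2)"
proof -
 define l u where "l = (\<chi> i. x $ i - r)" and "u = (\<chi> i. x $ i + r)"
 have "(NN c. ennreal (cell r c x)) = (NN c. indicator (cbox l u) c)"
  unfolding cell_def l_def u_def mem_box_cart
  by (intro nn_integral_cong) (auto simp: indicator_def mem_box_cart forall_2 abs_le_iff)
 also have "... = emeasure lborel (cbox l u)" by simp
 also have "... = ennreal (\<Prod>b\<in>Basis. (u - l) \<bullet> b)"
  using assms by (intro emeasure_lborel_cbox) (auto simp: l_def u_def Basis_vec_def inner_axis)
 also have "... = ennreal (4 * r\<^sup>2)"
  by (simp add: prod_Basis_plane[of "%t. t"] l_def u_def power2_eq_square)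
 finally show ?thesis .
qed

definition Cdef :: "real => real" where
 "Cdef \<kappa> = 4 / (1 - \<kappa>)^2 * (2 * pi)^2"

lemma Cdef_nonneg: "0 <= Cdef \<kappa>" by (simp add: Cdef_def)

text \<open>Freezing the deformation at \<open>c\<close> turns it into a translation. In the variable
  \<open>z = (c - y) / r\<close> the deformations by \<open>\<tau> (y + r z)\<close> and by \<open>\<tau> y\<close> differ by at most
  \<open>D r |z|\<close>, uniformly in \<open>y\<close>.\<close>
lemma freezing_error:
 assumes G: "G \<in> BLc" and \<kappa>: "\<kappa> < 1" and \<tau>: "\<kappa>-lipschitz_on UNIV \<tau>"
  and D: "D-lipschitz_on UNIV \<tau>" and r: "r > 0"
 shows "(NN c. \<integral>\<^sup>+y. ennreal (wt ((y - c) /\<^sub>R r) * (cmod (ift G (y - \<tau> y) - ift G (y - \<tau> c)))^2) \<partial>lborel)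
  <= ennreal (r ^ 4 * D\<^sup>2 * Cdef \<kappa>) * wt_moment * D2 G"
proof -
 have [measurable]: "\<tau> \<in> Bor" by (rule lipschitz_borel[OF \<tau> \<kappa>])
 have [measurable]: "ift G \<in> Bor" by (intro ift_borel BLc_borel G)
 have D0: "D >= 0" using D by (rule lipschitz_on_nonneg)
 let ?F = "%y c. ennreal (wt ((y - c) /\<^sub>R r) * (cmod (ift G (y - \<tau> y) - ift G (y - \<tau> c)))^2)"
 let ?H = "%z y. ennreal ((cmod (ift G (y - \<tau> y) - ift G (y - \<tau> (y + r *R z))))^2)"
 have "(NN c. \<integral>\<^sup>+y. ?F y c \<partial>lborel) = (NN y. \<integral>\<^sup>+c. ?F y c \<partial>lborel)"
  by (rule lborel_pair.Fubini') measurable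
 also have "... = (NN y. \<integral>\<^sup>+z. ennreal (r\<^sup>2) * (ennreal (wt z) * ?H z y) \<partial>lborel)"
 proof (rule nn_integral_cong)
  fix y
  have "(NN c. ?F y c) = ennreal (r\<^sup>2) * (NN z. ?F y (y + r *R z))"
   using r by (intro lborel_subst(1)) auto
  also have "(NN z. ?F y (y + r *R z)) = (NN z. ennreal (wt z) * ?H z y)"
   using r wt_pos by (intro nn_integral_cong) (simp add: wt_minus ennreal_mult less_imp_le)
  also have "ennreal (r\<^sup>2) * ... = (NN z. ennreal (r\<^sup>2) * (ennreal (wt z) * ?H z y))"
   by (rule nn_integral_cmult[symmetric]) measurable
  finally show "(NN c. ?F y c) = (NN z. ennreal (r\<^sup>2) * (ennreal (wt z) * ?H z y))" .
 qed
 also have "... = (NN z. \<integral>\<^sup>+y. ennreal (r\<^sup>2) * (ennreal (wt z) * ?H z y) \<partial>lborel)"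
  by (rule lborel_pair.Fubini') measurable
 also have "... = (NN z. ennreal (r\<^sup>2) * (ennreal (wt z) * (NN y. ?H z y)))"
  by (intro nn_integral_cong) (simp add: nn_integral_cmult)
 also have "... <= (NN z. ennreal (r\<^sup>2) * (ennreal (wt z) * (ennreal ((D * (r * norm z))^2 * Cdef \<kappa>) * D2 G)))"
 proof (intro nn_integral_mono mult_left_mono)
  fix z
  have lip: "\<kappa>-lipschitz_on UNIV (%y. \<tau> (y + r *R z))"
  proof (rule lipschitz_onI)
   show "dist (\<tau> (x + r *R z)) (\<tau> (y + r *R z)) <= \<kappa> * dist x y" for x y
    using lipschitz_onD[OF \<tau>, of "x + r *R z" "y + r *R z"] by simp
  qed (rule lipschitz_on_nonneg[OF \<tau>])
  have "E2 (%y. ift G (y - \<tau> y) - ift G (y - \<tau> (y + r *R z)))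
    <= ennreal ((D * (r * norm z))^2 * (4 / (1 - \<kappa>)^2 * (2 * pi)^2)) * D2 G"
  proof (rule E2_deform_diff[OF G \<kappa> \<tau> lip])
   show "norm (\<tau> y - \<tau> (y + r *R z)) <= D * (r * norm z)" for y
    using lipschitz_onD[OF D, of y "y + r *R z"] r by (simp add: dist_norm)
  qed
  then show "(NN y. ?H z y) <= ennreal ((D * (r * norm z))^2 * Cdef \<kappa>) * D2 G"
   by (simp add: E2_def Cdef_def)
 qed auto
 also have "... = (NN z. (ennreal (r ^ 4 * D\<^sup>2 * Cdef \<kappa>) * D2 G) * ennreal (wt z * (norm z)^2))"
 proof (intro nn_integral_cong)
  fix z
  have "ennreal (r\<^sup>2) * (ennreal (wt z) * (ennreal ((D * (r * norm z))^2 * Cdef \<kappa>) * D2 G))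
    = (ennreal (r\<^sup>2) * (ennreal (wt z) * ennreal ((D * (r * norm z))^2 * Cdef \<kappa>))) * D2 G"
   by (simp only: mult.assoc)
  also have "ennreal (r\<^sup>2) * (ennreal (wt z) * ennreal ((D * (r * norm z))^2 * Cdef \<kappa>))
    = ennreal (r\<^sup>2 * (wt z * ((D * (r * norm z))^2 * Cdef \<kappa>)))"
   using wt_pos[of z] Cdef_nonneg by (simp add: ennreal_mult)
  also have "r\<^sup>2 * (wt z * ((D * (r * norm z))^2 * Cdef \<kappa>)) = (r ^ 4 * D\<^sup>2 * Cdef \<kappa>) * (wt z * (norm z)^2)"
   by (simp add: power_mult_distrib power2_eq_square numeral_eq_Suc)
  also have "ennreal ... = ennreal (r ^ 4 * D\<^sup>2 * Cdef \<kappa>) * ennreal (wt z * (norm z)^2)"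
   using wt_pos[of z] Cdef_nonneg r by (intro ennreal_mult) auto
  finally show "ennreal (r\<^sup>2) * (ennreal (wt z) * (ennreal ((D * (r * norm z))^2 * Cdef \<kappa>) * D2 G))
    = (ennreal (r ^ 4 * D\<^sup>2 * Cdef \<kappa>) * D2 G) * ennreal (wt z * (norm z)^2)"
   by (simp only: mult_ac)
 qed
 also have "... = (ennreal (r ^ 4 * D\<^sup>2 * Cdef \<kappa>) * D2 G) * wt_moment"
  unfolding wt_moment_def by (rule nn_integral_cmult) measurable
 finally show ?thesis by (simp only: mult_ac)
qed

lemma sum_D2_le:
 assumes "finite J" and m: "!!i. i \<in> J ==> m i \<in> Bor"
  and B: "AE xi in lborel. (\<Sum>i\<in>J. (cmod (m i xi))\<^sup>2) <= B" "0 <= B" and G: "G \<in> Bor"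
 shows "(\<Sum>i\<in>J. D2 (%xi. m i xi * G xi)) <= ennreal B * D2 G"
proof -
 note [measurable] = G
 have "(\<Sum>i\<in>J. D2 (%xi. m i xi * G xi)) = (NN xi. (\<Sum>i\<in>J. ennreal ((norm xi)^2 * (cmod (m i xi * G xi))^2)))"
  unfolding D2_def using m by (intro nn_integral_sum[symmetric]) auto
 also have "... <= (NN xi. ennreal B * ennreal ((norm xi)^2 * (cmod (G xi))^2))"
 proof (rule nn_integral_mono_AE, use B(1) in eventually_elim)
  case (elim xi)
  have "(\<Sum>i\<in>J. ennreal ((norm xi)^2 * (cmod (m i xi * G xi))^2))
    = ennreal (\<Sum>i\<in>J. (norm xi)\<^sup>2 * (cmod (m i xi * G xi))^2)"
   by (rule sum_ennreal) simp
  also have "(\<Sum>i\<in>J. (norm xi)\<^sup>2 * (cmod (m i xi * G xi))^2) = (\<Sum>i\<in>J. (cmod (m i xi))\<^sup>2) * ((norm xi)^2 * (cmod (G xi))^2)"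
   unfolding sum_distrib_right by (intro sum.cong refl) (simp add: norm_mult power_mult_distrib)
  also have "ennreal ... <= ennreal (B * ((norm xi)^2 * (cmod (G xi))^2))"
   by (intro ennreal_leI mult_right_mono elim) simp
  finally show ?case using B(2) by (simp add: ennreal_mult)
 qed
 also have "... = ennreal B * D2 G" unfolding D2_def by (rule nn_integral_cmult) measurable
 finally show ?thesis .
qed

text \<open>Freezing the deformation at every centre \<open>c\<close> and averaging over \<open>c\<close> turns the commutator into
  local pieces. Each is a filter applied to the difference of a deformation and its translation, of
  size \<open>D\<close> times the distance to \<open>c\<close>, hence of size \<open>D r\<close> where the weight lives.\<close>
theorem commutator_low:
 assumes G: "G \<in> BLc" and \<kappa>: "\<kappa> < 1" and \<tau>: "\<kappa>-lipschitz_on UNIV \<tau>"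
  and D: "D-lipschitz_on UNIV \<tau>" and r: "r > 0"
  and bb: "bank_bound 4 J m r B" and B: "0 <= B"
 shows "(\<Sum>i\<in>J. E2 (%x. cv (%x. ift G (x - \<tau> x)) (m i) x - cv (ift G) (m i) (x - \<tau> x)))
  <= ennreal (656 * B * Cdef \<kappa> * r\<^sup>2 * D\<^sup>2) * wt_moment * D2 G"
proof -
 have J: "finite J" and reg: "!!i. i \<in> J ==> regular 4 (m i)" and mb: "!!i. i \<in> J ==> m i \<in> Bor"
  using bb by (auto simp: bank_bound_def)
 have m0: "AE xi in lborel. (\<Sum>i\<in>J. (cmod (m i xi))\<^sup>2) <= B"
  using bb unfolding bank_bound_def by (auto dest!: spec[of _ 0] simp: mderiv_Suc)
 have mc: "m i \<in> BLc" "\<exists>K. \<forall>xi. cmod (m i xi) <= K" if "i \<in> J" for i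
  using regular_mderiv_BLc[OF reg[OF that] mb[OF that], of 0 0] by (auto simp: mderiv_Suc)
 have m12: "i \<in> J ==> m i \<in> BL12" for i by (intro BLc_BL12 mc)
 define w where "w = ift G"
 have FTw: "FT w G" unfolding w_def by (intro FT_ift BLc_BL12 G)
 have w2: "w \<in> BL2" by (rule FT_BL2(1)[OF FTw])
 have [measurable]: "\<tau> \<in> Bor" by (rule lipschitz_borel[OF \<tau> \<kappa>])
 have [measurable]: "w \<in> Bor" using w2 by auto
 define Lw where "Lw = (%x. w (x - \<tau> x))"
 have Lw2: "Lw \<in> BL2" unfolding Lw_def by (rule deform_BL2[OF \<tau> \<kappa> w2])
 define V where "V = (%i xi. m i xi * G xi)"
 have Vc: "V i \<in> BLc" if i: "i \<in> J" for i
 proof -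
  obtain K where "!!xi. cmod (m i xi) <= K" using mc(2)[OF i] by blast
  then show ?thesis unfolding V_def using G by (intro BLc_times_BL2[OF mc(1)[OF i]]) (auto simp: BLc_def)
 qed
 define v where "v = (%i. ift (V i))"
 have v: "cv w (m i) = v i" if "i \<in> J" for i
  unfolding v_def V_def using cv_eq[OF FTw m12[OF that]] by auto
 have vm: "i \<in> J ==> v i \<in> Bor" for i
  unfolding v_def by (intro ift_borel BLc_borel Vc)
 have Lm: "i \<in> J ==> cv Lw (m i) \<in> Bor" for i
  by (intro cv_borel Lw2 m12)
 define h where "h = (%c y. w (y - \<tau> y) - w (y - \<tau> c))"
 have h2: "h c \<in> BL2" for c
  unfolding h_def using Lw2 shift_BL2[OF w2, of "\<tau> c"] unfolding Lw_def by (rule BL2_diff)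
 have hc: "cv (h c) (m i) x = cv Lw (m i) x - v i (x - \<tau> c)" if "i \<in> J" for i c x
 proof -
  have "cv (h c) (m i) x = cv Lw (m i) x - cv (%y. w (y - \<tau> c)) (m i) x"
   unfolding h_def Lw_def[symmetric]
   using cv_diff[OF Lw2 shift_BL2[OF w2, of "\<tau> c"] m12[OF that], of x] by (simp add: Lw_def)
  then show ?thesis unfolding cv_shift v[OF that] .
 qed
 define N where "N = (%i x. cv Lw (m i) x - v i (x - \<tau> x))"
 define X where "X = (%i c x. ennreal (cell r c x * (cmod (cv Lw (m i) x - v i (x - \<tau> c)))^2))"
 define Y where "Y = (%i c x. ennreal (cell r c x * (cmod (v i (x - \<tau> x) - v i (x - \<tau> c)))^2))"
 have [measurable]: "(%p. cell r (fst p) (snd p)) \<in> borel_measurable (borel \<Otimes>\<^sub>M borel)"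
  unfolding cell_def by measurable
 have bx1 [measurable]: "(%c. cell r c x) \<in> Bor" for x unfolding cell_def by measurable
 have bx2 [measurable]: "cell r c \<in> Bor" for c unfolding cell_def by measurable
 have XYm: "(%p. X i (fst p) (snd p)) \<in> borel_measurable (lborel \<Otimes>\<^sub>M lborel)"
  "(%p. Y i (fst p) (snd p)) \<in> borel_measurable (lborel \<Otimes>\<^sub>M lborel)"
  "X i c \<in> borel_measurable lborel" "Y i c \<in> borel_measurable lborel" if "i \<in> J" for i c
 proof -
  note [measurable] = vm[OF that] Lm[OF that]
  show "(%p. X i (fst p) (snd p)) \<in> borel_measurable (lborel \<Otimes>\<^sub>M lborel)"
   "(%p. Y i (fst p) (snd p)) \<in> borel_measurable (lborel \<Otimes>\<^sub>M lborel)"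
   "X i c \<in> borel_measurable lborel" "Y i c \<in> borel_measurable lborel"
   unfolding X_def Y_def by measurable
 qed
 have XYc: "(%c. \<integral>\<^sup>+x. X i c x \<partial>lborel) \<in> borel_measurable lborel" "(%c. \<integral>\<^sup>+x. Y i c x \<partial>lborel) \<in> borel_measurable lborel" if "i \<in> J" for i
  using XYm(1,2)[OF that] by (auto intro!: lborel.borel_measurable_nn_integral simp: case_prod_beta)
 have key: "ennreal (4 * r\<^sup>2) * E2 (N i) <= 2 * (NN c. \<integral>\<^sup>+x. X i c x \<partial>lborel) + 2 * (NN c. \<integral>\<^sup>+x. Y i c x \<partial>lborel)"
  if i: "i \<in> J" for i
 proof -
  note [measurable] = vm[OF i] Lm[OF i]
  have [measurable]: "N i \<in> Bor" unfolding N_def by measurable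
  have "ennreal (4 * r\<^sup>2) * E2 (N i) = (NN x. ennreal (4 * r\<^sup>2) * ennreal ((cmod (N i x))^2))"
   unfolding E2_def by (rule nn_integral_cmult[symmetric]) measurable
  also have "... = (NN x. \<integral>\<^sup>+c. ennreal (cell r c x) * ennreal ((cmod (N i x))^2) \<partial>lborel)"
  proof (rule nn_integral_cong)
   fix x
   show "ennreal (4 * r\<^sup>2) * ennreal ((cmod (N i x))^2) = (NN c. ennreal (cell r c x) * ennreal ((cmod (N i x))^2))"
    using nn_integral_cell[OF r, of x] by (subst nn_integral_multc) auto
  qed
  also have "... = (NN c. \<integral>\<^sup>+x. ennreal (cell r c x) * ennreal ((cmod (N i x))^2) \<partial>lborel)"
   by (rule lborel_pair.Fubini') measurable
  also have "... <= (NN c. \<integral>\<^sup>+x. 2 * X i c x + 2 * Y i c x \<partial>lborel)"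
  proof (intro nn_integral_mono)
   fix c x
   have b: "cell r c x = 0 \<or> cell r c x = 1" by (auto simp: cell_def indicator_def)
   have "N i x = (cv Lw (m i) x - v i (x - \<tau> c)) + - (v i (x - \<tau> x) - v i (x - \<tau> c))"
    by (simp add: N_def)
   then have "ennreal ((cmod (N i x))^2) <= 2 * ennreal ((cmod (cv Lw (m i) x - v i (x - \<tau> c)))^2)
    + 2 * ennreal ((cmod (- (v i (x - \<tau> x) - v i (x - \<tau> c))))^2)"
    by (simp only: ennreal_cmod_add_sq)
   then show "ennreal (cell r c x) * ennreal ((cmod (N i x))^2) <= 2 * X i c x + 2 * Y i c x"
    using b unfolding X_def Y_def norm_minus_cancel by auto
  qed
  also have "... = (NN c. 2 * (NN x. X i c x) + 2 * (NN x. Y i c x))"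
   using XYm(3,4)[OF i] by (intro nn_integral_cong) (simp add: nn_integral_add nn_integral_cmult)
  also have "... = 2 * (NN c. \<integral>\<^sup>+x. X i c x \<partial>lborel) + 2 * (NN c. \<integral>\<^sup>+x. Y i c x \<partial>lborel)"
   using XYc[OF i] by (simp add: nn_integral_add nn_integral_cmult)
  finally show ?thesis .
 qed
 define P where "P = ennreal (r ^ 4 * D\<^sup>2 * Cdef \<kappa>) * wt_moment"
 have Xb: "(\<Sum>i\<in>J. \<integral>\<^sup>+c. \<integral>\<^sup>+x. X i c x \<partial>lborel \<partial>lborel) <= ennreal (1296 * B) * (P * D2 G)"
 proof -
  have "(\<Sum>i\<in>J. \<integral>\<^sup>+c. \<integral>\<^sup>+x. X i c x \<partial>lborel \<partial>lborel) = (NN c. (\<Sum>i\<in>J. \<integral>\<^sup>+x. X i c x \<partial>lborel))"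
   using XYc by (intro nn_integral_sum[symmetric]) auto
  also have "... <= (NN c. ennreal (1296 * B) * (NN y. ennreal (wt ((y - c) /\<^sub>R r) * (cmod (h c y))^2)))"
  proof (rule nn_integral_mono)
   fix c
   have "(\<Sum>i\<in>J. \<integral>\<^sup>+x. X i c x \<partial>lborel) = (\<Sum>i\<in>J. \<integral>\<^sup>+x. ennreal (cell r c x * (cmod (cv (h c) (m i) x))^2) \<partial>lborel)"
    unfolding X_def using hc by (intro sum.cong refl nn_integral_cong) simp
   also have "... <= ennreal (1296 * B) * (NN y. ennreal (wt ((y - c) /\<^sub>R r) * (cmod (h c y))^2))"
    by (rule local_bound[OF r bb B h2])
   finally show "(\<Sum>i\<in>J. \<integral>\<^sup>+x. X i c x \<partial>lborel)
    <= ennreal (1296 * B) * (NN y. ennreal (wt ((y - c) /\<^sub>R r) * (cmod (h c y))^2))" .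
  qed
  also have "... = ennreal (1296 * B) * (NN c. \<integral>\<^sup>+y. ennreal (wt ((y - c) /\<^sub>R r) * (cmod (h c y))^2) \<partial>lborel)"
   unfolding h_def by (rule nn_integral_cmult) measurable
  also have "... <= ennreal (1296 * B) * (P * D2 G)"
   unfolding P_def h_def w_def by (intro mult_left_mono freezing_error G \<kappa> \<tau> D r) simp
  finally show ?thesis .
 qed
 have Yb: "(\<Sum>i\<in>J. \<integral>\<^sup>+c. \<integral>\<^sup>+x. Y i c x \<partial>lborel \<partial>lborel) <= ennreal (16 * B) * (P * D2 G)"
 proof -
  have "(NN c. \<integral>\<^sup>+x. Y i c x \<partial>lborel) <= 16 * (P * D2 (V i))" if i: "i \<in> J" for i
  proof -
   note [measurable] = vm[OF i]
   have "(NN c. \<integral>\<^sup>+x. Y i c x \<partial>lborel)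
    <= (NN c. \<integral>\<^sup>+x. 16 * ennreal (wt ((x - c) /\<^sub>R r) * (cmod (v i (x - \<tau> x) - v i (x - \<tau> c)))^2) \<partial>lborel)"
   proof (intro nn_integral_mono)
    fix c x
    have "cell r c x * (cmod (v i (x - \<tau> x) - v i (x - \<tau> c)))^2 <= 16 * wt ((x - c) /\<^sub>R r) * (cmod (v i (x - \<tau> x) - v i (x - \<tau> c)))^2"
    by (intro mult_right_mono cell_le_wt r) simp
    then have "Y i c x <= ennreal (16 * (wt ((x - c) /\<^sub>R r) * (cmod (v i (x - \<tau> x) - v i (x - \<tau> c)))^2))"
    unfolding Y_def by (intro ennreal_leI) (simp only: mult.assoc)
    also have "... = ennreal 16 * ennreal (wt ((x - c) /\<^sub>R r) * (cmod (v i (x - \<tau> x) - v i (x - \<tau> c)))^2)"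
    using wt_pos[of "(x - c) /\<^sub>R r"] by (intro ennreal_mult) auto
    finally show "Y i c x <= 16 * ennreal (wt ((x - c) /\<^sub>R r) * (cmod (v i (x - \<tau> x) - v i (x - \<tau> c)))^2)"
    by (simp only: ennreal_numeral)
   qed
   also have "... = (NN c. 16 * (NN x. ennreal (wt ((x - c) /\<^sub>R r) * (cmod (v i (x - \<tau> x) - v i (x - \<tau> c)))^2)))"
    by (rule nn_integral_cong, rule nn_integral_cmult) measurable
   also have "... = 16 * (NN c. \<integral>\<^sup>+x. ennreal (wt ((x - c) /\<^sub>R r) * (cmod (v i (x - \<tau> x) - v i (x - \<tau> c)))^2) \<partial>lborel)"
    by (rule nn_integral_cmult) measurable
   also have "... <= 16 * (P * D2 (V i))"
    unfolding P_def v_def by (intro mult_left_mono freezing_error Vc i \<kappa> \<tau> D r) simp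
   finally show ?thesis .
  qed
  then have "(\<Sum>i\<in>J. \<integral>\<^sup>+c. \<integral>\<^sup>+x. Y i c x \<partial>lborel \<partial>lborel) <= (\<Sum>i\<in>J. 16 * (P * D2 (V i)))"
   by (rule sum_mono)
  also have "... = 16 * (P * (\<Sum>i\<in>J. D2 (V i)))" by (simp only: sum_distrib_left)
  also have "... <= 16 * (P * (ennreal B * D2 G))"
   unfolding V_def by (intro mult_left_mono sum_D2_le J mb m0 B BLc_borel G) auto
  also have "... = ennreal (16 * B) * (P * D2 G)"
   using B by (simp add: ennreal_mult mult_ac)
  finally show ?thesis .
 qed
 have "ennreal (4 * r\<^sup>2) * (\<Sum>i\<in>J. E2 (N i)) <= (\<Sum>i\<in>J. 2 * (NN c. \<integral>\<^sup>+x. X i c x \<partial>lborel) + 2 * (NN c. \<integral>\<^sup>+x. Y i c x \<partial>lborel))"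
  unfolding sum_distrib_left by (intro sum_mono key)
 also have "... = 2 * (\<Sum>i\<in>J. \<integral>\<^sup>+c. \<integral>\<^sup>+x. X i c x \<partial>lborel \<partial>lborel) + 2 * (\<Sum>i\<in>J. \<integral>\<^sup>+c. \<integral>\<^sup>+x. Y i c x \<partial>lborel \<partial>lborel)"
  by (simp only: sum.distrib sum_distrib_left)
 also have "... <= 2 * (ennreal (1296 * B) * (P * D2 G)) + 2 * (ennreal (16 * B) * (P * D2 G))"
  by (intro add_mono mult_left_mono Xb Yb) auto
 also have "... = (ennreal (2 * (1296 * B)) + ennreal (2 * (16 * B))) * (P * D2 G)"
  using B by (simp only: ennreal_mult' [of 2 for B] ennreal_mult'[of 2] ennreal_numeral distrib_right mult.assoc)
 also have "ennreal (2 * (1296 * B)) + ennreal (2 * (16 * B)) = ennreal (2624 * B)"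
  using B by (subst ennreal_plus[symmetric]) auto
 also have "ennreal (2624 * B) * (P * D2 G) = ennreal (4 * r\<^sup>2) * (ennreal (656 * B * Cdef \<kappa> * r\<^sup>2 * D\<^sup>2) * wt_moment * D2 G)"
 proof -
  have "ennreal (2624 * B) * ennreal (r ^ 4 * D\<^sup>2 * Cdef \<kappa>) = ennreal (2624 * B * (r ^ 4 * D\<^sup>2 * Cdef \<kappa>))"
   using B Cdef_nonneg r by (intro ennreal_mult[symmetric]) auto
  also have "2624 * B * (r ^ 4 * D\<^sup>2 * Cdef \<kappa>) = (4 * r\<^sup>2) * (656 * B * Cdef \<kappa> * r\<^sup>2 * D\<^sup>2)"
   by (simp add: power2_eq_square numeral_eq_Suc)
  also have "ennreal ... = ennreal (4 * r\<^sup>2) * ennreal (656 * B * Cdef \<kappa> * r\<^sup>2 * D\<^sup>2)"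
   using B Cdef_nonneg by (intro ennreal_mult) auto
  finally show ?thesis unfolding P_def by (simp only: mult.assoc[symmetric])
 qed
 finally have "(\<Sum>i\<in>J. E2 (N i)) <= ennreal (656 * B * Cdef \<kappa> * r\<^sup>2 * D\<^sup>2) * wt_moment * D2 G"
  using r by (subst (asm) ennreal_mult_le_mult_iff) auto
 moreover have "E2 (N i) = E2 (%x. cv (%x. ift G (x - \<tau> x)) (m i) x - cv (ift G) (m i) (x - \<tau> x))" if "i \<in> J" for i
  using v[OF that] by (simp add: N_def Lw_def w_def)
 ultimately show ?thesis by simp
qed


section \<open>A smooth bump\<close>

text \<open>The functions \<open>poly p (1/t) * exp (-1/t)\<close>, extended by zero, are closed under
  differentiation; hence all of them are smooth.\<close>
definition expq :: "real poly => real => real" where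
 "expq p t = (if t <= 0 then 0 else poly p (1 / t) * exp (- (1 / t)))"

lemma expq_tendsto_0: "(expq p \<longlongrightarrow> 0) (at_right 0)"
proof -
 have "((%s. poly p s * exp (- s)) \<longlongrightarrow> (\<Sum>i\<le>degree p. coeff p i * 0)) at_top"
  unfolding poly_altdef sum_distrib_right mult.assoc
  by (intro tendsto_sum tendsto_mult tendsto_const)
    (use tendsto_power_div_exp_0 in \<open>simp add: exp_minus divide_inverse\<close>)
 then have "((%s. poly p s * exp (- s)) \<longlongrightarrow> 0) at_top" by simp
 then have "((%t. poly p (inverse t) * exp (- inverse t)) \<longlongrightarrow> 0) (at_right 0)"
  by (rule filterlim_compose[OF _ filterlim_inverse_at_top_right])
 moreover have "\<forall>\<^sub>F t in at_right 0. poly p (inverse t) * exp (- inverse t) = expq p t"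
  unfolding eventually_at_right_field by (intro exI[of _ 1]) (auto simp: expq_def inverse_eq_divide)
 ultimately show ?thesis by (rule Lim_transform_eventually)
qed

definition expq_step :: "real poly => real poly" where
 "expq_step p = [:0, 0, 1:] * (p - pderiv p)"

lemma expq_deriv: "(expq p has_real_derivative expq (expq_step p) t) (at t)"
proof -
 consider "t < 0" | "t > 0" | "t = 0" by linarith
 then show ?thesis
 proof cases
  case 1
  have "((%t. 0) has_real_derivative 0) (at t)" by simp
  then have "(expq p has_real_derivative 0) (at t)"
   by (rule has_field_derivative_transform_within_open[of _ _ _ "{..<0}"]) (use 1 in \<open>auto simp: expq_def\<close>)
  then show ?thesis using 1 by (simp add: expq_def)
 next
  case 2
  have "((%t. poly p (1 / t) * exp (- (1 / t))) has_real_derivative expq (expq_step p) t) (at t)"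
   using 2 by (auto intro!: derivative_eq_intros DERIV_chain2[of "poly p"] poly_DERIV
    simp: expq_def expq_step_def power2_eq_square field_simps)
  then show ?thesis
   by (rule has_field_derivative_transform_within_open[of _ _ _ "{0<..}"]) (use 2 in \<open>auto simp: expq_def\<close>)
 next
  case 3
  have "((%h. (expq p h - expq p 0) / h) \<longlongrightarrow> 0) (at 0)"
  proof (rule filterlim_split_at_real)
   have "\<forall>\<^sub>F h in at_left 0. 0 = (expq p h - expq p 0) / h"
    unfolding eventually_at_left_field by (intro exI[of _ "-1"]) (auto simp: expq_def)
   then show "((%h. (expq p h - expq p 0) / h) \<longlongrightarrow> 0) (at_left 0)"
    by (rule Lim_transform_eventually[OF tendsto_const])
   have "\<forall>\<^sub>F h in at_right 0. expq ([:0, 1:] * p) h = (expq p h - expq p 0) / h"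
    unfolding eventually_at_right_field by (intro exI[of _ 1]) (auto simp: expq_def)
   then show "((%h. (expq p h - expq p 0) / h) \<longlongrightarrow> 0) (at_right 0)"
    by (rule Lim_transform_eventually[OF expq_tendsto_0])
  qed
  then show ?thesis using 3 by (simp add: has_field_derivative_iff expq_def)
 qed
qed

subsection \<open>Closure properties of smooth functions\<close>

lemma partial_eqI:
 fixes f :: "plane => 'a::real_normed_vector"
 assumes "(f has_derivative D) (at x)"
 shows "partial k f x = D (axis k 1)"
proof -
 have "((%s. f (x + s *R axis k 1)) has_derivative (%s. D (s *R axis k 1))) (at 0)"
  by (rule has_derivative_compose[of "%s. x + s *R axis k 1" "%s. s *R axis k 1" 0 UNIV f D])
    (auto intro!: derivative_eq_intros assms)
 moreover have "D (s *R axis k 1) = s *R D (axis k 1)" for s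
  by (rule linear_scale[OF has_derivative_linear[OF assms]])
 ultimately show ?thesis
  unfolding partial_def by (intro vector_derivative_at) (simp add: has_vector_derivative_def)
qed

lemma td_Suc_imp: "times_differentiable (Suc n) f ==> times_differentiable n f"
proof (induction n arbitrary: f)
 case (Suc n)
 then have d: "!!x. f differentiable (at x)" "!!k. times_differentiable (Suc n) (partial k f)"
  by simp_all
 then show ?case using Suc.IH[OF d(2)] by simp
qed simp

lemma td_const: "times_differentiable n (%x. c)"
proof (induction n arbitrary: c)
 case (Suc n)
 have "partial k (%x. c) = (%x. 0)" for k by (auto simp: partial_def)
 then show ?case using Suc by simp
qed simp

lemma td_add:
 "times_differentiable n f ==> times_differentiable n g ==> times_differentiable n (%x. f x + g x)"
proof (induction n arbitrary: f g)
 case (Suc n)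
 have d: "f differentiable at x" "g differentiable at x" for x using Suc.prems by simp_all
 have "partial k (%x. f x + g x) = (%x. partial k f x + partial k g x)" for k
 proof
  fix x
  obtain F G where "(f has_derivative F) (at x)" "(g has_derivative G) (at x)"
   using d unfolding differentiable_def by blast
  then show "partial k (%x. f x + g x) x = partial k f x + partial k g x"
   by (simp add: partial_eqI[of f F x] partial_eqI[of g G x] partial_eqI[OF has_derivative_add])
 qed
 then show ?case using Suc.IH Suc.prems d by simp
qed simp

lemma td_mult:
 fixes f g :: "plane => 'a::real_normed_algebra"
 shows "times_differentiable n f ==> times_differentiable n g ==> times_differentiable n (%x. f x * g x)"
proof (induction n arbitrary: f g)
 case (Suc n)
 have d: "f differentiable at x" "g differentiable at x" for x using Suc.prems by simp_all
 have "partial k (%x. f x * g x) = (%x. f x * partial k g x + partial k f x * g x)" for k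
 proof
  fix x
  obtain F G where FG: "(f has_derivative F) (at x)" "(g has_derivative G) (at x)"
   using d unfolding differentiable_def by blast
  show "partial k (%x. f x * g x) x = f x * partial k g x + partial k f x * g x"
   using partial_eqI[OF has_derivative_mult[OF FG]] by (simp add: partial_eqI[OF FG(1)] partial_eqI[OF FG(2)])
 qed
 moreover have "times_differentiable n (%x. f x * partial k g x + partial k f x * g x)" for k
  using Suc.prems td_Suc_imp[OF Suc.prems(1)] td_Suc_imp[OF Suc.prems(2)] by (intro td_add Suc.IH) auto
 moreover have "(%x. f x * g x) differentiable at x" for x using d by (rule differentiable_mult)
 ultimately show ?case by simp
qed simp

lemma td_cmult:
 fixes f :: "plane => 'a::real_normed_algebra"
 shows "times_differentiable n f ==> times_differentiable n (%x. c * f x)"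
 by (rule td_mult[OF td_const])

lemma td_of_real:
 "times_differentiable n f ==> times_differentiable n (%x. complex_of_real (f x))"
proof (induction n arbitrary: f)
 case (Suc n)
 have d: "f differentiable at x" for x using Suc.prems by simp
 have p: "partial k (%x. complex_of_real (f x)) = (%x. of_real (partial k f x))"
  and d': "(%x. complex_of_real (f x)) differentiable at x" for k x
 proof -
  { fix x
   obtain F where F: "(f has_derivative F) (at x)"
    using d unfolding differentiable_def by blast
   have 1: "((%x. complex_of_real (f x)) has_derivative (%h. of_real (F h))) (at x)"
    by (rule has_derivative_of_real[OF F])
   have "partial k (%x. complex_of_real (f x)) x = of_real (partial k f x)" "(%x. complex_of_real (f x)) differentiable at x"
    using partial_eqI[OF 1] partial_eqI[OF F] 1 unfolding differentiable_def by auto }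
  then show "partial k (%x. complex_of_real (f x)) = (%x. of_real (partial k f x))"
   "(%x. complex_of_real (f x)) differentiable at x" by auto
 qed
 show ?case using Suc p d' by simp
qed simp

lemma td_affine_comp:
 fixes h :: "nat => real => real"
 assumes h: "!!m t. (h m has_real_derivative h (Suc m) t) (at t)"
 shows "times_differentiable n (%x::plane. h m (a + (b \<bullet> x)))"
proof (induction n arbitrary: m)
 case (Suc n)
 have D: "((%x::plane. h m (a + (b \<bullet> x))) has_derivative (%v. (b \<bullet> v) * h (Suc m) (a + (b \<bullet> x)))) (at x)" for x
 proof -
  have "((%x::plane. a + (b \<bullet> x)) has_derivative (%v. b \<bullet> v)) (at x)"
   by (auto intro!: derivative_eq_intros)
  from has_derivative_compose[OF this, of "h m" "%s. s * h (Suc m) (a + (b \<bullet> x))"] show ?thesis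
   using h[of m "a + (b \<bullet> x)"] by (simp add: has_field_derivative_def mult_commute_abs)
 qed
 then have "partial k (%x::plane. h m (a + (b \<bullet> x))) = (%x. (b $ k) * h (Suc m) (a + (b \<bullet> x)))" for k
  by (auto simp: partial_eqI[OF D] inner_axis)
 moreover have "(%x::plane. h m (a + (b \<bullet> x))) differentiable at x" for x
  using D unfolding differentiable_def by blast
 ultimately show ?case using td_cmult[OF Suc.IH] by simp
qed simp

definition smooth :: "(plane => 'a::real_normed_vector) => bool" where
 "smooth f \<longleftrightarrow> (\<forall>n. times_differentiable n f)"

lemma smooth_differentiable: "smooth f ==> f differentiable (at x)"
 unfolding smooth_def by (metis times_differentiable.simps(2))

lemma smooth_partial: "smooth f ==> smooth (partial k f)"
 unfolding smooth_def by (metis times_differentiable.simps(2))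

lemma smooth_continuous: "smooth f ==> continuous_on S f"
 by (intro continuous_at_imp_continuous_on ballI differentiable_imp_continuous_within smooth_differentiable)

lemma smooth_coordinate: "smooth (%x::plane. x $ k)"
 unfolding smooth_def
proof
 fix n
 define h where "h = (%(m::nat) (t::real). if m = 0 then t else if m = 1 then 1 else 0)"
 have "(h m has_real_derivative h (Suc m) t) (at t)" for m t
  by (cases m) (auto simp: h_def[abs_def] intro!: derivative_eq_intros)
 from td_affine_comp[of h n 0 0 "axis k 1", OF this] show "times_differentiable n (%x::plane. x $ k)"
  by (simp add: h_def inner_axis')
qed

text \<open>A smooth function that is positive exactly on the open square of side 2.\<close>
definition bump :: "plane => real" where
 "bump x = expq 1 (1 + x $ 1) * expq 1 (1 - x $ 1) * (expq 1 (1 + x $ 2) * expq 1 (1 - x $ 2))"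

lemma expq1: "expq 1 t >= 0" "expq 1 t <= 1" "expq 1 t > 0 \<longleftrightarrow> t > 0" "expq 1 t = 0 \<longleftrightarrow> t <= 0"
 by (auto simp: expq_def)

lemma smooth_expq_affine: "smooth (%x::plane. expq p (a + (b \<bullet> x)))"
 unfolding smooth_def
 using td_affine_comp[of "%m. expq ((expq_step ^^ m) p)" _ 0 a b] expq_deriv by simp

lemma smooth_bump_scaled: "smooth (%x. bump (s *R x + c))"
proof -
 have e: "bump (s *R x + c) = expq 1 ((1 + c $ 1) + (axis 1 s \<bullet> x)) * expq 1 ((1 - c $ 1) + (axis 1 (- s) \<bullet> x)) *
   (expq 1 ((1 + c $ 2) + (axis 2 s \<bullet> x)) * expq 1 ((1 - c $ 2) + (axis 2 (- s) \<bullet> x)))" for x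
  by (simp add: bump_def inner_axis' algebra_simps)
 show ?thesis
  unfolding e smooth_def using smooth_expq_affine unfolding smooth_def by (intro allI td_mult) auto
qed

lemma bump_nonneg: "bump x >= 0" by (simp add: bump_def expq1)

lemma bump_le_1: "bump x <= 1"
 unfolding bump_def by (intro mult_le_one expq1 mult_nonneg_nonneg)

lemma bump_pos: "bump x > 0 \<longleftrightarrow> \<bar>x $ 1\<bar> < 1 \<and> \<bar>x $ 2\<bar> < 1"
proof -
 have "bump x > 0 \<longleftrightarrow> bump x ~= 0" using bump_nonneg[of x] by (simp add: less_le)
 then show ?thesis by (auto simp: bump_def expq1(4) abs_less_iff)
qed

lemma bump_0: "norm x >= 2 ==> bump x = 0"
proof -
 assume x: "norm x >= 2"
 have "\<not> (\<bar>x $ 1\<bar> < 1 \<and> \<bar>x $ 2\<bar> < 1)"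
 proof
  assume a: "\<bar>x $ 1\<bar> < 1 \<and> \<bar>x $ 2\<bar> < 1"
  then have "(norm x)^2 < 2" unfolding norm_sq_plane using abs_square_less_1[of "x $ 1"] abs_square_less_1[of "x $ 2"] by simp
  moreover have "2\<^sup>2 <= (norm x)^2" using x by (intro power_mono) auto
  ultimately show False by simp
 qed
 then show ?thesis using bump_pos[of x] bump_nonneg[of x] by force
qed

lemma bump_borel [measurable]: "bump \<in> Bor"
 using smooth_continuous[OF smooth_bump_scaled[of 1 0], of UNIV] by (intro borel_measurable_continuous_onI) simp

subsection \<open>Decay of kernels of smooth multipliers\<close>

lemma smooth_mderiv: "smooth F ==> smooth (mderiv \<nu> F)"
proof -
 assume F: "smooth F"
 have 2: "smooth ((partial 2 ^^ b) F)" for b by (induction b) (auto simp: F smooth_partial)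
 have "smooth ((partial 1 ^^ a) ((partial 2 ^^ b) F))" for a b by (induction a) (auto simp: 2 smooth_partial)
 then show ?thesis by (simp add: mderiv_def)
qed

lemma smooth_regular:
 fixes F :: "plane => complex"
 assumes F: "smooth F" and R: "!!xi. R < norm xi ==> F xi = 0"
 shows "regular n F"
 unfolding regular_def
proof (intro conjI allI impI)
 show "times_differentiable n F" using F by (simp add: smooth_def)
 show "\<exists>R. \<forall>xi. R < norm xi --> F xi = 0" using R by blast
 fix \<nu>
 have "compact (mderiv \<nu> F ` cball 0 R)"
  by (intro compact_continuous_image smooth_continuous smooth_mderiv F compact_cball)
 then have "bounded (insert 0 (mderiv \<nu> F ` cball 0 R))" by (simp add: compact_imp_bounded)
 moreover have "range (mderiv \<nu> F) \<subseteq> insert 0 (mderiv \<nu> F ` cball 0 R)"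
  using mderiv_support[of R F, OF R] by (cases \<nu>) (force simp: not_le[symmetric])
 ultimately show "bounded (range (mderiv \<nu> F))" by (rule bounded_subset)
qed

lemma ift_norm_le: "cmod (ift G x) <= (LINT xi|lborel. cmod (G xi))"
 unfolding ift_eq_ft by (rule ft_bound)

lemma ift_decay:
 fixes F :: "plane => complex"
 assumes F: "smooth F" and R: "!!xi. R < norm xi ==> F xi = 0"
 shows "\<exists>C\<ge>0. \<forall>x. cmod (ift F x) <= C / (1 + (norm x)^2) ^ 3"
proof -
 have Fb: "F \<in> Bor"
  by (intro borel_measurable_continuous_onI smooth_continuous F)
 have reg: "regular n F" for n by (rule smooth_regular[OF F R])
 define M where "M = (%a b. LINT xi|lborel. cmod (mderiv (a, b) F xi))"
 have M: "(2 * pi) ^ (a + b) * (\<bar>x $ 1\<bar> ^ a * \<bar>x $ 2\<bar> ^ b * cmod (ift F x)) <= M a b" for a b x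
  using ift_norm_le[of "mderiv (a, b) F" x] unfolding M_def ift_mderiv[OF reg Fb order_refl]
  by (simp add: norm_mult norm_power mult_ac)
 have pw: "\<bar>x $ 1\<bar> ^ a * \<bar>x $ 2\<bar> ^ b * cmod (ift F x) <= M a b" for a b x
 proof -
  have "1 <= (2 * pi) ^ (a + b)" using pi_gt3 by (intro one_le_power) simp
  then have "1 * (\<bar>x $ 1\<bar> ^ a * \<bar>x $ 2\<bar> ^ b * cmod (ift F x)) <= (2 * pi) ^ (a + b) * (\<bar>x $ 1\<bar> ^ a * \<bar>x $ 2\<bar> ^ b * cmod (ift F x))"
   by (intro mult_right_mono) auto
  with M[of a b x] show ?thesis by simp
 qed
 define C where "C = 27 * (M 0 0 + M 6 0 + M 0 6)"
 have M0: "M a b >= 0" for a b by (simp add: M_def)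
 have "cmod (ift F x) <= C / (1 + (norm x)^2) ^ 3" for x
 proof -
  define m where "m = max 1 (max ((x $ 1)^2) ((x $ 2)^2))"
  have "1 + (norm x)^2 <= 3 * m" by (simp add: m_def norm_sq_plane)
  then have "(1 + (norm x)^2) ^ 3 <= (3 * m) ^ 3" by (intro power_mono) auto
  also have "... = 27 * m ^ 3" by (simp add: power_mult_distrib)
  also have "m ^ 3 <= 1 + \<bar>x $ 1\<bar> ^ 6 + \<bar>x $ 2\<bar> ^ 6"
  proof -
   have "m = 1 \<or> m = (x $ 1)^2 \<or> m = (x $ 2)^2" by (auto simp: m_def max_def)
   then show ?thesis by (auto simp: power_mult[symmetric])
  qed
  finally have "(1 + (norm x)^2) ^ 3 * cmod (ift F x) <= 27 * (1 + \<bar>x $ 1\<bar> ^ 6 + \<bar>x $ 2\<bar> ^ 6) * cmod (ift F x)"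
   by (intro mult_right_mono) auto
  also have "... <= C" using pw[of x 0 0] pw[of x 6 0] pw[of x 0 6] by (simp add: C_def algebra_simps)
  finally show ?thesis by (simp add: pos_le_divide_eq add_pos_nonneg mult.commute)
 qed
 moreover have "C >= 0" using M0 by (simp add: C_def)
 ultimately show ?thesis by blast
qed


section \<open>High frequencies do not leak down\<close>

lemma ift_scale:
 assumes "\<mu> > 0" and [measurable]: "F \<in> Bor"
 shows "ift (%xi. F (xi /\<^sub>R \<mu>)) x = of_real (\<mu>\<^sup>2) * ift F (\<mu> *R x)"
proof -
 have "ift (%xi. F (xi /\<^sub>R \<mu>)) x = \<mu>\<^sup>2 *R (LINT xi|lborel. cis (2 * pi * (x \<bullet> (0 + \<mu> *R xi))) * F ((0 + \<mu> *R xi) /\<^sub>R \<mu>))"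
  unfolding ift_def using assms(1) by (intro lborel_subst(2)) auto
 also have "... = \<mu>\<^sup>2 *R ift F (\<mu> *R x)"
  using assms(1) by (simp add: ift_def)
 finally show ?thesis by (simp add: scaleR_conv_of_real)
qed

definition lowpass :: "real => plane => complex" where
 "lowpass \<mu> xi = of_real (bump (xi /\<^sub>R (16 * \<mu>)))"

lemma lowpass_borel [measurable]: "lowpass \<mu> \<in> Bor"
 unfolding lowpass_def by measurable

lemma lowpass_0: "\<mu> > 0 ==> 32 * \<mu> <= norm xi ==> lowpass \<mu> xi = 0"
 unfolding lowpass_def by (subst bump_0) (auto simp: field_simps)

lemma lowpass_le_1: "cmod (lowpass \<mu> xi) <= 1"
 using bump_le_1 bump_nonneg by (simp add: lowpass_def)

lemma lowpass_BLc: "\<mu> > 0 ==> lowpass \<mu> \<in> BLc"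
proof -
 assume l: "\<mu> > 0"
 have "lowpass \<mu> \<in> BL2"
 proof (rule BL2_bound[OF BL2_indicator[of "cball 0 (32 * \<mu>)"], of _ 1])
  show "AE x in lborel. cmod (lowpass \<mu> x) <= 1 * cmod (indicator (cball 0 (32 * \<mu>)) x)"
   using lowpass_le_1 lowpass_0[OF l] by (intro AE_I2) (auto simp: indicator_def not_le less_imp_le)
 qed auto
 then show ?thesis using lowpass_0[OF l] by (auto simp: BLc_def intro!: exI[of _ "32 * \<mu>"] less_imp_le)
qed

lemma lowpass_lower: "\<exists>c>0. \<forall>\<mu>>0. \<forall>xi. norm xi <= 8 * \<mu> --> c <= cmod (lowpass \<mu> xi)"
proof -
 have cont: "continuous_on (cball 0 (1/2)) bump" using smooth_continuous[OF smooth_bump_scaled[of 1 0]] by simp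
 obtain x0 where x0: "x0 \<in> cball 0 (1/2)" "!!x. x \<in> cball 0 (1/2) ==> bump x0 <= bump x"
  using continuous_attains_inf[OF compact_cball _ cont] by auto
 have "\<bar>x0 $ k\<bar> < 1" for k using x0(1) component_le_norm_cart[of x0 k] by simp
 then have "bump x0 > 0" by (simp add: bump_pos)
 moreover have "bump x0 <= cmod (lowpass \<mu> xi)" if "\<mu> > 0" "norm xi <= 8 * \<mu>" for \<mu> xi
 proof -
  have "xi /\<^sub>R (16 * \<mu>) \<in> cball 0 (1/2)" using that by (simp add: field_simps)
  from x0(2)[OF this] show ?thesis using bump_nonneg by (simp add: lowpass_def)
 qed
 ultimately show ?thesis by blast
qed

lemma lowpass_scale: "\<mu> > 0 ==> lowpass \<mu> xi = lowpass 1 (xi /\<^sub>R \<mu>)"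
 by (simp add: lowpass_def)

lemma smooth_lowpass1: "smooth (lowpass 1)"
 using smooth_bump_scaled[of "1/16" 0] td_of_real by (simp add: smooth_def lowpass_def[abs_def] inverse_eq_divide)

lemma smooth_grad: "smooth F ==> smooth (grad k F)"
 unfolding grad_def[abs_def] using smooth_coordinate[of k]
 by (auto simp: smooth_def intro!: td_mult td_const td_of_real)

lemma lowpass_kernel_bound:
 "\<exists>C\<ge>0. \<forall>\<mu>>0. \<forall>w. cmod (ift (lowpass \<mu>) w) <= \<mu>\<^sup>2 * (C / (1 + (norm (\<mu> *R w))^2) ^ 3) \<and>
   (\<forall>k. cmod (ift (grad k (lowpass \<mu>)) w) <= \<mu> ^ 3 * (C / (1 + (norm (\<mu> *R w))^2) ^ 3))"
proof -
 have z: "!!xi. 32 < norm xi ==> lowpass 1 xi = 0" using lowpass_0[of 1] by simp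
 then have zg: "!!k xi. 32 < norm xi ==> grad k (lowpass 1) xi = 0" by (simp add: grad_def)
 obtain C0 where C0: "C0 >= 0" "!!x. cmod (ift (lowpass 1) x) <= C0 / (1 + (norm x)^2) ^ 3"
  using ift_decay[OF smooth_lowpass1 z] by blast
 have "\<exists>C\<ge>0. \<forall>x. cmod (ift (grad k (lowpass 1)) x) <= C / (1 + (norm x)^2) ^ 3" for k
  by (rule ift_decay[OF smooth_grad[OF smooth_lowpass1] zg])
 then obtain C1 where C1: "!!k. C1 k >= 0" "!!k x. cmod (ift (grad k (lowpass 1)) x) <= C1 k / (1 + (norm x)^2) ^ 3"
  by metis
 define C where "C = C0 + C1 1 + C1 2"
 have C: "C >= 0" "C0 <= C" "C1 k <= C" for k
  using C0(1) C1(1)[of 1] C1(1)[of 2] exhaust_2[of k] by (auto simp: C_def)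
 have den: "(1 + (norm (x::plane))^2) ^ 3 > 0" for x by (intro zero_less_power add_pos_nonneg) auto
 have gl: "grad k (lowpass \<mu>) = (%xi. of_real \<mu> * grad k (lowpass 1) (xi /\<^sub>R \<mu>))" if "\<mu> > 0" for k \<mu>
  using that by (auto simp: grad_def lowpass_scale[OF that])
 have [measurable]: "grad k (lowpass 1) \<in> Bor" for k
  by (intro BLc_borel grad_BLc lowpass_BLc) simp
 have ig: "ift (grad k (lowpass \<mu>)) w = of_real (\<mu> ^ 3) * ift (grad k (lowpass 1)) (\<mu> *R w)" if "\<mu> > 0" for k \<mu> w
 proof -
  have "ift (grad k (lowpass \<mu>)) w = of_real \<mu> * ift (%xi. grad k (lowpass 1) (xi /\<^sub>R \<mu>)) w"
   unfolding gl[OF that] ift_eq_ft by (rule ft_cmult)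
  then show ?thesis by (simp add: ift_scale[OF that] power3_eq_cube power2_eq_square)
 qed
 have il: "ift (lowpass \<mu>) w = of_real (\<mu>\<^sup>2) * ift (lowpass 1) (\<mu> *R w)" if "\<mu> > 0" for \<mu> w
  using ift_scale[OF that lowpass_borel[of 1], of w] by (simp add: lowpass_scale[OF that, abs_def])
 show ?thesis
 proof (intro exI[of _ C] conjI C(1) allI impI)
  fix \<mu> :: real and w :: plane and k :: 2 assume l: "\<mu> > 0"
  have "cmod (ift (lowpass 1) (\<mu> *R w)) <= C / (1 + (norm (\<mu> *R w))^2) ^ 3"
   by (rule order_trans[OF C0(2) divide_right_mono[OF C(2)]]) (simp add: den less_imp_le del: norm_scaleR)
  then show "cmod (ift (lowpass \<mu>) w) <= \<mu>\<^sup>2 * (C / (1 + (norm (\<mu> *R w))^2) ^ 3)"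
   unfolding il[OF l] norm_mult by (simp add: mult_left_mono norm_power del: norm_scaleR times_divide_eq_right)
  have "cmod (ift (grad k (lowpass 1)) (\<mu> *R w)) <= C / (1 + (norm (\<mu> *R w))^2) ^ 3"
   by (rule order_trans[OF C1(2) divide_right_mono[OF C(3)]]) (simp add: den less_imp_le del: norm_scaleR)
  then show "cmod (ift (grad k (lowpass \<mu>)) w) <= \<mu> ^ 3 * (C / (1 + (norm (\<mu> *R w))^2) ^ 3)"
   unfolding ig[OF l] norm_mult using l by (simp add: mult_left_mono norm_power del: norm_scaleR times_divide_eq_right)
 qed
qed

subsection \<open>Change of variables\<close>

definition c2p :: "complex => plane" where "c2p z = (\<chi> i. if i = 1 then Re z else Im z)"
definition p2c :: "plane => complex" where "p2c v = Complex (v $ 1) (v $ 2)"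

lemma p2c_c2p: "p2c (c2p z) = z" by (simp add: p2c_def c2p_def)

lemma bounded_linear_c2p: "bounded_linear c2p"
 unfolding linear_conv_bounded_linear[symmetric]
 by (rule linearI) (auto simp: c2p_def vec_eq_iff)

lemma bounded_linear_p2c: "bounded_linear p2c"
 unfolding linear_conv_bounded_linear[symmetric]
 by (rule linearI) (auto simp: p2c_def complex_eq_iff)

lemma change_of_variables_complex:
 fixes g :: "plane => plane" and F :: "plane => complex"
 assumes der: "!!x. (g has_derivative g' x) (at x)" and bij: "bij g" and F: "integrable lborel F"
 shows "integrable lebesgue (%y. \<bar>det (matrix (g' y))\<bar> *R F (g y))"
  and "(LINT y|lebesgue. \<bar>det (matrix (g' y))\<bar> *R F (g y)) = (LINT z|lborel. F z)"
proof -
 have Fm: "F \<in> borel_measurable lborel" using F by auto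
 have Fl: "integrable lebesgue F" using F Fm by (simp add: integrable_completion)
 let ?J = "%y. \<bar>det (matrix (g' y))\<bar>"
 have "(%x. c2p (F x)) absolutely_integrable_on UNIV"
  using integrable_bounded_linear[OF bounded_linear_c2p Fl] by (simp add: set_integrable_def)
 then have "(%x. c2p (F x)) absolutely_integrable_on (g ` UNIV) \<and> integral (g ` UNIV) (%x. c2p (F x)) = integral UNIV (%x. c2p (F x))"
  using bij by (simp add: bij_is_surj)
 then have *: "(%x. ?J x *R c2p (F (g x))) absolutely_integrable_on UNIV \<and>
   integral UNIV (%x. ?J x *R c2p (F (g x))) = integral UNIV (%x. c2p (F x))"
  by (subst has_absolute_integral_change_of_variables[where g' = g'])
    (use der bij in \<open>auto simp: bij_is_inj\<close>)
 have J: "?J x *R c2p (F (g x)) = c2p (?J x *R F (g x))" for x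
  by (simp add: bounded_linear.linear[OF bounded_linear_c2p, THEN linear_scale])
 have i: "integrable lebesgue (%x. c2p (?J x *R F (g x)))"
  using * unfolding J by (simp add: set_integrable_def)
 from integrable_bounded_linear[OF bounded_linear_p2c i]
 show I: "integrable lebesgue (%y. ?J y *R F (g y))" by (simp add: p2c_c2p)
 have "c2p (LINT y|lebesgue. ?J y *R F (g y)) = (LINT y|lebesgue. c2p (?J y *R F (g y)))"
  by (rule integral_bounded_linear[OF bounded_linear_c2p I, symmetric])
 also have "... = integral UNIV (%x. c2p (?J x *R F (g x)))"
  using set_lebesgue_integral_eq_integral(2)[of UNIV "%x. c2p (?J x *R F (g x))"] i
  by (simp add: set_integrable_def set_lebesgue_integral_def)
 also have "... = integral UNIV (%x. c2p (F x))" using * unfolding J by simp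
 also have "... = (LINT z|lebesgue. c2p (F z))"
  using set_lebesgue_integral_eq_integral(2)[of UNIV "%x. c2p (F x)"] integrable_bounded_linear[OF bounded_linear_c2p Fl]
  by (simp add: set_integrable_def set_lebesgue_integral_def)
 also have "... = c2p (LINT z|lebesgue. F z)"
  by (rule integral_bounded_linear[OF bounded_linear_c2p Fl])
 finally have "p2c (c2p (LINT y|lebesgue. ?J y *R F (g y))) = p2c (c2p (LINT z|lebesgue. F z))" by simp
 then show "(LINT y|lebesgue. ?J y *R F (g y)) = (LINT z|lborel. F z)"
  using Fm by (simp add: p2c_c2p integral_completion)
qed

lemma det_id_minus:
 fixes A :: "plane => plane"
 assumes A: "linear A" and D: "!!v. norm (A v) <= D * norm v" "D <= 1"
 shows "\<bar>\<bar>det (matrix (%v. v - A v))\<bar> - 1\<bar> <= 4 * D"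
proof -
 define a where "a = (%i j. A (axis j 1) $ i)"
 have a: "\<bar>a i j\<bar> <= D" for i j
  using component_le_norm_cart[of "A (axis j 1)" i] D(1)[of "axis j 1"] by (simp add: a_def)
 have D0: "D >= 0" using a[of 1 1] by linarith
 have "det (matrix (%v. v - A v)) = (1 - a 1 1) * (1 - a 2 2) - (- a 1 2) * (- a 2 1)"
  unfolding det_2 by (simp add: matrix_def a_def axis_def)
 then have "det (matrix (%v. v - A v)) - 1 = - a 1 1 - a 2 2 + a 1 1 * a 2 2 - a 1 2 * a 2 1"
  by (simp add: algebra_simps)
 moreover have "\<bar>a i j * a k l\<bar> <= D * 1" for i j k l
  unfolding abs_mult using a[of i j] a[of k l] D(2) D0 by (intro mult_mono) auto
 note this[of 1 1 2 2] this[of 1 2 2 1]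
 ultimately have "\<bar>det (matrix (%v. v - A v)) - 1\<bar> <= 4 * D"
  using a[of 1 1] a[of 2 2] by linarith
 then show ?thesis by linarith
qed

locale regular_deformation =
 fixes \<tau> :: "plane => plane" and \<tau>' :: "plane => plane => plane" and D \<kappa> :: real
 assumes der: "!!x. (\<tau> has_derivative \<tau>' x) (at x)"
  and bound: "!!x v. norm (\<tau>' x v) <= D * norm v"
  and D: "0 <= D" "D <= \<kappa>" and \<kappa>: "\<kappa> < 1"
begin

lemma lipschitz_D: "D-lipschitz_on UNIV \<tau>"
proof (rule lipschitz_onI)
 fix x y
 have "norm (\<tau> x - \<tau> y) <= D * norm (x - y)"
  by (rule differentiable_bound[where S = UNIV and f' = \<tau>'])
    (use der D bound in \<open>auto intro: onorm_le has_derivative_at_withinI\<close>)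
 then show "dist (\<tau> x) (\<tau> y) <= D * dist x y" by (simp add: dist_norm)
qed (rule D)

lemma lipschitz_\<kappa>: "\<kappa>-lipschitz_on UNIV \<tau>"
 by (rule lipschitz_on_le[OF lipschitz_D D(2)])

lemma \<tau>_diff: "norm (\<tau> x - \<tau> y) <= D * norm (x - y)"
 using lipschitz_onD[OF lipschitz_D, of x y] by (simp add: dist_norm)

lemma bij_deformation: "bij (%x. x - \<tau> x)"
proof (rule bijI)
 show "inj (%x. x - \<tau> x)"
 proof (rule injI)
  fix x y assume "x - \<tau> x = y - \<tau> y"
  then have "(1 - \<kappa>) * norm (x - y) <= 0" using id_minus_expanding[OF lipschitz_\<kappa> \<kappa>, of x y] by simp
  then show "x = y" using \<kappa> by (simp add: mult_le_0_iff)
 qed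
 show "surj (%x. x - \<tau> x)"
  unfolding surj_def
 proof
  fix z
  have "\<exists>!x. z + \<tau> x = x"
  proof (rule banach_fix_type[where c = \<kappa>])
   show "\<forall>x y. dist (z + \<tau> x) (z + \<tau> y) <= \<kappa> * dist x y"
    using lipschitz_onD[OF lipschitz_\<kappa>] by simp
  qed (use D \<kappa> in auto)
  then obtain x where "z + \<tau> x = x" by blast
  then have "z = x - \<tau> x" by (metis add_diff_cancel_right')
  then show "\<exists>x. z = x - \<tau> x" by blast
 qed
qed

end


definition cauchy2 :: "plane => real" where
 "cauchy2 z = 1 / ((1 + (z $ 1)^2) * (1 + (z $ 2)^2))"

lemma cauchy2_borel [measurable]: "cauchy2 \<in> Bor"
 unfolding cauchy2_def by measurable

lemma cauchy2_pos: "cauchy2 z > 0"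
 unfolding cauchy2_def by (intro divide_pos_pos mult_pos_pos add_pos_nonneg) auto

lemma cauchy2_dominates: "1 / (1 + (norm z)^2)^2 <= cauchy2 z"
 unfolding cauchy2_def
proof (rule divide_left_mono)
 show "(1 + (z $ 1)^2) * (1 + (z $ 2)^2) <= (1 + (norm z)^2)^2"
  unfolding power2_eq_square[of "1 + (norm z)^2"] by (intro mult_mono) (auto simp: norm_sq_plane)
 show "0 < (1 + (norm z)^2)\<^sup>2 * ((1 + (z $ 1)^2) * (1 + (z $ 2)^2))"
  by (intro mult_pos_pos zero_less_power add_pos_nonneg) auto
qed simp

lemma nn_integral_scaled:
 fixes F :: "plane => ennreal"
 assumes "\<mu> > 0" and [measurable]: "F \<in> Bor"
 shows "(NN y. ennreal (\<mu>\<^sup>2) * F (\<mu> *R (x - y))) = (NN z. F z)"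
  "(NN y. ennreal (\<mu>\<^sup>2) * F (\<mu> *R (y - x))) = (NN z. F z)"
proof -
 have "(NN z. F z) = ennreal (\<mu>\<^sup>2) * (NN y. F ((\<mu> *R x) + (- \<mu>) *R y))"
  using lborel_subst(1)[of "- \<mu>" F "\<mu> *R x"] assms by simp
 then show "(NN y. ennreal (\<mu>\<^sup>2) * F (\<mu> *R (x - y))) = (NN z. F z)"
  by (simp add: nn_integral_cmult scaleR_diff_right)
 have "(NN z. F z) = ennreal (\<mu>\<^sup>2) * (NN y. F ((- (\<mu> *R x)) + \<mu> *R y))"
  using lborel_subst(1)[of \<mu> F "- (\<mu> *R x)"] assms by simp
 then show "(NN y. ennreal (\<mu>\<^sup>2) * F (\<mu> *R (y - x))) = (NN z. F z)"
  by (simp add: nn_integral_cmult scaleR_diff_right)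
qed

text \<open>Young's inequality for a dilated integrable majorant.\<close>
lemma young_scaled:
 assumes \<mu>: "\<mu> > 0" and [measurable]: "h \<in> Bor" and D: "D >= 0"
  and A: "!!x. ennreal (cmod (A x)) <= (NN y. ennreal (D * (\<mu>\<^sup>2 * cauchy2 (\<mu> *R (x - y))) * cmod (h y)))"
 shows "E2 A <= ennreal (D\<^sup>2) * (NN z. ennreal (cauchy2 z))^2 * E2 h"
proof -
 define M where "M = (NN z. ennreal (cauchy2 z))"
 define k where "k = (%v. \<mu>\<^sup>2 * cauchy2 (\<mu> *R v))"
 have k0: "k v >= 0" for v using cauchy2_pos[of "\<mu> *R v"] by (simp add: k_def)
 have [measurable]: "k \<in> Bor" unfolding k_def by measurable
 have kM: "(NN y. ennreal (k (x - y))) = M" "(NN x. ennreal (k (x - y))) = M" for x y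
  unfolding k_def M_def
  using nn_integral_scaled(1)[OF \<mu>, of "%z. ennreal (cauchy2 z)" x] nn_integral_scaled(2)[OF \<mu>, of "%z. ennreal (cauchy2 z)" y]
  by (simp_all add: ennreal_mult less_imp_le[OF cauchy2_pos])
 have "ennreal ((cmod (A x))^2) <= ennreal (D\<^sup>2) * (M * (NN y. ennreal (k (x - y)) * ennreal ((cmod (h y))^2)))" for x
 proof -
  have "(NN y. ennreal (D * (\<mu>\<^sup>2 * cauchy2 (\<mu> *R (x - y))) * cmod (h y)))
    = (NN y. ennreal D * (ennreal (sqrt (k (x - y))) * ennreal (sqrt (k (x - y)) * cmod (h y))))"
  proof (rule nn_integral_cong)
   fix y
   have "ennreal D * (ennreal (sqrt (k (x - y))) * ennreal (sqrt (k (x - y)) * cmod (h y)))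
    = ennreal (D * (sqrt (k (x - y)) * (sqrt (k (x - y)) * cmod (h y))))"
    using D k0 by (simp add: ennreal_mult)
   also have "sqrt (k (x - y)) * (sqrt (k (x - y)) * cmod (h y)) = k (x - y) * cmod (h y)"
    using k0 by (simp add: mult.assoc[symmetric])
   finally show "ennreal (D * (\<mu>\<^sup>2 * cauchy2 (\<mu> *R (x - y))) * cmod (h y))
    = ennreal D * (ennreal (sqrt (k (x - y))) * ennreal (sqrt (k (x - y)) * cmod (h y)))"
    by (simp only: k_def mult.assoc)
  qed
  also have "... = ennreal D * (NN y. ennreal (sqrt (k (x - y))) * ennreal (sqrt (k (x - y)) * cmod (h y)))"
   by (rule nn_integral_cmult) measurable
  finally have "ennreal (cmod (A x)) <= ennreal D * (NN y. ennreal (sqrt (k (x - y))) * ennreal (sqrt (k (x - y)) * cmod (h y)))"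
   using A[of x] by simp
  then have "(ennreal (cmod (A x)))^2 <= (ennreal D * (NN y. ennreal (sqrt (k (x - y))) * ennreal (sqrt (k (x - y)) * cmod (h y))))^2"
   by (rule power_mono) simp
  also have "... <= (ennreal D)^2 * ((NN y. (ennreal (sqrt (k (x - y))))\<^sup>2) * (NN y. (ennreal (sqrt (k (x - y)) * cmod (h y)))\<^sup>2))"
   unfolding power_mult_distrib by (intro mult_left_mono Cauchy_Schwarz_nn_integral) auto
  also have "(NN y. (ennreal (sqrt (k (x - y))))\<^sup>2) = M"
   using k0 kM(1)[of x] by (simp add: ennreal_power)
  also have "(NN y. (ennreal (sqrt (k (x - y)) * cmod (h y)))\<^sup>2) = (NN y. ennreal (k (x - y)) * ennreal ((cmod (h y))^2))"
   using k0 by (intro nn_integral_cong) (simp add: ennreal_power power_mult_distrib ennreal_mult)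
  finally show ?thesis using D by (simp add: ennreal_power)
 qed
 then have "E2 A <= (NN x. ennreal (D\<^sup>2) * (M * (NN y. ennreal (k (x - y)) * ennreal ((cmod (h y))^2))))"
  unfolding E2_def by (rule nn_integral_mono)
 also have "... = ennreal (D\<^sup>2) * (M * (NN x. \<integral>\<^sup>+y. ennreal (k (x - y)) * ennreal ((cmod (h y))^2) \<partial>lborel))"
  by (subst nn_integral_cmult, measurable) (subst nn_integral_cmult, auto)
 also have "(NN x. \<integral>\<^sup>+y. ennreal (k (x - y)) * ennreal ((cmod (h y))^2) \<partial>lborel)
   = (NN y. \<integral>\<^sup>+x. ennreal (k (x - y)) * ennreal ((cmod (h y))^2) \<partial>lborel)"
  by (rule lborel_pair.Fubini') measurable
 also have "... = (NN y. M * ennreal ((cmod (h y))^2))"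
  by (rule nn_integral_cong) (simp add: nn_integral_multc kM(2))
 also have "... = M * E2 h" unfolding E2_def by (rule nn_integral_cmult) measurable
 finally show ?thesis by (simp add: M_def power2_eq_square mult.assoc)
qed

text \<open>If the transform of \<open>f\<close> vanishes on the support of the low-pass filter, then filtering any
  translate of \<open>f\<close> gives zero. At the point \<open>x\<close> the deformed \<open>f\<close> is compared with its
  translate by \<open>\<tau> x\<close>; after a change of variables both are integrals against \<open>f (y - \<tau> y)\<close>,
  and the two kernels differ by a factor \<open>D\<close>.\<close>
definition high_bound :: "real => real => bool" where
 "high_bound \<kappa> C \<longleftrightarrow> (\<forall>\<tau> \<tau>' D \<mu> f G. regular_deformation \<tau> \<tau>' D \<kappa> --> \<mu> > 0 --> FT f G -->
  (\<forall>xi. norm xi < 32 * \<mu> --> G xi = 0) -->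
  E2 (cv (%x. f (x - \<tau> x)) (lowpass \<mu>)) <= ennreal (C * D\<^sup>2) * E2 f)"

lemma high_boundD:
 assumes "high_bound \<kappa> C" "regular_deformation \<tau> \<tau>' D \<kappa>" "\<mu> > 0" "FT f G" "!!xi. norm xi < 32 * \<mu> ==> G xi = 0"
 shows "E2 (cv (%x. f (x - \<tau> x)) (lowpass \<mu>)) <= ennreal (C * D\<^sup>2) * E2 f"
 by (rule assms(1)[unfolded high_bound_def, rule_format, OF assms(2-4)]) (simp add: assms(5))

text \<open>Changing variables moves the deformation from the function to the kernel, which changes by
  a dilated integrable kernel times \<open>D\<close>; the undeformed kernel annihilates the function. Young finishes.\<close>
lemma high_bound_exists:
 assumes \<kappa>: "\<kappa> < 1"
 shows "\<exists>C\<ge>0. high_bound \<kappa> C"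
proof -
 obtain C1 where C1: "C1 >= 0"
  and p0: "!!\<mu> w. \<mu> > 0 ==> cmod (ift (lowpass \<mu>) w) <= \<mu>\<^sup>2 * (C1 / (1 + (norm (\<mu> *R w))^2) ^ 3)"
  and p1: "!!\<mu> w k. \<mu> > 0 ==> cmod (ift (grad k (lowpass \<mu>)) w) <= \<mu> ^ 3 * (C1 / (1 + (norm (\<mu> *R w))^2) ^ 3)"
  using lowpass_kernel_bound by blast
 define q where "q = (1 - \<kappa>)^2"
 have q: "q > 0" using \<kappa> by (simp add: q_def)
 define M where "M = 6 * C1 / q ^ 3"
 have M: "M >= 0" using C1 q by (simp add: M_def)
 define N where "N = (NN z. ennreal (cauchy2 z))"
 have N: "N < \<infinity>" using nn_integral_cauchy_plane by (simp add: N_def cauchy2_def)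
 define C where "C = M\<^sup>2 * (enn2real N)^2 * (4 / (1 - \<kappa>)^2)"
 have "E2 (cv (%x. f (x - \<tau> x)) (lowpass \<mu>)) <= ennreal (C * D\<^sup>2) * E2 f"
  if rd: "regular_deformation \<tau> \<tau>' D \<kappa>" and \<mu>: "\<mu> > 0" and FT: "FT f G" and G0: "!!xi. norm xi < 32 * \<mu> ==> G xi = 0"
  for \<tau> \<tau>' D \<mu> f G
 proof -
  interpret regular_deformation \<tau> \<tau>' D \<kappa> by (rule rd)
  have q1: "q <= 1" using D \<kappa> by (simp add: q_def power_le_one)
  have f2: "f \<in> BL2" by (rule FT_BL2(1)[OF FT])
  have [measurable]: "f \<in> Bor" using f2 by auto
  have [measurable]: "\<tau> \<in> Bor" by (rule lipschitz_borel[OF lipschitz_\<kappa> \<kappa>])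
  define h where "h = (%y. f (y - \<tau> y))"
  have h2: "h \<in> BL2" unfolding h_def by (rule deform_BL2[OF lipschitz_\<kappa> \<kappa> f2])
  have [measurable]: "h \<in> Bor" using h2 by auto
  define p where "p = ift (lowpass \<mu>)"
  have lp12: "lowpass \<mu> \<in> BL12" by (intro BLc_BL12 lowpass_BLc \<mu>)
  have [measurable]: "p \<in> Bor" unfolding p_def by (intro ift_borel lowpass_borel)
  define g where "g = (%y. y - \<tau> y)"
  define g' where "g' = (%y v. v - \<tau>' y v)"
  define J where "J = (%y. \<bar>det (matrix (g' y))\<bar>)"
  have gder: "(g has_derivative g' y) (at y)" for y
   unfolding g_def g'_def by (intro has_derivative_diff has_derivative_ident der)
  have J1: "\<bar>J y - 1\<bar> <= 4 * D" for y
   unfolding J_def g'_def using bound D \<kappa>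
   by (intro det_id_minus has_derivative_linear[OF der]) auto
  have seg: "cmod (p v - p (v - e)) <= 2 * norm e * (\<mu> ^ 3 * (C1 / (q * (1 + (norm (\<mu> *R v))^2)) ^ 3))"
   and low: "cmod (p (v - e)) <= \<mu>\<^sup>2 * (C1 / (q * (1 + (norm (\<mu> *R v))^2)) ^ 3)"
   if e: "norm e <= \<kappa> * norm v" for v e
  proof -
   define S where "S = \<mu> ^ 3 * (C1 / (q * (1 + (norm (\<mu> *R v))^2)) ^ 3)"
   have S0: "S >= 0" using \<mu> C1 q by (simp add: S_def)
   have den: "q * (1 + (norm (\<mu> *R v))^2) <= 1 + (norm (\<mu> *R (v - t *R e)))^2" if t: "t \<in> {0..1}" for t
   proof -
    have "norm (t *R e) <= \<kappa> * norm v" using t e mult_left_le_one_le[of "norm e" t] by simp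
    then have "(1 - \<kappa>) * norm v <= norm (v - t *R e)"
    using norm_triangle_ineq2[of v "t *R e"] by (simp add: algebra_simps)
    then have "\<mu> * ((1 - \<kappa>) * norm v) <= norm (\<mu> *R (v - t *R e))"
    using \<mu> by (simp add: mult_left_mono)
    then have "(\<mu> * ((1 - \<kappa>) * norm v))^2 <= (norm (\<mu> *R (v - t *R e)))^2"
    using \<mu> \<kappa> by (intro power_mono) auto
    moreover have "(\<mu> * ((1 - \<kappa>) * norm v))^2 = q * (norm (\<mu> *R v))^2"
    using \<mu> by (simp add: q_def power_mult_distrib)
    ultimately show ?thesis using q1 by (simp only: distrib_left)
   qed
   have frac: "C1 / (1 + (norm (\<mu> *R (v - t *R e)))^2) ^ 3 <= C1 / (q * (1 + (norm (\<mu> *R v))^2)) ^ 3" if t: "t \<in> {0..1}" for t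
   proof (rule divide_left_mono)
    have pos: "0 < q * (1 + (norm (\<mu> *R v))^2)" by (intro mult_pos_pos q add_pos_nonneg) auto
    then show "(q * (1 + (norm (\<mu> *R v))^2)) ^ 3 <= (1 + (norm (\<mu> *R (v - t *R e)))^2) ^ 3"
    by (intro power_mono den t) simp
    show "0 < (1 + (norm (\<mu> *R (v - t *R e)))^2) ^ 3 * (q * (1 + (norm (\<mu> *R v))^2)) ^ 3"
    by (intro mult_pos_pos[OF zero_less_power zero_less_power[OF pos]] add_pos_nonneg) auto
   qed (rule C1)
   have gs: "gsq (lowpass \<mu>) (v + t *R (- e)) <= 2 * S\<^sup>2" if t: "t \<in> {0..1}" for t
   proof -
    have "cmod (ift (grad k (lowpass \<mu>)) (v - t *R e)) <= S" for k
    unfolding S_def using \<mu> by (intro order_trans[OF p1[OF \<mu>]] mult_left_mono frac t) auto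
    then have "(cmod (ift (grad k (lowpass \<mu>)) (v - t *R e)))^2 <= S\<^sup>2" for k
    by (intro power_mono) auto
    from this[of 1] this[of 2] show ?thesis by (simp add: gsq_def)
   qed
   have "ennreal ((cmod (p (v + - e) - p v))^2)
    <= ennreal ((norm (- e))^2) * (NN t. indicator {0..1} t * ennreal (gsq (lowpass \<mu>) (v + t *R (- e))))"
    unfolding p_def by (rule ift_segment_bound[OF lowpass_BLc[OF \<mu>]])
   also have "... <= ennreal ((norm (- e))^2) * (NN t. ennreal (2 * S\<^sup>2) * indicator {0..1::real} t)"
    using gs by (intro mult_left_mono nn_integral_mono) (auto split: split_indicator intro!: ennreal_leI)
   also have "(NN t. ennreal (2 * S\<^sup>2) * indicator {0..1::real} t) = ennreal (2 * S\<^sup>2)"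
    by (subst nn_integral_cmult_indicator) auto
   also have "ennreal ((norm (- e))^2) * ennreal (2 * S\<^sup>2) = ennreal ((norm e)^2 * (2 * S\<^sup>2))"
    by (subst ennreal_mult) auto
   also have "... <= ennreal ((2 * norm e * S)^2)"
    by (intro ennreal_leI) (simp add: power_mult_distrib)
   finally have "(cmod (p (v + - e) - p v))^2 <= (2 * norm e * S)^2"
    by (simp only: ennreal_le_iff[OF zero_le_power2])
   then have "cmod (p (v + - e) - p v) <= 2 * norm e * S"
    by (rule power2_le_imp_le) (simp add: S0)
   then show "cmod (p v - p (v - e)) <= 2 * norm e * (\<mu> ^ 3 * (C1 / (q * (1 + (norm (\<mu> *R v))^2)) ^ 3))"
    unfolding S_def[symmetric] norm_minus_commute[of "p v"] by (simp only: diff_conv_add_uminus[of v])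
   have "cmod (p (v - e)) <= \<mu>\<^sup>2 * (C1 / (1 + (norm (\<mu> *R (v - 1 *R e)))^2) ^ 3)"
    using p0[OF \<mu>, of "v - e"] by (simp add: p_def)
   also have "... <= \<mu>\<^sup>2 * (C1 / (q * (1 + (norm (\<mu> *R v))^2)) ^ 3)"
    by (intro mult_left_mono frac) auto
   finally show "cmod (p (v - e)) <= \<mu>\<^sup>2 * (C1 / (q * (1 + (norm (\<mu> *R v))^2)) ^ 3)" .
  qed
  have kern: "cmod (p (x - y) - J y *R p (x - \<tau> x - g y)) <= (D * M) * (\<mu>\<^sup>2 * cauchy2 (\<mu> *R (x - y)))" for x y
  proof -
   define v e where "v = x - y" and "e = \<tau> x - \<tau> y"
   have ev: "norm e <= D * norm v" by (simp add: v_def e_def \<tau>_diff)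
   also have "... <= \<kappa> * norm v" by (intro mult_right_mono D) auto
   finally have e\<kappa>: "norm e <= \<kappa> * norm v" .
   have ve: "x - \<tau> x - g y = v - e" by (simp add: v_def e_def g_def)
   define z where "z = norm (\<mu> *R v)"
   have z: "z = \<mu> * norm v" using \<mu> by (simp add: z_def)
   have z0: "1 + z\<^sup>2 > 0" by (intro add_pos_nonneg) auto
   define T where "T = C1 / (q * (1 + z\<^sup>2)) ^ 3"
   have T0: "T >= 0" unfolding T_def using C1 q z0 by simp
   have "cmod (p v - J y *R p (v - e)) = cmod ((p v - p (v - e)) + (1 - J y) *R p (v - e))"
    by (simp add: algebra_simps)
   also have "... <= cmod (p v - p (v - e)) + \<bar>1 - J y\<bar> * cmod (p (v - e))"
    by (rule order_trans[OF norm_triangle_ineq]) simp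
   also have "... <= 2 * norm e * (\<mu> ^ 3 * T) + (4 * D) * (\<mu>\<^sup>2 * T)"
    using seg[OF e\<kappa>] low[OF e\<kappa>] J1[of y] D unfolding T_def z_def
    by (intro add_mono mult_mono) (auto simp: abs_minus_commute)
   also have "... <= 2 * (D * norm v) * (\<mu> ^ 3 * T) + (4 * D) * (\<mu>\<^sup>2 * T)"
    using ev \<mu> T0 by (intro add_mono mult_right_mono mult_left_mono) auto
   also have "... = (D * \<mu>\<^sup>2 * T) * (2 * z + 4)"
    unfolding z by (simp add: power3_eq_cube power2_eq_square algebra_simps)
   also have "... <= (D * \<mu>\<^sup>2 * T) * (6 * (1 + z\<^sup>2))"
   proof (rule mult_left_mono)
    have "0 <= (z - 1)^2" by simp
    then have "2 * z <= 1 + z\<^sup>2" by (simp add: power2_eq_square algebra_simps)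
    moreover have "2 * z <= 1 + a ==> 0 <= a ==> 2 * z + 4 <= 6 * (1 + a)" for a :: real by simp
    ultimately show "2 * z + 4 <= 6 * (1 + z\<^sup>2)" using zero_le_power2 by blast
   qed (use D T0 in auto)
   also have "... = (D * M) * (\<mu>\<^sup>2 * (1 / (1 + z\<^sup>2)^2))"
   proof -
    have "(D * \<mu>\<^sup>2 * (C1 / (q * w) ^ 3)) * (6 * w) = (D * M) * (\<mu>\<^sup>2 * (1 / w\<^sup>2))" if "w > 0" for w
    using that q by (simp add: M_def power_mult_distrib field_simps power2_eq_square power3_eq_cube)
    from this[OF z0] show ?thesis by (simp only: T_def)
   qed
   also have "... <= (D * M) * (\<mu>\<^sup>2 * cauchy2 (\<mu> *R v))"
    unfolding z_def using D M by (intro mult_left_mono cauchy2_dominates) auto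
   finally show ?thesis unfolding ve v_def[symmetric] .
  qed
  have A: "ennreal (cmod (cv h (lowpass \<mu>) x))
    <= (NN y. ennreal ((D * M) * (\<mu>\<^sup>2 * cauchy2 (\<mu> *R (x - y))) * cmod (h y)))" for x
  proof -
   have i1: "integrable lborel (%y. h y * p (x - y))"
    unfolding p_def by (intro BL2_mult_integrable h2 reflect_BL2 ift_BL2 lp12)
   have e1: "cv h (lowpass \<mu>) x = (LINT y|lebesgue. h y * p (x - y))"
   proof -
    have "cv h (lowpass \<mu>) x = (LINT y|lborel. h y * p (x - y))"
    unfolding cv_def p_def[symmetric] by (subst lborel_reflect(2)[of _ x]) auto
    also have "... = (LINT y|lebesgue. h y * p (x - y))" by (rule integral_completion[symmetric]) measurable
    finally show ?thesis .
   qed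
   have i2: "integrable lborel (%z. f z * p (x - \<tau> x - z))"
    unfolding p_def by (intro BL2_mult_integrable f2 reflect_BL2 ift_BL2 lp12)
   have "cv f (lowpass \<mu>) (x - \<tau> x) = ift (%xi. lowpass \<mu> xi * G xi) (x - \<tau> x)"
    by (rule cv_eq[OF FT lp12])
   also have "(%xi. lowpass \<mu> xi * G xi) = (%xi. 0)"
   proof
    show "lowpass \<mu> xi * G xi = 0" for xi
    by (cases "norm xi < 32 * \<mu>") (simp_all add: G0 lowpass_0[OF \<mu>])
   qed
   finally have z: "(LINT z|lborel. f z * p (x - \<tau> x - z)) = 0"
    unfolding cv_def p_def[symmetric] by (subst (asm) lborel_reflect(2)[of _ "x - \<tau> x"]) (auto simp: ift_def)
   have i3: "integrable lebesgue (%y. J y *R (f (g y) * p (x - \<tau> x - g y)))"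
    and z3: "(LINT y|lebesgue. J y *R (f (g y) * p (x - \<tau> x - g y))) = 0"
    using change_of_variables_complex[OF gder _ i2] bij_deformation z by (auto simp: J_def g_def)
   have i1': "integrable lebesgue (%y. h y * p (x - y))"
    using i1 by (subst integrable_completion) auto
   have "cv h (lowpass \<mu>) x = (LINT y|lebesgue. h y * p (x - y) - J y *R (f (g y) * p (x - \<tau> x - g y)))"
    using i1' i3 by (simp add: e1 z3)
   also have "ennreal (cmod ...) <= (\<integral>\<^sup>+y. ennreal (cmod (h y * p (x - y) - J y *R (f (g y) * p (x - \<tau> x - g y)))) \<partial>lebesgue)"
    by (intro integral_norm_bound_ennreal Bochner_Integration.integrable_diff i1' i3)
   also have "... = (NN y. ennreal (cmod (h y * p (x - y) - J y *R (f (g y) * p (x - \<tau> x - g y)))))"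
    by (rule nn_integral_completion)
   also have "... <= (NN y. ennreal ((D * M) * (\<mu>\<^sup>2 * cauchy2 (\<mu> *R (x - y))) * cmod (h y)))"
   proof (intro nn_integral_mono ennreal_leI)
    fix y
    have "h y * p (x - y) - J y *R (f (g y) * p (x - \<tau> x - g y)) = (p (x - y) - J y *R p (x - \<tau> x - g y)) * h y"
    by (simp add: h_def g_def algebra_simps)
    then show "cmod (h y * p (x - y) - J y *R (f (g y) * p (x - \<tau> x - g y))) <= (D * M) * (\<mu>\<^sup>2 * cauchy2 (\<mu> *R (x - y))) * cmod (h y)"
    using mult_right_mono[OF kern[of x y], of "cmod (h y)"] by (simp only: norm_mult norm_ge_zero)
   qed
   finally show ?thesis .
  qed
  have "E2 (cv h (lowpass \<mu>)) <= ennreal ((D * M)^2) * N\<^sup>2 * E2 h"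
   unfolding N_def using D M A by (intro young_scaled[OF \<mu>]) auto
  also have "... <= ennreal ((D * M)^2) * N\<^sup>2 * (ennreal (4 / (1 - \<kappa>)^2) * E2 f)"
   unfolding h_def by (intro mult_left_mono E2_deform_le[OF lipschitz_\<kappa> \<kappa>]) auto
  also have "... = ennreal (C * D\<^sup>2) * E2 f"
  proof -
   have "N\<^sup>2 = ennreal ((enn2real N)^2)" using N by (simp add: ennreal_power[symmetric])
   then have "ennreal ((D * M)^2) * N\<^sup>2 * (ennreal (4 / (1 - \<kappa>)^2) * E2 f)
    = ennreal ((D * M)^2 * (enn2real N)^2 * (4 / (1 - \<kappa>)^2)) * E2 f"
    by (simp only: ennreal_mult zero_le_power2 mult_nonneg_nonneg divide_nonneg_nonneg zero_le_numeral mult.assoc)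
   also have "(D * M)^2 * (enn2real N)^2 * (4 / (1 - \<kappa>)^2) = C * D\<^sup>2"
    by (simp add: C_def power_mult_distrib)
   finally show ?thesis .
  qed
  finally show ?thesis by (simp only: h_def)
 qed
 then have "high_bound \<kappa> C" unfolding high_bound_def by (intro allI impI) simp
 moreover have "C >= 0" by (simp add: C_def)
 ultimately show ?thesis by (intro exI[of _ C] conjI)
qed

text \<open>A bank whose multipliers live where the low-pass filter is bounded below.\<close>
definition lowpass_dominates :: "'i itself => real => bool" where
 "lowpass_dominates _ C \<longleftrightarrow> (\<forall>J (m :: 'i => plane => complex) \<mu> v. finite J --> (\<forall>i\<in>J. m i \<in> BLc \<and> (\<exists>K. \<forall>xi. cmod (m i xi) <= K)) -->
   \<mu> > 0 --> (\<forall>i\<in>J. \<forall>xi. 8 * \<mu> < norm xi --> m i xi = 0) -->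
   (AE xi in lborel. (\<Sum>i\<in>J. (cmod (m i xi))\<^sup>2) <= 1) --> v \<in> BL2 -->
   (\<Sum>i\<in>J. E2 (cv v (m i))) <= ennreal C * E2 (cv v (lowpass \<mu>)))"

lemma lowpass_dominatesD:
 assumes "lowpass_dominates TYPE('i) C" "finite J" "!!i. i \<in> J ==> m i \<in> BLc" "!!i. i \<in> J ==> \<exists>K. \<forall>xi. cmod (m i xi) <= K"
  "\<mu> > 0" "!!i xi. i \<in> J ==> 8 * \<mu> < norm xi ==> m i xi = 0"
  "AE xi in lborel. (\<Sum>i\<in>J. (cmod (m i xi))\<^sup>2) <= 1" "v \<in> BL2"
 shows "(\<Sum>i\<in>(J :: 'i set). E2 (cv v (m i))) <= ennreal C * E2 (cv v (lowpass \<mu>))"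
 by (rule assms(1)[unfolded lowpass_dominates_def, rule_format, of J m \<mu> v]) (use assms(2-) in simp_all)

lemma lowpass_dominates_exists: "\<exists>C\<ge>0. lowpass_dominates TYPE('i) C"
proof -
 obtain c where c: "c > 0" "!!\<mu> xi. \<mu> > 0 ==> norm xi <= 8 * \<mu> ==> c <= cmod (lowpass \<mu> xi)"
  using lowpass_lower by blast
 have "(\<Sum>i\<in>J. E2 (cv v (m i))) <= ennreal (1 / c\<^sup>2) * E2 (cv v (lowpass \<mu>))"
  if J: "finite J" and m: "!!i. i \<in> J ==> m i \<in> BLc" "!!i. i \<in> J ==> \<exists>K. \<forall>xi. cmod (m i xi) <= K" and \<mu>: "\<mu> > 0"
   and s: "!!i xi. i \<in> J ==> 8 * \<mu> < norm xi ==> m i xi = 0"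
   and B: "AE xi in lborel. (\<Sum>i\<in>J. (cmod (m i xi))\<^sup>2) <= 1" and v: "v \<in> BL2"
  for J and m :: "'i => plane => complex" and \<mu> v
 proof -
  obtain g where g: "FT v g" using FT_exists[OF v] by blast
  have [measurable]: "g \<in> Bor" using FT_BL2(2)[OF g] by auto
  have e: "E2 (cv v M) = E2 (%xi. M xi * g xi)" if "M \<in> BLc" "!!xi. cmod (M xi) <= K" for M K
  proof -
   have "cv v M = ift (%xi. M xi * g xi)" using cv_eq[OF g BLc_BL12[OF that(1)]] by auto
   then show ?thesis
    using plancherel_ift[OF BLc_BL12[OF BLc_times_BL2[OF that FT_BL2(2)[OF g]]]] by simp
  qed
  have mm: "i \<in> J ==> m i \<in> Bor" for i by (intro BLc_borel m)
  have "(\<Sum>i\<in>J. E2 (cv v (m i))) = (\<Sum>i\<in>J. E2 (%xi. m i xi * g xi))"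
  proof (rule sum.cong[OF refl])
   fix i assume i: "i \<in> J"
   obtain K where "!!xi. cmod (m i xi) <= K" using m(2)[OF i] by blast
   then show "E2 (cv v (m i)) = E2 (%xi. m i xi * g xi)" by (rule e[OF m(1)[OF i]])
  qed
  also have "... = (NN xi. (\<Sum>i\<in>J. ennreal ((cmod (m i xi * g xi))^2)))"
   unfolding E2_def using mm by (intro nn_integral_sum[symmetric]) auto
  also have "... <= (NN xi. ennreal (1 / c\<^sup>2) * ennreal ((cmod (lowpass \<mu> xi * g xi))^2))"
  proof (rule nn_integral_mono_AE, use B in eventually_elim)
   case (elim xi)
   have le: "(\<Sum>i\<in>J. (cmod (m i xi))\<^sup>2) <= (1 / c\<^sup>2) * (cmod (lowpass \<mu> xi))^2"
   proof (cases "8 * \<mu> < norm xi")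
    case True
    then have "(\<Sum>i\<in>J. (cmod (m i xi))\<^sup>2) = 0" using s by simp
    then show ?thesis by simp
   next
    case False
    then have "c\<^sup>2 <= (cmod (lowpass \<mu> xi))^2" using c \<mu> by (intro power_mono) auto
    then have "1 <= (1 / c\<^sup>2) * (cmod (lowpass \<mu> xi))^2" using c(1) by (simp add: field_simps)
    with elim show ?thesis by simp
   qed
   have "(\<Sum>i\<in>J. ennreal ((cmod (m i xi * g xi))^2)) = ennreal ((\<Sum>i\<in>J. (cmod (m i xi))\<^sup>2) * (cmod (g xi))^2)"
    by (simp add: norm_mult power_mult_distrib sum_distrib_right)
   also have "... <= ennreal ((1 / c\<^sup>2) * (cmod (lowpass \<mu> xi))^2 * (cmod (g xi))^2)"
    by (intro ennreal_leI mult_right_mono le) simp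
   also have "... = ennreal (1 / c\<^sup>2) * ennreal ((cmod (lowpass \<mu> xi * g xi))^2)"
    by (subst ennreal_mult[symmetric]) (auto simp: norm_mult power_mult_distrib)
   finally show ?case .
  qed
  also have "... = ennreal (1 / c\<^sup>2) * E2 (%xi. lowpass \<mu> xi * g xi)"
   unfolding E2_def by (rule nn_integral_cmult) measurable
  also have "E2 (%xi. lowpass \<mu> xi * g xi) = E2 (cv v (lowpass \<mu>))"
   by (rule e[OF lowpass_BLc[OF \<mu>] lowpass_le_1, symmetric])
  finally show ?thesis .
 qed
 then have "lowpass_dominates TYPE('i) (1 / c\<^sup>2)"
  unfolding lowpass_dominates_def by (intro allI impI) simp
 then show ?thesis by (intro exI[of _ "1 / c\<^sup>2"]) simp
qed


section \<open>One layer of the scattering network\<close>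

text \<open>The squared Sobolev norm of order \<open>t\<close>, computed from the transform.\<close>
definition Hn :: "real => (plane => complex) => ennreal" where
 "Hn t g = (NN xi. ennreal ((1 + (norm xi)^2) powr t * (cmod (g xi))^2))"


lemma Hn_mono:
 assumes "s <= t" shows "Hn s g <= Hn t g"
 unfolding Hn_def
proof (intro nn_integral_mono ennreal_leI mult_right_mono)
 fix xi :: plane
 show "(1 + (norm xi)^2) powr s <= (1 + (norm xi)^2) powr t"
  using assms by (intro powr_mono) auto
qed simp

lemma Hn_0: "Hn 0 g = E2 g"
proof -
 have "1 + (norm (xi::plane))^2 ~= 0" for xi :: plane by (smt (verit) zero_le_power2)
 then show ?thesis by (simp add: Hn_def E2_def)
qed

lemma E2_le_Hn: "0 <= t ==> E2 g <= Hn t g"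
 using Hn_mono[of 0 t g] by (simp add: Hn_0)

lemma D2_le_Hn1: "D2 g <= Hn 1 g"
 unfolding D2_def Hn_def
proof (intro nn_integral_mono ennreal_leI mult_right_mono)
 fix xi :: plane
 have "1 + (norm xi)^2 > 0" by (intro add_pos_nonneg) auto
 then show "(norm xi)^2 <= (1 + (norm xi)^2) powr 1" by simp
qed simp

lemma cv_E2_le:
 assumes v: "v \<in> BL2" and m: "m \<in> BLc" "!!xi. cmod (m xi) <= K"
 shows "E2 (cv v m) <= ennreal (K\<^sup>2) * E2 v"
proof -
 obtain g where g: "FT v g" using FT_exists[OF v] by blast
 have [measurable]: "g \<in> Bor" using FT_BL2(2)[OF g] by auto
 have "cv v m = ift (%xi. m xi * g xi)" using cv_eq[OF g BLc_BL12[OF m(1)]] by auto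
 then have "E2 (cv v m) = E2 (%xi. m xi * g xi)"
  using plancherel_ift[OF BLc_BL12[OF BLc_times_BL2[OF m FT_BL2(2)[OF g]]]] by simp
 also have "... <= E2 (%xi. of_real K * g xi)"
  using m(2) by (intro E2_mono AE_I2) (auto simp: norm_mult intro!: mult_right_mono order_trans[OF m(2) abs_ge_self])
 also have "... = ennreal (K\<^sup>2) * E2 v" by (simp add: E2_cmult FT_E2[OF g])
 finally show ?thesis .
qed

lemma cv_add: "f \<in> BL2 ==> g \<in> BL2 ==> m \<in> BL12 ==> cv (%x. f x + g x) m x = cv f m x + cv g m x"
 unfolding cv_def distrib_right by (intro Bochner_Integration.integral_add cv_integrable)

text \<open>Splitting a function at the frequency \<open>R\<close>.\<close>
definition lowp :: "real => (plane => complex) => plane => complex" where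
 "lowp R g xi = (if norm xi < R then g xi else 0)"

definition highp :: "real => (plane => complex) => plane => complex" where
 "highp R g xi = (if norm xi < R then 0 else g xi)"

lemma lowp_BLc: assumes g: "g \<in> BL2" shows "lowp R g \<in> BLc"
proof -
 have [measurable]: "g \<in> Bor" using g by auto
 have "lowp R g \<in> Bor" unfolding lowp_def[abs_def] by measurable
 then have "lowp R g \<in> BL2"
  by (rule BL2_bound[OF g, of _ 1]) (auto simp: lowp_def)
 then show ?thesis by (auto simp: BLc_def lowp_def intro!: exI[of _ R])
qed

lemma split_frequency:
 assumes "FT f g"
 shows "FT (ift (lowp R g)) (lowp R g)" "FT (%x. f x - ift (lowp R g) x) (highp R g)"
proof -
 show 1: "FT (ift (lowp R g)) (lowp R g)"
  by (intro FT_ift BLc_BL12 lowp_BLc FT_BL2(2)[OF assms])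
 have "highp R g = (%xi. g xi - lowp R g xi)" by (auto simp: highp_def lowp_def)
 then show "FT (%x. f x - ift (lowp R g) x) (highp R g)"
  using FT_diff[OF assms 1] by simp
qed

lemma cv_high_0:
 assumes F: "FT f (highp R g)" and m: "m \<in> BLc" "!!xi. R <= norm xi ==> m xi = 0"
 shows "cv f m x = 0"
proof -
 have "cv f m x = ift (%xi. m xi * highp R g xi) x" by (rule cv_eq[OF F BLc_BL12[OF m(1)]])
 also have "(%xi. m xi * highp R g xi) = (%xi. 0)" using m(2) by (auto simp: highp_def)
 finally show ?thesis by (simp add: ift_def)
qed

text \<open>A deformation moves a function of one derivative by at most its size.\<close>
lemma E2_deform_minus_id_le:
 assumes lip: "\<kappa>-lipschitz_on UNIV \<tau>" and \<kappa>: "0 <= \<kappa>" "\<kappa> < 1" and T: "!!x. norm (\<tau> x) <= T" and FT: "FT f g"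
 shows "E2 (%x. f (x - \<tau> x) - f x) <= ennreal (T\<^sup>2 * Cdef \<kappa>) * D2 g"
proof -
 have f2: "f \<in> BL2" and g2: "g \<in> BL2" using FT_BL2[OF FT] by auto
 have [measurable]: "\<tau> \<in> Bor" by (rule lipschitz_borel[OF lip \<kappa>(2)])
 define G where "G = (%n. trunc n g)"
 have G12: "G n \<in> BL12" for n unfolding G_def by (rule trunc_BL12[OF g2])
 have Gc: "G n \<in> BLc" for n
 proof -
  have "\<forall>xi. real n < norm xi --> G n xi = 0" by (auto simp: G_def trunc_def)
  then show ?thesis using BL12D(1)[OF G12[of n]] by (auto simp: BLc_def)
 qed
 have FTn: "FT (ift (G n)) (G n)" for n by (rule FT_ift[OF G12])
 have i2: "ift (G n) \<in> BL2" for n by (rule ift_BL2[OF G12])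
 have [measurable]: "f \<in> Bor" "ift (G n) \<in> Bor" for n using f2 i2 by auto
 note dB = deform_BL2[OF lip \<kappa>(2)]
 have d0: "(%n. E2 (%x. ift (G n) x - f x)) ----> 0"
  using trunc_limit[OF g2] FT_E2[OF FT_diff[OF FTn FT]] by (simp add: G_def)
 have "(%n. E2 (%x. (ift (G n) (x - \<tau> x) - ift (G n) x) - (f (x - \<tau> x) - f x))) ----> 0"
 proof (rule tendsto_ennreal_0_le)
  have "(%n. ennreal (2 * (4 / (1 - \<kappa>)^2) + 2) * E2 (%x. ift (G n) x - f x)) ----> ennreal (2 * (4 / (1 - \<kappa>)^2) + 2) * 0"
   by (intro ennreal_tendsto_cmult d0) simp
  then show "(%n. ennreal (2 * (4 / (1 - \<kappa>)^2) + 2) * E2 (%x. ift (G n) x - f x)) ----> 0" by simp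
  fix n
  have "E2 (%x. (ift (G n) (x - \<tau> x) - ift (G n) x) - (f (x - \<tau> x) - f x))
    = E2 (%x. (ift (G n) (x - \<tau> x) - f (x - \<tau> x)) - (ift (G n) x - f x))"
   by (intro arg_cong[where f = E2] ext) simp
  also have "... <= 2 * E2 (%x. ift (G n) (x - \<tau> x) - f (x - \<tau> x)) + 2 * E2 (%x. ift (G n) x - f x)"
   by (rule E2_diff) measurable
  also have "... <= 2 * (ennreal (4 / (1 - \<kappa>)^2) * E2 (%x. ift (G n) x - f x)) + 2 * E2 (%x. ift (G n) x - f x)"
   using E2_deform_le[OF lip \<kappa>(2), of "%x. ift (G n) x - f x"] by (intro add_right_mono mult_left_mono) auto
  also have "... = ennreal (2 * (4 / (1 - \<kappa>)^2) + 2) * E2 (%x. ift (G n) x - f x)"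
   by (subst ennreal_plus, simp, simp, subst ennreal_mult, simp, simp) (simp only: distrib_right ennreal_numeral mult.assoc)
  finally show "E2 (%x. (ift (G n) (x - \<tau> x) - ift (G n) x) - (f (x - \<tau> x) - f x))
   <= ennreal (2 * (4 / (1 - \<kappa>)^2) + 2) * E2 (%x. ift (G n) x - f x)" .
 qed
 then have lim: "(%n. E2 (%x. ift (G n) (x - \<tau> x) - ift (G n) x)) ----> E2 (%x. f (x - \<tau> x) - f x)"
  by (intro E2_tendsto BL2_diff dB f2 i2) simp
 have "E2 (%x. ift (G n) (x - \<tau> x) - ift (G n) x) <= ennreal (T\<^sup>2 * Cdef \<kappa>) * D2 g" for n
 proof -
  have "E2 (%y. ift (G n) (y - \<tau> y) - ift (G n) (y - (%y. 0) y)) <= ennreal (T\<^sup>2 * (4 / (1 - \<kappa>)^2 * (2 * pi)^2)) * D2 (G n)"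
   by (rule E2_deform_diff[OF Gc \<kappa>(2) lip]) (use \<kappa> T in \<open>auto simp: lipschitz_on_def\<close>)
  also have "... <= ennreal (T\<^sup>2 * (4 / (1 - \<kappa>)^2 * (2 * pi)^2)) * D2 g"
   unfolding D2_def G_def trunc_def
   by (intro mult_left_mono nn_integral_mono ennreal_leI) (auto split: split_indicator)
  finally show ?thesis by (simp add: Cdef_def)
 qed
 then show ?thesis by (intro LIMSEQ_le_const2[OF lim]) auto
qed

text \<open>The modulus moves a wave packet to low frequencies: its difference quotients do not
  exceed those of the packet demodulated to the origin, whose frequencies are bounded by the
  radius of the packet.\<close>
lemma modulus_demodulation:
 assumes V: "V \<in> BLc" and supp: "!!xi. V xi ~= 0 ==> norm (xi - c) <= \<rho>" and \<rho>: "0 <= \<rho>"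
  and FT: "FT (%x. of_real (cmod (ift V x))) w"
 shows "D2 w <= ennreal (8 * \<rho>\<^sup>2) * E2 V"
proof -
 have [measurable]: "V \<in> Bor" using BLc_borel[OF V] .
 have [measurable]: "w \<in> Bor" using FT_BL2(2)[OF FT] by auto
 define u where "u = (%x. complex_of_real (cmod (ift V x)))"
 define G where "G = (%xi. V (xi + c))"
 have V2: "V \<in> BL2" using V by (simp add: BLc_def)
 have G2: "G \<in> BL2" using shift_BL2[OF V2, of "- c"] by (simp add: G_def)
 have Gs: "norm xi <= \<rho>" if "G xi ~= 0" for xi using supp[of "xi + c"] that by (simp add: G_def)
 then have Gc: "G \<in> BLc" using G2 by (auto simp: BLc_def intro!: exI[of _ \<rho>] dest: leD)
 have DG: "D2 G <= ennreal (\<rho>\<^sup>2) * E2 V"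
 proof -
  have "D2 G <= (NN xi. ennreal (\<rho>\<^sup>2) * ennreal ((cmod (V (c + xi)))^2))"
   unfolding D2_def
  proof (rule nn_integral_mono)
   fix xi :: plane
   have "(norm xi)^2 * (cmod (G xi))^2 <= \<rho>\<^sup>2 * (cmod (V (c + xi)))^2"
    using Gs[of xi] by (cases "G xi = 0") (auto simp: G_def add.commute intro!: mult_right_mono power_mono)
   then show "ennreal ((norm xi)^2 * (cmod (G xi))^2) <= ennreal (\<rho>\<^sup>2) * ennreal ((cmod (V (c + xi)))^2)"
    by (subst ennreal_mult[symmetric]) (auto intro: ennreal_leI)
  qed
  also have "... = ennreal (\<rho>\<^sup>2) * E2 V"
   using lborel_shift(1)[of "%xi. ennreal ((cmod (V xi))^2)" c]
   by (subst nn_integral_cmult) (simp_all add: E2_def)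
  finally show ?thesis .
 qed
 have zG: "ift G x = cis (- 2 * pi * (x \<bullet> c)) * ift V x" for x
  unfolding G_def by (rule ift_shift) measurable
 have quot: "E2 (%xi. (cis (2 * pi * (xi \<bullet> a)) - 1) * w xi) <= ennreal ((norm a)^2 * (4 * (2 * pi)^2)) * D2 G" for a
 proof -
  have "FT (%x. u (x + a) - u x) (%xi. cis (2 * pi * (xi \<bullet> a)) * w xi - w xi)"
   unfolding u_def by (intro FT_diff FT_shift FT)
  from FT_E2[OF this] have "E2 (%xi. (cis (2 * pi * (xi \<bullet> a)) - 1) * w xi) = E2 (%x. u (x + a) - u x)"
   by (simp add: algebra_simps)
  also have "... <= E2 (%x. ift G (x - (%_. - a) x) - ift G (x - (%_. 0) x))"
  proof (intro E2_mono AE_I2)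
   fix x
   have "cmod (u (x + a) - u x) = \<bar>cmod (ift G (x + a)) - cmod (ift G x)\<bar>"
    by (simp add: u_def zG norm_mult flip: of_real_diff)
   also have "... <= cmod (ift G (x + a) - ift G x)" by (rule norm_triangle_ineq3)
   finally show "cmod (u (x + a) - u x) <= cmod (ift G (x - (%_. - a) x) - ift G (x - (%_. 0) x))" by simp
  qed
  also have "... <= ennreal ((norm a)^2 * (4 / (1 - 0)^2 * (2 * pi)^2)) * D2 G"
   by (rule E2_deform_diff[OF Gc]) (auto simp: lipschitz_on_def)
  finally show ?thesis by simp
 qed
 have comp: "(NN xi. ennreal ((xi $ k)^2 * (cmod (w xi))^2)) <= 4 * D2 G" for k
 proof -
  define e :: plane where "e = axis k 1"
  define q where "q = (%n xi. of_real (real (Suc n)) * ((cis (2 * pi * (xi \<bullet> (e /\<^sub>R real (Suc n)))) - 1) * w xi))"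
  have [measurable]: "q n \<in> Bor" for n unfolding q_def by measurable
  have "(%n. q n xi) ----> \<i> * of_real (2 * pi * (xi $ k)) * w xi" for xi
  proof -
   define s where "s = 2 * pi * (xi $ k)"
   have "((%z. exp (\<i> * of_real s * z)) has_field_derivative \<i> * of_real s) (at 0)"
    by (auto intro!: derivative_eq_intros)
   then have "((%h. (exp (\<i> * of_real s * h) - 1) / h) \<longlongrightarrow> \<i> * of_real s) (at 0)"
    by (simp add: DERIV_def)
   moreover have "filterlim (%n. complex_of_real (inverse (real (Suc n)))) (at 0) sequentially"
   proof -
    have "(%n. complex_of_real (inverse (real (Suc n)))) ----> of_real 0"
    by (intro tendsto_of_real LIMSEQ_inverse_real_of_nat)
    then show ?thesis by (auto simp: filterlim_at simp del: of_nat_Suc)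
   qed
   ultimately have "(%n. (exp (\<i> * of_real s * of_real (inverse (real (Suc n)))) - 1) / of_real (inverse (real (Suc n)))) ----> \<i> * of_real s"
    by (rule filterlim_compose)
   moreover have "(exp (\<i> * of_real s * of_real (inverse (real (Suc n)))) - 1) / of_real (inverse (real (Suc n)))
    = (cis (s * inverse (real (Suc n))) - cis 0) /\<^sub>R inverse (real (Suc n))" for n
    by (simp add: cis_conv_exp scaleR_conv_of_real field_simps)
   ultimately have "(%n. (cis (s * inverse (real (Suc n))) - cis 0) /\<^sub>R inverse (real (Suc n))) ----> \<i> * of_real s"
    by (simp only:)
   then have "(%n. ((cis (s * inverse (real (Suc n))) - cis 0) /\<^sub>R inverse (real (Suc n))) * w xi) ----> \<i> * of_real s * w xi"
    by (intro tendsto_intros)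
   moreover have "((cis (s * inverse (real (Suc n))) - cis 0) /\<^sub>R inverse (real (Suc n))) * w xi = q n xi" for n
   proof -
    have "xi \<bullet> (e /\<^sub>R real (Suc n)) = inverse (real (Suc n)) * xi $ k" by (simp add: e_def inner_axis)
    then show ?thesis unfolding q_def s_def by (simp add: scaleR_conv_of_real mult_ac del: of_nat_Suc)
   qed
   ultimately show ?thesis by (simp add: s_def)
  qed
  then have "E2 (%xi. \<i> * of_real (2 * pi * (xi $ k)) * w xi) <= liminf (%n. E2 (q n))"
   by (intro E2_fatou AE_I2) measurable
  also have "... <= ennreal (4 * (2 * pi)^2) * D2 G"
  proof (intro liminf_le_const always_eventually allI)
   fix n
   have "E2 (q n) = ennreal ((real (Suc n))^2) * E2 (%xi. (cis (2 * pi * (xi \<bullet> (e /\<^sub>R real (Suc n)))) - 1) * w xi)"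
    unfolding q_def by (subst E2_cmult) (auto simp del: of_nat_Suc)
   also have "... <= ennreal ((real (Suc n))^2) * (ennreal ((norm (e /\<^sub>R real (Suc n)))^2 * (4 * (2 * pi)^2)) * D2 G)"
    by (intro mult_left_mono quot) simp
   also have "... = ennreal ((real (Suc n))^2 * ((norm (e /\<^sub>R real (Suc n)))^2 * (4 * (2 * pi)^2))) * D2 G"
    by (simp add: ennreal_mult mult.assoc)
   also have "(real (Suc n))^2 * ((norm (e /\<^sub>R real (Suc n)))^2 * (4 * (2 * pi)^2)) = 4 * (2 * pi)^2"
    by (simp add: e_def norm_axis_1 power_inverse)
   finally show "E2 (q n) <= ennreal (4 * (2 * pi)^2) * D2 G" .
  qed
  finally have le: "E2 (%xi. \<i> * of_real (2 * pi * (xi $ k)) * w xi) <= ennreal (4 * (2 * pi)^2) * D2 G" .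
  have "E2 (%xi. \<i> * of_real (2 * pi * (xi $ k)) * w xi)
    = (NN xi. ennreal ((2 * pi)^2) * ennreal ((xi $ k)^2 * (cmod (w xi))^2))"
   unfolding E2_def
   by (intro nn_integral_cong) (simp add: norm_mult power_mult_distrib ennreal_mult[symmetric] abs_mult mult_ac)
  also have "... = ennreal ((2 * pi)^2) * (NN xi. ennreal ((xi $ k)^2 * (cmod (w xi))^2))"
   by (rule nn_integral_cmult) measurable
  finally have "ennreal ((2 * pi)^2) * (NN xi. ennreal ((xi $ k)^2 * (cmod (w xi))^2)) <= ennreal ((2 * pi)^2) * (4 * D2 G)"
   using le by (simp add: ennreal_mult mult_ac)
  then have "ennreal (1 / (2 * pi)^2) * (ennreal ((2 * pi)^2) * (NN xi. ennreal ((xi $ k)^2 * (cmod (w xi))^2))) <= ennreal (1 / (2 * pi)^2) * (ennreal ((2 * pi)^2) * (4 * D2 G))"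
   by (rule mult_left_mono) simp
  moreover have "ennreal (1 / (2 * pi)^2) * (ennreal ((2 * pi)^2) * X) = X" for X
   by (subst mult.assoc[symmetric], subst ennreal_mult[symmetric]) (auto simp: power2_eq_square)
  ultimately show ?thesis by (simp only:)
 qed
 have "D2 w = (NN xi. ennreal ((xi $ 1)^2 * (cmod (w xi))^2) + ennreal ((xi $ 2)^2 * (cmod (w xi))^2))"
  unfolding D2_def by (intro nn_integral_cong) (simp add: norm_sq_plane distrib_right ennreal_plus[symmetric] del: ennreal_plus)
 also have "... = (NN xi. ennreal ((xi $ 1)^2 * (cmod (w xi))^2)) + (NN xi. ennreal ((xi $ 2)^2 * (cmod (w xi))^2))"
  by (rule nn_integral_add) measurable
 also have "... <= 4 * D2 G + 4 * D2 G" by (intro add_mono comp)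
 also have "... = ennreal 8 * D2 G" by (simp flip: distrib_right)
 also have "... <= ennreal 8 * (ennreal (\<rho>\<^sup>2) * E2 V)" by (intro mult_left_mono DG) simp
 also have "... = ennreal (8 * \<rho>\<^sup>2) * E2 V" by (simp add: ennreal_mult mult.assoc)
 finally show ?thesis .
qed

text \<open>What the estimates use of a wave packet bank. Level \<open>j\<close> has frequencies of size \<open>2^j\<close>, in
  packets of radius \<open>2^(\<alpha> j)\<close> about \<open>ctr\<close>, with kernels of spatial extent \<open>2^(-\<beta> j)\<close>.\<close>
locale wave_bank =
 fixes \<alpha> \<beta> B :: real and Lv :: "nat => 'i set" and m :: "'i => plane => complex"
  and m\<chi> :: "plane => complex" and ctr :: "'i => plane"
 assumes ab: "0 <= \<beta>" "\<beta> <= \<alpha>" "\<alpha> < 1" and B: "0 <= B"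
  and disj: "i \<in> Lv j ==> i \<in> Lv j' ==> j = j'"
  and bb: "1 <= j ==> bank_bound 4 (Lv j) m (2 powr (- \<beta> * real j)) B"
  and ann: "1 <= j ==> i \<in> Lv j ==> m i xi ~= 0 ==> 2 ^ j / 4 <= norm xi \<and> norm xi <= 8 * 2 ^ j"
  and loc: "1 <= j ==> i \<in> Lv j ==> m i xi ~= 0 ==> norm (xi - ctr i) <= 4 * 2 powr (\<alpha> * real j)"
  and LP: "finite J ==> J \<subseteq> (\<Union>j\<in>{1..}. Lv j) ==> AE xi in lborel. (cmod (m\<chi> xi))\<^sup>2 + (\<Sum>i\<in>J. (cmod (m i xi))\<^sup>2) <= 1"
  and \<chi>c: "m\<chi> \<in> BLc" and \<chi>b: "\<exists>K. \<forall>xi. cmod (m\<chi> xi) <= K" and \<chi>s: "8 < norm xi ==> m\<chi> xi = 0"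
begin

definition Ix :: "'i set" where "Ix = (\<Union>j\<in>{1..}. Lv j)"

lemma Ix_level: assumes "i \<in> Ix" obtains j where "1 <= j" "i \<in> Lv j"
 using assms by (auto simp: Ix_def)

lemma finite_Lv: "1 <= j ==> finite (Lv j)"
 using bb by (auto simp: bank_bound_def)

lemma m_BLc: "i \<in> Ix ==> m i \<in> BLc" and m_bdd: "i \<in> Ix ==> \<exists>K. \<forall>xi. cmod (m i xi) <= K"
proof -
 assume "i \<in> Ix"
 then obtain j where "1 <= j" "i \<in> Lv j" by (rule Ix_level)
 then have "regular 4 (m i)" "m i \<in> Bor" using bb[of j] by (auto simp: bank_bound_def)
 from regular_mderiv_BLc[OF this, of 0 0] show "m i \<in> BLc" "\<exists>K. \<forall>xi. cmod (m i xi) <= K"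
  by (auto simp: mderiv_Suc)
qed

lemma m_BL12: "i \<in> Ix ==> m i \<in> BL12" by (intro BLc_BL12 m_BLc)

lemma \<chi>_BL12: "m\<chi> \<in> BL12" by (intro BLc_BL12 \<chi>c)

lemma AE_sum_le_1: "finite J ==> J \<subseteq> Ix ==> AE xi in lborel. (\<Sum>i\<in>J. (cmod (m i xi))\<^sup>2) <= 1"
 using LP[of J] unfolding Ix_def by (auto elim!: eventually_mono intro: order_trans[rotated])

lemma AE_\<chi>_le_1: "AE xi in lborel. (cmod (m\<chi> xi))\<^sup>2 <= 1"
 using LP[of "{}"] by simp

subsection \<open>The averaging filter\<close>

text \<open>The average only sees frequencies below 32. Low frequencies move by at most \<open>T\<close> times a
  bounded gradient. High ones can reach the average only through the leakage of order \<open>D\<close> caused by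
  the deformation. So no derivative of \<open>f\<close> is needed.\<close>
lemma chi_estimate:
 assumes k01: "0 <= \<kappa>" "\<kappa> < 1"
 shows "\<exists>C\<ge>0. \<forall>\<tau> \<tau>' D T f. regular_deformation \<tau> \<tau>' D \<kappa> --> (\<forall>x. norm (\<tau> x) <= T) --> f \<in> BL2 -->
  E2 (cv (%x. f (x - \<tau> x) - f x) m\<chi>) <= ennreal (C * (T\<^sup>2 + D\<^sup>2)) * E2 f"
proof -
 obtain C1 where C1: "C1 >= 0" and hi: "high_bound \<kappa> C1" using high_bound_exists[OF k01(2)] by blast
 obtain C2 where C2: "C2 >= 0" and lp: "lowpass_dominates TYPE(unit) C2" using lowpass_dominates_exists by blast
 define C where "C = C2 * (2 * (Cdef \<kappa> * 32\<^sup>2) + 2 * C1)"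
 have C: "C >= 0" using C1 C2 Cdef_nonneg by (simp add: C_def)
 have "E2 (cv (%x. f (x - \<tau> x) - f x) m\<chi>) <= ennreal (C * (T\<^sup>2 + D\<^sup>2)) * E2 f"
  if rd: "regular_deformation \<tau> \<tau>' D \<kappa>" and T: "!!x. norm (\<tau> x) <= T" and f: "f \<in> BL2" for \<tau> \<tau>' D T f
 proof -
  interpret regular_deformation \<tau> \<tau>' D \<kappa> by (rule rd)
  note dB = deform_BL2[OF lipschitz_\<kappa> k01(2)]
  obtain g where g: "FT f g" using FT_exists[OF f] by blast
  have [measurable]: "g \<in> Bor" using FT_BL2(2)[OF g] by auto
  define fl fh where "fl = ift (lowp 32 g)" and "fh = (%x. f x - fl x)"
  note spl = split_frequency[OF g, of 32]
  have FTl: "FT fl (lowp 32 g)" and FTh: "FT fh (highp 32 g)"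
   using spl by (simp_all add: fl_def fh_def)
  have l2: "fl \<in> BL2" and h2: "fh \<in> BL2" using FT_BL2(1) FTl FTh by auto
  define vl vh where "vl = (%x. fl (x - \<tau> x) - fl x)" and "vh = (%x. fh (x - \<tau> x) - fh x)"
  have vl2: "vl \<in> BL2" and vh2: "vh \<in> BL2" unfolding vl_def vh_def by (intro BL2_diff dB l2 h2)+
  have v: "(%x. f (x - \<tau> x) - f x) = (%x. vl x + vh x)" by (auto simp: vl_def vh_def fh_def)
  have lc: "lowpass 1 \<in> BLc" "lowpass 1 \<in> BL12" by (simp_all add: BLc_BL12 lowpass_BLc)
  have dom: "E2 (cv (%x. f (x - \<tau> x) - f x) m\<chi>) <= ennreal C2 * E2 (cv (%x. vl x + vh x) (lowpass 1))"
  proof -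
   have "(\<Sum>i\<in>{()}. E2 (cv (%x. vl x + vh x) m\<chi>)) <= ennreal C2 * E2 (cv (%x. vl x + vh x) (lowpass 1))"
    by (rule lowpass_dominatesD[OF lp]) (use \<chi>c \<chi>b \<chi>s AE_\<chi>_le_1 BL2_add[OF vl2 vh2] in auto)
   then show ?thesis by (simp add: v)
  qed
  have add_le: "E2 (cv (%x. vl x + vh x) (lowpass 1)) <= 2 * E2 (cv vl (lowpass 1)) + 2 * E2 (cv vh (lowpass 1))"
   using E2_add[OF cv_borel[OF vl2 lc(2)] cv_borel[OF vh2 lc(2)]] by (simp only: cv_add[OF vl2 vh2 lc(2), symmetric])
  have vl_le: "E2 (cv vl (lowpass 1)) <= ennreal (Cdef \<kappa> * 32\<^sup>2 * T\<^sup>2) * E2 f"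
  proof -
   have "E2 (cv vl (lowpass 1)) <= ennreal (1\<^sup>2) * E2 vl"
    by (rule cv_E2_le[OF vl2 lc(1) lowpass_le_1])
   also have "... = E2 vl" by simp
   also have "... <= ennreal (T\<^sup>2 * Cdef \<kappa>) * D2 (lowp 32 g)"
    unfolding vl_def by (rule E2_deform_minus_id_le[OF lipschitz_\<kappa> k01 T FTl])
   also have "... <= ennreal (T\<^sup>2 * Cdef \<kappa>) * (ennreal (32\<^sup>2) * E2 g)"
   proof (rule mult_left_mono)
    have "D2 (lowp 32 g) <= (NN xi. ennreal (32\<^sup>2) * ennreal ((cmod (g xi))^2))"
    unfolding D2_def
    proof (rule nn_integral_mono)
    fix xi :: plane
    have "(norm xi)^2 * (cmod (lowp 32 g xi))^2 <= 32\<^sup>2 * (cmod (g xi))^2"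
    proof (cases "norm xi < 32")
    case True
    then have "(norm xi)^2 <= 32\<^sup>2" by (intro power_mono) auto
    then show ?thesis using True by (simp add: lowp_def mult_right_mono)
    qed (simp add: lowp_def)
    then show "ennreal ((norm xi)^2 * (cmod (lowp 32 g xi))^2) <= ennreal (32\<^sup>2) * ennreal ((cmod (g xi))^2)"
    by (subst ennreal_mult[symmetric]) (auto intro: ennreal_leI)
    qed
    also have "... = ennreal (32\<^sup>2) * E2 g" unfolding E2_def by (rule nn_integral_cmult) measurable
    finally show "D2 (lowp 32 g) <= ennreal (32\<^sup>2) * E2 g" .
   qed simp
   also have "... = ennreal (T\<^sup>2 * Cdef \<kappa> * 32\<^sup>2) * E2 f"
    using Cdef_nonneg by (subst ennreal_mult[of "T\<^sup>2 * Cdef \<kappa>"]) (auto simp: FT_E2[OF g] mult.assoc)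
   finally show ?thesis by (simp add: mult_ac)
  qed
  have vh_le: "E2 (cv vh (lowpass 1)) <= ennreal (C1 * D\<^sup>2) * E2 f"
  proof -
   have h0: "cv fh (lowpass 1) x = 0" for x
    by (rule cv_high_0[OF FTh lc(1)]) (use lowpass_0[of 1] in simp)
   have "cv vh (lowpass 1) x = cv (%x. fh (x - \<tau> x)) (lowpass 1) x - cv fh (lowpass 1) x" for x
    unfolding vh_def by (intro cv_diff dB h2 lc)
   then have "cv vh (lowpass 1) = cv (%x. fh (x - \<tau> x)) (lowpass 1)" by (auto simp: h0)
   then have "E2 (cv vh (lowpass 1)) <= ennreal (C1 * D\<^sup>2) * E2 fh"
    using high_boundD[OF hi rd _ FTh] by (simp add: highp_def)
   also have "... <= ennreal (C1 * D\<^sup>2) * E2 f"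
    unfolding FT_E2[OF FTh, symmetric] FT_E2[OF g, symmetric]
    by (intro mult_left_mono E2_mono AE_I2) (auto simp: highp_def)
   finally show ?thesis .
  qed
  have "E2 (cv (%x. f (x - \<tau> x) - f x) m\<chi>) <= ennreal C2 * (2 * E2 (cv vl (lowpass 1)) + 2 * E2 (cv vh (lowpass 1)))"
   by (rule order_trans[OF dom mult_left_mono[OF add_le]]) simp
  also have "... <= ennreal C2 * (2 * (ennreal (Cdef \<kappa> * 32\<^sup>2 * T\<^sup>2) * E2 f) + 2 * (ennreal (C1 * D\<^sup>2) * E2 f))"
   by (intro mult_left_mono add_mono vl_le vh_le) auto
  also have "ennreal C2 * (2 * (ennreal (Cdef \<kappa> * 32\<^sup>2 * T\<^sup>2) * E2 f) + 2 * (ennreal (C1 * D\<^sup>2) * E2 f))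
    = ennreal (C2 * (2 * (Cdef \<kappa> * 32\<^sup>2 * T\<^sup>2) + 2 * (C1 * D\<^sup>2))) * E2 f"
   using C1 C2 Cdef_nonneg[of \<kappa>]
   by (simp only: ennreal_mult ennreal_plus mult_nonneg_nonneg zero_le_power2 zero_le_numeral add_nonneg_nonneg distrib_left distrib_right mult.assoc ennreal_numeral)
  also have "... <= ennreal (C * (T\<^sup>2 + D\<^sup>2)) * E2 f"
  proof (intro mult_right_mono ennreal_leI)
   have "2 * (Cdef \<kappa> * 32\<^sup>2 * T\<^sup>2) + 2 * (C1 * D\<^sup>2) <= (2 * (Cdef \<kappa> * 32\<^sup>2) + 2 * C1) * (T\<^sup>2 + D\<^sup>2)"
    using C1 Cdef_nonneg[of \<kappa>] by (simp add: algebra_simps)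
   then show "C2 * (2 * (Cdef \<kappa> * 32\<^sup>2 * T\<^sup>2) + 2 * (C1 * D\<^sup>2)) <= C * (T\<^sup>2 + D\<^sup>2)"
    unfolding C_def mult.assoc using C2 by (intro mult_left_mono)
  qed simp
  finally show ?thesis .
 qed
 with C show ?thesis by blast
qed

subsection \<open>The commutator\<close>

text \<open>Summation over the levels: a frequency \<open>\<xi>\<close> is low for the levels above it, which
  contribute a geometric series, and high for the levels below it, which are few.\<close>
lemma level_sum:
 assumes b: "0 < \<beta>"
 shows "\<exists>K\<ge>0. \<forall>n. \<forall>xi::plane. (\<Sum>j=1..n. (2 powr (- \<beta> * real j))\<^sup>2 * (if norm xi < 32 * 2 ^ j then (norm xi)\<^sup>2 else 0)
   + (if norm xi < 32 * 2 ^ j then 0 else 1)) <= K * (1 + (norm xi)^2) powr (1 - \<beta>)"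
proof -
 have b1: "\<beta> < 1" using ab by simp
 define \<rho> where "\<rho> = 2 powr (- 2 * \<beta>)"
 have \<rho>: "0 < \<rho>" "\<rho> < 1" using b by (auto simp: \<rho>_def powr_less_one)
 define \<sigma> where "\<sigma> = 2 powr (2 * (1 - \<beta>))"
 have \<sigma>: "\<sigma> > 1" using b1 by (simp add: \<sigma>_def gr_one_powr)
 have \<rho>j: "(2 powr (- \<beta> * real j))^2 = \<rho> ^ j" for j
  by (simp add: \<rho>_def powr_powr powr_power mult_ac)
 define K where "K = 32\<^sup>2 / (1 - \<rho>) + 1 / (\<sigma> - 1)"
 have K: "K >= 0" using \<rho> \<sigma> by (simp add: K_def)
 have "(\<Sum>j=1..n. (2 powr (- \<beta> * real j))\<^sup>2 * (if norm xi < 32 * 2 ^ j then (norm xi)\<^sup>2 else 0)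
   + (if norm xi < 32 * 2 ^ j then 0 else 1)) <= K * (1 + (norm xi)^2) powr (1 - \<beta>)" for n and xi :: plane
 proof -
  define X where "X = norm xi"
  have X0: "X >= 0" by (simp add: X_def)
  define P where "P = (1 + X\<^sup>2) powr (1 - \<beta>)"
  have XP: "X powr (2 * (1 - \<beta>)) <= P"
  proof (cases "X = 0")
   case False
   then have "X powr (2 * (1 - \<beta>)) = (X\<^sup>2) powr (1 - \<beta>)"
    using X0 by (simp add: powr_powr powr_numeral[symmetric] del: powr_numeral)
   also have "... <= P" unfolding P_def using b1 by (intro powr_mono2) auto
   finally show ?thesis .
  qed (simp add: P_def)
  have low: "(\<Sum>j=1..n. \<rho> ^ j * (if X < 32 * 2 ^ j then X\<^sup>2 else 0)) <= (32\<^sup>2 / (1 - \<rho>)) * P"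
  proof (cases "\<exists>j. 1 <= j \<and> X < 32 * 2 ^ j \<and> X ~= 0")
   case True
   define j0 where "j0 = (LEAST j. X < 32 * 2 ^ j)"
   have j0: "X < 32 * 2 ^ j0" unfolding j0_def using True by (metis (mono_tags, lifting) LeastI_ex)
   have least: "X < 32 * 2 ^ j ==> j0 <= j" for j unfolding j0_def by (rule Least_le)
   have Xp: "X > 0" using True X0 by auto
   have "(\<Sum>j=1..n. \<rho> ^ j * (if X < 32 * 2 ^ j then X\<^sup>2 else 0)) <= (\<Sum>j\<in>{j0..n + j0}. \<rho> ^ j * X\<^sup>2)"
   proof -
    have "(\<Sum>j=1..n. \<rho> ^ j * (if X < 32 * 2 ^ j then X\<^sup>2 else 0)) = (\<Sum>j\<in>{j\<in>{1..n}. X < 32 * 2 ^ j}. \<rho> ^ j * X\<^sup>2)"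
    by (intro sum.mono_neutral_cong_right) auto
    also have "... <= (\<Sum>j\<in>{j0..n + j0}. \<rho> ^ j * X\<^sup>2)"
    using least \<rho> by (intro sum_mono2) auto
    finally show ?thesis .
   qed
   also have "... = \<rho> ^ j0 * X\<^sup>2 * (\<Sum>i\<le>n. \<rho> ^ i)"
   proof -
    have "{j0..n + j0} = (%i. i + j0) ` {..n}" using image_add_atLeastAtMost'[of j0 0 n] by (simp add: atMost_atLeast0)
    then show ?thesis
    by (simp add: sum.reindex inj_on_def power_add sum_distrib_left sum_distrib_right mult_ac)
   qed
   also have "... <= \<rho> ^ j0 * X\<^sup>2 * (1 / (1 - \<rho>))"
   proof (intro mult_left_mono)
    have "(\<Sum>i\<le>n. \<rho> ^ i) = (1 - \<rho> ^ Suc n) / (1 - \<rho>)" using \<rho> by (simp add: sum_gp_basic[symmetric] field_simps sum_gp0)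
    also have "... <= 1 / (1 - \<rho>)" using \<rho> by (intro divide_right_mono) auto
    finally show "(\<Sum>i\<le>n. \<rho> ^ i) <= 1 / (1 - \<rho>)" .
   qed (use \<rho> in auto)
   also have "\<rho> ^ j0 * X\<^sup>2 <= 32\<^sup>2 * P"
   proof -
    have "\<rho> ^ j0 = (2 ^ j0) powr (- 2 * \<beta>)"
    by (simp add: \<rho>_def powr_powr powr_realpow[symmetric] mult_ac)
    also have "... <= (X / 32) powr (- 2 * \<beta>)"
    using j0 Xp b by (intro powr_mono2') auto
    also have "... = X powr (- 2 * \<beta>) * 32 powr (2 * \<beta>)"
    using Xp by (simp add: powr_divide powr_minus_divide)
    also have "... <= X powr (- 2 * \<beta>) * 32\<^sup>2"
    proof (intro mult_left_mono)
    have "(32::real) powr (2 * \<beta>) <= 32 powr 2" using b1 by (intro powr_mono) auto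
    then show "(32::real) powr (2 * \<beta>) <= 32\<^sup>2" by simp
    qed simp
    finally have "\<rho> ^ j0 * X\<^sup>2 <= X powr (- 2 * \<beta>) * 32\<^sup>2 * X\<^sup>2" by (rule mult_right_mono) simp
    also have "... = 32\<^sup>2 * (X powr (- 2 * \<beta>) * X powr 2)" using Xp by simp
    also have "X powr (- 2 * \<beta>) * X powr 2 = X powr (2 * (1 - \<beta>))"
    unfolding powr_add[symmetric] by (simp add: algebra_simps)
    finally show ?thesis using XP by simp
   qed
   finally show ?thesis using \<rho> by (simp add: divide_right_mono)
  next
   case False
   then have "(\<Sum>j=1..n. \<rho> ^ j * (if X < 32 * 2 ^ j then X\<^sup>2 else 0)) = 0" by (intro sum.neutral) auto
   then show ?thesis using \<rho> by (simp add: P_def)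
  qed
  have high: "(\<Sum>j=1..n. (if X < 32 * 2 ^ j then 0 else 1)) <= (1 / (\<sigma> - 1)) * P"
  proof (cases "\<exists>j\<in>{1..n}. \<not> X < 32 * 2 ^ j")
   case True
   define S where "S = {j\<in>{1..n}. \<not> X < 32 * 2 ^ j}"
   have S: "finite S" "S ~= {}" using True by (auto simp: S_def)
   define k where "k = Max S"
   have k: "k \<in> S" "!!j. j \<in> S ==> j <= k" using S by (auto simp: k_def)
   have "(\<Sum>j=1..n. (if X < 32 * 2 ^ j then 0 else 1)) = real (card S)"
    unfolding S_def by (simp add: sum.If_cases Int_def)
   also have "... <= real k"
   proof -
    have "S \<subseteq> {1..k}" using k(2) by (auto simp: S_def)
    then have "card S <= card {1..k}" by (intro card_mono) auto
    then show ?thesis by simp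
   qed
   also have "... <= \<sigma> ^ k / (\<sigma> - 1)"
   proof -
    have "1 + real k * (\<sigma> - 1) <= (1 + (\<sigma> - 1)) ^ k" using \<sigma> by (intro Bernoulli_inequality) auto
    then show ?thesis using \<sigma> by (simp add: field_simps)
   qed
   also have "\<sigma> ^ k <= P"
   proof -
    have "\<sigma> ^ k = (2 ^ k) powr (2 * (1 - \<beta>))"
    by (simp add: \<sigma>_def powr_powr powr_realpow[symmetric] mult_ac)
    also have "... <= X powr (2 * (1 - \<beta>))"
    proof (intro powr_mono2)
    have "32 * 2 ^ k <= X" using k(1) by (simp add: S_def)
    then show "2 ^ k <= X" using zero_less_power[of "2::real" k] by linarith
    qed (use b1 in auto)
    finally show ?thesis using XP by simp
   qed
   finally show ?thesis using \<sigma> by (simp add: divide_right_mono)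
  next
   case False
   then have "(\<Sum>j=1..n. (if X < 32 * 2 ^ j then 0 else 1::real)) = 0" by (intro sum.neutral) auto
   then show ?thesis using \<sigma> by (simp add: P_def)
  qed
  have "(\<Sum>j=1..n. \<rho> ^ j * (if X < 32 * 2 ^ j then X\<^sup>2 else 0) + (if X < 32 * 2 ^ j then 0 else 1)) <= K * P"
   unfolding sum.distrib K_def distrib_right by (intro add_mono low high)
  then show ?thesis unfolding \<rho>j X_def P_def .
 qed
 with K show ?thesis by blast
qed

definition commut :: "(plane => plane) => (plane => complex) => 'i => plane => complex" where
 "commut \<tau> f i x = cv (%x. f (x - \<tau> x)) (m i) x - cv f (m i) (x - \<tau> x)"

text \<open>Splitting \<open>f\<close> at the frequency of each level, the low part pays \<open>D\<close> times the kernel size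
  \<open>2^(-\<beta> j)\<close> times a gradient, and of the high part only the leakage of order \<open>D\<close> remains. Summed over
  the levels the gradients amount to \<open>1 - \<beta>\<close> derivatives.\<close>
lemma commutator_estimate:
 assumes k01: "0 <= \<kappa>" "\<kappa> < 1" and b: "0 < \<beta>"
 shows "\<exists>C\<ge>0. \<forall>\<tau> \<tau>' D f g J. regular_deformation \<tau> \<tau>' D \<kappa> --> FT f g --> finite J --> J \<subseteq> Ix -->
  (\<Sum>i\<in>J. E2 (commut \<tau> f i)) <= ennreal (C * D\<^sup>2) * Hn (1 - \<beta>) g"
proof -
 obtain C1 where C1: "C1 >= 0" and hi: "high_bound \<kappa> C1" using high_bound_exists[OF k01(2)] by blast
 obtain C2 where C2: "C2 >= 0" and lp: "lowpass_dominates TYPE('i) C2" using lowpass_dominates_exists by blast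
 obtain K where K: "K >= 0" and lev: "!!n xi. (\<Sum>j=1..n. (2 powr (- \<beta> * real j))\<^sup>2 * (if norm (xi::plane) < 32 * 2 ^ j then (norm xi)\<^sup>2 else 0)
   + (if norm xi < 32 * 2 ^ j then 0 else 1)) <= K * (1 + (norm xi)^2) powr (1 - \<beta>)"
  using level_sum[OF b] by blast
 define W where "W = enn2real wt_moment"
 have W: "wt_moment = ennreal W" "W >= 0" using wt_moment_fin by (auto simp: W_def)
 define C3 where "C3 = 2 * (656 * B * Cdef \<kappa> * W) + 2 * (C2 * C1)"
 have C3: "C3 >= 0" using B C1 C2 W Cdef_nonneg[of \<kappa>] by (simp add: C3_def)
 have "(\<Sum>i\<in>J. E2 (commut \<tau> f i)) <= ennreal (C3 * K * D\<^sup>2) * Hn (1 - \<beta>) g"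
  if rd: "regular_deformation \<tau> \<tau>' D \<kappa>" and FT: "FT f g" and J: "finite J" "J \<subseteq> Ix" for \<tau> \<tau>' D f g J
 proof -
  interpret regular_deformation \<tau> \<tau>' D \<kappa> by (rule rd)
  note dB = deform_BL2[OF lipschitz_\<kappa> k01(2)]
  have [measurable]: "\<tau> \<in> Bor" by (rule lipschitz_borel[OF lipschitz_\<kappa> k01(2)])
  have g2: "g \<in> BL2" using FT_BL2(2)[OF FT] .
  have [measurable]: "g \<in> Bor" using g2 by auto
  have level: "(\<Sum>i\<in>Lv j. E2 (commut \<tau> f i))
    <= ennreal (C3 * D\<^sup>2) * (NN xi. ennreal (((2 powr (- \<beta> * real j))^2 * (if norm xi < 32 * 2 ^ j then (norm xi)\<^sup>2 else 0)
   + (if norm xi < 32 * 2 ^ j then 0 else 1)) * (cmod (g xi))^2))"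
   if j: "1 <= j" for j
  proof -
   define R :: real where "R = 32 * 2 ^ j"
   define r where "r = 2 powr (- \<beta> * real j)"
   define G where "G = lowp R g"
   have Gc: "G \<in> BLc" unfolding G_def by (rule lowp_BLc[OF g2])
   define fl fh where "fl = ift G" and "fh = (%x. f x - fl x)"
   note spl = split_frequency[OF FT, of R]
   have FTl: "FT fl G" and FTh: "FT fh (highp R g)" using spl by (simp_all add: fl_def fh_def G_def)
   have l2: "fl \<in> BL2" and h2: "fh \<in> BL2" using FT_BL2(1) FTl FTh by auto
   have Lv_Ix: "i \<in> Lv j ==> i \<in> Ix" for i using j by (auto simp: Ix_def)
   have c: "commut \<tau> f i = (%x. commut \<tau> fl i x + cv (%x. fh (x - \<tau> x)) (m i) x)" if i: "i \<in> Lv j" for i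
   proof
    fix x
    have h0: "cv fh (m i) y = 0" for y
    proof (rule cv_high_0[OF FTh m_BLc[OF Lv_Ix[OF i]]])
    fix xi :: plane assume "R <= norm xi"
    moreover have "8 * 2 ^ j < R" by (simp add: R_def)
    ultimately show "m i xi = 0" using ann[OF j i, of xi] by force
    qed
    have f: "f = (%x. fl x + fh x)" by (auto simp: fh_def)
    have "cv (%x. f (x - \<tau> x)) (m i) x = cv (%x. fl (x - \<tau> x)) (m i) x + cv (%x. fh (x - \<tau> x)) (m i) x"
    unfolding f by (intro cv_add dB l2 h2 m_BL12 Lv_Ix i)
    moreover have "cv f (m i) y = cv fl (m i) y" for y
    using cv_add[OF l2 h2 m_BL12[OF Lv_Ix[OF i]], of y] h0[of y] unfolding f by simp
    ultimately show "commut \<tau> f i x = commut \<tau> fl i x + cv (%x. fh (x - \<tau> x)) (m i) x"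
    by (simp add: commut_def)
   qed
   have cm: "commut \<tau> fl i \<in> Bor" "cv (%x. fh (x - \<tau> x)) (m i) \<in> Bor" if i: "i \<in> Lv j" for i
   proof -
    have [measurable]: "cv fl (m i) \<in> Bor" "cv (%x. fl (x - \<tau> x)) (m i) \<in> Bor"
    by (intro cv_borel dB l2 m_BL12 Lv_Ix i)+
    show "commut \<tau> fl i \<in> Bor" unfolding commut_def[abs_def] by measurable
    show "cv (%x. fh (x - \<tau> x)) (m i) \<in> Bor" by (intro cv_borel dB h2 m_BL12 Lv_Ix i)
   qed
   have "(\<Sum>i\<in>Lv j. E2 (commut \<tau> f i)) <= (\<Sum>i\<in>Lv j. 2 * E2 (commut \<tau> fl i) + 2 * E2 (cv (%x. fh (x - \<tau> x)) (m i)))"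
    using c cm by (intro sum_mono) (simp add: E2_add)
   also have "... = 2 * (\<Sum>i\<in>Lv j. E2 (commut \<tau> fl i)) + 2 * (\<Sum>i\<in>Lv j. E2 (cv (%x. fh (x - \<tau> x)) (m i)))"
    by (simp only: sum.distrib sum_distrib_left)
   also have "... <= 2 * (ennreal (656 * B * Cdef \<kappa> * r\<^sup>2 * D\<^sup>2) * wt_moment * D2 G) + 2 * (ennreal C2 * (ennreal (C1 * D\<^sup>2) * E2 (highp R g)))"
   proof (intro add_mono mult_left_mono)
    show "(\<Sum>i\<in>Lv j. E2 (commut \<tau> fl i)) <= ennreal (656 * B * Cdef \<kappa> * r\<^sup>2 * D\<^sup>2) * wt_moment * D2 G"
    unfolding commut_def[abs_def] fl_def r_def
    by (intro commutator_low[OF Gc k01(2) lipschitz_\<kappa> lipschitz_D _ bb[OF j] B]) simp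
    have "(\<Sum>i\<in>Lv j. E2 (cv (%x. fh (x - \<tau> x)) (m i))) <= ennreal C2 * E2 (cv (%x. fh (x - \<tau> x)) (lowpass (2 ^ j)))"
    proof (rule lowpass_dominatesD[OF lp finite_Lv[OF j]])
    show "m i xi = 0" if "i \<in> Lv j" "8 * 2 ^ j < norm xi" for i xi
    using ann[OF j that(1), of xi] that(2) by force
    show "AE xi in lborel. (\<Sum>i\<in>Lv j. (cmod (m i xi))\<^sup>2) <= 1"
    using Lv_Ix by (intro AE_sum_le_1 finite_Lv j) auto
    qed (use m_BLc m_bdd Lv_Ix dB h2 in auto)
    also have "E2 (cv (%x. fh (x - \<tau> x)) (lowpass (2 ^ j))) <= ennreal (C1 * D\<^sup>2) * E2 fh"
    by (rule high_boundD[OF hi rd _ FTh]) (auto simp: highp_def R_def)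
    finally show "(\<Sum>i\<in>Lv j. E2 (cv (%x. fh (x - \<tau> x)) (m i))) <= ennreal C2 * (ennreal (C1 * D\<^sup>2) * E2 (highp R g))"
    by (simp add: mult_left_mono FT_E2[OF FTh])
   qed auto
   also have "... <= ennreal (C3 * D\<^sup>2) * (ennreal (r\<^sup>2) * D2 G) + ennreal (C3 * D\<^sup>2) * E2 (highp R g)"
   proof (rule add_mono)
    have "2 * (ennreal (656 * B * Cdef \<kappa> * r\<^sup>2 * D\<^sup>2) * wt_moment * D2 G) = ennreal (2 * (656 * B * Cdef \<kappa> * W) * D\<^sup>2 * r\<^sup>2) * D2 G"
    proof -
    have "ennreal (2 * (656 * B * Cdef \<kappa> * W) * D\<^sup>2 * r\<^sup>2) = ennreal (2 * ((656 * B * Cdef \<kappa> * r\<^sup>2 * D\<^sup>2) * W))"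
    by (simp add: mult_ac)
    also have "... = 2 * (ennreal (656 * B * Cdef \<kappa> * r\<^sup>2 * D\<^sup>2) * ennreal W)"
    using B W Cdef_nonneg[of \<kappa>] by (subst ennreal_mult, simp, simp, subst ennreal_mult) auto
    finally show ?thesis by (simp only: W mult.assoc)
    qed
    also have "... <= ennreal (C3 * D\<^sup>2 * r\<^sup>2) * D2 G"
    using C1 C2 by (intro mult_right_mono ennreal_leI) (auto simp: C3_def)
    also have "... = ennreal (C3 * D\<^sup>2) * (ennreal (r\<^sup>2) * D2 G)"
    using C3 by (subst ennreal_mult) (auto simp: mult.assoc)
    finally show "2 * (ennreal (656 * B * Cdef \<kappa> * r\<^sup>2 * D\<^sup>2) * wt_moment * D2 G) <= ennreal (C3 * D\<^sup>2) * (ennreal (r\<^sup>2) * D2 G)" .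
    have "2 * (ennreal C2 * (ennreal (C1 * D\<^sup>2) * E2 (highp R g))) = ennreal (2 * (C2 * (C1 * D\<^sup>2))) * E2 (highp R g)"
    using C1 C2 by (subst ennreal_mult, simp, simp, subst ennreal_mult) (auto simp: mult.assoc)
    also have "... <= ennreal (C3 * D\<^sup>2) * E2 (highp R g)"
    proof (intro mult_right_mono ennreal_leI)
    have "0 <= 2 * (656 * B * Cdef \<kappa> * W) * D\<^sup>2" using B W Cdef_nonneg[of \<kappa>] by simp
    then show "2 * (C2 * (C1 * D\<^sup>2)) <= C3 * D\<^sup>2" by (simp add: C3_def algebra_simps)
    qed simp
    finally show "2 * (ennreal C2 * (ennreal (C1 * D\<^sup>2) * E2 (highp R g))) <= ennreal (C3 * D\<^sup>2) * E2 (highp R g)" .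
   qed
   also have "... = ennreal (C3 * D\<^sup>2) * (NN xi. ennreal ((r\<^sup>2 * (if norm xi < R then (norm xi)\<^sup>2 else 0) + (if norm xi < R then 0 else 1)) * (cmod (g xi))^2))"
   proof -
    have "(NN xi. ennreal ((r\<^sup>2 * (if norm xi < R then (norm xi)\<^sup>2 else 0) + (if norm xi < R then 0 else 1)) * (cmod (g xi))^2))
    = (NN xi. ennreal (r\<^sup>2) * ennreal ((norm xi)^2 * (cmod (G xi))^2) + ennreal ((cmod (highp R g xi))^2))"
    by (intro nn_integral_cong) (auto simp: G_def lowp_def highp_def ennreal_mult mult.assoc)
    also have "... = ennreal (r\<^sup>2) * D2 G + E2 (highp R g)"
    proof -
    have [measurable]: "G \<in> Bor" "highp R g \<in> Bor"
    using BLc_borel[OF Gc] FT_BL2(2)[OF FTh] by auto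
    show ?thesis unfolding D2_def E2_def by (subst nn_integral_add, measurable, measurable) (simp add: nn_integral_cmult)
    qed
    finally show ?thesis by (simp only: distrib_left)
   qed
   finally show ?thesis by (simp only: r_def R_def)
  qed
  define n where "n = Max (insert 0 ((%i. THE j. i \<in> Lv j) ` J))"
  have Jn: "J \<subseteq> (\<Union>j\<in>{1..n}. Lv j)"
  proof
   fix i assume i: "i \<in> J"
   then obtain j where j: "1 <= j" "i \<in> Lv j" using J(2) Ix_level by blast
   then have "(THE j. i \<in> Lv j) = j" using disj by blast
   then have "j <= n" unfolding n_def using i J(1) by (intro Max_ge) auto
   then show "i \<in> (\<Union>j\<in>{1..n}. Lv j)" using j by auto
  qed
  let ?w = "%j xi. (2 powr (- \<beta> * real j))\<^sup>2 * (if norm (xi::plane) < 32 * 2 ^ j then (norm xi)\<^sup>2 else 0) + (if norm xi < 32 * 2 ^ j then 0 else 1)"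
  have w0: "0 <= ?w j xi" for j xi by simp
  have "(\<Sum>i\<in>J. E2 (commut \<tau> f i)) <= (\<Sum>i\<in>(\<Union>j\<in>{1..n}. Lv j). E2 (commut \<tau> f i))"
   using Jn finite_Lv by (intro sum_mono2) auto
  also have "... = (\<Sum>j=1..n. \<Sum>i\<in>Lv j. E2 (commut \<tau> f i))"
   using finite_Lv disj by (intro sum.UNION_disjoint) auto
  also have "... <= (\<Sum>j=1..n. ennreal (C3 * D\<^sup>2) * (NN xi. ennreal (?w j xi * (cmod (g xi))^2)))"
   by (intro sum_mono level) auto
  also have "... = ennreal (C3 * D\<^sup>2) * (NN xi. (\<Sum>j=1..n. ennreal (?w j xi * (cmod (g xi))^2)))"
   unfolding sum_distrib_left[symmetric] by (subst nn_integral_sum) auto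
  also have "... <= ennreal (C3 * D\<^sup>2) * (NN xi. ennreal K * ennreal ((1 + (norm xi)^2) powr (1 - \<beta>) * (cmod (g xi))^2))"
  proof (intro mult_left_mono nn_integral_mono)
   fix xi :: plane
   have "(\<Sum>j=1..n. ennreal (?w j xi * (cmod (g xi))^2)) = ennreal (\<Sum>j=1..n. ?w j xi * (cmod (g xi))^2)"
    by (rule sum_ennreal) (intro mult_nonneg_nonneg w0 zero_le_power2)
   also have "... = ennreal ((\<Sum>j=1..n. ?w j xi) * (cmod (g xi))^2)"
    by (simp only: sum_distrib_right)
   also have "... <= ennreal (K * (1 + (norm xi)^2) powr (1 - \<beta>) * (cmod (g xi))^2)"
    by (intro ennreal_leI mult_right_mono lev) simp
   also have "... = ennreal K * ennreal ((1 + (norm xi)^2) powr (1 - \<beta>) * (cmod (g xi))^2)"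
    unfolding mult.assoc using K by (intro ennreal_mult) auto
   finally show "(\<Sum>j=1..n. ennreal (?w j xi * (cmod (g xi))^2)) <= ennreal K * ennreal ((1 + (norm xi)^2) powr (1 - \<beta>) * (cmod (g xi))^2)" .
  qed simp
  also have "... = ennreal (C3 * D\<^sup>2) * (ennreal K * Hn (1 - \<beta>) g)"
   unfolding Hn_def by (subst nn_integral_cmult) auto
  also have "... = ennreal (C3 * K * D\<^sup>2) * Hn (1 - \<beta>) g"
   using C3 K by (simp add: mult.assoc[symmetric] ennreal_mult[symmetric]) (simp add: mult_ac)
  finally show ?thesis .
 qed
 moreover have "C3 * K >= 0" using C3 K by simp
 ultimately show ?thesis by (intro exI[of _ "C3 * K"] conjI allI impI)
qed


subsection \<open>The modulus\<close>

lemma weight_interpolation: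
 assumes "0 < L" "0 < (y::real)" "0 <= t" "t <= 1"
 shows "y powr t <= L powr t + L powr (t - 1) * y"
proof (cases "y <= L")
 case True
 then have "y powr t <= L powr t" using assms by (intro powr_mono2) auto
 also have "... <= L powr t + L powr (t - 1) * y" using assms by simp
 finally show ?thesis .
next
 case False
 have "y powr t = y powr (t - 1) * y" using assms by (simp add: powr_diff)
 also have "... <= L powr (t - 1) * y" using assms False by (intro mult_right_mono powr_mono2') auto
 also have "... <= L powr t + L powr (t - 1) * y" by simp
 finally show ?thesis .
qed

text \<open>The modulus of a packet of level \<open>j\<close> has frequencies of size \<open>2^(\<alpha> j)\<close>, whereas the packet
  itself has \<open>2^j\<close>: \<open>t\<close> derivatives after the modulus cost only \<open>\<alpha> t\<close> before it.\<close>
lemma modulus_estimate: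
 assumes f: "FT f g" and J: "finite J" "J \<subseteq> Ix" and t: "0 <= t" "t <= 1"
  and w: "!!i. i \<in> J ==> FT (%x. of_real (cmod (cv f (m i) x))) (w i)"
 shows "(\<Sum>i\<in>J. Hn t (w i)) <= ennreal 2080 * Hn (\<alpha> * t) g"
proof -
 have g2: "g \<in> BL2" using FT_BL2(2)[OF f] .
 have gm[measurable]: "g \<in> Bor" using g2 by auto
 have mm: "m i \<in> Bor" if "i \<in> J" for i using BLc_borel[OF m_BLc] that J by auto
 have single: "Hn t (w i) <= (NN xi. ennreal 2080 * ennreal ((1 + (norm xi)^2) powr (\<alpha> * t) * (cmod (g xi))^2 * (cmod (m i xi))^2))"
  if i: "i \<in> J" for i
 proof -
  have iI: "i \<in> Ix" using i J by auto
  obtain j where j: "1 <= j" "i \<in> Lv j" using iI by (rule Ix_level)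
  obtain K where K: "!!xi. cmod (m i xi) <= K" using m_bdd[OF iI] by blast
  define V where "V = (%xi. m i xi * g xi)"
  have Vc: "V \<in> BLc" unfolding V_def by (rule BLc_times_BL2[OF m_BLc[OF iI] K g2])
  have Vm[measurable]: "V \<in> Bor" using BLc_borel[OF Vc] .
  have wi[measurable]: "w i \<in> Bor" using FT_BL2(2)[OF w[OF i]] by auto
  have FTw: "FT (%x. of_real (cmod (ift V x))) (w i)"
   using w[OF i] by (simp add: cv_eq[OF f m_BL12[OF iI]] V_def)
  define \<mu> where "\<mu> = 2 powr (\<alpha> * real j)"
  define L where "L = \<mu>\<^sup>2"
  have L0: "0 < L" by (simp add: L_def \<mu>_def)
  have "1 <= \<mu>" using ab by (simp add: \<mu>_def ge_one_powr_ge_zero)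
  then have L1: "1 <= L" by (simp add: L_def)
  have D: "D2 (w i) <= ennreal (8 * (4 * \<mu>)^2) * E2 V"
   by (rule modulus_demodulation[OF Vc _ _ FTw, of "ctr i"]) (use loc[OF j] in \<open>auto simp: V_def \<mu>_def\<close>)
  have E: "E2 (w i) = E2 V"
   using FT_E2[OF FTw] plancherel_ift[OF BLc_BL12[OF Vc]] by (simp add: E2_def)
  have "Hn t (w i) <= (NN xi. ennreal (2 * L powr t) * ennreal ((cmod (w i xi))^2) + ennreal (L powr (t - 1)) * ennreal ((norm xi)^2 * (cmod (w i xi))^2))"
   unfolding Hn_def
  proof (rule nn_integral_mono)
   fix xi :: plane
   have "(1 + (norm xi)^2) powr t <= L powr t + L powr (t - 1) * (1 + (norm xi)^2)"
    using L0 t by (intro weight_interpolation add_pos_nonneg) auto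
   also have "... <= 2 * L powr t + L powr (t - 1) * (norm xi)^2"
    using L1 powr_mono[of "t - 1" t L] by (simp add: algebra_simps)
   finally have "(1 + (norm xi)^2) powr t * (cmod (w i xi))^2 <= (2 * L powr t + L powr (t - 1) * (norm xi)^2) * (cmod (w i xi))^2"
    by (rule mult_right_mono) simp
   also have "... = 2 * L powr t * (cmod (w i xi))^2 + L powr (t - 1) * ((norm xi)^2 * (cmod (w i xi))^2)"
    by (simp add: algebra_simps)
   finally have *: "(1 + (norm xi)^2) powr t * (cmod (w i xi))^2 <= 2 * L powr t * (cmod (w i xi))^2 + L powr (t - 1) * ((norm xi)^2 * (cmod (w i xi))^2)" .
   show "ennreal ((1 + (norm xi)^2) powr t * (cmod (w i xi))^2) <= ennreal (2 * L powr t) * ennreal ((cmod (w i xi))^2) + ennreal (L powr (t - 1)) * ennreal ((norm xi)^2 * (cmod (w i xi))^2)"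
    using ennreal_leI[OF *] by (simp add: ennreal_mult[symmetric] ennreal_plus[symmetric] del: ennreal_plus)
  qed
  also have "... = ennreal (2 * L powr t) * E2 (w i) + ennreal (L powr (t - 1)) * D2 (w i)"
   unfolding E2_def D2_def by (subst nn_integral_add, measurable) (simp add: nn_integral_cmult)
  also have "... <= ennreal (2 * L powr t) * E2 V + ennreal (L powr (t - 1)) * (ennreal (8 * (4 * \<mu>)^2) * E2 V)"
   unfolding E by (intro add_left_mono mult_left_mono D) simp
  also have "... = ennreal (2 * L powr t + L powr (t - 1) * (8 * (4 * \<mu>)^2)) * E2 V"
   by (simp only: ennreal_mult ennreal_plus mult_nonneg_nonneg zero_le_power2 zero_le_numeral powr_ge_zero distrib_right mult.assoc)
  also have "2 * L powr t + L powr (t - 1) * (8 * (4 * \<mu>)^2) = 130 * L powr t"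
   using L0 by (simp add: power_mult_distrib L_def[symmetric] powr_diff)
  also have "ennreal (130 * L powr t) * E2 V = (NN xi. ennreal (130 * L powr t) * ennreal ((cmod (V xi))^2))"
   unfolding E2_def by (rule nn_integral_cmult[symmetric]) measurable
  also have "... <= (NN xi. ennreal 2080 * ennreal ((1 + (norm xi)^2) powr (\<alpha> * t) * (cmod (g xi))^2 * (cmod (m i xi))^2))"
  proof (rule nn_integral_mono)
   fix xi :: plane
   have "130 * L powr t * (cmod (V xi))^2 <= 2080 * ((1 + (norm xi)^2) powr (\<alpha> * t) * (cmod (g xi))^2 * (cmod (m i xi))^2)"
   proof (cases "m i xi = 0")
    case False
    have "2 ^ j <= 4 * norm xi" using ann[OF j False] by simp
    then have "(2 ^ j)^2 <= (4 * norm xi)^2" by (intro power_mono) auto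
    also have "... <= 16 * (1 + (norm xi)^2)" by (simp add: power_mult_distrib)
    finally have *: "(2 ^ j)^2 <= 16 * (1 + (norm xi)^2)" .
    have "L powr t = ((2 ^ j)^2) powr (\<alpha> * t)"
    by (simp add: L_def \<mu>_def powr_powr powr_realpow[symmetric] powr_power mult_ac)
    also have "... <= (16 * (1 + (norm xi)^2)) powr (\<alpha> * t)" using * ab t by (intro powr_mono2) auto
    also have "... = 16 powr (\<alpha> * t) * (1 + (norm xi)^2) powr (\<alpha> * t)" by (intro powr_mult)
    also have "... <= 16 powr 1 * (1 + (norm xi)^2) powr (\<alpha> * t)"
    using ab t mult_mono[of \<alpha> 1 t 1] by (intro mult_right_mono powr_mono) auto
    finally have "130 * L powr t * ((cmod (g xi))^2 * (cmod (m i xi))^2) <= 130 * (16 * (1 + (norm xi)^2) powr (\<alpha> * t)) * ((cmod (g xi))^2 * (cmod (m i xi))^2)"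
    by (intro mult_right_mono mult_left_mono) auto
    then show ?thesis by (simp add: V_def norm_mult power_mult_distrib mult_ac)
   qed (simp add: V_def)
   then show "ennreal (130 * L powr t) * ennreal ((cmod (V xi))^2) <= ennreal 2080 * ennreal ((1 + (norm xi)^2) powr (\<alpha> * t) * (cmod (g xi))^2 * (cmod (m i xi))^2)"
    by (subst (1 2) ennreal_mult[symmetric]) (auto intro: ennreal_leI)
  qed
  finally show ?thesis .
 qed
 have "(\<Sum>i\<in>J. Hn t (w i)) <= (\<Sum>i\<in>J. (NN xi. ennreal 2080 * ennreal ((1 + (norm xi)^2) powr (\<alpha> * t) * (cmod (g xi))^2 * (cmod (m i xi))^2)))"
  by (intro sum_mono single)
 also have "... = (NN xi. (\<Sum>i\<in>J. ennreal 2080 * ennreal ((1 + (norm xi)^2) powr (\<alpha> * t) * (cmod (g xi))^2 * (cmod (m i xi))^2)))"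
  using mm by (intro nn_integral_sum[symmetric]) measurable
 also have "... <= (NN xi. ennreal 2080 * ennreal ((1 + (norm xi)^2) powr (\<alpha> * t) * (cmod (g xi))^2))"
 proof (rule nn_integral_mono_AE)
  show "AE xi in lborel. (\<Sum>i\<in>J. ennreal 2080 * ennreal ((1 + (norm xi)^2) powr (\<alpha> * t) * (cmod (g xi))^2 * (cmod (m i xi))^2))
    <= ennreal 2080 * ennreal ((1 + (norm xi)^2) powr (\<alpha> * t) * (cmod (g xi))^2)"
   using AE_sum_le_1[OF J]
  proof (rule eventually_mono)
   fix xi :: plane assume le: "(\<Sum>i\<in>J. (cmod (m i xi))\<^sup>2) <= 1"
   let ?a = "(1 + (norm xi)^2) powr (\<alpha> * t) * (cmod (g xi))^2"
   have "(\<Sum>i\<in>J. ennreal 2080 * ennreal (?a * (cmod (m i xi))^2)) = ennreal 2080 * ennreal (?a * (\<Sum>i\<in>J. (cmod (m i xi))\<^sup>2))"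
    by (simp add: sum_distrib_left[symmetric] sum_ennreal)
   also have "... <= ennreal 2080 * ennreal (?a * 1)"
    by (intro mult_left_mono ennreal_leI le) auto
   finally show "(\<Sum>i\<in>J. ennreal 2080 * ennreal (?a * (cmod (m i xi))^2)) <= ennreal 2080 * ennreal ?a" by simp
  qed
 qed
 also have "... = ennreal 2080 * Hn (\<alpha> * t) g" unfolding Hn_def by (rule nn_integral_cmult) measurable
 finally show ?thesis .
qed

end


section \<open>The scattering tree\<close>

context wave_bank
begin

definition U :: "'i => (plane => complex) => plane => complex" where
 "U i a x = of_real (cmod (cv a (m i) x))"

lemma U_BL2: assumes a: "a \<in> BL2" and i: "i \<in> Ix" shows "U i a \<in> BL2"
proof -
 obtain K where K: "!!xi. cmod (m i xi) <= K" using m_bdd[OF i] by blast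
 have [measurable]: "cv a (m i) \<in> Bor" by (rule cv_borel[OF a m_BL12[OF i]])
 have "E2 (U i a) = E2 (cv a (m i))" by (simp add: U_def E2_def)
 also have "... <= ennreal (K\<^sup>2) * E2 a" by (rule cv_E2_le[OF a m_BLc[OF i] K])
 also have "... < \<infinity>" using a by (auto simp: BL2_def ennreal_mult_less_top)
 finally have "E2 (U i a) < \<infinity>" .
 moreover have "U i a \<in> Bor" unfolding U_def[abs_def] by measurable
 ultimately show ?thesis by (simp add: BL2_def)
qed

lemma U_diff_le:
 assumes "a \<in> BL2" "b \<in> BL2" "i \<in> Ix"
 shows "E2 (%x. U i a x - U i b x) <= E2 (cv (%x. a x - b x) (m i))"
proof (intro E2_mono AE_I2)
 fix x
 have "cmod (U i a x - U i b x) = \<bar>cmod (cv a (m i) x) - cmod (cv b (m i) x)\<bar>"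
  by (simp add: U_def flip: of_real_diff)
 also have "... <= cmod (cv a (m i) x - cv b (m i) x)" by (rule norm_triangle_ineq3)
 finally show "cmod (U i a x - U i b x) <= cmod (cv (%x. a x - b x) (m i) x)"
  using cv_diff[OF assms(1,2) m_BL12[OF assms(3)]] by simp
qed

text \<open>The Littlewood-Paley inequality on the Fourier side.\<close>
lemma layer_contraction:
 assumes c: "c \<in> BL2" and J: "finite J" "J \<subseteq> Ix"
 shows "E2 (cv c m\<chi>) + (\<Sum>i\<in>J. E2 (cv c (m i))) <= E2 c"
proof -
 obtain h where h: "FT c h" using FT_exists[OF c] by blast
 have h2: "h \<in> BL2" using FT_BL2(2)[OF h] .
 have hm[measurable]: "h \<in> Bor" using h2 by auto
 have eq: "E2 (cv c p) = (NN xi. ennreal ((cmod (p xi))^2 * (cmod (h xi))^2))"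
  if p: "p \<in> BLc" "\<exists>K. \<forall>xi. cmod (p xi) <= K" for p
 proof -
  obtain K where K: "!!xi. cmod (p xi) <= K" using p by blast
  have "cv c p = ift (%xi. p xi * h xi)" using cv_eq[OF h BLc_BL12[OF p(1)]] by auto
  then have "E2 (cv c p) = E2 (%xi. p xi * h xi)"
   using plancherel_ift[OF BLc_BL12[OF BLc_times_BL2[OF p(1) K h2]]] by simp
  then show ?thesis by (simp add: E2_def norm_mult power_mult_distrib)
 qed
 have mm: "m i \<in> Bor" if "i \<in> J" for i using BLc_borel[OF m_BLc] that J by auto
 have [measurable]: "m\<chi> \<in> Bor" using BLc_borel[OF \<chi>c] .
 have "E2 (cv c m\<chi>) + (\<Sum>i\<in>J. E2 (cv c (m i)))
   = (NN xi. ennreal ((cmod (m\<chi> xi))^2 * (cmod (h xi))^2)) + (\<Sum>i\<in>J. \<integral>\<^sup>+xi. ennreal ((cmod (m i xi))^2 * (cmod (h xi))^2) \<partial>lborel)"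
  using J by (intro arg_cong2[where f = "(+)"] sum.cong refl eq \<chi>c \<chi>b m_BLc m_bdd) auto
 also have "... = (NN xi. ennreal ((cmod (m\<chi> xi))^2 * (cmod (h xi))^2) + (\<Sum>i\<in>J. ennreal ((cmod (m i xi))^2 * (cmod (h xi))^2)))"
 proof -
  have "(%xi. ennreal ((cmod (m i xi))^2 * (cmod (h xi))^2)) \<in> borel_measurable lborel" if "i \<in> J" for i
  proof -
   have [measurable]: "m i \<in> Bor" by (rule mm[OF that])
   show ?thesis by measurable
  qed
  then have "(NN xi. (\<Sum>i\<in>J. ennreal ((cmod (m i xi))^2 * (cmod (h xi))^2)))
    = (\<Sum>i\<in>J. \<integral>\<^sup>+xi. ennreal ((cmod (m i xi))^2 * (cmod (h xi))^2) \<partial>lborel)"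
   and "(%xi. \<Sum>i\<in>J. ennreal ((cmod (m i xi))^2 * (cmod (h xi))^2)) \<in> borel_measurable lborel"
   by (auto intro!: nn_integral_sum borel_measurable_sum simp del: sum_ennreal)
  then show ?thesis by (subst nn_integral_add) (simp_all del: sum_ennreal)
 qed
 also have "... <= (NN xi. ennreal ((cmod (h xi))^2))"
 proof (rule nn_integral_mono_AE)
  show "AE xi in lborel. ennreal ((cmod (m\<chi> xi))^2 * (cmod (h xi))^2) + (\<Sum>i\<in>J. ennreal ((cmod (m i xi))^2 * (cmod (h xi))^2)) <= ennreal ((cmod (h xi))^2)"
   using LP[OF J[unfolded Ix_def]]
  proof (rule eventually_mono)
   fix xi assume le: "(cmod (m\<chi> xi))^2 + (\<Sum>i\<in>J. (cmod (m i xi))\<^sup>2) <= 1"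
   have "ennreal ((cmod (m\<chi> xi))^2 * (cmod (h xi))^2) + (\<Sum>i\<in>J. ennreal ((cmod (m i xi))^2 * (cmod (h xi))^2))
    = ennreal (((cmod (m\<chi> xi))^2 + (\<Sum>i\<in>J. (cmod (m i xi))\<^sup>2)) * (cmod (h xi))^2)"
    by (simp add: distrib_right sum_distrib_right sum_nonneg)
   also have "... <= ennreal (1 * (cmod (h xi))^2)" by (intro ennreal_leI mult_right_mono le) simp
   finally show "ennreal ((cmod (m\<chi> xi))^2 * (cmod (h xi))^2) + (\<Sum>i\<in>J. ennreal ((cmod (m i xi))^2 * (cmod (h xi))^2)) <= ennreal ((cmod (h xi))^2)" by simp
  qed
 qed
 also have "... = E2 c" using FT_E2[OF h] by (simp add: E2_def)
 finally show ?thesis .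
qed

text \<open>The squared distance of two scattering transforms, restricted to the paths of length at
  most \<open>n\<close> over \<open>J\<close>, by recursion along the first filter of a path.\<close>
primrec tree_dist :: "'i set => nat => (plane => complex) => (plane => complex) => ennreal" where
 "tree_dist J 0 a b = E2 (%x. cv a m\<chi> x - cv b m\<chi> x)"
| "tree_dist J (Suc n) a b = E2 (%x. cv a m\<chi> x - cv b m\<chi> x) + (\<Sum>i\<in>J. tree_dist J n (U i a) (U i b))"

text \<open>One layer is a contraction before the modulus, and the modulus is a contraction.\<close>
lemma tree_dist_nonexpansive:
 assumes J: "finite J" "J \<subseteq> Ix"
 shows "a \<in> BL2 ==> b \<in> BL2 ==> tree_dist J n a b <= E2 (%x. a x - b x)"
proof (induction n arbitrary: a b)
 case 0
 have "tree_dist J 0 a b = E2 (cv (%x. a x - b x) m\<chi>)"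
  using cv_diff[OF 0 \<chi>_BL12] by (simp add: cv_diff[OF 0 \<chi>_BL12, abs_def])
 also have "... <= E2 (%x. a x - b x)"
  using layer_contraction[OF BL2_diff[OF 0], of "{}"] by simp
 finally show ?case .
next
 case (Suc n)
 have "tree_dist J (Suc n) a b = E2 (cv (%x. a x - b x) m\<chi>) + (\<Sum>i\<in>J. tree_dist J n (U i a) (U i b))"
  by (simp add: cv_diff[OF Suc.prems \<chi>_BL12, abs_def])
 also have "... <= E2 (cv (%x. a x - b x) m\<chi>) + (\<Sum>i\<in>J. E2 (cv (%x. a x - b x) (m i)))"
 proof (intro add_left_mono sum_mono)
  fix i assume "i \<in> J"
  then have i: "i \<in> Ix" using J by auto
  show "tree_dist J n (U i a) (U i b) <= E2 (cv (%x. a x - b x) (m i))"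
   using Suc.IH[OF U_BL2[OF Suc.prems(1) i] U_BL2[OF Suc.prems(2) i]] U_diff_le[OF Suc.prems i] by (rule order_trans)
 qed
 also have "... <= E2 (%x. a x - b x)" by (rule layer_contraction[OF BL2_diff[OF Suc.prems] J])
 finally show ?case .
qed

lemma tree_dist_triangle:
 assumes J: "finite J" "J \<subseteq> Ix"
 shows "a \<in> BL2 ==> b \<in> BL2 ==> c \<in> BL2 ==> tree_dist J n a c <= 2 * tree_dist J n a b + 2 * tree_dist J n b c"
proof (induction n arbitrary: a b c)
 case (0 a b c)
 have [measurable]: "cv a m\<chi> \<in> Bor" "cv b m\<chi> \<in> Bor" "cv c m\<chi> \<in> Bor"
  by (intro cv_borel \<chi>_BL12 0)+
 show ?case using E2_add[of "%x. cv a m\<chi> x - cv b m\<chi> x" "%x. cv b m\<chi> x - cv c m\<chi> x"] by simp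
next
 case (Suc n a b c)
 have [measurable]: "cv a m\<chi> \<in> Bor" "cv b m\<chi> \<in> Bor" "cv c m\<chi> \<in> Bor"
  by (intro cv_borel \<chi>_BL12 Suc.prems)+
 have 1: "E2 (%x. cv a m\<chi> x - cv c m\<chi> x) <= 2 * E2 (%x. cv a m\<chi> x - cv b m\<chi> x) + 2 * E2 (%x. cv b m\<chi> x - cv c m\<chi> x)"
  using E2_add[of "%x. cv a m\<chi> x - cv b m\<chi> x" "%x. cv b m\<chi> x - cv c m\<chi> x"] by simp
 have 2: "(\<Sum>i\<in>J. tree_dist J n (U i a) (U i c)) <= (\<Sum>i\<in>J. 2 * tree_dist J n (U i a) (U i b) + 2 * tree_dist J n (U i b) (U i c))"
  using J by (intro sum_mono Suc.IH U_BL2 Suc.prems) auto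
 have "tree_dist J (Suc n) a c <= (2 * E2 (%x. cv a m\<chi> x - cv b m\<chi> x) + 2 * E2 (%x. cv b m\<chi> x - cv c m\<chi> x))
   + (\<Sum>i\<in>J. 2 * tree_dist J n (U i a) (U i b) + 2 * tree_dist J n (U i b) (U i c))"
  unfolding tree_dist.simps by (rule add_mono[OF 1 2])
 also have "... = 2 * tree_dist J (Suc n) a b + 2 * tree_dist J (Suc n) b c"
  by (simp add: sum.distrib sum_distrib_left distrib_left add_ac)
 finally show ?case .
qed

text \<open>The stability estimate with the Sobolev norm of order \<open>t\<close> on its right hand side, for
  smooth deformations. \<open>T\<close> and \<open>D\<close> bound the displacement and its derivative.\<close>
definition stable :: "real => real => bool" where
 "stable \<kappa> t \<longleftrightarrow> (\<exists>C\<ge>0. \<forall>n J \<tau> \<tau>' D T f g. regular_deformation \<tau> \<tau>' D \<kappa> --> (\<forall>x. norm (\<tau> x) <= T) -->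
   FT f g --> finite J --> J \<subseteq> Ix -->
   tree_dist J n (%x. f (x - \<tau> x)) f <= ennreal (C * (T\<^sup>2 + D\<^sup>2)) * Hn t g)"

lemma stable_mono:
 assumes s: "stable \<kappa> s" and st: "s <= t" shows "stable \<kappa> t"
proof -
 obtain C where C: "C >= 0" and *: "!!n J \<tau> \<tau>' D T f g. regular_deformation \<tau> \<tau>' D \<kappa> ==> (\<forall>x. norm (\<tau> x) <= T) ==>
   FT f g ==> finite J ==> J \<subseteq> Ix ==> tree_dist J n (%x. f (x - \<tau> x)) f <= ennreal (C * (T\<^sup>2 + D\<^sup>2)) * Hn s g"
  using s unfolding stable_def by blast
 show ?thesis
  unfolding stable_def
  by (intro exI[of _ C] conjI C allI impI) (rule order_trans[OF * mult_left_mono[OF Hn_mono[OF st]]], assumption+, simp)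
qed

lemma stable_1:
 assumes k01: "0 <= \<kappa>" "\<kappa> < 1" shows "stable \<kappa> 1"
 unfolding stable_def
proof (intro exI[of _ "Cdef \<kappa>"] conjI Cdef_nonneg allI impI)
 fix n :: nat and J :: "'i set" and \<tau> :: "plane => plane" and \<tau>' D T f g
 assume rd: "regular_deformation \<tau> \<tau>' D \<kappa>" and T: "\<forall>x. norm (\<tau> x) <= T" and FT: "FT f g" and J: "finite J" "J \<subseteq> Ix"
 interpret regular_deformation \<tau> \<tau>' D \<kappa> by (rule rd)
 have f2: "f \<in> BL2" using FT_BL2(1)[OF FT] .
 have "tree_dist J n (%x. f (x - \<tau> x)) f <= E2 (%x. f (x - \<tau> x) - f x)"
  by (intro tree_dist_nonexpansive J f2 deform_BL2[OF lipschitz_\<kappa> k01(2)])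
 also have "... <= ennreal (T\<^sup>2 * Cdef \<kappa>) * D2 g"
  by (rule E2_deform_minus_id_le[OF lipschitz_\<kappa> k01 _ FT]) (use T in blast)
 also have "... <= ennreal (Cdef \<kappa> * (T\<^sup>2 + D\<^sup>2)) * Hn 1 g"
  using Cdef_nonneg[of \<kappa>] by (intro mult_mono[OF ennreal_leI D2_le_Hn1]) (auto simp: distrib_left mult_ac)
 finally show "tree_dist J n (%x. f (x - \<tau> x)) f <= ennreal (Cdef \<kappa> * (T\<^sup>2 + D\<^sup>2)) * Hn 1 g" .
qed

text \<open>One layer trades the order \<open>t\<close> for the larger of \<open>1 - \<beta>\<close>, which the commutators of the
  first layer cost, and of \<open>\<alpha> t\<close>, since the modulus of a wave packet of level \<open>j\<close> has
  frequencies of size \<open>2^(\<alpha> j)\<close> instead of \<open>2^j\<close>.\<close>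
lemma stable_step:
 assumes k01: "0 <= \<kappa>" "\<kappa> < 1" and b: "0 < \<beta>" and t: "0 <= t" "t <= 1" and st: "stable \<kappa> t"
 shows "stable \<kappa> (max (1 - \<beta>) (\<alpha> * t))"
proof -
 let ?s = "max (1 - \<beta>) (\<alpha> * t)"
 obtain C where C: "C >= 0" and IH: "!!n J \<tau> \<tau>' D T f g. regular_deformation \<tau> \<tau>' D \<kappa> ==> (\<forall>x. norm (\<tau> x) <= T) ==>
   FT f g ==> finite J ==> J \<subseteq> Ix ==> tree_dist J n (%x. f (x - \<tau> x)) f <= ennreal (C * (T\<^sup>2 + D\<^sup>2)) * Hn t g"
  using st unfolding stable_def by blast
 obtain C1 where C1: "C1 >= 0" and chi: "!!\<tau> \<tau>' D T f. regular_deformation \<tau> \<tau>' D \<kappa> ==> (\<forall>x. norm (\<tau> x) <= T) ==> f \<in> BL2 ==>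
  E2 (cv (%x. f (x - \<tau> x) - f x) m\<chi>) <= ennreal (C1 * (T\<^sup>2 + D\<^sup>2)) * E2 f"
  using chi_estimate[OF k01] by blast
 obtain C2 where C2: "C2 >= 0" and com: "!!\<tau> \<tau>' D f g J. regular_deformation \<tau> \<tau>' D \<kappa> ==> FT f g ==> finite J ==> J \<subseteq> Ix ==>
  (\<Sum>i\<in>J. E2 (commut \<tau> f i)) <= ennreal (C2 * D\<^sup>2) * Hn (1 - \<beta>) g"
  using commutator_estimate[OF k01 b] by blast
 define C' where "C' = C1 + 2 * C2 + 2 * (2080 * C)"
 have "tree_dist J n (%x. f (x - \<tau> x)) f <= ennreal (C' * (T\<^sup>2 + D\<^sup>2)) * Hn ?s g"
  if rd: "regular_deformation \<tau> \<tau>' D \<kappa>" and T: "\<forall>x. norm (\<tau> x) <= T" and FT: "FT f g" and J: "finite J" "J \<subseteq> Ix"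
  for n J \<tau> \<tau>' D T f g
 proof -
  interpret regular_deformation \<tau> \<tau>' D \<kappa> by (rule rd)
  have f2: "f \<in> BL2" using FT_BL2(1)[OF FT] .
  note dB = deform_BL2[OF lipschitz_\<kappa> k01(2)]
  have L2: "(%x. f (x - \<tau> x)) \<in> BL2" by (rule dB[OF f2])
  let ?S = "T\<^sup>2 + D\<^sup>2" and ?H = "Hn ?s g"
  have s0: "0 <= ?s" using ab by auto
  have "E2 (%x. cv (%x. f (x - \<tau> x)) m\<chi> x - cv f m\<chi> x) <= ennreal (C1 * ?S) * E2 f"
   using chi[OF rd T f2] by (simp add: cv_diff[OF L2 f2 \<chi>_BL12, abs_def])
  also have "... <= ennreal (C1 * ?S) * ?H"
   unfolding FT_E2[OF FT, symmetric] by (intro mult_left_mono E2_le_Hn s0) simp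
  finally have A: "E2 (%x. cv (%x. f (x - \<tau> x)) m\<chi> x - cv f m\<chi> x) <= ennreal (C1 * ?S) * ?H" .
  have split: "tree_dist J n (U i (%x. f (x - \<tau> x))) (U i f)
    <= 2 * E2 (commut \<tau> f i) + 2 * tree_dist J n (%x. U i f (x - \<tau> x)) (U i f)" if i: "i \<in> J" for n i
  proof -
   have i': "i \<in> Ix" using i J by auto
   have Uf: "U i f \<in> BL2" and UL: "U i (%x. f (x - \<tau> x)) \<in> BL2" and LU: "(%x. U i f (x - \<tau> x)) \<in> BL2"
    by (intro U_BL2 dB f2 L2 i')+
   have "tree_dist J n (U i (%x. f (x - \<tau> x))) (%x. U i f (x - \<tau> x)) <= E2 (%x. U i (%x. f (x - \<tau> x)) x - U i f (x - \<tau> x))"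
    by (rule tree_dist_nonexpansive[OF J UL LU])
   also have "... <= E2 (commut \<tau> f i)"
   proof (intro E2_mono AE_I2)
    fix x
    have "cmod (U i (%x. f (x - \<tau> x)) x - U i f (x - \<tau> x)) = \<bar>cmod (cv (%x. f (x - \<tau> x)) (m i) x) - cmod (cv f (m i) (x - \<tau> x))\<bar>"
    by (simp add: U_def flip: of_real_diff)
    also have "... <= cmod (commut \<tau> f i x)" unfolding commut_def by (rule norm_triangle_ineq3)
    finally show "cmod (U i (%x. f (x - \<tau> x)) x - U i f (x - \<tau> x)) <= cmod (commut \<tau> f i x)" .
   qed
   finally have "tree_dist J n (U i (%x. f (x - \<tau> x))) (%x. U i f (x - \<tau> x)) <= E2 (commut \<tau> f i)" .
   then show ?thesis
    by (intro order_trans[OF tree_dist_triangle[OF J UL LU Uf]] add_right_mono mult_left_mono) auto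
  qed
  obtain w where w: "!!i. i \<in> J ==> FT (U i f) (w i)"
   using FT_exists[OF U_BL2[OF f2]] J by (metis subsetD)
  have modul: "(\<Sum>i\<in>J. Hn t (w i)) <= ennreal 2080 * Hn (\<alpha> * t) g"
   by (rule modulus_estimate[OF FT J t]) (use w in \<open>simp add: U_def[abs_def]\<close>)
  have B: "(\<Sum>i\<in>J. tree_dist J n (U i (%x. f (x - \<tau> x))) (U i f)) <= ennreal (2 * C2 * ?S + 2 * (2080 * C) * ?S) * ?H" for n
  proof -
   have "(\<Sum>i\<in>J. tree_dist J n (U i (%x. f (x - \<tau> x))) (U i f))
    <= (\<Sum>i\<in>J. 2 * E2 (commut \<tau> f i) + 2 * (ennreal (C * ?S) * Hn t (w i)))"
   proof (rule sum_mono)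
    fix i assume i: "i \<in> J"
    show "tree_dist J n (U i (%x. f (x - \<tau> x))) (U i f) <= 2 * E2 (commut \<tau> f i) + 2 * (ennreal (C * ?S) * Hn t (w i))"
    by (rule order_trans[OF split[OF i] add_left_mono[OF mult_left_mono[OF IH[OF rd T w[OF i] J]]]]) simp
   qed
   also have "... = 2 * (\<Sum>i\<in>J. E2 (commut \<tau> f i)) + 2 * (ennreal (C * ?S) * (\<Sum>i\<in>J. Hn t (w i)))"
    by (simp only: sum.distrib sum_distrib_left)
   also have "... <= 2 * (ennreal (C2 * ?S) * ?H) + 2 * (ennreal (C * ?S) * (ennreal 2080 * ?H))"
   proof (intro add_mono mult_left_mono)
    have "(\<Sum>i\<in>J. E2 (commut \<tau> f i)) <= ennreal (C2 * D\<^sup>2) * Hn (1 - \<beta>) g" by (rule com[OF rd FT J])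
    also have "... <= ennreal (C2 * ?S) * ?H"
    using C2 by (intro mult_mono ennreal_leI mult_left_mono Hn_mono) auto
    finally show "(\<Sum>i\<in>J. E2 (commut \<tau> f i)) <= ennreal (C2 * ?S) * ?H" .
    show "(\<Sum>i\<in>J. Hn t (w i)) <= ennreal 2080 * ?H"
    by (rule order_trans[OF modul mult_left_mono[OF Hn_mono]]) auto
   qed auto
   also have "... = ennreal (2 * C2 * ?S + 2 * (2080 * C) * ?S) * ?H"
   proof -
    have "2 * (ennreal (C2 * ?S) * ?H) = ennreal (2 * C2 * ?S) * ?H"
    using C2 by (simp add: ennreal_mult mult.assoc)
    moreover have "2 * (ennreal (C * ?S) * (ennreal 2080 * ?H)) = ennreal (2 * (2080 * C) * ?S) * ?H"
    proof -
    have "ennreal (2 * (2080 * C) * ?S) = ennreal 2 * (ennreal (C * ?S) * ennreal 2080)"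
    using C by (simp only: ennreal_mult[symmetric] mult_nonneg_nonneg add_nonneg_nonneg zero_le_power2 zero_le_numeral) (simp add: mult_ac)
    then show ?thesis by (simp only: mult.assoc ennreal_numeral)
    qed
    ultimately show ?thesis
    using C C2 by (subst ennreal_plus) (auto simp: distrib_right)
   qed
   finally show ?thesis .
  qed
  have "tree_dist J n (%x. f (x - \<tau> x)) f <= ennreal (C1 * ?S) * ?H + ennreal (2 * C2 * ?S + 2 * (2080 * C) * ?S) * ?H"
  proof (cases n)
   case 0
   then show ?thesis using A by (auto intro: add_increasing2)
  next
   case (Suc k)
   show ?thesis unfolding Suc tree_dist.simps by (rule add_mono[OF A B])
  qed
  also have "... = ennreal (C1 * ?S + (2 * C2 * ?S + 2 * (2080 * C) * ?S)) * ?H"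
   using C C1 C2 by (subst (2) ennreal_plus) (auto simp: distrib_right)
  also have "C1 * ?S + (2 * C2 * ?S + 2 * (2080 * C) * ?S) = C' * ?S"
   by (simp add: C'_def algebra_simps)
  finally show ?thesis .
 qed
 moreover have "C' >= 0" using C C1 C2 by (simp add: C'_def)
 ultimately show ?thesis unfolding stable_def by (intro exI[of _ C'] conjI allI impI)
qed

text \<open>Start from one derivative, where a deformation is close to the identity outright, and let
  each step multiply the order by \<open>\<alpha> < 1\<close> until the commutators, at order \<open>1 - \<beta>\<close>, are the only cost.
  Finitely many steps suffice because \<open>\<beta> < 1\<close>. For \<open>\<beta> = 0\<close> the starting point is already the claim.\<close>
theorem stable_critical:
 assumes k01: "0 <= \<kappa>" "\<kappa> < 1" shows "stable \<kappa> (1 - \<beta>)"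
proof (cases "\<beta> = 0")
 case True
 then show ?thesis using stable_1[OF k01] by simp
next
 case False
 then have b: "0 < \<beta>" using ab by simp
 have a: "0 < \<alpha>" "\<beta> < 1" using b ab by auto
 have "stable \<kappa> (max (1 - \<beta>) (\<alpha> ^ n))" for n
 proof (induction n)
  case 0
  then show ?case using stable_1[OF k01] b by (simp add: max_def)
 next
  case (Suc n)
  have "stable \<kappa> (max (1 - \<beta>) (\<alpha> * max (1 - \<beta>) (\<alpha> ^ n)))"
   by (rule stable_step[OF k01 b _ _ Suc]) (use ab a power_le_one[of \<alpha> n] in \<open>auto simp: le_max_iff_disj\<close>)
  moreover have "\<alpha> * (1 - \<beta>) <= 1 * (1 - \<beta>)" using ab a by (intro mult_right_mono) auto
  ultimately show ?case by (elim stable_mono) (auto simp: max_def)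
 qed
 moreover obtain n where "\<alpha> ^ n < 1 - \<beta>" using real_arch_pow_inv[of "1 - \<beta>" \<alpha>] a ab by auto
 ultimately show ?thesis by (metis max.absorb1 less_imp_le)
qed

end


section \<open>Mollification of Sobolev deformations\<close>

definition tgt :: "(plane => real) => plane => plane => real" where
 "tgt f z v = v $ 1 * partial 1 f z + v $ 2 * partial 2 f z"

lemma smooth_has_derivative: assumes "smooth f" shows "(f has_derivative tgt f z) (at z)"
proof -
 obtain d where d: "(f has_derivative d) (at z)" using smooth_differentiable[OF assms] by (auto simp: differentiable_def)
 have "d v = tgt f z v" for v
 proof -
  have "v = v $ 1 *R axis 1 1 + v $ 2 *R axis 2 (1::real)" by (simp add: vec_eq_iff forall_2 axis_def)
  then have "d v = d (v $ 1 *R axis 1 1 + v $ 2 *R axis 2 1)" by simp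
  also have "... = v $ 1 * d (axis 1 1) + v $ 2 * d (axis 2 1)"
   using has_derivative_linear[OF d] by (simp add: linear_add linear_scale)
  finally show ?thesis by (simp add: tgt_def partial_eqI[OF d])
 qed
 then have "d = tgt f z" by (rule ext)
 then show ?thesis using d by simp
qed

lemma smooth_bounded:
 fixes f :: "plane => real"
 assumes "smooth f" "!!z. R < norm z ==> f z = 0"
 shows "\<exists>K\<ge>0. \<forall>z. \<bar>f z\<bar> <= K"
proof -
 have "compact (f ` cball 0 R)" by (intro compact_continuous_image smooth_continuous assms) simp
 then have "bounded (f ` cball 0 R)" by (rule compact_imp_bounded)
 then obtain K where K': "\<forall>y\<in>f ` cball 0 R. norm y <= K"
  unfolding bounded_iff by (elim exE) (rule that)
 then have K: "norm (f z) <= K" if "z \<in> cball 0 R" for z using that by blast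
 have "\<bar>f z\<bar> <= max K 0" for z
 proof (cases "norm z <= R")
  case True
  then show ?thesis using K[of z] by simp
 qed (simp add: assms(2))
 then show ?thesis by (intro exI[of _ "max K 0"] conjI allI) simp_all
qed

lemma smooth_lipschitz:
 fixes f :: "plane => real"
 assumes f: "smooth f" "!!z. R < norm z ==> f z = 0"
 shows "\<exists>L\<ge>0. \<forall>z w. \<bar>f z - f w\<bar> <= L * norm (z - w)"
proof -
 have "\<exists>K\<ge>0. \<forall>z. \<bar>partial k f z\<bar> <= K" for k
  by (rule smooth_bounded[OF smooth_partial[OF f(1)] partial_support[OF f(2)]])
 note pb = this
 obtain K1 where K1: "K1 >= 0" "!!z. \<bar>partial 1 f z\<bar> <= K1" using pb[of 1] by blast
 obtain K2 where K2: "K2 >= 0" "!!z. \<bar>partial 2 f z\<bar> <= K2" using pb[of 2] by blast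
 note K = K1 K2
 have "norm (f z - f w) <= (K1 + K2) * norm (z - w)" for z w
 proof (rule differentiable_bound[of UNIV])
  fix x :: plane
  show "(f has_derivative tgt f x) (at x within UNIV)" using smooth_has_derivative[OF f(1)] by simp
  show "onorm (tgt f x) <= K1 + K2"
  proof (rule onorm_le)
   fix v :: plane
   have "norm (tgt f x v) <= \<bar>v $ 1\<bar> * \<bar>partial 1 f x\<bar> + \<bar>v $ 2\<bar> * \<bar>partial 2 f x\<bar>"
    unfolding tgt_def real_norm_def by (rule order_trans[OF abs_triangle_ineq]) (simp add: abs_mult)
   also have "... <= norm v * K1 + norm v * K2" by (intro add_mono mult_mono K component_le_norm_cart) auto
   finally show "norm (tgt f x v) <= (K1 + K2) * norm v" by (simp add: algebra_simps)
  qed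
 qed auto
 then show ?thesis using K(1,3) by (intro exI[of _ "K1 + K2"] conjI allI) simp_all
qed

lemma cball_const_integrable: "integrable lborel (%y. indicator (cball x r) y * (c::real))" for x :: plane
proof -
 have "emeasure lborel (cball x r) < \<infinity>" by (rule emeasure_bounded_finite[OF bounded_cball])
 then have "integrable lborel (indicator (cball x r) :: plane => real)" by (intro integrable_real_indicator) simp_all
 then show ?thesis by (rule integrable_mult_left)
qed

text \<open>The last assumption makes the translates \<open>y \<mapsto> \<eta> (x - y)\<close> test functions.\<close>
locale mollifier =
 fixes \<eta> :: "plane => real" and R :: real
 assumes \<eta>: "smooth \<eta>" and pos: "\<eta> z >= 0" and out: "R < norm z ==> \<eta> z = 0" and R0: "0 <= R"
  and mass: "(LINT z|lborel. \<eta> z) = 1" and smooth_reflected: "smooth (%y. \<eta> (x - y))"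
begin

lemma out_partial: "R < norm z ==> partial k \<eta> z = 0" by (rule partial_support[OF out])

lemma taylor: "\<exists>K\<ge>0. \<forall>z h. \<bar>\<eta> (z + h) - \<eta> z - tgt \<eta> z h\<bar> <= K * (norm h)^2"
proof -
 have "\<exists>L\<ge>0. \<forall>z w. \<bar>partial k \<eta> z - partial k \<eta> w\<bar> <= L * norm (z - w)" for k
  by (rule smooth_lipschitz[OF smooth_partial[OF \<eta>] out_partial])
 note pb = this
 obtain L1 where L1: "L1 >= 0" "!!z w. \<bar>partial 1 \<eta> z - partial 1 \<eta> w\<bar> <= L1 * norm (z - w)" using pb[of 1] by blast
 obtain L2 where L2: "L2 >= 0" "!!z w. \<bar>partial 2 \<eta> z - partial 2 \<eta> w\<bar> <= L2 * norm (z - w)" using pb[of 2] by blast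
 note L = L1 L2
 have "norm (\<eta> (z + h) - \<eta> z - tgt \<eta> z ((z + h) - z)) <= norm ((z + h) - z) * ((L1 + L2) * norm h)" for z h
 proof (rule differentiable_bound_linearization[of _ _ "cball z (norm h)"])
  fix t :: real assume "t \<in> {0..1}"
  then show "z + t *R (z + h - z) \<in> cball z (norm h)" by (auto simp: dist_norm mult_left_le_one_le)
 next
  fix x assume "x \<in> cball z (norm h)"
  then have x: "norm (x - z) <= norm h" by (simp add: dist_norm norm_minus_commute)
  show "(\<eta> has_derivative tgt \<eta> x) (at x within cball z (norm h))"
   by (rule has_derivative_at_withinI[OF smooth_has_derivative[OF \<eta>]])
  show "onorm (tgt \<eta> x - tgt \<eta> z) <= (L1 + L2) * norm h"
  proof (rule onorm_le)
   fix v :: plane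
   have "norm ((tgt \<eta> x - tgt \<eta> z) v) = \<bar>v $ 1 * (partial 1 \<eta> x - partial 1 \<eta> z) + v $ 2 * (partial 2 \<eta> x - partial 2 \<eta> z)\<bar>"
    by (simp add: tgt_def algebra_simps)
   also have "... <= \<bar>v $ 1\<bar> * \<bar>partial 1 \<eta> x - partial 1 \<eta> z\<bar> + \<bar>v $ 2\<bar> * \<bar>partial 2 \<eta> x - partial 2 \<eta> z\<bar>"
    by (rule order_trans[OF abs_triangle_ineq]) (simp add: abs_mult)
   also have "... <= norm v * (L1 * norm h) + norm v * (L2 * norm h)"
    using L(1,3) x
    by (intro add_mono mult_mono component_le_norm_cart order_trans[OF L(2) mult_left_mono] order_trans[OF L(4) mult_left_mono]) simp_all
   finally show "norm ((tgt \<eta> x - tgt \<eta> z) v) <= (L1 + L2) * norm h * norm v" by (simp add: algebra_simps)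
  qed
 qed simp
 then show ?thesis using L(1,3) by (intro exI[of _ "L1 + L2"] conjI allI) (simp_all add: power2_eq_square mult_ac)
qed

lemma \<eta>_borel [measurable]: "\<eta> \<in> Bor"
 by (intro borel_measurable_continuous_onI smooth_continuous \<eta>)

lemma partial_\<eta>_borel [measurable]: "partial k \<eta> \<in> Bor"
 by (intro borel_measurable_continuous_onI smooth_continuous smooth_partial \<eta>)

lemma kernel_integrable:
 fixes s :: "plane => 'a::{banach, second_countable_topology}" and f :: "plane => real"
 assumes f: "smooth f" "!!z. R < norm z ==> f z = 0"
  and [measurable]: "s \<in> Bor" and s: "!!y. norm (s y) <= T"
 shows "integrable lborel (%y. f (x - y) *R s y)"
proof -
 have [measurable]: "f \<in> Bor" by (intro borel_measurable_continuous_onI smooth_continuous f)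
 obtain K where K: "K >= 0" "!!z. \<bar>f z\<bar> <= K" using smooth_bounded[OF f] by blast
 have T: "0 <= T" using order_trans[OF norm_ge_zero s] .
 have "integrable lborel (%y. indicator (cball x R) y * (K * T))"
  by (rule cball_const_integrable)
 then show ?thesis
 proof (rule Bochner_Integration.integrable_bound)
  show "AE y in lborel. norm (f (x - y) *R s y) <= norm (indicator (cball x R) y * (K * T))"
  proof (rule AE_I2)
   fix y
   show "norm (f (x - y) *R s y) <= norm (indicator (cball x R) y * (K * T))"
   proof (cases "norm (x - y) <= R")
    case True
    have "\<bar>f (x - y)\<bar> * norm (s y) <= K * T" by (rule mult_mono[OF K(2) s K(1)]) simp
    then show ?thesis using True K(1) T by (simp add: dist_norm abs_mult)
   qed (use f(2)[of "x - y"] in simp)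
  qed
 qed measurable
qed

definition mol :: "(plane => 'a::{banach, second_countable_topology}) => plane => 'a" where
 "mol s x = (LINT y|lborel. \<eta> (x - y) *R s y)"

lemma mass_at: "(LINT y|lborel. \<eta> (x - y)) = 1"
 using lborel_reflect(2)[of "%y. of_real (\<eta> y) :: complex" x] mass by simp

lemma int1: "integrable lborel (%y. \<eta> (x - y))"
 using kernel_integrable[OF \<eta> out, of "%_. 1::real" 1 x] by simp

text \<open>Averaging against a probability density keeps every bound on the values.\<close>
lemma average_le:
 fixes F :: "plane => 'a::{banach, second_countable_topology}"
 assumes "integrable lborel (%y. \<eta> (x - y) *R F y)" "!!y. norm (x - y) <= R ==> norm (F y) <= B"
 shows "norm (LINT y|lborel. \<eta> (x - y) *R F y) <= B"
proof -
 have "norm (LINT y|lborel. \<eta> (x - y) *R F y) <= (LINT y|lborel. norm (\<eta> (x - y) *R F y))"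
  by (rule integral_norm_bound)
 also have "... <= (LINT y|lborel. \<eta> (x - y) * B)"
 proof (rule integral_mono)
  fix y
  show "norm (\<eta> (x - y) *R F y) <= \<eta> (x - y) * B"
   using pos[of "x - y"] assms(2)[of y] out[of "x - y"]
   by (cases "norm (x - y) <= R") (auto intro: mult_left_mono)
 qed (intro integrable_norm assms(1) integrable_mult_left int1)+
 also have "... = B" by (simp add: mass_at)
 finally show ?thesis .
qed

lemma mol_bound:
 assumes [measurable]: "s \<in> Bor" and s: "!!y. norm (s y) <= T"
 shows "norm (mol s x) <= T"
 unfolding mol_def by (rule average_le[OF kernel_integrable[OF \<eta> out assms] s])

lemma mol_lipschitz:
 assumes [measurable]: "s \<in> Bor" and s: "!!y. norm (s y) <= T" and lip: "D-lipschitz_on UNIV s"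
 shows "norm (mol s x - s x) <= D * R"
proof -
 have i: "integrable lborel (%y. \<eta> (x - y) *R (s y - s x))"
  unfolding scaleR_diff_right
  using kernel_integrable[OF \<eta> out assms(1) s, of x] int1[of x] by (intro Bochner_Integration.integrable_diff) auto
 have "mol s x - s x = (LINT y|lborel. \<eta> (x - y) *R (s y - s x))"
  unfolding scaleR_diff_right mol_def
  by (subst Bochner_Integration.integral_diff) (use kernel_integrable[OF \<eta> out assms(1) s, of x] int1[of x] in \<open>auto simp: mass_at\<close>)
 also have "norm ... <= D * R"
 proof (rule average_le[OF i])
  fix y assume y: "norm (x - y) <= R"
  have "norm (s y - s x) <= D * dist y x" using lipschitz_onD[OF lip, of y x] by (simp add: dist_norm)
  also have "... <= D * R" using y lipschitz_on_nonneg[OF lip] by (intro mult_left_mono) (auto simp: dist_norm norm_minus_commute)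
  finally show "norm (s y - s x) <= D * R" .
 qed
 finally show ?thesis .
qed

text \<open>The second order Taylor remainder of the kernel, integrated over a fixed ball, is of second
  order.\<close>
lemma mol_has_derivative:
 assumes [measurable]: "s \<in> Bor" and s: "!!y. norm (s y) <= T"
 shows "(mol s has_derivative (%v. v $ 1 *R (LINT y|lborel. partial 1 \<eta> (x - y) *R s y) + v $ 2 *R (LINT y|lborel. partial 2 \<eta> (x - y) *R s y))) (at x)"
  (is "(_ has_derivative ?A) _")
proof -
 obtain K where K: "K >= 0" "!!z h. \<bar>\<eta> (z + h) - \<eta> z - tgt \<eta> z h\<bar> <= K * (norm h)^2" using taylor by blast
 have T: "0 <= T" using order_trans[OF norm_ge_zero s] .
 define V where "V = measure lborel (cball x (R + 1))"
 note i0 = kernel_integrable[OF \<eta> out assms] and ip = kernel_integrable[OF smooth_partial[OF \<eta>] out_partial assms]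
 show ?thesis
 proof (rule has_derivativeI_sandwich[of 1])
  show "bounded_linear ?A"
   by (intro bounded_linear_add bounded_linear_compose[OF bounded_linear_scaleR_left bounded_linear_vec_nth])
  show "((%y. K * T * V * norm (y - x)) \<longlongrightarrow> 0) (at x within UNIV)"
   
  proof -
   have "((%y. K * T * V * norm (y - x)) \<longlongrightarrow> K * T * V * norm (x - x)) (at x)" by (intro tendsto_intros)
   then show ?thesis by simp
  qed
  fix z assume z: "z ~= x" "dist z x < 1"
  define h where "h = z - x"
  have h: "norm h < 1" "h ~= 0" "z = x + h" using z by (auto simp: h_def dist_norm)
  have pt: "(\<eta> (x - y + h) - \<eta> (x - y) - tgt \<eta> (x - y) h) *R s y
    = (\<eta> (z - y) *R s y - \<eta> (x - y) *R s y) - (h $ 1 *R (partial 1 \<eta> (x - y) *R s y) + h $ 2 *R (partial 2 \<eta> (x - y) *R s y))" for y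
  proof -
   have e: "z - y = x - y + h" by (simp add: h_def)
   show ?thesis unfolding e by (simp add: tgt_def scaleR_diff_left scaleR_add_left)
  qed
  have "mol s z - mol s x - ?A h = (LINT y|lborel. (\<eta> (x - y + h) - \<eta> (x - y) - tgt \<eta> (x - y) h) *R s y)"
  proof -
   have "(LINT y|lborel. (\<eta> (x - y + h) - \<eta> (x - y) - tgt \<eta> (x - y) h) *R s y)
    = (LINT y|lborel. (\<eta> (z - y) *R s y - \<eta> (x - y) *R s y) - (h $ 1 *R (partial 1 \<eta> (x - y) *R s y) + h $ 2 *R (partial 2 \<eta> (x - y) *R s y)))"
    by (simp only: pt)
   also have "... = mol s z - mol s x - ?A h"
    unfolding mol_def
    using i0[of z] i0[of x] ip[of 1 x] ip[of 2 x] by (simp del: scaleR_scaleR)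
   finally show ?thesis by simp
  qed
  also have "norm ... <= (LINT y|lborel. indicator (cball x (R + 1)) y * (K * (norm h)^2 * T))"
  proof (rule order_trans[OF integral_norm_bound integral_mono])
   show "integrable lborel (%y. indicator (cball x (R + 1)) y * (K * (norm h)^2 * T))"
    by (rule cball_const_integrable)
   have "integrable lborel (%y. (\<eta> (z - y) *R s y - \<eta> (x - y) *R s y) - (h $ 1 *R (partial 1 \<eta> (x - y) *R s y) + h $ 2 *R (partial 2 \<eta> (x - y) *R s y)))"
    by (intro Bochner_Integration.integrable_diff Bochner_Integration.integrable_add integrable_scaleR_right i0 ip)
   then show "integrable lborel (%y. norm ((\<eta> (x - y + h) - \<eta> (x - y) - tgt \<eta> (x - y) h) *R s y))"
    unfolding pt by (rule integrable_norm)
   fix y :: plane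
   show "norm ((\<eta> (x - y + h) - \<eta> (x - y) - tgt \<eta> (x - y) h) *R s y) <= indicator (cball x (R + 1)) y * (K * (norm h)^2 * T)"
   proof (cases "norm (x - y) <= R + 1")
    case True
    have "\<bar>\<eta> (x - y + h) - \<eta> (x - y) - tgt \<eta> (x - y) h\<bar> * norm (s y) <= K * (norm h)^2 * T"
    by (rule mult_mono[OF K(2) s]) (simp_all add: K(1))
    then show ?thesis using True by (simp add: dist_norm)
   next
    case False
    have "norm (x - y) <= norm (x - y + h) + norm h" using norm_triangle_ineq4[of "x - y + h" h] by simp
    then have "R < norm (x - y + h)" "R < norm (x - y)" using False h(1) by linarith+
    then have "\<eta> (x - y + h) = 0" "\<eta> (x - y) = 0" "tgt \<eta> (x - y) h = 0"
    by (simp_all add: out out_partial tgt_def)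
    then show ?thesis using K(1) T by simp
   qed
  qed
  also have "... = K * T * V * norm h * norm h" by (simp add: V_def power2_eq_square)
  finally have "norm (mol s z - mol s x - ?A h) <= (K * T * V * norm h) * norm h" .
  then show "norm (mol s z - mol s x - ?A (z - x)) / norm (z - x) <= K * T * V * norm (z - x)"
   unfolding h_def[symmetric] using h(2) by (simp add: pos_divide_le_eq)
 qed simp
qed

lemma mol_L1:
 fixes u :: "plane => complex"
 assumes [measurable]: "u \<in> Bor" and u: "!!y. norm (u y) <= T"
  and e: "!!y. norm y <= R ==> (NN x. ennreal (cmod (u (x - y) - u x))) <= e"
 shows "(NN x. ennreal (cmod (mol u x - u x))) <= e"
proof -
 have i: "integrable lborel (%y. \<eta> (x - y) *R (u y - u x))" for x
  unfolding scaleR_diff_right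
  using kernel_integrable[OF \<eta> out assms(1) u, of x] int1[of x] by (intro Bochner_Integration.integrable_diff) auto
 have "ennreal (cmod (mol u x - u x)) <= (NN z. ennreal (\<eta> z) * ennreal (cmod (u (x - z) - u x)))" for x
 proof -
  have "mol u x - u x = (LINT y|lborel. \<eta> (x - y) *R (u y - u x))"
   unfolding scaleR_diff_right mol_def
   by (subst Bochner_Integration.integral_diff) (use kernel_integrable[OF \<eta> out assms(1) u, of x] int1[of x] in \<open>auto simp: mass_at\<close>)
  then have "ennreal (cmod (mol u x - u x)) <= (NN y. ennreal (norm (\<eta> (x - y) *R (u y - u x))))"
   using integral_norm_bound_ennreal[OF i, of x] by simp
  also have "... = (NN y. ennreal (\<eta> (x - y)) * ennreal (cmod (u (x - (x - y)) - u x)))"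
   by (intro nn_integral_cong) (simp add: ennreal_mult pos)
  also have "... = (NN z. ennreal (\<eta> z) * ennreal (cmod (u (x - z) - u x)))"
   by (rule lborel_reflect(1)[of "%z. ennreal (\<eta> z) * ennreal (cmod (u (x - z) - u x))", symmetric]) measurable
  finally show ?thesis .
 qed
 then have "(NN x. ennreal (cmod (mol u x - u x))) <= (NN x. (NN z. ennreal (\<eta> z) * ennreal (cmod (u (x - z) - u x))))"
  by (rule nn_integral_mono)
 also have "... = (NN z. (NN x. ennreal (\<eta> z) * ennreal (cmod (u (x - z) - u x))))"
  by (rule lborel_pair.Fubini') measurable
 also have "... <= (NN z. ennreal (\<eta> z) * e)"
 proof (rule nn_integral_mono)
  fix z
  show "(NN x. ennreal (\<eta> z) * ennreal (cmod (u (x - z) - u x))) <= ennreal (\<eta> z) * e"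
   using e[of z] out[of z] by (cases "norm z <= R") (auto simp: nn_integral_cmult intro: mult_left_mono)
 qed
 also have "... = (NN z. ennreal (\<eta> z)) * e" by (rule nn_integral_multc) measurable
 also have "(NN z. ennreal (\<eta> z)) = 1"
 proof -
  have "integrable lborel \<eta>" using mass not_integrable_integral_eq by fastforce
  from nn_integral_eq_integral[OF this] show ?thesis using mass pos by simp
 qed
 finally show ?thesis by simp
qed

text \<open>The derivative of a mollified field is the mollified weak derivative: the definition of
  the latter, tested with the translates of the kernel, moves the derivative off the kernel.\<close>
lemma mol_weak_derivative:
 assumes [measurable]: "\<sigma> \<in> Bor" and T: "!!y. norm (\<sigma> y :: plane) <= T"
  and Wm: "!!v. (%y. W y *v v) \<in> Bor" and WD: "!!y v. norm (W y *v v) <= D * norm v"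
  and weak: "!!\<phi> i k. \<phi> \<in> test_functions ==> (LINT y|lborel. \<sigma> y $ i * partial k \<phi> y) = - (LINT y|lborel. W y $ i $ k * \<phi> y)"
 shows "(mol \<sigma> has_derivative (%v. LINT y|lborel. \<eta> (x - y) *R (W y *v v))) (at x)"
  and "norm (LINT y|lborel. \<eta> (x - y) *R (W y *v v)) <= D * norm v"
proof -
 have iW: "integrable lborel (%y. \<eta> (x - y) *R (W y *v v))" for v
  by (rule kernel_integrable[OF \<eta> out Wm WD])
 then show "norm (LINT y|lborel. \<eta> (x - y) *R (W y *v v)) <= D * norm v"
  by (rule average_le) (rule WD)
 have ip: "integrable lborel (%y. partial k \<eta> (x - y) *R \<sigma> y)" for k
  by (rule kernel_integrable[OF smooth_partial[OF \<eta>] out_partial assms(1) T])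
 define \<phi> where "\<phi> = (%y. \<eta> (x - y))"
 have "\<phi> \<in> test_functions"
 proof -
  have "{y. \<phi> y ~= 0} \<subseteq> cball x R" using out by (force simp: \<phi>_def dist_norm)
  then have "supp \<phi> \<subseteq> cball x R" unfolding supp_def by (rule closure_minimal) simp
  then have "compact (supp \<phi>)"
   by (metis bounded_cball bounded_subset closed_closure compact_eq_bounded_closed supp_def)
  then show ?thesis using smooth_reflected[of x] by (simp add: test_functions_def \<phi>_def smooth_def)
 qed
 note weak = weak[OF this]
 have part: "partial k \<phi> y = - partial k \<eta> (x - y)" for k y
 proof -
  have "(\<phi> has_derivative (%v. tgt \<eta> (x - y) (- v))) (at y)"
   unfolding \<phi>_def
   by (rule has_derivative_compose[of "%y. x - y" "%v. - v" y UNIV \<eta>]) (auto intro!: derivative_eq_intros smooth_has_derivative \<eta>)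
  then have "partial k \<phi> y = tgt \<eta> (x - y) (- axis k 1)" by (rule partial_eqI)
  also have "... = - partial k \<eta> (x - y)" using exhaust_2[of k] by (auto simp: tgt_def axis_def)
  finally show ?thesis .
 qed
 have eq: "(LINT y|lborel. partial k \<eta> (x - y) *R \<sigma> y) = (LINT y|lborel. \<eta> (x - y) *R (W y *v axis k 1))" (is "?L = ?R") for k
 proof -
  have "?L $ i = ?R $ i" for i
  proof -
   have "?L $ i = (LINT y|lborel. (partial k \<eta> (x - y) *R \<sigma> y) $ i)"
    by (rule integral_bounded_linear[OF bounded_linear_vec_nth ip, symmetric])
   also have "... = - (LINT y|lborel. \<sigma> y $ i * partial k \<phi> y)" by (simp add: part mult.commute)
   also have "... = (LINT y|lborel. W y $ i $ k * \<phi> y)" by (simp add: weak)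
   also have "... = (LINT y|lborel. (\<eta> (x - y) *R (W y *v axis k 1)) $ i)"
    by (simp add: \<phi>_def matrix_vector_mult_basis column_def mult.commute)
   also have "... = ?R $ i" by (rule integral_bounded_linear[OF bounded_linear_vec_nth iW])
   finally show ?thesis .
  qed
  then show ?thesis by (simp add: vec_eq_iff)
 qed
 have "(LINT y|lborel. \<eta> (x - y) *R (W y *v v)) = v $ 1 *R (LINT y|lborel. partial 1 \<eta> (x - y) *R \<sigma> y) + v $ 2 *R (LINT y|lborel. partial 2 \<eta> (x - y) *R \<sigma> y)" for v
 proof -
  have v: "v = v $ 1 *R axis 1 1 + v $ 2 *R axis 2 (1::real)" by (simp add: vec_eq_iff forall_2 axis_def)
  have pt: "\<eta> (x - y) *R (W y *v v) = v $ 1 *R (\<eta> (x - y) *R (W y *v axis 1 1)) + v $ 2 *R (\<eta> (x - y) *R (W y *v axis 2 1))" for y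
   by (subst v) (simp add: matrix_vector_right_distrib matrix_vector_mult_scaleR scaleR_add_right mult.commute)
  show ?thesis unfolding eq pt using iW by (simp del: scaleR_scaleR)
 qed
 then show "(mol \<sigma> has_derivative (%v. LINT y|lborel. \<eta> (x - y) *R (W y *v v))) (at x)"
  using mol_has_derivative[OF assms(1) T, of x] by simp
qed

end

lemma mollifier_exists:
 assumes r: "0 < r" shows "\<exists>\<eta>. mollifier \<eta> r"
proof -
 define f where "f = (%z. bump ((2 / r) *R z))"
 have sm: "smooth f" using smooth_bump_scaled[of "2 / r" 0] by (simp add: f_def)
 have [measurable]: "f \<in> Bor" unfolding f_def by measurable
 have out: "f z = 0" if "r < norm z" for z using bump_0[of "(2 / r) *R z"] that r by (simp add: f_def pos_le_divide_eq)
 have int: "integrable lborel f"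
 proof (rule Bochner_Integration.integrable_bound[OF cball_const_integrable[of 0 r 1]])
  show "AE y in lborel. norm (f y) <= norm (indicator (cball 0 r) y * (1::real))"
  proof (rule AE_I2)
   fix y
   show "norm (f y) <= norm (indicator (cball 0 r) y * (1::real))"
    using bump_le_1[of "(2 / r) *R y"] bump_nonneg[of "(2 / r) *R y"] out[of y]
    by (cases "norm y <= r") (auto simp: f_def)
  qed
 qed measurable
 define c where "c = (LINT z|lborel. f z)"
 have "c >= 0" unfolding c_def by (rule Bochner_Integration.integral_nonneg) (simp add: f_def bump_nonneg)
 moreover have "c ~= 0"
 proof
  assume "c = 0"
  then have "AE z in lborel. f z = 0"
   using integral_nonneg_eq_0_iff_AE[OF int] by (simp add: c_def f_def bump_nonneg)
  then have "AE z in lborel. (z :: plane) \<notin> ball 0 (r / 2)"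
  proof (rule eventually_mono)
   fix z assume z: "f z = 0"
   show "z \<notin> ball 0 (r / 2)"
   proof
    assume "z \<in> ball 0 (r / 2)"
    then have "norm ((2 / r) *R z) < 1" using r by (simp add: field_simps)
    then have "\<bar>((2 / r) *R z) $ k\<bar> < 1" for k using component_le_norm_cart[of "(2 / r) *R z" k] by linarith
    then have "bump ((2 / r) *R z) > 0" unfolding bump_pos by blast
    then show False using z by (simp add: f_def)
   qed
  qed
  then have "ball 0 (r / 2) \<in> null_sets (lborel :: plane measure)" by (subst AE_iff_null_sets) auto
  then show False using r emeasure_ball_plane[of "r / 2" 0] by (simp add: null_sets_def)
 qed
 ultimately have c: "c > 0" by simp
 have td: "smooth (%y. bump (s *R y + b) / c)" for s b
  using td_cmult[of _ "%y. bump (s *R y + b)" "1 / c"] smooth_bump_scaled[of s b] by (simp add: smooth_def)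
 have "mollifier (%z. f z / c) r"
 proof
  show "smooth (%z. f z / c)" using td[of "2 / r" 0] by (simp add: f_def)
  show "smooth (%y. f (x - y) / c)" for x
   using td[of "- (2 / r)" "(2 / r) *R x"] by (simp add: f_def scaleR_diff_right)
  show "0 <= f z / c" for z using c by (simp add: f_def bump_nonneg)
  show "f z / c = 0" if "r < norm z" for z using out[OF that] by simp
  show "(LINT z|lborel. f z / c) = 1" using c by (simp add: c_def[symmetric])
 qed (use r in simp)
 then show ?thesis by blast
qed

lemma translation_modulus:
 fixes u :: "plane => complex"
 assumes u: "integrable lborel u" and e: "0 < e"
 shows "\<exists>\<delta>>0. \<forall>y. norm y < \<delta> --> (NN x. ennreal (cmod (u (x - y) - u x))) <= ennreal e"
proof (rule ccontr)
 assume "\<not> ?thesis"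
 then have "\<forall>n. \<exists>y. norm y < 1 / real (Suc n) \<and> \<not> (NN x. ennreal (cmod (u (x - y) - u x))) <= ennreal e"
  by (metis of_nat_0_less_iff zero_less_Suc zero_less_divide_1_iff)
 then obtain Y where Y: "!!n. norm (Y n) < 1 / real (Suc n)" "!!n. \<not> (NN x. ennreal (cmod (u (x - Y n) - u x))) <= ennreal e"
  by metis
 have "(%n. norm (Y n)) ----> 0"
 proof (rule tendsto_sandwich[OF always_eventually always_eventually tendsto_const])
  show "(%n. 1 / real (Suc n)) ----> 0" using LIMSEQ_inverse_real_of_nat by (simp add: inverse_eq_divide)
 qed (use Y(1) in \<open>auto intro: less_imp_le\<close>)
 then have "(%n. - Y n) ----> - 0" by (intro tendsto_minus) (simp add: tendsto_norm_zero_iff)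
 then have "(%n. \<integral>\<^sup>+x. ennreal (cmod (u (x + - Y n) - u x)) \<partial>lborel) ----> 0"
  by (intro translation_continuous_L1[OF u]) simp
 then have "\<forall>\<^sub>F n in sequentially. (NN x. ennreal (cmod (u (x + - Y n) - u x))) < ennreal e"
  by (rule order_tendstoD) (use e in simp)
 then show False using Y(2) by (auto simp: eventually_sequentially dest!: spec less_imp_le)
qed

lemma null_complement_dense:
 assumes N: "(N :: plane set) \<in> null_sets lborel" shows "closure (- N) = UNIV"
proof (rule ccontr)
 assume "closure (- N) ~= UNIV"
 then obtain x e where e: "e > 0" "ball x e \<subseteq> - closure (- N)" by (metis UNIV_eq_I closed_closure open_Compl open_contains_ball ComplI)
 then have "ball x e \<subseteq> N" using closure_subset[of "- N"] by blast
 then have "ball x e \<in> null_sets lborel" using N by (rule null_sets_subset[rotated 2]) simp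
 then show False using emeasure_ball_plane[of e x] e(1) by (simp add: null_sets_def)
qed

definition cplx :: "plane => complex" where "cplx v = Complex (v $ 1) (v $ 2)"

lemma cplx: "bounded_linear cplx" "norm (cplx v) = norm v"
proof -
 show n: "norm (cplx v) = norm v" for v by (simp add: cplx_def cmod_def norm_vec_def L2_set_def sum_2)
 show "bounded_linear cplx"
  by (rule bounded_linear_intro[of _ 1]) (simp_all add: n, simp_all add: cplx_def complex_eq_iff)
qed

text \<open>A field all of whose mollifications are \<open>D\<close>-Lipschitz is so itself, up to a null set.\<close>
lemma lipschitz_representative:
 fixes \<sigma> :: "plane => plane"
 assumes \<sigma>m [measurable]: "\<sigma> \<in> Bor" and T: "!!y. norm (\<sigma> y) <= T" and D: "0 <= D"
  and moll: "!!n. mollifier (\<eta> n) (1 / real (Suc n))"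
  and lip: "!!n. D-lipschitz_on UNIV (mollifier.mol (\<eta> n) \<sigma>)"
 shows "\<exists>\<sigma>'. D-lipschitz_on UNIV \<sigma>' \<and> (AE x in lborel. \<sigma>' x = \<sigma> x)"
proof -
 define s where "s = (%n. mollifier.mol (\<eta> n) \<sigma>)"
 have [measurable]: "s n \<in> Bor" for n
  using lip[of n] lipschitz_on_continuous_on[of D UNIV "s n"] by (intro borel_measurable_continuous_onI) (simp add: s_def)
 have T0: "0 <= T" using order_trans[OF norm_ge_zero T] .
 have conv: "\<exists>r::nat=>nat. strict_mono r \<and> (AE x in lborel. norm x < real R --> (%n. s (r n) x) ----> \<sigma> x)" for R :: nat
 proof -
  define u where "u = (%x. indicator (cball 0 (real R + 1)) x *R cplx (\<sigma> x))"
  have cm: "cplx \<in> Bor"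
   by (intro borel_measurable_continuous_onI linear_continuous_on cplx)
  have um [measurable]: "u \<in> Bor"
   unfolding u_def by (intro borel_measurable_scaleR borel_measurable_indicator measurable_compose[OF \<sigma>m cm]) simp
  have uT: "norm (u y) <= T" for y using T[of y] T0 by (auto simp: u_def cplx split: split_indicator)
  have ui: "integrable lborel u"
  proof (rule Bochner_Integration.integrable_bound[OF cball_const_integrable[of 0 "real R + 1" T]])
   show "AE x in lborel. norm (u x) <= norm (indicator (cball 0 (real R + 1)) x * T)"
    using T T0 by (intro AE_I2) (auto simp: u_def cplx split: split_indicator)
  qed measurable
  define v where "v = (%n x. indicator (cball 0 (real R)) x *R cplx (s n x - \<sigma> x))"
  have vb: "norm (v n x) <= norm (indicator (cball 0 (real R)) x * (2 * T))" for n x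
  proof -
   have "norm (s n x) <= T" unfolding s_def by (rule mollifier.mol_bound[OF moll \<sigma>m T])
   then have "norm (s n x - \<sigma> x) <= 2 * T" using T[of x] norm_triangle_ineq4[of "s n x" "\<sigma> x"] by linarith
   then show ?thesis by (auto simp: v_def cplx split: split_indicator)
  qed
  have [measurable]: "v n \<in> Bor" for n
   unfolding v_def
   by (intro borel_measurable_scaleR borel_measurable_indicator measurable_compose[OF _ cm] borel_measurable_diff) simp_all
  have vi: "integrable lborel (v n)" for n
   by (rule Bochner_Integration.integrable_bound[OF cball_const_integrable[of 0 "real R" "2 * T"]], simp, rule AE_I2, rule vb)
  have le: "ennreal (LINT x|lborel. norm (v n x)) <= (NN x. ennreal (cmod (mollifier.mol (\<eta> n) u x - u x)))" for n
  proof -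
   interpret mollifier "\<eta> n" "1 / real (Suc n)" by (rule moll)
   have "v n x = indicator (cball 0 (real R)) x *R (mol u x - u x)" for x
   proof (cases "norm x <= real R")
    case True
    have "cplx (s n x) = (LINT y|lborel. cplx (\<eta> n (x - y) *R \<sigma> y))"
    unfolding s_def mol_def
    by (rule integral_bounded_linear[OF cplx(1) kernel_integrable[OF \<eta> out \<sigma>m T], symmetric])
    also have "... = mol u x"
    unfolding mol_def
    proof (intro Bochner_Integration.integral_cong refl)
    fix y
    show "cplx (\<eta> n (x - y) *R \<sigma> y) = \<eta> n (x - y) *R u y"
    proof (cases "norm (x - y) <= 1 / real (Suc n)")
    case True
    have "1 / real (Suc n) <= 1" by simp
    moreover have "norm y - norm x <= norm (x - y)" using norm_triangle_ineq2[of y x] by (simp add: norm_minus_commute)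
    ultimately have "norm y <= real R + 1" using True \<open>norm x <= real R\<close> by linarith
    then show ?thesis by (simp add: u_def linear_scale[OF bounded_linear.linear[OF cplx(1)]])
    next
    case False
    then have "\<eta> n (x - y) = 0" by (intro out) simp
    then show ?thesis by (simp add: cplx_def complex_eq_iff)
    qed
    qed
    finally show ?thesis using True by (simp add: v_def u_def linear_diff[OF bounded_linear.linear[OF cplx(1)]])
   qed (simp add: v_def)
   then have "norm (v n x) <= cmod (mol u x - u x)" for x by (simp split: split_indicator)
   then have "(NN x. ennreal (norm (v n x))) <= (NN x. ennreal (cmod (mol u x - u x)))"
    by (intro nn_integral_mono ennreal_leI)
   then show ?thesis using nn_integral_eq_integral[OF integrable_norm[OF vi[of n]]] by simp
  qed
  have "(%n. ennreal (LINT x|lborel. norm (v n x))) ----> 0"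
  proof (rule tendsto_ennreal_0I)
   fix e :: real assume "e > 0"
   then obtain \<delta> where \<delta>: "\<delta> > 0" "!!y. norm y < \<delta> ==> (NN x. ennreal (cmod (u (x - y) - u x))) <= ennreal e"
    using translation_modulus[OF ui] by blast
   have "\<forall>\<^sub>F n in sequentially. 1 / real (Suc n) < \<delta>"
    using order_tendstoD(2)[OF LIMSEQ_inverse_real_of_nat \<delta>(1)] by (simp add: inverse_eq_divide)
   then show "\<forall>\<^sub>F n in sequentially. ennreal (LINT x|lborel. norm (v n x)) <= ennreal e"
   proof (rule eventually_mono)
    fix n assume n: "1 / real (Suc n) < \<delta>"
    show "ennreal (LINT x|lborel. norm (v n x)) <= ennreal e"
    by (rule order_trans[OF le mollifier.mol_L1[OF moll um uT]]) (use n \<delta>(2) in force)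
   qed
  qed
  then have "(%n. LINT x|lborel. norm (v n x)) ----> 0"
   using tendsto_ennrealD[of "%n. LINT x|lborel. norm (v n x)" 0 sequentially] by (simp add: Bochner_Integration.integral_nonneg)
  from tendsto_L1_AE_subseq[OF vi this] obtain r :: "nat => nat"
   where r: "strict_mono r" "AE x in lborel. (%n. v (r n) x) ----> 0" by blast
  from r(2) have "AE x in lborel. norm x < real R --> (%n. s (r n) x) ----> \<sigma> x"
  proof (rule eventually_mono, intro impI)
   fix x assume x: "(%n. v (r n) x) ----> 0" "norm x < real R"
   then have "(%n. norm (v (r n) x)) ----> 0" by (simp only: tendsto_norm_zero_iff)
   then have "(%n. norm (s (r n) x - \<sigma> x)) ----> 0" using x(2) by (simp add: v_def cplx)
   then show "(%n. s (r n) x) ----> \<sigma> x" by (simp add: tendsto_norm_zero_iff LIM_zero_iff)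
  qed
  then show ?thesis using r(1) by blast
 qed
 then have "\<forall>R. \<exists>r. AE x in lborel. norm x < real R --> (%n. s (r n) x) ----> \<sigma> x" by blast
 from choice[OF this] obtain r where "\<forall>R. AE x in lborel. norm x < real R --> (%n. s (r R n) x) ----> \<sigma> x" ..
 then have "AE x in lborel. \<forall>R. norm x < real R --> (%n. s (r R n) x) ----> \<sigma> x" by (simp add: AE_all_countable)
 then obtain N where N: "N \<in> null_sets lborel" "{x. \<not> (\<forall>R. norm x < real R --> (%n. s (r R n) x) ----> \<sigma> x)} \<subseteq> N"
  by (auto elim!: AE_E simp: null_sets_def)
 have "D-lipschitz_on (- N) \<sigma>"
 proof (rule lipschitz_onI[OF _ D])
  fix x y assume xy: "x \<in> - N" "y \<in> - N"
  obtain R :: nat where R: "max (norm x) (norm y) < real R" using reals_Archimedean2 by blast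
  then have "(%n. s (r R n) x) ----> \<sigma> x" "(%n. s (r R n) y) ----> \<sigma> y" using xy N(2) by auto
  then have "(%n. dist (s (r R n) x) (s (r R n) y)) ----> dist (\<sigma> x) (\<sigma> y)" by (rule tendsto_dist)
  then show "dist (\<sigma> x) (\<sigma> y) <= D * dist x y"
   by (rule LIMSEQ_le_const2) (use lipschitz_onD[OF lip] in \<open>auto simp: s_def\<close>)
 qed
 from lipschitz_extend_closure[OF this] obtain \<sigma>' where s': "D-lipschitz_on UNIV \<sigma>'" "!!x. x \<in> - N ==> \<sigma>' x = \<sigma> x"
  unfolding null_complement_dense[OF N(1)] by blast
 have "AE x in lborel. \<sigma>' x = \<sigma> x"
  by (rule AE_I'[OF N(1)]) (use s'(2) in auto)
 with s'(1) show ?thesis by blast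
qed

text \<open>The Lipschitz representative provides uniform convergence of the mollifications, which
  almost everywhere convergence alone would not.\<close>
theorem mollification:
 fixes \<sigma> :: "plane => plane"
 assumes \<sigma>m [measurable]: "\<sigma> \<in> Bor" and T: "!!y. norm (\<sigma> y) <= T" and D: "0 <= D" "D <= \<kappa>" "\<kappa> < 1"
  and Wm: "!!v. (%y. W y *v v) \<in> Bor" and WD: "!!y v. norm (W y *v v) <= D * norm v"
  and weak: "!!\<phi> i k. \<phi> \<in> test_functions ==> (LINT y|lborel. \<sigma> y $ i * partial k \<phi> y) = - (LINT y|lborel. W y $ i $ k * \<phi> y)"
 shows "\<exists>\<sigma>' s s'. D-lipschitz_on UNIV \<sigma>' \<and> (AE x in lborel. \<sigma>' x = \<sigma> x) \<and>
  (\<forall>n. regular_deformation (s n) (s' n) D \<kappa> \<and> (\<forall>x. norm (s n x) <= T) \<and> (\<forall>x. norm (s n x - \<sigma>' x) <= D * (1 / real (Suc n))))"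
proof -
 have "\<forall>n. \<exists>\<eta>. mollifier \<eta> (1 / real (Suc n))" by (intro allI mollifier_exists) simp
 then obtain \<eta> where moll: "!!n. mollifier (\<eta> n) (1 / real (Suc n))" by metis
 define s where "s = (%n. mollifier.mol (\<eta> n) \<sigma>)"
 define s' where "s' = (%n x v. LINT y|lborel. \<eta> n (x - y) *R (W y *v v))"
 have rd: "regular_deformation (s n) (s' n) D \<kappa>" for n
  unfolding s_def s'_def
  by unfold_locales (use mollifier.mol_weak_derivative[OF moll \<sigma>m T Wm WD weak] D in auto)
 have lip: "D-lipschitz_on UNIV (s n)" for n by (rule regular_deformation.lipschitz_D[OF rd])
 obtain \<sigma>' where \<sigma>': "D-lipschitz_on UNIV \<sigma>'" "AE x in lborel. \<sigma>' x = \<sigma> x"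
  using lipschitz_representative[OF \<sigma>m T D(1) moll] lip unfolding s_def by blast
 have [measurable]: "\<sigma>' \<in> Bor"
  by (intro borel_measurable_continuous_onI lipschitz_on_continuous_on[OF \<sigma>'(1)])
 have \<sigma>'T: "norm (\<sigma>' x) <= T" for x
 proof -
  obtain N where N: "N \<in> null_sets lborel" "{x. \<not> \<sigma>' x = \<sigma> x} \<subseteq> N"
   using \<sigma>'(2) by (auto elim!: AE_E simp: null_sets_def)
  have "norm (\<sigma>' x) <= T" if "x \<in> closure (- N)"
  proof (rule continuous_le_on_closure[OF _ that])
   show "continuous_on (closure (- N)) (%x. norm (\<sigma>' x))"
    by (intro continuous_intros continuous_on_subset[OF lipschitz_on_continuous_on[OF \<sigma>'(1)]]) simp
   fix y assume "y \<in> - N"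
   then show "norm (\<sigma>' y) <= T" using N(2) T[of y] by force
  qed
  then show ?thesis unfolding null_complement_dense[OF N(1)] by simp
 qed
 have eq: "s n x = mollifier.mol (\<eta> n) \<sigma>' x" for n x
 proof -
  interpret mollifier "\<eta> n" "1 / real (Suc n)" by (rule moll)
  show ?thesis unfolding s_def mol_def
   by (rule integral_cong_AE) (measurable, use \<sigma>'(2) in auto)
 qed
 have "norm (s n x - \<sigma>' x) <= D * (1 / real (Suc n))" for n x
  unfolding eq by (rule mollifier.mol_lipschitz[OF moll _ \<sigma>'T \<sigma>'(1)]) measurable
 moreover have "norm (s n x) <= T" for n x
  unfolding s_def by (rule mollifier.mol_bound[OF moll \<sigma>m T])
 ultimately show ?thesis using rd \<sigma>' by blast
qed


section \<open>Borel representatives\<close>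

text \<open>The statement lives on the completed measure, the estimates on Borel functions.\<close>
definition rep :: "(plane => 'a::euclidean_space) => (plane => 'a) => bool" where
 "rep f f0 \<longleftrightarrow> f0 \<in> Bor \<and> (AE x in lborel. f0 x = f x)"

lemma rep_refl: "f \<in> Bor ==> rep f f" by (simp add: rep_def)

lemma rep_lebesgue: assumes "rep f f0" shows "f \<in> borel_measurable lebesgue"
proof (rule borel_measurable_AE)
 show "f0 \<in> borel_measurable lebesgue" using assms by (auto simp: rep_def intro: measurable_completion)
 show "AE x in lebesgue. f0 x = f x" using assms by (auto simp: rep_def AE_completion_iff)
qed

lemma rep_integral:
 assumes "rep f f0" shows "(LINT x|lebesgue. f x) = (LINT x|lborel. f0 x)"
proof -
 have f0: "f0 \<in> borel_measurable lborel" using assms by (simp add: rep_def)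
 have "(LINT x|lebesgue. f x) = (LINT x|lebesgue. f0 x)"
 proof (rule integral_cong_AE)
  show "AE x in lebesgue. f x = f0 x" using assms by (auto simp: rep_def AE_completion_iff eq_commute)
 qed (use rep_lebesgue[OF assms] f0 in \<open>auto intro: measurable_completion\<close>)
 also have "... = (LINT x|lborel. f0 x)" by (rule integral_completion[OF f0])
 finally show ?thesis .
qed

lemma rep_real_exists: "f \<in> borel_measurable lebesgue ==> \<exists>f0. rep (f :: plane => real) f0"
 using completion_ex_borel_measurable_real[of f lborel] by (auto simp: rep_def eq_commute)

lemma rep_complex_exists: assumes "f \<in> borel_measurable lebesgue" shows "\<exists>f0. rep (f :: plane => complex) f0"
proof -
 have "(%x. Re (f x)) \<in> borel_measurable lebesgue" "(%x. Im (f x)) \<in> borel_measurable lebesgue"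
  using assms by measurable
 then obtain a b where ab: "rep (%x. Re (f x)) a" "rep (%x. Im (f x)) b" using rep_real_exists by metis
 have [measurable]: "a \<in> Bor" "b \<in> Bor" using ab by (auto simp: rep_def)
 have "(%x. of_real (a x) + \<i> * of_real (b x)) \<in> Bor" by measurable
 moreover have "AE x in lborel. of_real (a x) + \<i> * of_real (b x) = f x"
  using ab unfolding rep_def by (auto elim!: eventually_elim2 simp: complex_eq_iff)
 ultimately show ?thesis unfolding rep_def by blast
qed

lemma rep_mult: "rep f f0 ==> rep g g0 ==> rep (%x. f x * g x :: complex) (%x. f0 x * g0 x)"
 unfolding rep_def by (auto elim!: eventually_elim2)

lemma rep_reflect:
 fixes f :: "plane => complex"
 assumes "rep f f0" shows "rep (%y. f (x - y)) (%y. f0 (x - y))"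
proof -
 have [measurable]: "f0 \<in> Bor" using assms by (simp add: rep_def)
 have "AE y in lborel. f0 (x + (-1) *R y) = f (x + (-1) *R y)"
  using assms by (intro AE_lborel_subst) (auto simp: rep_def)
 then show ?thesis by (simp add: rep_def)
qed

lemma rep_integrable: "rep (f :: plane => complex) f0 ==> integrable lebesgue f \<longleftrightarrow> integrable lborel f0"
proof -
 assume r: "rep f f0"
 have f0: "f0 \<in> borel_measurable lborel" using r by (simp add: rep_def)
 have "integrable lebesgue f \<longleftrightarrow> integrable lebesgue f0"
  using r f0 rep_lebesgue[OF r] by (intro integrable_cong_AE) (auto simp: rep_def AE_completion_iff eq_commute intro: measurable_completion)
 also have "... \<longleftrightarrow> integrable lborel f0" by (rule integrable_completion[OF f0])
 finally show ?thesis .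
qed

lemma rep_L2:
 assumes r: "rep f f0"
 shows "f \<in> L2 \<longleftrightarrow> f0 \<in> BL2" and "f0 \<in> BL2 ==> ennreal ((L2_norm f)^2) = E2 f0"
proof -
 have f0[measurable]: "f0 \<in> Bor" using r by (simp add: rep_def)
 have sq: "rep (%x. (cmod (f x))\<^sup>2) (%x. (cmod (f0 x))\<^sup>2)" using r by (auto simp: rep_def elim!: eventually_mono)
 have sq': "(%x. (cmod (f0 x))\<^sup>2) \<in> borel_measurable lborel" by measurable
 have "integrable lebesgue (%x. (cmod (f x))\<^sup>2) \<longleftrightarrow> integrable lebesgue (%x. (cmod (f0 x))\<^sup>2)"
  using sq sq' rep_lebesgue[OF sq]
  by (intro integrable_cong_AE) (auto simp: rep_def AE_completion_iff eq_commute intro: measurable_completion)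
 also have "... \<longleftrightarrow> integrable lborel (%x. (cmod (f0 x))\<^sup>2)" by (rule integrable_completion[OF sq'])
 also have "... \<longleftrightarrow> f0 \<in> BL2"
  using f0 by (simp add: BL2_def E2_def integrable_iff_bounded)
 finally have int: "integrable lebesgue (%x. (cmod (f x))\<^sup>2) \<longleftrightarrow> f0 \<in> BL2" .
 then show "f \<in> L2 \<longleftrightarrow> f0 \<in> BL2" using rep_lebesgue[OF r] by (simp add: L2_def)
 assume "f0 \<in> BL2"
 then have i0: "integrable lborel (%x. (cmod (f0 x))\<^sup>2)" using f0 by (simp add: BL2_def E2_def integrable_iff_bounded)
 have "(L2_norm f)^2 = (LINT x|lborel. (cmod (f0 x))\<^sup>2)"
  unfolding L2_norm_def rep_integral[OF sq] by (simp add: Bochner_Integration.integral_nonneg)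
 then show "ennreal ((L2_norm f)^2) = E2 f0"
  using nn_integral_eq_integral[OF i0] by (simp add: E2_def)
qed

lemma rep_BL2_exists: assumes "f \<in> L2" shows "\<exists>f0\<in>BL2. rep f f0"
 using assms rep_complex_exists[of f] rep_L2(1) by (auto simp: L2_def)

lemma fourier_rep: assumes "rep f f0" shows "fourier f xi = ft f0 xi"
proof -
 have e: "exp (- 2 * of_real pi * \<i> * of_real (x \<bullet> xi)) = cis (- 2 * pi * (x \<bullet> xi))" for x :: plane
  by (simp add: cis_conv_exp mult_ac)
 have "rep (%x. cis (- 2 * pi * (x \<bullet> xi))) (%x. cis (- 2 * pi * (x \<bullet> xi)))" by (rule rep_refl) measurable
 from rep_integral[OF rep_mult[OF this assms]] show ?thesis unfolding fourier_def ft_def e .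
qed

lemma conv_rep: "rep f f0 ==> rep g (ift m) ==> conv f g x = cv f0 m x"
 unfolding conv_def cv_def by (rule rep_integral[OF rep_mult[OF rep_reflect]])

text \<open>A filter whose transform has bounded support is, up to a null set, the inverse transform
  of its transform.\<close>
lemma filter_rep:
 assumes \<psi>: "\<psi> \<in> L1 \<inter> L2" and R: "!!xi. R < norm xi ==> fourier \<psi> xi = 0"
 shows "rep \<psi> (ift (fourier \<psi>))" "fourier \<psi> \<in> BLc" "\<exists>K. \<forall>xi. cmod (fourier \<psi> xi) <= K"
proof -
 obtain \<psi>0 where p: "\<psi>0 \<in> BL2" "rep \<psi> \<psi>0" using rep_BL2_exists \<psi> by blast
 then have p12: "\<psi>0 \<in> BL12" using \<psi> rep_integrable[OF p(2)] by (simp add: BL12_def L1_def)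
 have m: "fourier \<psi> = ft \<psi>0" using fourier_rep[OF p(2)] by blast
 have FT1: "FT \<psi>0 (fourier \<psi>)" unfolding m by (rule FT_ft[OF p12])
 show c: "fourier \<psi> \<in> BLc" using R FT_BL2(2)[OF FT1] by (auto simp: BLc_def)
 have FT2: "FT (ift (fourier \<psi>)) (fourier \<psi>)" by (rule FT_ift[OF BLc_BL12[OF c]])
 have i: "ift (fourier \<psi>) \<in> Bor" using FT_BL2(1)[OF FT2] by auto
 have "AE x in lborel. ift (fourier \<psi>) x = \<psi>0 x" by (rule FT_inj[OF FT2 FT1])
 moreover have "AE x in lborel. \<psi>0 x = \<psi> x" using p(2) by (simp add: rep_def)
 ultimately have "AE x in lborel. ift (fourier \<psi>) x = \<psi> x" by (auto elim: eventually_elim2)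
 with i show "rep \<psi> (ift (fourier \<psi>))" by (simp add: rep_def)
 have "cmod (fourier \<psi> xi) <= (LINT x|lborel. cmod (\<psi>0 x))" for xi
 proof -
  have "cmod (ft \<psi>0 xi) <= (LINT x|lborel. cmod (cis (- 2 * pi * (x \<bullet> xi)) * \<psi>0 x))"
   unfolding ft_def by (rule integral_norm_bound)
  then show ?thesis by (simp add: m norm_mult)
 qed
 then show "\<exists>K. \<forall>xi. cmod (fourier \<psi> xi) <= K" by blast
qed

lemma fourier_L2_rep:
 assumes f: "f \<in> L2" and f0: "f0 \<in> BL2" "rep f f0"
 shows "\<exists>g. FT f0 g \<and> rep (fourier_L2 f) g"
proof -
 have f0m[measurable]: "f0 \<in> Bor" using f0(1) by auto
 have tr: "rep (%x. indicator (ball 0 (real n)) x * f x) (trunc n f0)" for n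
 proof -
  have "rep (%x. indicator (ball 0 (real n)) x :: complex) (%x. indicator (ball 0 (real n)) x)"
   by (rule rep_refl) (intro borel_measurable_indicator, simp)
  from rep_mult[OF this f0(2)] show ?thesis by (simp add: trunc_def[abs_def])
 qed
 have four: "fourier (%x. indicator (ball 0 (real n)) x * f x) xi = ft (trunc n f0) xi" for n xi
  by (rule fourier_rep[OF tr])
 have key: "is_fourier_L2 f h \<longleftrightarrow> h \<in> L2 \<and> (%n. E2 (%xi. ft (trunc n f0) xi - h0 xi)) ----> 0" if h: "h0 \<in> BL2" "rep h h0" for h h0
 proof -
  have d: "rep (%xi. ft (trunc n f0) xi - h xi) (%xi. ft (trunc n f0) xi - h0 xi)" for n
  proof -
   have [measurable]: "ft (trunc n f0) \<in> Bor" "h0 \<in> Bor"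
    using ft_BL2[OF trunc_BL12[OF f0(1)], of n] h(1) by auto
   show ?thesis using h(2) by (auto simp: rep_def elim!: eventually_mono)
  qed
  have "ennreal ((L2_norm (%xi. ft (trunc n f0) xi - h xi))^2) = E2 (%xi. ft (trunc n f0) xi - h0 xi)" for n
   by (intro rep_L2(2)[OF d] BL2_diff ft_BL2 trunc_BL12 f0 h)
  then have "(%n. E2 (%xi. ft (trunc n f0) xi - h0 xi)) ----> 0 \<longleftrightarrow> (%n. ennreal ((L2_norm (%xi. ft (trunc n f0) xi - h xi))^2)) ----> ennreal 0"
   by simp
  also have "... \<longleftrightarrow> (%n. (L2_norm (%xi. ft (trunc n f0) xi - h xi))\<^sup>2) ----> 0"
   by (rule tendsto_ennreal_iff) auto
  also have "... \<longleftrightarrow> (%n. L2_norm (%xi. ft (trunc n f0) xi - h xi)) ----> 0"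
  proof
   assume "(%n. (L2_norm (%xi. ft (trunc n f0) xi - h xi))\<^sup>2) ----> 0"
   from tendsto_real_sqrt[OF this] show "(%n. L2_norm (%xi. ft (trunc n f0) xi - h xi)) ----> 0"
    by (simp add: L2_norm_def Bochner_Integration.integral_nonneg)
  next
   assume "(%n. L2_norm (%xi. ft (trunc n f0) xi - h xi)) ----> 0"
   from tendsto_power[OF this, of 2] show "(%n. (L2_norm (%xi. ft (trunc n f0) xi - h xi))\<^sup>2) ----> 0" by simp
  qed
  finally show ?thesis unfolding is_fourier_L2_def four by blast
 qed
 obtain g where g: "FT f0 g" "(%n. E2 (%xi. ft (trunc n f0) xi - g xi)) ----> 0" using FT_exists[OF f0(1)] by blast
 have g2: "g \<in> BL2" by (rule FT_BL2(2)[OF g(1)])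
 have rg: "rep g g" using g2 by (intro rep_refl) auto
 have "is_fourier_L2 f g" using key[OF g2 rg] g(2) rep_L2(1)[OF rg] g2 by simp
 then have F: "is_fourier_L2 f (fourier_L2 f)" unfolding fourier_L2_def using someI_ex[of "is_fourier_L2 f"] by blast
 then obtain h0 where h0: "h0 \<in> BL2" "rep (fourier_L2 f) h0" using rep_BL2_exists by (auto simp: is_fourier_L2_def)
 then have lim: "(%n. E2 (%xi. ft (trunc n f0) xi - h0 xi)) ----> 0" using key F by blast
 have "FT f0 h0"
  by (rule FT_limit[OF f0(1) h0(1) FT_ft[OF trunc_BL12[OF f0(1)]] trunc_limit[OF f0(1)] lim])
 with h0(2) show ?thesis by blast
qed

lemma Hs_rep:
 assumes f: "f \<in> Hs s" and f0: "f0 \<in> BL2" "rep f f0"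
 shows "\<exists>g. FT f0 g \<and> Hn s g = ennreal ((Hs_norm s f)^2)"
proof -
 have f2: "f \<in> L2" and w2: "bessel_weight s (fourier_L2 f) \<in> L2" using f by (auto simp: Hs_def)
 obtain g where g: "FT f0 g" "rep (fourier_L2 f) g" using fourier_L2_rep[OF f2 f0] by blast
 have [measurable]: "g \<in> Bor" using g(2) by (simp add: rep_def)
 have r: "rep (bessel_weight s (fourier_L2 f)) (bessel_weight s g)"
  using g(2) unfolding rep_def bessel_weight_def[abs_def] by (auto elim!: eventually_mono)
 have "ennreal ((Hs_norm s f)^2) = E2 (bessel_weight s g)"
  unfolding Hs_norm_def using rep_L2[OF r] w2 by simp
 also have "... = Hn s g"
  unfolding E2_def Hn_def
 proof (rule nn_integral_cong)
  fix xi :: plane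
  have "(a powr (s / 2))^2 = a powr s" for a :: real
   by (simp add: power2_eq_square flip: powr_add)
  then show "ennreal ((cmod (bessel_weight s g xi))^2) = ennreal ((1 + (norm xi)^2) powr s * (cmod (g xi))^2)"
   by (simp add: bessel_weight_def norm_mult power_mult_distrib)
 qed
 finally show ?thesis using g(1) by auto
qed

section \<open>Representatives of Sobolev deformations\<close>

text \<open>Finiteness rules out the default value of the real part of an infinite supremum.\<close>
lemma AE_le_Linf_norm:
 fixes f :: "plane => 'a::real_normed_vector"
 assumes "(%x. norm (f x)) \<in> borel_measurable lebesgue" "esssup lebesgue (%x. ereal (norm (f x))) < \<infinity>"
 shows "AE x in lborel. norm (f x) <= Linf_norm f" "0 <= Linf_norm f"
proof -
 define S where "S = esssup lebesgue (%x. ereal (norm (f x)))"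
 have ae: "AE x in lborel. ereal (norm (f x)) <= S"
  using esssup_AE[of "%x. ereal (norm (f x))" lebesgue] by (simp add: AE_completion_iff S_def)
 have "0 <= S"
 proof (rule ccontr)
  assume "\<not> 0 <= S"
  then have "AE x in (lborel :: plane measure). False"
  proof (intro eventually_mono[OF ae])
   fix x assume "ereal (norm (f x)) <= S"
   with order_trans[of 0 "ereal (norm (f x))" S] \<open>\<not> 0 <= S\<close> show False by simp
  qed
  then show False using emeasure_ball_plane[of 1 0] by (simp add: AE_iff_null ae_filter_eq_bot_iff)
 qed
 then obtain r where r: "S = ereal r" "0 <= r" using assms(2) unfolding S_def[symmetric] by (cases S) auto
 then have "Linf_norm f = r" by (simp add: Linf_norm_def S_def[symmetric])
 then show "AE x in lborel. norm (f x) <= Linf_norm f" "0 <= Linf_norm f" using ae r by auto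
qed

lemma onorm_lipschitz:
 fixes A B :: "real^2^2"
 shows "\<bar>onorm ((*v) A) - onorm ((*v) B)\<bar> <= 4 * norm (A - B)"
proof -
 have "onorm ((*v) A) <= onorm ((*v) B) + 4 * norm (A - B)" for A B :: "real^2^2"
 proof -
  have "\<bar>(A - B) $ i $ j\<bar> <= norm (A - B)" for i j
   by (rule order_trans[OF component_le_norm_cart Finite_Cartesian_Product.norm_nth_le])
  then have "onorm ((*v) (A - B)) <= real CARD(2) * real CARD(2) * norm (A - B)" by (rule onorm_le_matrix_component)
  moreover have "(*v) A = (%v. B *v v + (A - B) *v v)" by (auto simp: matrix_vector_mult_diff_rdistrib)
  then have "onorm ((*v) A) <= onorm ((*v) B) + onorm ((*v) (A - B))"
   using onorm_triangle[OF matrix_vector_mul_bounded_linear[of B] matrix_vector_mul_bounded_linear[of "A - B"]] by simp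
  ultimately show ?thesis by simp
 qed
 from this[of A B] this[of B A] show ?thesis by (simp add: norm_minus_commute abs_le_iff)
qed

lemma jacobian_norm_properties:
 assumes W: "W \<in> Linf"
 shows "AE x in lborel. onorm ((*v) (W x)) <= Linf_norm (%x. onorm ((*v) (W x :: real^2^2)))" "0 <= Linf_norm (%x. onorm ((*v) (W x)))"
proof -
 have cont: "continuous_on UNIV (%A::real^2^2. onorm ((*v) A))"
  by (rule lipschitz_on_continuous_on[of 4]) (rule lipschitz_onI, use onorm_lipschitz in \<open>auto simp: dist_norm\<close>)
 have Wm: "W \<in> borel_measurable lebesgue" using W by (simp add: Linf_def)
 have om: "(%x. onorm ((*v) (W x))) \<in> borel_measurable lebesgue"
  by (rule measurable_compose[OF Wm borel_measurable_continuous_onI[OF cont]])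
 have o0: "0 <= onorm ((*v) A)" for A :: "real^2^2" by (rule onorm_pos_le) simp
 have "esssup lebesgue (%x. ereal (norm (onorm ((*v) (W x))))) <= esssup lebesgue (%x. 4 * ereal (norm (W x)))"
 proof (rule esssup_mono)
  show "(%x. ereal (norm (onorm ((*v) (W x))))) \<in> borel_measurable lebesgue" using om by measurable
  fix x
  have "(*v) (0 :: real^2^2) = (%v. 0)" by auto
  then show "ereal (norm (onorm ((*v) (W x)))) <= 4 * ereal (norm (W x))"
   using onorm_lipschitz[of "W x" 0] by (simp add: onorm_zero)
 qed
 also have "... = ereal 4 * esssup lebesgue (%x. ereal (norm (W x)))" using esssup_cmult[of 4 lebesgue "%x. ereal (norm (W x))"] by simp
 also have "... < \<infinity>" using W by (auto simp: Linf_def ereal_mult_less_right)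
 finally have fin: "esssup lebesgue (%x. ereal (norm (onorm ((*v) (W x))))) < \<infinity>" .
 have "(%x. norm (onorm ((*v) (W x)))) \<in> borel_measurable lebesgue" using om by measurable
 from AE_le_Linf_norm[OF this fin] show "AE x in lborel. onorm ((*v) (W x)) <= Linf_norm (%x. onorm ((*v) (W x :: real^2^2)))" "0 <= Linf_norm (%x. onorm ((*v) (W x)))"
  using o0 by auto
qed

text \<open>The bounds hold everywhere, because both fields are set to zero on an exceptional null set.\<close>
lemma deformation_representative:
 assumes \<tau>: "\<tau> \<in> W1inf"
 shows "\<exists>\<sigma> W. \<sigma> \<in> Bor \<and> (AE x in lborel. \<sigma> x = \<tau> x) \<and> (\<forall>x. norm (\<sigma> x) <= Linf_norm \<tau>) \<and>
  (\<forall>v. (%y. W y *v v) \<in> Bor) \<and> (\<forall>y v. norm (W y *v v) <= jacobian_norm \<tau> * norm v) \<and>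
  (\<forall>\<phi>\<in>test_functions. \<forall>i k. (LINT y|lborel. \<sigma> y $ i * partial k \<phi> y) = - (LINT y|lborel. W y $ i $ k * \<phi> y)) \<and> 0 <= jacobian_norm \<tau>"
proof -
 define V where "V = weak_jacobian \<tau>"
 have V: "V \<in> Linf" "has_weak_jacobian \<tau> V"
  using \<tau> someI_ex[of "%D. D \<in> Linf \<and> has_weak_jacobian \<tau> D"] unfolding W1inf_def V_def weak_jacobian_def by auto
 have jac: "jacobian_norm \<tau> = Linf_norm (%x. onorm ((*v) (V x)))"
  by (simp add: jacobian_norm_def V_def)
 have \<tau>L: "\<tau> \<in> Linf" using \<tau> by (simp add: W1inf_def)
 have \<tau>m: "\<tau> \<in> borel_measurable lebesgue" and Vm: "V \<in> borel_measurable lebesgue" using \<tau>L V by (auto simp: Linf_def)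
 have "(%x. norm (\<tau> x)) \<in> borel_measurable lebesgue" using \<tau>m by measurable
 from AE_le_Linf_norm[OF this] have T: "AE x in lborel. norm (\<tau> x) <= Linf_norm \<tau>" "0 <= Linf_norm \<tau>"
  using \<tau>L by (auto simp: Linf_def)
 note D = jacobian_norm_properties[OF V(1), folded jac]
 have nth_borel: "(%v::plane. v $ i) \<in> Bor" for i
  by (intro borel_measurable_continuous_onI continuous_intros)
 have "(%x. \<tau> x $ i) \<in> borel_measurable lebesgue" for i
  by (rule measurable_compose[OF \<tau>m nth_borel])
 then have "\<exists>t. rep (%x. \<tau> x $ i) t" for i by (rule rep_real_exists)
 then obtain t where t: "!!i. rep (%x. \<tau> x $ i) (t i)" by metis
 have "(%x. V x $ i $ k) \<in> borel_measurable lebesgue" for i k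
 proof -
  have "(%A::real^2^2. A $ i $ k) \<in> Bor" by (intro borel_measurable_continuous_onI continuous_intros)
  then show ?thesis by (rule measurable_compose[OF Vm])
 qed
 then have "\<exists>w. rep (%x. V x $ i $ k) w" for i k by (rule rep_real_exists)
 then obtain w where w: "!!i k. rep (%x. V x $ i $ k) (w i k)" by metis
 have tm[measurable]: "t i \<in> Bor" and wm[measurable]: "w i k \<in> Bor" for i k
  using t w by (auto simp: rep_def)
 have "AE x in lborel. \<forall>i. t i x = \<tau> x $ i" "AE x in lborel. \<forall>i k. w i k x = V x $ i $ k"
  using t w by (simp_all add: rep_def AE_all_countable)
 then have "AE x in lborel. (\<forall>i. t i x = \<tau> x $ i) \<and> (\<forall>i k. w i k x = V x $ i $ k) \<and> norm (\<tau> x) <= Linf_norm \<tau> \<and> onorm ((*v) (V x)) <= jacobian_norm \<tau>"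
  using T(1) D(1) by auto
 then obtain N where N0: "!!x. x \<in> space lborel - N ==> (\<forall>i. t i x = \<tau> x $ i) \<and> (\<forall>i k. w i k x = V x $ i $ k) \<and> norm (\<tau> x) <= Linf_norm \<tau> \<and> onorm ((*v) (V x)) <= jacobian_norm \<tau>"
  and N: "N \<in> null_sets lborel" by (rule AE_E3) (rule that)
 have Nm: "N \<in> sets borel" using N by (simp add: null_sets_def)
 have nN: "t i x = \<tau> x $ i" "w i k x = V x $ i $ k" "norm (\<tau> x) <= Linf_norm \<tau>" "onorm ((*v) (V x)) <= jacobian_norm \<tau>" if "x \<notin> N" for x i k
  using N0[of x] that by simp_all
 have AEN: "AE x in lborel. x \<notin> N" by (rule AE_not_in[OF N])
 define \<sigma> where "\<sigma> = (%x. indicator (- N) x *R (t 1 x *R axis 1 1 + t 2 x *R axis 2 (1::real)) :: plane)"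
 define W where "W = (%x. \<chi> i k. indicator (- N) x * w i k x :: real^2^2)"
 have \<sigma>eq: "\<sigma> x = \<tau> x" if "x \<notin> N" for x
  using nN(1)[OF that] that by (simp add: \<sigma>_def vec_eq_iff forall_2 axis_def)
 have Weq: "W x = V x" if "x \<notin> N" for x
  using nN(2)[OF that] that by (simp add: W_def vec_eq_iff)
 have \<sigma>0: "\<sigma> x = 0" "W x = 0" if "x \<in> N" for x using that by (simp_all add: \<sigma>_def W_def vec_eq_iff)
 have \<sigma>m[measurable]: "\<sigma> \<in> Bor"
  unfolding \<sigma>_def using Nm by (intro borel_measurable_scaleR borel_measurable_indicator borel_measurable_add) auto
 have Wc[measurable]: "(%x. W x $ i $ k) \<in> Bor" for i k
  unfolding W_def vec_lambda_beta using Nm by (intro borel_measurable_times borel_measurable_indicator wm) simp_all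
 have Wv: "(%y. W y *v v) \<in> Bor" for v
 proof -
  have "(%y. W y *v v) = (%y. (W y $ 1 $ 1 * v $ 1 + W y $ 1 $ 2 * v $ 2) *R axis 1 1 + (W y $ 2 $ 1 * v $ 1 + W y $ 2 $ 2 * v $ 2) *R axis 2 1)"
   by (auto simp: fun_eq_iff vec_eq_iff forall_2 axis_def matrix_vector_mult_def sum_2)
  then show ?thesis by simp
 qed
 have \<sigma>T: "norm (\<sigma> x) <= Linf_norm \<tau>" for x using \<sigma>eq \<sigma>0 nN(3) T(2) by (cases "x \<in> N") auto
 have WD: "norm (W y *v v) <= jacobian_norm \<tau> * norm v" for y v
 proof (cases "y \<in> N")
  case False
  have "norm (V y *v v) <= onorm ((*v) (V y)) * norm v" by (rule onorm) simp
  also have "... <= jacobian_norm \<tau> * norm v" by (intro mult_right_mono nN(4)[OF False]) simp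
  finally show ?thesis by (simp add: Weq[OF False])
 qed (use D(2) \<sigma>0 in simp)
 have weak: "(LINT y|lborel. \<sigma> y $ i * partial k \<phi> y) = - (LINT y|lborel. W y $ i $ k * \<phi> y)" if "\<phi> \<in> test_functions" for \<phi> i k
 proof -
  have sm: "smooth \<phi>" using that by (simp add: test_functions_def smooth_def)
  have [measurable]: "\<phi> \<in> Bor" "partial k \<phi> \<in> Bor"
   by (intro borel_measurable_continuous_onI smooth_continuous smooth_partial sm)+
  have [measurable]: "(%y. \<sigma> y $ i) \<in> Bor" by (rule measurable_compose[OF \<sigma>m nth_borel])
  have "rep (%y. \<tau> y $ i * partial k \<phi> y) (%y. \<sigma> y $ i * partial k \<phi> y)" "rep (%y. V y $ i $ k * \<phi> y) (%y. W y $ i $ k * \<phi> y)"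
   unfolding rep_def using AEN by (auto elim!: eventually_mono simp: \<sigma>eq Weq)
  from this[THEN rep_integral] show ?thesis using V(2) that by (simp add: has_weak_jacobian_def)
 qed
 have "AE x in lborel. \<sigma> x = \<tau> x" using AEN by (auto elim!: eventually_mono simp: \<sigma>eq)
 then show ?thesis using \<sigma>m \<sigma>T Wv WD weak D(2) by blast
qed


section \<open>Limits of deformations and sums over paths\<close>

text \<open>Deformations are uniformly bounded on square integrable functions and depend continuously
  on the field when the function is band limited.\<close>
lemma E2_deform_tendsto:
 assumes FT: "FT f g" and k: "\<kappa> < 1" and lip: "\<kappa>-lipschitz_on UNIV \<sigma>" and lips: "!!n. \<kappa>-lipschitz_on UNIV (s n)"
  and d: "!!n x. norm (s n x - \<sigma> x) <= \<delta> n" and \<delta>: "\<delta> ----> 0"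
 shows "(%n. E2 (%x. f (x - \<sigma> x) - f (x - s n x))) ----> 0"
proof (rule tendsto_ennreal_0I)
 fix e :: real assume e: "e > 0"
 have f2: "f \<in> BL2" and g2: "g \<in> BL2" using FT_BL2[OF FT] by auto
 define c where "c = 4 / (1 - \<kappa>)^2"
 have c: "c >= 0" by (simp add: c_def)
 have [measurable]: "\<sigma> \<in> Bor" "s n \<in> Bor" for n
  by (rule lipschitz_borel[OF lip k] lipschitz_borel[OF lips k])+
 have G12: "trunc N g \<in> BL12" for N by (rule trunc_BL12[OF g2])
 have i2: "ift (trunc N g) \<in> BL2" for N by (rule ift_BL2[OF G12])
 have [measurable]: "f \<in> Bor" "ift (trunc N g) \<in> Bor" for N using f2 i2 by auto
 have "(%N. E2 (%x. f x - ift (trunc N g) x)) ----> 0"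
 proof -
  have "E2 (%x. f x - ift (trunc N g) x) = E2 (%xi. trunc N g xi - g xi)" for N
   using FT_E2[OF FT_diff[OF FT FT_ift[OF G12]]] E2_minus[of "%xi. trunc N g xi - g xi"] by simp
  then show ?thesis using trunc_limit[OF g2] by simp
 qed
 then have "(%N. ennreal (6 * c) * E2 (%x. f x - ift (trunc N g) x)) ----> ennreal (6 * c) * 0"
  by (intro ennreal_tendsto_cmult) simp_all
 then have "\<forall>\<^sub>F N in sequentially. ennreal (6 * c) * E2 (%x. f x - ift (trunc N g) x) < ennreal (e / 2)"
  by (rule order_tendstoD) (use e in simp)
 then obtain N where N: "ennreal (6 * c) * E2 (%x. f x - ift (trunc N g) x) < ennreal (e / 2)"
  by (auto simp: eventually_sequentially)
 define G where "G = trunc N g"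
 define h where "h = ift G"
 have h2: "h \<in> BL2" and [measurable]: "h \<in> Bor" using i2[of N] by (auto simp: h_def G_def)
 have Gc: "G \<in> BLc"
  using BL12D(1)[OF G12[of N]] by (auto simp: BLc_def G_def trunc_def intro!: exI[of _ "real N"])
 have "D2 G <= (NN xi. ennreal ((real N)^2) * ennreal ((cmod (g xi))^2))"
  unfolding D2_def
 proof (rule nn_integral_mono)
  fix xi :: plane
  have "(norm xi)^2 * (cmod (G xi))^2 <= (real N)^2 * (cmod (g xi))^2"
   by (cases "norm xi < real N") (auto simp: G_def trunc_def intro!: mult_right_mono power_mono)
  then show "ennreal ((norm xi)^2 * (cmod (G xi))^2) <= ennreal ((real N)^2) * ennreal ((cmod (g xi))^2)"
   by (subst ennreal_mult[symmetric]) (auto intro: ennreal_leI)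
 qed
 also have "... = ennreal ((real N)^2) * E2 g"
  unfolding E2_def using g2 by (intro nn_integral_cmult) (auto dest: BL2D)
 also have "... < \<infinity>" using g2 by (auto simp: BL2_def ennreal_mult_less_top)
 finally obtain M where M: "D2 G = ennreal M" "0 <= M" by (cases "D2 G") auto
 define c' where "c' = 4 / (1 - \<kappa>)^2 * (2 * pi)^2"
 have c': "c' >= 0" by (simp add: c'_def)
 have bnd: "E2 (%x. f (x - \<sigma> x) - f (x - s n x)) <= ennreal (6 * c) * E2 (%x. f x - h x) + ennreal (4 * ((\<delta> n)^2 * c' * M))" for n
 proof -
  have de: "E2 (%x. (%y. f y - h y) (x - \<sigma>1 x)) <= ennreal c * E2 (%x. f x - h x)" if "\<kappa>-lipschitz_on UNIV \<sigma>1" for \<sigma>1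
   unfolding c_def by (rule E2_deform_le[OF that k]) measurable
  have "E2 (%x. f (x - \<sigma> x) - f (x - s n x))
    = E2 (%x. (f (x - \<sigma> x) - h (x - \<sigma> x)) + ((h (x - \<sigma> x) - h (x - s n x)) - (f (x - s n x) - h (x - s n x))))"
   by simp
  also have "... <= 2 * E2 (%x. f (x - \<sigma> x) - h (x - \<sigma> x)) + 2 * E2 (%x. (h (x - \<sigma> x) - h (x - s n x)) - (f (x - s n x) - h (x - s n x)))"
   by (rule E2_add) measurable
  also have "... <= 2 * (ennreal c * E2 (%x. f x - h x)) + 2 * (2 * ennreal ((\<delta> n)^2 * c' * M) + 2 * (ennreal c * E2 (%x. f x - h x)))"
  proof (intro add_mono mult_left_mono)
   have "E2 (%x. (h (x - \<sigma> x) - h (x - s n x)) - (f (x - s n x) - h (x - s n x)))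
    <= 2 * E2 (%x. h (x - \<sigma> x) - h (x - s n x)) + 2 * E2 (%x. f (x - s n x) - h (x - s n x))"
    by (rule E2_diff) measurable
   also have "... <= 2 * ennreal ((\<delta> n)^2 * c' * M) + 2 * (ennreal c * E2 (%x. f x - h x))"
   proof (intro add_mono mult_left_mono)
    have "E2 (%x. h (x - \<sigma> x) - h (x - s n x)) <= ennreal ((\<delta> n)^2 * c') * D2 G"
    unfolding h_def c'_def by (rule E2_deform_diff[OF Gc k lip lips]) (use d in \<open>simp add: norm_minus_commute\<close>)
    also have "... = ennreal ((\<delta> n)^2 * c' * M)" using c' M by (simp add: ennreal_mult)
    finally show "E2 (%x. h (x - \<sigma> x) - h (x - s n x)) <= ennreal ((\<delta> n)^2 * c' * M)" .
   qed (use de[OF lips[of n]] in auto)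
   finally show "E2 (%x. (h (x - \<sigma> x) - h (x - s n x)) - (f (x - s n x) - h (x - s n x))) <= 2 * ennreal ((\<delta> n)^2 * c' * M) + 2 * (ennreal c * E2 (%x. f x - h x))" .
  qed (use de[OF lip] in auto)
  also have "... = ennreal 6 * (ennreal c * E2 (%x. f x - h x)) + ennreal 4 * ennreal ((\<delta> n)^2 * c' * M)"
  proof -
   have "2 * X + 2 * (2 * Y + 2 * X) = 6 * X + 4 * Y" for X Y :: ennreal
   proof -
    have "6 * X = 2 * X + 4 * X" by (simp flip: distrib_right)
    then show ?thesis by (simp add: distrib_left mult.assoc[symmetric] add_ac)
   qed
   then show ?thesis by simp
  qed
  also have "... = ennreal (6 * c) * E2 (%x. f x - h x) + ennreal (4 * ((\<delta> n)^2 * c' * M))"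
   using c c' M(2) by (simp only: ennreal_mult[symmetric] mult.assoc[symmetric] mult_nonneg_nonneg zero_le_numeral zero_le_power2)
  finally show ?thesis .
 qed
 have "(%n. 4 * ((\<delta> n)^2 * c' * M)) ----> 4 * (0\<^sup>2 * c' * M)" by (intro tendsto_intros \<delta>)
 then have "\<forall>\<^sub>F n in sequentially. 4 * ((\<delta> n)^2 * c' * M) < e / 2" by (rule order_tendstoD) (use e in simp)
 then show "\<forall>\<^sub>F n in sequentially. E2 (%x. f (x - \<sigma> x) - f (x - s n x)) <= ennreal e"
 proof (rule eventually_mono)
  fix n assume n: "4 * ((\<delta> n)^2 * c' * M) < e / 2"
  have "E2 (%x. f (x - \<sigma> x) - f (x - s n x)) <= ennreal (e / 2) + ennreal (e / 2)"
   by (rule order_trans[OF bnd add_mono]) (use N n in \<open>auto simp: h_def G_def intro: ennreal_leI less_imp_le\<close>)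
  also have "... = ennreal e" using e by (simp flip: ennreal_plus)
  finally show "E2 (%x. f (x - \<sigma> x) - f (x - s n x)) <= ennreal e" .
 qed
qed

context wave_bank
begin

primrec cascade :: "'i list => (plane => complex) => plane => complex" where
 "cascade [] a = a"
| "cascade (i # p) a = cascade p (U i a)"

lemma cascade_BL2: "a \<in> BL2 ==> set p \<subseteq> Ix ==> cascade p a \<in> BL2"
 by (induction p arbitrary: a) (auto simp: U_BL2)

lemma tree_dist_paths:
 assumes J: "finite J"
 shows "tree_dist J n a b = (\<Sum>p\<in>{p. set p \<subseteq> J \<and> length p <= n}. E2 (%x. cv (cascade p a) m\<chi> x - cv (cascade p b) m\<chi> x))"
proof (induction n arbitrary: a b)
 case 0
 have "{p. set p \<subseteq> J \<and> length p <= 0} = {[]}" by auto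
 then show ?case by simp
next
 case (Suc n)
 let ?S = "%n. {p. set p \<subseteq> J \<and> length p <= n}"
 have S: "?S (Suc n) = insert [] ((%(i, p). i # p) ` (J \<times> ?S n))"
 proof (intro set_eqI iffI)
  fix p assume "p \<in> ?S (Suc n)"
  then show "p \<in> insert [] ((%(i, p). i # p) ` (J \<times> ?S n))" by (cases p) (auto simp: image_iff)
 qed auto
 have fin: "finite (?S n)" by (rule finite_lists_length_le[OF J])
 have inj: "inj_on (%(i, p). i # p) (J \<times> ?S n)" by (auto simp: inj_on_def)
 have "(\<Sum>p\<in>?S (Suc n). E2 (%x. cv (cascade p a) m\<chi> x - cv (cascade p b) m\<chi> x))
   = E2 (%x. cv a m\<chi> x - cv b m\<chi> x) + (\<Sum>q\<in>(%(i, p). i # p) ` (J \<times> ?S n). E2 (%x. cv (cascade q a) m\<chi> x - cv (cascade q b) m\<chi> x))"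
  unfolding S using J fin by (subst sum.insert) auto
 also have "(\<Sum>q\<in>(%(i, p). i # p) ` (J \<times> ?S n). E2 (%x. cv (cascade q a) m\<chi> x - cv (cascade q b) m\<chi> x))
   = (\<Sum>i\<in>J. \<Sum>p\<in>?S n. E2 (%x. cv (cascade p (U i a)) m\<chi> x - cv (cascade p (U i b)) m\<chi> x))"
  unfolding sum.reindex[OF inj] sum.cartesian_product by (intro sum.cong refl) auto
 finally show ?case using Suc by simp
qed

lemma tree_dist_limit:
 fixes M :: ennreal
 assumes k: "\<kappa> < 1" and FT: "FT f g" and J: "finite J" "J \<subseteq> Ix"
  and lip: "\<kappa>-lipschitz_on UNIV \<sigma>" and rd: "!!n. regular_deformation (s n) (s' n) D \<kappa>"
  and d: "!!n x. norm (s n x - \<sigma> x) <= \<delta> n" and \<delta>: "\<delta> ----> 0"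
  and M: "!!n. tree_dist J N (%x. f (x - s n x)) f <= M"
 shows "tree_dist J N (%x. f (x - \<sigma> x)) f <= 2 * M"
proof -
 have f2: "f \<in> BL2" using FT_BL2(1)[OF FT] .
 have lips: "\<kappa>-lipschitz_on UNIV (s n)" for n by (rule regular_deformation.lipschitz_\<kappa>[OF rd])
 have 2: "(%x. f (x - \<sigma> x)) \<in> BL2" "(%x. f (x - s n x)) \<in> BL2" for n
  by (rule deform_BL2[OF lip k f2] deform_BL2[OF lips k f2])+
 have "tree_dist J N (%x. f (x - \<sigma> x)) f <= 2 * E2 (%x. f (x - \<sigma> x) - f (x - s n x)) + 2 * M" for n
  by (rule order_trans[OF tree_dist_triangle[OF J 2(1) 2(2)[of n] f2]])
   (intro add_mono mult_left_mono M tree_dist_nonexpansive[OF J 2(1) 2(2)[of n]], simp_all)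
 moreover have "(%n. 2 * E2 (%x. f (x - \<sigma> x) - f (x - s n x)) + 2 * M) ----> 2 * 0 + 2 * M"
  by (intro tendsto_add tendsto_const ennreal_tendsto_cmult E2_deform_tendsto[OF FT k lip lips d \<delta>]) simp
 ultimately show ?thesis by (intro LIMSEQ_le_const[where X = "%n. 2 * E2 (%x. f (x - \<sigma> x) - f (x - s n x)) + 2 * M"]) simp_all
qed

end

section \<open>The wave packet covering\<close>

lemma norm_rotation: "norm (rotation \<theta> *v v) = norm v"
proof -
 have "(norm (rotation \<theta> *v v))^2 = ((cos \<theta>)^2 + (sin \<theta>)^2) * ((v $ 1)^2 + (v $ 2)^2)"
 proof -
  have "(a * x - b * y)^2 + (b * x + a * y)^2 = (a\<^sup>2 + b\<^sup>2) * (x\<^sup>2 + y\<^sup>2)" for a b x y :: real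
   by (simp add: power2_eq_square algebra_simps)
  from this[of "cos \<theta>" "v $ 1" "sin \<theta>" "v $ 2"] show ?thesis
   unfolding norm_sq_plane rotation_def by (simp add: matrix_vector_mult_def sum_2)
 qed
 then have "(norm (rotation \<theta> *v v))^2 = (norm v)^2" by (simp add: norm_sq_plane)
 then show ?thesis by (simp add: power2_eq_iff_nonneg)
qed

lemma norm_plane_le: "norm (v :: plane) <= \<bar>v $ 1\<bar> + \<bar>v $ 2\<bar>"
 using norm_le_l1_cart[of v] by (simp add: sum_2)

text \<open>A box of level \<open>j\<close> starts at distance \<open>2^(j-1)\<close>, and the overlap \<open>\<epsilon>\<close> moves its inner edge by
  at most \<open>2^j / 32\<close>.\<close>
lemma cover_set_bounds:
 assumes ab: "0 <= \<beta>" "\<beta> <= \<alpha>" "\<alpha> < 1" and e: "0 < \<epsilon>" "\<epsilon> < 1 / 32" and m: "m <= m_max \<alpha> j"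
  and xi: "xi \<in> cover_set \<alpha> \<beta> \<epsilon> (j, m, l)"
 shows "2 ^ j / 4 <= norm xi \<and> norm xi <= 8 * 2 ^ j \<and> norm (xi - rotation (angle \<beta> j l) *v shift \<alpha> j m) <= 4 * 2 powr (\<alpha> * real j)"
proof -
 obtain x where x: "x \<in> base_box \<epsilon>" "xi = rotation (angle \<beta> j l) *v (dilation \<alpha> \<beta> j *v x + shift \<alpha> j m)"
  using xi by auto
 define a where "a = 2 powr (\<alpha> * real j)"
 define b where "b = 2 powr (\<beta> * real j)"
 define q where "q = (2::real) ^ j"
 have qp: "q = 2 powr (real j)" by (simp add: q_def powr_realpow)
 have a: "0 < a" "a <= q" unfolding a_def qp using ab by (auto intro!: powr_mono mult_left_le_one_le)
 have b: "0 < b" "b <= a" unfolding a_def b_def using ab by (auto intro!: powr_mono mult_right_mono)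
 have q2: "2 powr (real j - 1) = q / 2" by (simp add: qp powr_diff)
 have ma: "real m * a <= q / 2 + a"
 proof -
  have "real m <= real (m_max \<alpha> j)" using m by simp
  also have "... <= 2 powr ((1 - \<alpha>) * real j - 1) + 1"
  proof -
   have "0 <= \<lceil>x\<rceil> ==> real (nat \<lceil>x\<rceil>) <= x + 1" for x :: real
    using ceiling_correct[of x] by (simp add: of_nat_nat)
   moreover have "0 <= \<lceil>2 powr ((1 - \<alpha>) * real j - 1)\<rceil>"
    using powr_ge_zero[of 2 "(1 - \<alpha>) * real j - 1"] by (simp only: zero_le_ceiling)
   ultimately show ?thesis unfolding m_max_def by blast
  qed
  finally have "real m * a <= (2 powr ((1 - \<alpha>) * real j - 1) + 1) * a" using a by (intro mult_right_mono) auto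
  also have "... = 2 powr (((1 - \<alpha>) * real j - 1) + \<alpha> * real j) + a" unfolding a_def powr_add by (simp add: distrib_right)
  also have "((1 - \<alpha>) * real j - 1) + \<alpha> * real j = real j - 1" by (simp add: algebra_simps)
  finally show ?thesis by (simp add: q2)
 qed
 have xb: "\<bar>x $ 1\<bar> <= 33 / 32" "- (1 / 32) <= x $ 1" "\<bar>x $ 2\<bar> <= 33 / 32" using x(1) e by (auto simp: base_box_def)
 define y where "y = dilation \<alpha> \<beta> j *v x"
 have y: "y $ 1 = a * x $ 1" "y $ 2 = b * x $ 2" by (simp_all add: y_def dilation_def matrix_vector_mult_def sum_2 a_def b_def)
 have s: "shift \<alpha> j m $ 1 = q / 2 + real m * a" "shift \<alpha> j m $ 2 = 0" by (simp_all add: shift_def q2 a_def)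
 have y1: "\<bar>y $ 1\<bar> <= a * (33 / 32)" "\<bar>y $ 2\<bar> <= a * (33 / 32)"
  using a b mult_left_mono[OF xb(1), of a] mult_mono[OF b(2) xb(3)] by (simp_all add: y abs_mult)
 have lo: "- (a / 32) <= y $ 1" using mult_left_mono[OF xb(2), of a] a by (simp add: y)
 have n: "norm xi = norm (y + shift \<alpha> j m)" by (simp add: x(2) norm_rotation y_def)
 have ma0: "0 <= real m * a" using a by simp
 have "q / 4 <= (y + shift \<alpha> j m) $ 1" unfolding vector_add_component s using lo a ma0 by linarith
 also have "... <= norm xi" unfolding n by (rule order_trans[OF abs_ge_self component_le_norm_cart])
 finally have 1: "q / 4 <= norm xi" .
 have "norm xi <= \<bar>(y + shift \<alpha> j m) $ 1\<bar> + \<bar>(y + shift \<alpha> j m) $ 2\<bar>" unfolding n by (rule norm_plane_le)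
 also have "... <= 8 * q"
 proof -
  have z: "0 <= q / 2 + real m * a" using ma0 a by linarith
  have "\<bar>(y + shift \<alpha> j m) $ 1\<bar> <= \<bar>y $ 1\<bar> + (q / 2 + real m * a)"
   unfolding vector_add_component s using abs_triangle_ineq[of "y $ 1" "q / 2 + real m * a"] abs_of_nonneg[OF z] by linarith
  moreover have "\<bar>(y + shift \<alpha> j m) $ 2\<bar> = \<bar>y $ 2\<bar>" by (simp add: s)
  ultimately show ?thesis using y1 ma a by linarith
 qed
 finally have 2: "norm xi <= 8 * q" .
 have "xi - rotation (angle \<beta> j l) *v shift \<alpha> j m = rotation (angle \<beta> j l) *v y"
  by (simp add: x(2) y_def matrix_vector_right_distrib)
 then have "norm (xi - rotation (angle \<beta> j l) *v shift \<alpha> j m) = norm y" by (simp add: norm_rotation)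
 also have "... <= \<bar>y $ 1\<bar> + \<bar>y $ 2\<bar>" by (rule norm_plane_le)
 also have "... <= 4 * a" using y1 a by linarith
 finally show ?thesis using 1 2 by (simp add: q_def a_def)
qed

text \<open>The regularity conditions as one uniform bound: the finitely many levels below \<open>jreg\<close>
 only enlarge the constant, and order zero is the Littlewood-Paley condition.\<close>
lemma uniform_bank_bound:
 assumes reg: "multiplier_regular \<alpha> \<beta> mu" and b0: "0 <= \<beta>"
  and supp: "!!i. i \<in> Istar \<alpha> \<beta> ==> \<exists>R. \<forall>xi. R < norm xi --> mu i xi = 0"
  and bdd: "!!i. i \<in> Istar \<alpha> \<beta> ==> \<exists>K. \<forall>xi. cmod (mu i xi) <= K"
  and meas: "!!i. i \<in> Istar \<alpha> \<beta> ==> mu i \<in> Bor"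
  and LP: "!!j. AE xi in lborel. (\<Sum>i\<in>Istar_level \<alpha> \<beta> j. (cmod (mu i xi))\<^sup>2) <= 1"
 shows "\<exists>B\<ge>0. \<forall>j\<ge>1. bank_bound 4 (Istar_level \<alpha> \<beta> j) mu (2 powr (- \<beta> * real j)) B"
proof -
 let ?L = "Istar_level \<alpha> \<beta>"
 let ?r = "%j. 2 powr (- \<beta> * real j)"
 have td: "!!i. i \<in> Istar \<alpha> \<beta> ==> times_differentiable 4 (mu i)" using reg by (simp add: multiplier_regular_def)
 obtain jr where C1: "multiplier_C1 \<alpha> \<beta> mu jr" and C2: "multiplier_C2 \<alpha> \<beta> mu jr" using reg by (auto simp: multiplier_regular_def)
 have lev: "i \<in> Istar \<alpha> \<beta>" if "i \<in> ?L j" for i j using that by (simp add: Istar_level_def)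
 have high: "\<exists>K\<ge>0. \<forall>j\<ge>jr. \<forall>xi. (\<Sum>i\<in>?L j. (cmod (mderiv \<nu> (mu i) xi))\<^sup>2) <= K * ((?r j) ^ mdeg \<nu>)^2"
  if \<nu>: "1 <= mdeg \<nu>" "mdeg \<nu> <= 4" for \<nu>
 proof -
  obtain K where K: "!!j xi. j >= jr ==> 2 powr (\<beta> * real j * real (mdeg \<nu>)) * sqrt (\<Sum>i\<in>?L j. (cmod (mderiv \<nu> (mu i) xi))\<^sup>2) <= K"
   using C2 \<nu> unfolding multiplier_C2_def by blast
  have "(\<Sum>i\<in>?L j. (cmod (mderiv \<nu> (mu i) xi))\<^sup>2) <= K\<^sup>2 * ((?r j) ^ mdeg \<nu>)^2" if "j >= jr" for j xi
  proof -
   let ?S = "\<Sum>i\<in>?L j. (cmod (mderiv \<nu> (mu i) xi))\<^sup>2"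
   have S0: "0 <= ?S" by (intro sum_nonneg) simp
   have "(?r j) ^ mdeg \<nu> * 2 powr (\<beta> * real j * real (mdeg \<nu>)) = 1"
    by (simp add: powr_power powr_add[symmetric])
   then have "sqrt ?S = (?r j) ^ mdeg \<nu> * (2 powr (\<beta> * real j * real (mdeg \<nu>)) * sqrt ?S)" by (simp add: mult.assoc[symmetric])
   also have "... <= (?r j) ^ mdeg \<nu> * K" by (intro mult_left_mono K that) simp
   finally have "(sqrt ?S)^2 <= ((?r j) ^ mdeg \<nu> * K)^2" using S0 by (intro power_mono) auto
   then show ?thesis using S0 by (simp add: power_mult_distrib mult.commute)
  qed
  then show ?thesis by (intro exI[of _ "K\<^sup>2"]) simp
 qed
 have bd: "bounded (range (mderiv \<nu> (mu i)))" if i: "i \<in> ?L j" and j: "1 <= j" and \<nu>: "mdeg \<nu> <= 4" for i j \<nu>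
 proof (cases "j < jr")
  case True
  then show ?thesis using C1 i j \<nu> unfolding multiplier_C1_def by blast
 next
  case False
  show ?thesis
  proof (cases "mdeg \<nu> = 0")
   case True
   then have "mderiv \<nu> (mu i) = mu i" by (simp add: mdeg_def mderiv_def)
   then show ?thesis using bdd[OF lev[OF i]] by (auto simp: bounded_iff)
  next
   case nz: False
   then obtain K where K: "K >= 0" "!!xi. (\<Sum>i\<in>?L j. (cmod (mderiv \<nu> (mu i) xi))\<^sup>2) <= K * ((?r j) ^ mdeg \<nu>)^2"
    using high[of \<nu>] \<nu> False by (auto simp: Suc_le_eq)
   have "cmod (mderiv \<nu> (mu i) xi) <= sqrt (K * ((?r j) ^ mdeg \<nu>)^2)" for xi
   proof -
    have "(cmod (mderiv \<nu> (mu i) xi))^2 <= (\<Sum>i\<in>?L j. (cmod (mderiv \<nu> (mu i) xi))\<^sup>2)"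
    by (rule member_le_sum[OF i]) (simp_all add: finite_Istar_level)
    then show ?thesis using K(2)[of xi] by (intro real_le_rsqrt) linarith
   qed
   then show ?thesis by (auto simp: bounded_iff)
  qed
 qed
 have one: "\<exists>K\<ge>0. 1 <= j --> (\<forall>xi. (\<Sum>i\<in>?L j. (cmod (mderiv \<nu> (mu i) xi))\<^sup>2) <= K * ((?r j) ^ mdeg \<nu>)^2)" if \<nu>: "mdeg \<nu> <= 4" for \<nu> j
 proof (cases "1 <= j")
  case True
  have "\<forall>i\<in>?L j. \<exists>k. \<forall>xi. cmod (mderiv \<nu> (mu i) xi) <= k" using bd[OF _ True \<nu>] by (simp add: bounded_iff)
  then obtain k where k: "!!i xi. i \<in> ?L j ==> cmod (mderiv \<nu> (mu i) xi) <= k i" by metis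
  have "(\<Sum>i\<in>?L j. (cmod (mderiv \<nu> (mu i) xi))\<^sup>2) <= (\<Sum>i\<in>?L j. (k i)\<^sup>2)" for xi
   by (intro sum_mono power_mono k) auto
  then show ?thesis
   by (intro exI[of _ "(\<Sum>i\<in>?L j. (k i)\<^sup>2) / ((?r j) ^ mdeg \<nu>)^2"]) (auto intro!: divide_nonneg_nonneg sum_nonneg)
 qed auto
 have "\<exists>B\<ge>0. \<forall>j\<ge>1. AE xi in lborel. (\<Sum>i\<in>?L j. (cmod (mderiv \<nu> (mu i) xi))\<^sup>2) <= B * ((?r j) ^ mdeg \<nu>)^2"
  if \<nu>: "mdeg \<nu> <= 4" for \<nu>
 proof (cases "mdeg \<nu> = 0")
  case True
  then have "mderiv \<nu> (mu i) = mu i" for i by (simp add: mdeg_def mderiv_def)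
  then show ?thesis using LP True by (intro exI[of _ 1]) simp
 next
  case False
  then obtain K where K: "K >= 0" "!!j xi. j >= jr ==> (\<Sum>i\<in>?L j. (cmod (mderiv \<nu> (mu i) xi))\<^sup>2) <= K * ((?r j) ^ mdeg \<nu>)^2"
   using high[of \<nu>] \<nu> by (auto simp: Suc_le_eq)
  obtain k where k: "!!j. k j >= 0" "!!j xi. 1 <= j ==> (\<Sum>i\<in>?L j. (cmod (mderiv \<nu> (mu i) xi))\<^sup>2) <= k j * ((?r j) ^ mdeg \<nu>)^2"
   using one[OF \<nu>] by metis
  have s0: "0 <= (\<Sum>j<jr. k j)" by (intro sum_nonneg k)
  have "(\<Sum>i\<in>?L j. (cmod (mderiv \<nu> (mu i) xi))\<^sup>2) <= (K + (\<Sum>j<jr. k j)) * ((?r j) ^ mdeg \<nu>)^2" if j: "1 <= j" for j xi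
  proof (cases "j < jr")
   case True
   have "k j <= (\<Sum>j<jr. k j)" by (rule member_le_sum) (use True k in auto)
   then have "k j * ((?r j) ^ mdeg \<nu>)^2 <= (K + (\<Sum>j<jr. k j)) * ((?r j) ^ mdeg \<nu>)^2" using K(1) by (intro mult_right_mono) auto
   then show ?thesis by (rule order_trans[OF k(2)[OF j]])
  next
   case False
   have "K * ((?r j) ^ mdeg \<nu>)^2 <= (K + (\<Sum>j<jr. k j)) * ((?r j) ^ mdeg \<nu>)^2" using s0 by (intro mult_right_mono) auto
   then show ?thesis using K(2)[of j] False by (intro order_trans[OF K(2)]) auto
  qed
  then show ?thesis using K(1) s0 by (intro exI[of _ "K + (\<Sum>j<jr. k j)"]) auto
 qed
 then obtain Bf where Bf: "!!\<nu>. mdeg \<nu> <= 4 ==> Bf \<nu> >= 0"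
  "!!\<nu> j. mdeg \<nu> <= 4 ==> 1 <= j ==> AE xi in lborel. (\<Sum>i\<in>?L j. (cmod (mderiv \<nu> (mu i) xi))\<^sup>2) <= Bf \<nu> * ((?r j) ^ mdeg \<nu>)^2"
  by metis
 define N where "N = {\<nu>. mdeg \<nu> <= 4}"
 have finN: "finite N" by (rule finite_subset[of _ "{..4} \<times> {..4}"]) (auto simp: N_def mdeg_def)
 define B where "B = (\<Sum>\<nu>\<in>N. Bf \<nu>)"
 have "bank_bound 4 (?L j) mu (?r j) B" if j: "1 <= j" for j
  unfolding bank_bound_def
 proof (intro conjI ballI allI impI finite_Istar_level)
  fix i assume i: "i \<in> ?L j"
  show "mu i \<in> Bor" by (rule meas[OF lev[OF i]])
  show "regular 4 (mu i)" unfolding regular_def using td[OF lev[OF i]] supp[OF lev[OF i]] bd[OF i j] by blast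
 next
  fix a b :: nat assume "a + b <= 4"
  then have \<nu>: "mdeg (a, b) <= 4" by (simp add: mdeg_def)
  have "Bf (a, b) <= B" unfolding B_def by (rule member_le_sum) (use \<nu> Bf(1) finN in \<open>auto simp: N_def\<close>)
  then have le: "Bf (a, b) * ((?r j) ^ mdeg (a, b))^2 <= B * ((?r j) ^ (a + b))^2" by (simp add: mdeg_def mult_right_mono)
  show "AE xi in lborel. (\<Sum>i\<in>?L j. (cmod (mderiv (a, b) (mu i) xi))\<^sup>2) <= B * ((?r j) ^ (a + b))^2"
   using Bf(2)[OF \<nu> j] by (rule eventually_mono) (rule order_trans[OF _ le])
 qed
 moreover have "B >= 0" unfolding B_def by (intro sum_nonneg Bf(1)) (simp add: N_def)
 ultimately show ?thesis by blast
qed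


section \<open>The stability estimate\<close>

theorem corollary1p5:
  fixes \<alpha> \<beta> \<epsilon>0 \<kappa> :: real
    and chi :: "plane \<Rightarrow> complex"
    and \<psi> :: "index \<Rightarrow> plane \<Rightarrow> complex"
  assumes "0 \<le> \<beta>" and "\<beta> \<le> \<alpha>" and "\<alpha> < 1"
    and "0 < \<epsilon>0" and "\<epsilon>0 < 1 / 32"
    and "wave_packet_bank \<alpha> \<beta> \<epsilon>0 chi \<psi>"
    and "multiplier_regular \<alpha> \<beta> (\<lambda>i. fourier (\<psi> i))"
    and "0 < \<kappa>" and "\<kappa> < 1"
  shows "\<exists>C>0. \<forall>\<tau>\<in>W1inf. jacobian_norm \<tau> \<le> \<kappa> \<longrightarrow> (\<forall>f\<in>Hs (1 - \<beta>).
    (\<lambda>p x. scattering chi \<psi> (deform \<tau> f) p x - scattering chi \<psi> f p x)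
        \<in> ell2_L2 (lists (Istar \<alpha> \<beta>)) \<and>
    ell2_L2_norm (lists (Istar \<alpha> \<beta>))
        (\<lambda>p x. scattering chi \<psi> (deform \<tau> f) p x - scattering chi \<psi> f p x)
      \<le> C * (Linf_norm \<tau> + jacobian_norm \<tau>) * Hs_norm (1 - \<beta>) f)"
proof -
 note ab = assms(1-3) and e0 = assms(4,5) and bank = assms(6) and reg = assms(7) and \<kappa> = assms(8,9)
 define m where "m = (%i. fourier (\<psi> i))"
 define m\<chi> where "m\<chi> = fourier chi"
 define ctr where "ctr = (%(j, k, l). rotation (angle \<beta> j l) *v shift \<alpha> j k)"
 have chi: "chi \<in> L1 \<inter> L2" and psi: "!!i. i \<in> Istar \<alpha> \<beta> ==> \<psi> i \<in> L1 \<inter> L2"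
  and AE1: "AE xi in lborel. (%i. (cmod (m i xi))\<^sup>2) summable_on Istar \<alpha> \<beta> \<and>
    (cmod (m\<chi> xi))\<^sup>2 + (\<Sum>\<^sub>\<infinity>i\<in>Istar \<alpha> \<beta>. (cmod (m i xi))\<^sup>2) = 1"
  and suppc: "supp m\<chi> \<subseteq> ball 0 4" and suppm: "!!i. i \<in> Istar \<alpha> \<beta> ==> supp (m i) \<subseteq> cover_set \<alpha> \<beta> \<epsilon>0 i"
  using bank unfolding wave_packet_bank_def m_def m\<chi>_def by (auto simp: AE_completion_iff)
 have in_supp: "xi \<in> supp F" if "F xi ~= 0" for F :: "plane => complex" and xi
  unfolding supp_def using closure_subset[of "{x. F x ~= 0}"] that by auto
 have geo: "2 ^ fst i / 4 <= norm xi \<and> norm xi <= 8 * 2 ^ fst i \<and> norm (xi - ctr i) <= 4 * 2 powr (\<alpha> * real (fst i))"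
  if i: "i \<in> Istar \<alpha> \<beta>" and nz: "m i xi ~= 0" for i xi
 proof -
  obtain j k l where i': "i = (j, k, l)" by (cases i)
  have "xi \<in> cover_set \<alpha> \<beta> \<epsilon>0 (j, k, l)" using suppm[OF i] in_supp[of "m i" xi, OF nz] i' by auto
  moreover have "k <= m_max \<alpha> j" using i by (simp add: i' Istar_def)
  ultimately show ?thesis using cover_set_bounds[OF ab e0] by (simp add: i' ctr_def)
 qed
 have m0: "m i xi = 0" if "i \<in> Istar \<alpha> \<beta>" "8 * 2 ^ fst i < norm xi" for i xi
  using geo[OF that(1), of xi] that(2) by force
 have c0: "m\<chi> xi = 0" if "8 < norm xi" for xi
  using suppc in_supp[of m\<chi> xi] that by force
 have mi: "m i = fourier (\<psi> i)" for i by (simp add: m_def)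
 have fm: "rep (\<psi> i) (ift (m i))" "m i \<in> BLc" "\<exists>K. \<forall>xi. cmod (m i xi) <= K" if i: "i \<in> Istar \<alpha> \<beta>" for i
  using filter_rep[OF psi[OF i] m0[OF i, unfolded mi]] unfolding mi by blast+
 have fc: "rep chi (ift m\<chi>)" "m\<chi> \<in> BLc" "\<exists>K. \<forall>xi. cmod (m\<chi> xi) <= K"
  using filter_rep[OF chi c0[unfolded m\<chi>_def]] unfolding m\<chi>_def by blast+
 have LP: "AE xi in lborel. (cmod (m\<chi> xi))\<^sup>2 + (\<Sum>i\<in>J. (cmod (m i xi))\<^sup>2) <= 1" if J: "finite J" "J \<subseteq> Istar \<alpha> \<beta>" for J
  using AE1
 proof (rule eventually_mono)
  fix xi assume a: "(%i. (cmod (m i xi))\<^sup>2) summable_on Istar \<alpha> \<beta> \<and>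
    (cmod (m\<chi> xi))\<^sup>2 + (\<Sum>\<^sub>\<infinity>i\<in>Istar \<alpha> \<beta>. (cmod (m i xi))\<^sup>2) = 1"
  then have "(\<Sum>i\<in>J. (cmod (m i xi))\<^sup>2) <= (\<Sum>\<^sub>\<infinity>i\<in>Istar \<alpha> \<beta>. (cmod (m i xi))\<^sup>2)"
   by (intro finite_sum_le_infsum J) auto
  with a show "(cmod (m\<chi> xi))^2 + (\<Sum>i\<in>J. (cmod (m i xi))\<^sup>2) <= 1" by linarith
 qed
 have levI: "Istar_level \<alpha> \<beta> j \<subseteq> Istar \<alpha> \<beta>" for j by (auto simp: Istar_level_def)
 have "\<exists>B\<ge>0. \<forall>j\<ge>1. bank_bound 4 (Istar_level \<alpha> \<beta> j) m (2 powr (- \<beta> * real j)) B"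
 proof (rule uniform_bank_bound[OF _ ab(1)])
  show "multiplier_regular \<alpha> \<beta> m" using reg by (simp add: m_def)
  show "\<exists>R. \<forall>xi. R < norm xi --> m i xi = 0" if "i \<in> Istar \<alpha> \<beta>" for i using m0[OF that] by blast
  show "\<exists>K. \<forall>xi. cmod (m i xi) <= K" if "i \<in> Istar \<alpha> \<beta>" for i by (rule fm(3)[OF that])
  show "m i \<in> Bor" if "i \<in> Istar \<alpha> \<beta>" for i by (rule BLc_borel[OF fm(2)[OF that]])
  show "AE xi in lborel. (\<Sum>i\<in>Istar_level \<alpha> \<beta> j. (cmod (m i xi))\<^sup>2) <= 1" for j
   using LP[OF finite_Istar_level levI[of j]] by (rule eventually_mono) (smt (verit) zero_le_power2)
 qed
 then obtain B where B: "B >= 0" "!!j. 1 <= j ==> bank_bound 4 (Istar_level \<alpha> \<beta> j) m (2 powr (- \<beta> * real j)) B" by blast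
 have union: "(\<Union>j\<in>{1..}. Istar_level \<alpha> \<beta> j) = Istar \<alpha> \<beta>" by (auto simp: Istar_level_def Istar_def)
 interpret wave_bank \<alpha> \<beta> B "Istar_level \<alpha> \<beta>" m m\<chi> ctr
 proof
  show "0 <= \<beta>" "\<beta> <= \<alpha>" "\<alpha> < 1" "0 <= B" by (fact ab B(1))+
  show "j = j'" if "i \<in> Istar_level \<alpha> \<beta> j" "i \<in> Istar_level \<alpha> \<beta> j'" for i j j' using that by (simp add: Istar_level_def)
  show "bank_bound 4 (Istar_level \<alpha> \<beta> j) m (2 powr (- \<beta> * real j)) B" if "1 <= j" for j by (rule B(2)[OF that])
  fix j :: nat and i xi assume i: "i \<in> Istar_level \<alpha> \<beta> j" and nz: "m i xi ~= 0"
  have j: "i \<in> Istar \<alpha> \<beta>" "fst i = j" using i by (auto simp: Istar_level_def)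
  show "2 ^ j / 4 <= norm xi \<and> norm xi <= 8 * 2 ^ j" "norm (xi - ctr i) <= 4 * 2 powr (\<alpha> * real j)"
   using geo[OF j(1) nz] by (auto simp: j(2))
 next
  show "AE xi in lborel. (cmod (m\<chi> xi))\<^sup>2 + (\<Sum>i\<in>J. (cmod (m i xi))\<^sup>2) <= 1"
   if "finite J" "J \<subseteq> (\<Union>j\<in>{1..}. Istar_level \<alpha> \<beta> j)" for J using LP that unfolding union by blast
  show "m\<chi> \<in> BLc" "\<exists>K. \<forall>xi. cmod (m\<chi> xi) <= K" using fc(2,3) by simp_all
  show "m\<chi> xi = 0" if "8 < norm xi" for xi by (rule c0[OF that])
 qed
 have Ix: "Ix = Istar \<alpha> \<beta>" unfolding Ix_def by (rule union)
 have path: "rep (propagate \<psi> p f) (cascade p f0)" if "rep f f0" "f0 \<in> BL2" "set p \<subseteq> Istar \<alpha> \<beta>" for p f f0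
  using that
 proof (induction p arbitrary: f f0)
  case (Cons i p)
  have i: "i \<in> Istar \<alpha> \<beta>" using Cons.prems by simp
  have "(%x. of_real (cmod (conv f (\<psi> i) x))) = U i f0"
   by (auto simp: U_def conv_rep[OF Cons.prems(1) fm(1)[OF i]])
  moreover have "U i f0 \<in> BL2" by (rule U_BL2[OF Cons.prems(2)]) (simp add: Ix i)
  moreover from this have "rep (U i f0) (U i f0)" by (intro rep_refl) auto
  ultimately show ?case using Cons by simp
 qed simp
 have scat: "scattering chi \<psi> f p x = cv (cascade p f0) m\<chi> x" if "rep f f0" "f0 \<in> BL2" "set p \<subseteq> Istar \<alpha> \<beta>" for p f f0 x
  unfolding scattering_def by (rule conv_rep[OF path[OF that] fc(1)])
 have cvB: "cv a m\<chi> \<in> BL2" if a: "a \<in> BL2" for a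
 proof -
  obtain K where K: "!!xi. cmod (m\<chi> xi) <= K" using \<chi>b by blast
  have "E2 (cv a m\<chi>) <= ennreal (K\<^sup>2) * E2 a" by (rule cv_E2_le[OF a \<chi>c K])
  also have "... < \<infinity>" using a by (auto simp: BL2_def ennreal_mult_less_top)
  finally show ?thesis using cv_borel[OF a \<chi>_BL12] by (simp add: BL2_def)
 qed
 obtain C where C: "C >= 0" and st: "!!n J \<tau> \<tau>' D T f g. regular_deformation \<tau> \<tau>' D \<kappa> ==> (\<forall>x. norm (\<tau> x) <= T) ==>
   FT f g ==> finite J ==> J \<subseteq> Ix ==> tree_dist J n (%x. f (x - \<tau> x)) f <= ennreal (C * (T\<^sup>2 + D\<^sup>2)) * Hn (1 - \<beta>) g"
  using stable_critical[of \<kappa>] \<kappa> unfolding stable_def by (auto simp: less_imp_le)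
 show ?thesis
 proof (intro exI[of _ "sqrt (2 * C) + 1"] conjI ballI impI)
  show "0 < sqrt (2 * C) + 1" using C by (simp add: add_nonneg_pos)
  fix \<tau> f assume \<tau>: "\<tau> \<in> W1inf" and jac: "jacobian_norm \<tau> <= \<kappa>" and f: "f \<in> Hs (1 - \<beta>)"
  define D where "D = jacobian_norm \<tau>"
  define T where "T = Linf_norm \<tau>"
  define H where "H = Hs_norm (1 - \<beta>) f"
  have Dk: "D <= \<kappa>" and k1: "\<kappa> < 1" using jac \<kappa> by (auto simp: D_def)
  obtain \<sigma> W where \<sigma>: "\<sigma> \<in> Bor" "AE x in lborel. \<sigma> x = \<tau> x" "!!x. norm (\<sigma> x) <= T"
   and W: "!!v. (%y. W y *v v) \<in> Bor" "!!y v. norm (W y *v v) <= D * norm v"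
   and weak: "!!\<phi> i k. \<phi> \<in> test_functions ==> (LINT y|lborel. \<sigma> y $ i * partial k \<phi> y) = - (LINT y|lborel. W y $ i $ k * \<phi> y)"
   and D0: "0 <= D"
   using deformation_representative[OF \<tau>] unfolding D_def T_def by blast
  obtain \<sigma>' s s' where \<sigma>': "D-lipschitz_on UNIV \<sigma>'" "AE x in lborel. \<sigma>' x = \<sigma> x"
   and rd: "!!n. regular_deformation (s n) (s' n) D \<kappa>" and sT: "!!n x. norm (s n x) <= T"
   and sd: "!!n x. norm (s n x - \<sigma>' x) <= D * (1 / real (Suc n))"
   using mollification[OF \<sigma>(1,3) D0 Dk k1 W weak] by blast
  have T0: "0 <= T" using order_trans[OF norm_ge_zero \<sigma>(3)] .
  have lip: "\<kappa>-lipschitz_on UNIV \<sigma>'" by (rule lipschitz_on_le[OF \<sigma>'(1) Dk])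
  have f2: "f \<in> L2" using f by (simp add: Hs_def)
  obtain f0 where f0: "f0 \<in> BL2" "rep f f0" using rep_BL2_exists[OF f2] by blast
  obtain g where g: "FT f0 g" "Hn (1 - \<beta>) g = ennreal (H\<^sup>2)" using Hs_rep[OF f f0] unfolding H_def by blast
  define L where "L = (%x. f0 (x - \<sigma>' x))"
  have L2: "L \<in> BL2" unfolding L_def by (rule deform_BL2[OF lip k1 f0(1)])
  have rL: "rep (deform \<tau> f) L"
  proof -
   have "AE x in lborel. f0 (x - \<sigma>' x) = f (x - \<sigma>' x)"
    by (rule AE_deform[OF lip k1]) (use f0(2) in \<open>simp add: rep_def\<close>)
   moreover have "AE x in lborel. \<sigma>' x = \<tau> x" using \<sigma>'(2) \<sigma>(2) by (auto elim: eventually_elim2)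
   ultimately have "AE x in lborel. L x = deform \<tau> f x"
    unfolding L_def deform_def by (auto elim: eventually_elim2)
   then show ?thesis using L2 by (auto simp: rep_def)
  qed
  let ?q = "%p x. scattering chi \<psi> (deform \<tau> f) p x - scattering chi \<psi> f p x"
  have q: "?q p = (%x. cv (cascade p L) m\<chi> x - cv (cascade p f0) m\<chi> x)" "?q p \<in> L2"
   "ennreal ((L2_norm (?q p))^2) = E2 (%x. cv (cascade p L) m\<chi> x - cv (cascade p f0) m\<chi> x)"
   if p: "p \<in> lists (Istar \<alpha> \<beta>)" for p
  proof -
   have p': "set p \<subseteq> Istar \<alpha> \<beta>" using p by (auto simp: in_lists_conv_set)
   show eq: "?q p = (%x. cv (cascade p L) m\<chi> x - cv (cascade p f0) m\<chi> x)"
    by (simp add: scat[OF rL L2 p'] scat[OF f0(2,1) p'])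
   have b: "(%x. cv (cascade p L) m\<chi> x - cv (cascade p f0) m\<chi> x) \<in> BL2"
    by (intro BL2_diff cvB cascade_BL2 L2 f0) (simp_all add: Ix p')
   then have r: "rep (?q p) (%x. cv (cascade p L) m\<chi> x - cv (cascade p f0) m\<chi> x)" unfolding eq by (intro rep_refl) auto
   show "?q p \<in> L2" using rep_L2(1)[OF r] b by blast
   show "ennreal ((L2_norm (?q p))^2) = E2 (%x. cv (cascade p L) m\<chi> x - cv (cascade p f0) m\<chi> x)" by (rule rep_L2(2)[OF r b])
  qed
  define M where "M = 2 * C * (T\<^sup>2 + D\<^sup>2) * H\<^sup>2"
  have M0: "0 <= M" using C by (simp add: M_def)
  have tree: "tree_dist J N L f0 <= ennreal M" if J: "finite J" "J \<subseteq> Istar \<alpha> \<beta>" for J N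
  proof -
   have J': "J \<subseteq> Ix" using J by (simp add: Ix)
   have "(%n. D * (1 / real (Suc n))) ----> D * 0"
    by (intro tendsto_mult tendsto_const) (use LIMSEQ_inverse_real_of_nat in \<open>simp add: inverse_eq_divide\<close>)
   then have lim: "(%n. D * (1 / real (Suc n))) ----> 0" by simp
   have "tree_dist J N L f0 <= 2 * (ennreal (C * (T\<^sup>2 + D\<^sup>2)) * Hn (1 - \<beta>) g)"
    unfolding L_def
    by (rule tree_dist_limit[OF k1 g(1) J(1) J' lip rd sd lim]) (use st[OF rd _ g(1) J(1) J'] sT in blast)
   also have "... = ennreal M" using C by (simp add: g(2) M_def ennreal_mult mult.assoc)
   finally show ?thesis .
  qed
  have fin: "(\<Sum>p\<in>F. (L2_norm (?q p))\<^sup>2) <= M" if F: "finite F" "F \<subseteq> lists (Istar \<alpha> \<beta>)" for F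
  proof -
   define J where "J = (\<Union>p\<in>F. set p)"
   define N where "N = (\<Sum>p\<in>F. length p)"
   have J: "finite J" "J \<subseteq> Istar \<alpha> \<beta>" using F by (auto simp: J_def in_lists_conv_set)
   have FS: "F \<subseteq> {p. set p \<subseteq> J \<and> length p <= N}"
    using F(1) by (auto simp: J_def N_def intro: member_le_sum)
   have "ennreal (\<Sum>p\<in>F. (L2_norm (?q p))\<^sup>2) = (\<Sum>p\<in>F. ennreal ((L2_norm (?q p))^2))"
    by (rule sum_ennreal[symmetric]) simp
   also have "... = (\<Sum>p\<in>F. E2 (%x. cv (cascade p L) m\<chi> x - cv (cascade p f0) m\<chi> x))"
    using F(2) by (intro sum.cong refl q(3)) auto
   also have "... <= tree_dist J N L f0"
    unfolding tree_dist_paths[OF J(1)] by (rule sum_mono2[OF finite_lists_length_le[OF J(1)] FS]) simp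
   also have "... <= ennreal M" by (rule tree[OF J])
   finally show ?thesis using M0 by (simp add: ennreal_le_iff)
  qed
  have summ: "(%p. (L2_norm (?q p))\<^sup>2) summable_on lists (Istar \<alpha> \<beta>)"
   by (rule nonneg_bdd_above_summable_on) (auto intro!: bdd_aboveI[of _ M] fin)
  show "?q \<in> ell2_L2 (lists (Istar \<alpha> \<beta>))" using q(2) summ by (simp add: ell2_L2_def)
  have "ell2_L2_norm (lists (Istar \<alpha> \<beta>)) ?q <= sqrt M"
   unfolding ell2_L2_norm_def by (rule real_sqrt_le_mono[OF infsum_le_finite_sums[OF summ fin]])
  also have "... = sqrt (2 * C) * sqrt (T\<^sup>2 + D\<^sup>2) * H"
   by (simp add: M_def real_sqrt_mult H_def Hs_norm_def L2_norm_def Bochner_Integration.integral_nonneg)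
  also have "... <= (sqrt (2 * C) + 1) * (T + D) * H"
  proof (intro mult_right_mono mult_mono)
   show "sqrt (T\<^sup>2 + D\<^sup>2) <= T + D" using T0 D0 by (intro real_le_lsqrt) (auto simp: power2_sum)
  qed (use C T0 D0 in \<open>auto simp: H_def Hs_norm_def L2_norm_def Bochner_Integration.integral_nonneg\<close>)
  finally show "ell2_L2_norm (lists (Istar \<alpha> \<beta>)) ?q <= (sqrt (2 * C) + 1) * (Linf_norm \<tau> + jacobian_norm \<tau>) * Hs_norm (1 - \<beta>) f"
   unfolding T_def D_def H_def .
 qed
qed

end
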